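(* Let $k$ be an arbitrary field, and let $A$ be a finitely generated connected graded Koszul $k$-algebra. Then $A$ is a domain if and only if $\Lambda=\operatorname{Ext}^\bullet_A(k,k)\cong A^!$ satisfies the Koszul syzygy condition.
   Context: A connected graded $k$-algebra is an $\mathbb N$-graded $k$-algebra $A=\bigoplus_{n\ge0}A_n$ with $A_0=k$; $k=A/A_{\ge1}$ is the trivial module. $A^!$ denotes the quadratic dual algebra, isomorphic to the Ext algebra $\operatorname{Ext}^\bullet_A(k,k)$ of the trivial left module, graded by cohomological degree (convention: homomorphisms of left modules act on the right and are composed from left to right). Graded modules. Let $\Lambda=\bigoplus_{i\ge 0}\Lambda_i$ be an $\mathbb N$-graded ring with $\Lambda_0$ semisimple. Graded modules are $\mathbb Z$-graded, graded homomorphisms are degree-preserving, and $M(i)_n=M_{i+n}$. Every left bounded graded module $M$ (i.e. $M_n=0$ for $n\ll0$) has a projective cover $P_M\to M$ in the category of left bounded graded modules; its kernel is the syzygy $\Omega M$ (well defined up to isomorphism). Put $\Omega^0M=M$, $\Omega^nM=\Omega(\Omega^{n-1}M)$. A left bounded graded module $M$ is Koszul if it is generated in degree $0$ and its minimal graded projective resolution $\cdots\to P_1\to P_0\to M\to 0$ has each $P_i$ generated in degree $i$ (the zero module is Koszul). An $\mathbb N$-graded ring $A$ with $A_0$ semisimple is Koszul if $A_0=A/A_{\ge1}$ is a Koszul left $A$-module (equivalently, a Koszul right module). Koszul syzygy condition. Let $\Lambda$ be a Koszul ring, $S=\Lambda_0=\Lambda/\Lambda_{\ge1}$, and fix a decomposition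 $S=S_1\oplus\dots\oplus S_r$ into graded simple right $\Lambda$-modules. $\Lambda$ satisfies the Koszul syzygy condition if for every integer $i\ge 0$, all $1\le j,\ell\le r$, and every graded $\Lambda$-module homomorphism $f:\Omega^i(S_j)(i)\to S_\ell$, the kernel of $f$ is a Koszul module. (In the present situation $\Lambda_0=k$ and $r=1$.) *)

theory Defs
  imports "HOL-Algebra.Module" "HOL-Algebra.QuotRing" "HOL-Algebra.Generated_Rings"
begin

section \<open>Graded rings and graded modules\<close>

record 'a graded_ring = "'a ring" +
  component :: "nat \<Rightarrow> 'a set"

record ('a, 'm) graded_module = "('a, 'm) module" +
  mcomponent :: "int \<Rightarrow> 'm set"

text \<open>
  As for the modules of \<^theory>\<open>HOL-Algebra.Module\<close>, the multiplicative fields of a module record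
  carry no information.
\<close>

definition internal_direct_sum :: "('m, 'z) ring_scheme \<Rightarrow> 'i set \<Rightarrow> ('i \<Rightarrow> 'm set) \<Rightarrow> bool"
  where "internal_direct_sum G I C \<longleftrightarrow>
    (\<forall>i\<in>I. subgroup (C i) (add_monoid G)) \<and>
    (\<forall>x\<in>carrier G. \<exists>!c. c \<in> (\<Pi>\<^sub>E i\<in>I. C i) \<and> finite {i \<in> I. c i \<noteq> \<zero>\<^bsub>G\<^esub>} \<and>
        x = (\<Oplus>\<^bsub>G\<^esub>i\<in>{i \<in> I. c i \<noteq> \<zero>\<^bsub>G\<^esub>}. c i))"

locale graded_ring = ring R for R :: "('a, 'z) graded_ring_scheme" (structure) +
  assumes decomposition: "internal_direct_sum R UNIV (component R)"
    and component_mult: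
      "\<lbrakk>x \<in> component R m; y \<in> component R n\<rbrakk> \<Longrightarrow> x \<otimes> y \<in> component R (m + n)"
    and one_component: "\<one> \<in> component R 0"

text \<open>The locale \<^locale>\<open>module\<close> of the library is restricted to commutative base rings.\<close>

locale left_module = R?: ring R + M?: abelian_group M
  for R :: "('a, 'y) ring_scheme" (structure) and M :: "('a, 'm, 'z) module_scheme" (structure) +
  assumes smult_closed: "\<lbrakk>a \<in> carrier R; x \<in> carrier M\<rbrakk> \<Longrightarrow> a \<odot>\<^bsub>M\<^esub> x \<in> carrier M"
    and smult_l_distr: "\<lbrakk>a \<in> carrier R; b \<in> carrier R; x \<in> carrier M\<rbrakk> \<Longrightarrow>
      (a \<oplus>\<^bsub>R\<^esub> b) \<odot>\<^bsub>M\<^esub> x = a \<odot>\<^bsub>M\<^esub> x \<oplus>\<^bsub>M\<^esub> b \<odot>\<^bsub>M\<^esub> x"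
    and smult_r_distr: "\<lbrakk>a \<in> carrier R; x \<in> carrier M; y \<in> carrier M\<rbrakk> \<Longrightarrow>
      a \<odot>\<^bsub>M\<^esub> (x \<oplus>\<^bsub>M\<^esub> y) = a \<odot>\<^bsub>M\<^esub> x \<oplus>\<^bsub>M\<^esub> a \<odot>\<^bsub>M\<^esub> y"
    and smult_assoc: "\<lbrakk>a \<in> carrier R; b \<in> carrier R; x \<in> carrier M\<rbrakk> \<Longrightarrow>
      (a \<otimes>\<^bsub>R\<^esub> b) \<odot>\<^bsub>M\<^esub> x = a \<odot>\<^bsub>M\<^esub> (b \<odot>\<^bsub>M\<^esub> x)"
    and smult_one: "x \<in> carrier M \<Longrightarrow> \<one>\<^bsub>R\<^esub> \<odot>\<^bsub>M\<^esub> x = x"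

locale graded_left_module = graded_ring R + left_module R M
  for R :: "('a, 'y) graded_ring_scheme" (structure)
    and M :: "('a, 'm, 'z) graded_module_scheme" (structure) +
  assumes mdecomposition: "internal_direct_sum M UNIV (mcomponent M)"
    and component_smult: "\<lbrakk>a \<in> component R m; x \<in> mcomponent M n\<rbrakk> \<Longrightarrow>
      a \<odot>\<^bsub>M\<^esub> x \<in> mcomponent M (int m + n)"

text \<open>Right \<open>R\<close>-modules are treated as left modules over the opposite ring.\<close>

definition opposite :: "('a, 'z) ring_scheme \<Rightarrow> ('a, 'z) ring_scheme"
  where "opposite R = R\<lparr>mult := (\<lambda>x y. y \<otimes>\<^bsub>R\<^esub> x)\<rparr>"

definition left_bounded :: "('a, 'm) graded_module \<Rightarrow> bool"
  where "left_bounded M \<longleftrightarrow> (\<exists>b. \<forall>n<b. mcomponent M n = {\<zero>\<^bsub>M\<^esub>})"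

definition shift :: "('a, 'm) graded_module \<Rightarrow> int \<Rightarrow> ('a, 'm) graded_module"
  where "shift M i = M\<lparr>mcomponent := (\<lambda>n. mcomponent M (i + n))\<rparr>"

definition restrict_module :: "('a, 'm) graded_module \<Rightarrow> 'm set \<Rightarrow> ('a, 'm) graded_module"
  where "restrict_module M U = M\<lparr>carrier := U, mcomponent := (\<lambda>n. mcomponent M n \<inter> U)\<rparr>"

definition graded_submodule :: "('a, 'z) graded_ring_scheme \<Rightarrow> 'm set \<Rightarrow> ('a, 'm) graded_module \<Rightarrow> bool"
  where "graded_submodule R U M \<longleftrightarrow>
    submodule U R M \<and> internal_direct_sum (restrict_module M U) UNIV (\<lambda>n. mcomponent M n \<inter> U)"

text \<open>Generation in degree \<open>i\<close>, that is, \<open>M = R M\<^sub>i\<close>.\<close>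

definition generated_in_degree ::
    "('a, 'z) graded_ring_scheme \<Rightarrow> ('a, 'm) graded_module \<Rightarrow> int \<Rightarrow> bool"
  where "generated_in_degree R M i \<longleftrightarrow>
    (\<forall>U. submodule U R M \<and> mcomponent M i \<subseteq> U \<longrightarrow> U = carrier M)"

definition linear_maps ::
    "('a, 'y) ring_scheme \<Rightarrow> ('a, 'm, 'z) module_scheme \<Rightarrow> ('a, 'n, 'w) module_scheme \<Rightarrow> ('m \<Rightarrow> 'n) set"
  where "linear_maps R M N =
    {f \<in> hom (add_monoid M) (add_monoid N).
      \<forall>a\<in>carrier R. \<forall>x\<in>carrier M. f (a \<odot>\<^bsub>M\<^esub> x) = a \<odot>\<^bsub>N\<^esub> f x}"

definition graded_hom ::
    "('a, 'z) graded_ring_scheme \<Rightarrow> ('a, 'm) graded_module \<Rightarrow> ('a, 'n) graded_module \<Rightarrow> ('m \<Rightarrow> 'n) set"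
  where "graded_hom R M N =
    {f \<in> linear_maps R M N. \<forall>n. f ` mcomponent M n \<subseteq> mcomponent N n}"

definition graded_isomorphic ::
    "('a, 'z) graded_ring_scheme \<Rightarrow> ('a, 'm) graded_module \<Rightarrow> ('a, 'n) graded_module \<Rightarrow> bool"
  where "graded_isomorphic R M N \<longleftrightarrow>
    graded_left_module R M \<and> graded_left_module R N \<and>
    (\<exists>f\<in>graded_hom R M N. bij_betw f (carrier M) (carrier N))"

definition kernel_module ::
    "('a, 'm) graded_module \<Rightarrow> ('a, 'n) graded_module \<Rightarrow> ('m \<Rightarrow> 'n) \<Rightarrow> ('a, 'm) graded_module"
  where "kernel_module M N f = restrict_module M (a_kernel M N f)"

definition augmentation_ideal :: "('a, 'z) graded_ring_scheme \<Rightarrow> 'a set"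
  where "augmentation_ideal R =
    {\<Oplus>\<^bsub>R\<^esub>n\<in>N. c n | N c. finite N \<and> 0 \<notin> N \<and> c \<in> (\<Pi> n\<in>N. component R n)}"

text \<open>The left \<open>R\<close>-module \<open>R / R\<^bsub>\<ge>1\<^esub>\<close>, concentrated in degree \<open>0\<close>.\<close>

definition top_module :: "('a, 'z) graded_ring_scheme \<Rightarrow> ('a, 'a set) graded_module"
  where "top_module R = (let I = augmentation_ideal R; Q = R Quot I in
    \<lparr>carrier = carrier Q, mult = mult Q, one = one Q, zero = zero Q, add = add Q,
     smult = (\<lambda>a X. (I +>\<^bsub>R\<^esub> a) \<otimes>\<^bsub>Q\<^esub> X),
     mcomponent = (\<lambda>n. if n = 0 then carrier Q else {\<zero>\<^bsub>Q\<^esub>})\<rparr>)"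

text \<open>A decomposition of \<open>R / R\<^bsub>\<ge>1\<^esub>\<close> into finitely many graded simple submodules.\<close>

definition graded_simple :: "('a, 'z) graded_ring_scheme \<Rightarrow> ('a, 'm) graded_module \<Rightarrow> bool"
  where "graded_simple R M \<longleftrightarrow>
    graded_left_module R M \<and> carrier M \<noteq> {\<zero>\<^bsub>M\<^esub>} \<and>
    (\<forall>U. graded_submodule R U M \<longrightarrow> U = {\<zero>\<^bsub>M\<^esub>} \<or> U = carrier M)"

definition simple_decomposition :: "('a, 'z) graded_ring_scheme \<Rightarrow> 'a set set list \<Rightarrow> bool"
  where "simple_decomposition R Ss \<longleftrightarrow>
    (\<forall>U\<in>set Ss. graded_submodule R U (top_module R) \<and>
        graded_simple R (restrict_module (top_module R) U)) \<and>
    internal_direct_sum (top_module R) {..<length Ss} (\<lambda>j. Ss ! j)"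


section \<open>Projective covers, syzygies and Koszul modules\<close>

text \<open>
  Projectivity in the category of left bounded graded modules. HOL cannot quantify over all types,
  so the test modules \<open>X\<close>, \<open>Y\<close> are carried by the type \<open>('a + 'p) list\<close>. This loses nothing: that
  type is infinite and at least as large as \<open>'a\<close> and \<open>'p\<close>, so it carries copies of \<open>P\<close> and of the
  free module on the homogeneous elements of \<open>P\<close>. The lifting property therefore already makes \<open>P\<close>
  a direct summand of a left bounded graded free module.
\<close>

definition graded_projective :: "('a, 'z) graded_ring_scheme \<Rightarrow> ('a, 'p) graded_module \<Rightarrow> bool"
  where "graded_projective R P \<longleftrightarrow>
    graded_left_module R P \<and> left_bounded P \<and>
    (\<forall>(X :: ('a, ('a + 'p) list) graded_module) (Y :: ('a, ('a + 'p) list) graded_module) g h.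
       graded_left_module R X \<and> left_bounded X \<and> graded_left_module R Y \<and> left_bounded Y \<and>
       g \<in> graded_hom R X Y \<and> g ` carrier X = carrier Y \<and> h \<in> graded_hom R P Y \<longrightarrow>
       (\<exists>l\<in>graded_hom R P X. \<forall>x\<in>carrier P. g (l x) = h x))"

text \<open>A projective cover: an epimorphism from a projective with superfluous kernel.\<close>

definition projective_cover ::
    "('a, 'z) graded_ring_scheme \<Rightarrow> ('a, 'p) graded_module \<Rightarrow> ('a, 'm) graded_module \<Rightarrow> ('p \<Rightarrow> 'm) \<Rightarrow> bool"
  where "projective_cover R P M \<pi> \<longleftrightarrow>
    graded_projective R P \<and> graded_left_module R M \<and> left_bounded M \<and>
    \<pi> \<in> graded_hom R P M \<and> \<pi> ` carrier P = carrier M \<and>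
    (\<forall>U. graded_submodule R U P \<and> \<pi> ` U = carrier M \<longrightarrow> U = carrier P)"

text \<open>
  \<open>\<dots> \<rightarrow> P 2 \<rightarrow> P 1 \<rightarrow> P 0 \<rightarrow> M \<rightarrow> 0\<close> with \<open>d n : P (n + 1) \<rightarrow> P n\<close> and \<open>\<epsilon> : P 0 \<rightarrow> M\<close>; exactness is
  part of the surjectivity of each cover onto the preceding kernel.
\<close>

definition minimal_projective_resolution ::
    "('a, 'z) graded_ring_scheme \<Rightarrow> ('a, 'm) graded_module \<Rightarrow>
     (nat \<Rightarrow> ('a, 'p) graded_module) \<Rightarrow> ('p \<Rightarrow> 'm) \<Rightarrow> (nat \<Rightarrow> 'p \<Rightarrow> 'p) \<Rightarrow> bool"
  where "minimal_projective_resolution R M P \<epsilon> d \<longleftrightarrow>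
    projective_cover R (P 0) M \<epsilon> \<and>
    projective_cover R (P 1) (kernel_module (P 0) M \<epsilon>) (d 0) \<and>
    (\<forall>n. projective_cover R (P (n + 2)) (kernel_module (P (n + 1)) (P n) (d n)) (d (n + 1)))"

text \<open>
  The relation \<open>N \<cong> \<Omega>\<^sup>n M\<close>. As above, the type \<open>('a + 'm) list\<close> is large enough to carry copies of all
  modules \<open>\<Omega>\<^sup>n M\<close> and of their projective covers.
\<close>

inductive is_syzygy ::
    "('a, 'z) graded_ring_scheme \<Rightarrow> ('a, 'm) graded_module \<Rightarrow> nat \<Rightarrow>
     ('a, ('a + 'm) list) graded_module \<Rightarrow> bool"
  for R M where
  zero: "graded_isomorphic R M N \<Longrightarrow> is_syzygy R M 0 N"
| Suc: "\<lbrakk>is_syzygy R M n N; projective_cover R (P :: ('a, ('a + 'm) list) graded_module) N \<pi>;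
         graded_isomorphic R (kernel_module P N \<pi>) N'\<rbrakk> \<Longrightarrow> is_syzygy R M (Suc n) N'"

definition koszul_module :: "('a, 'z) graded_ring_scheme \<Rightarrow> ('a, 'm) graded_module \<Rightarrow> bool"
  where "koszul_module R M \<longleftrightarrow>
    graded_left_module R M \<and> left_bounded M \<and> generated_in_degree R M 0 \<and>
    (\<exists>(P :: nat \<Rightarrow> ('a, ('a + 'm) list) graded_module) \<epsilon> d.
       minimal_projective_resolution R M P \<epsilon> d \<and>
       (\<forall>i. generated_in_degree R (P i) (int i)))"

text \<open>
  Semisimplicity of the degree-zero part is expressed on \<open>R / R\<^bsub>\<ge>1\<^esub>\<close>, whose submodules are the left
  ideals of \<open>R\<^sub>0\<close>.
\<close>

definition koszul_ring :: "('a, 'z) graded_ring_scheme \<Rightarrow> bool"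
  where "koszul_ring R \<longleftrightarrow>
    graded_ring R \<and> (\<exists>Ss. simple_decomposition R Ss) \<and> koszul_module R (top_module R)"


section \<open>The Koszul syzygy condition\<close>

text \<open>
  Here \<open>Ss\<close> is the chosen decomposition of the right module \<open>L / L\<^bsub>\<ge>1\<^esub>\<close>, so that
  \<open>simple_decomposition (opposite L) Ss\<close> is presupposed.
\<close>

definition koszul_syzygy_condition :: "('a, 'z) graded_ring_scheme \<Rightarrow> 'a set set list \<Rightarrow> bool"
  where "koszul_syzygy_condition L Ss \<longleftrightarrow>
    (let R = opposite L; S = (\<lambda>j. restrict_module (top_module R) (Ss ! j)) in
     \<forall>i. \<forall>j<length Ss. \<forall>l<length Ss. \<forall>N f.
       is_syzygy R (S j) i N \<and> f \<in> graded_hom R (shift N (int i)) (S l) \<longrightarrow>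
       koszul_module R (kernel_module (shift N (int i)) (S l) f))"


section \<open>Connected graded algebras\<close>

text \<open>The map \<open>\<iota> : k \<rightarrow> A\<close> is the structure map of the algebra; it identifies \<open>k\<close> with \<open>A\<^sub>0\<close>.\<close>

definition connected_graded_algebra ::
    "('k, 'y) ring_scheme \<Rightarrow> ('k \<Rightarrow> 'a) \<Rightarrow> ('a, 'z) graded_ring_scheme \<Rightarrow> bool"
  where "connected_graded_algebra k \<iota> A \<longleftrightarrow>
    graded_ring A \<and> \<iota> \<in> ring_hom k A \<and>
    (\<forall>c\<in>carrier k. \<forall>x\<in>carrier A. \<iota> c \<otimes>\<^bsub>A\<^esub> x = x \<otimes>\<^bsub>A\<^esub> \<iota> c) \<and>
    bij_betw \<iota> (carrier k) (component A 0)"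

definition finitely_generated_algebra ::
    "('k, 'y) ring_scheme \<Rightarrow> ('k \<Rightarrow> 'a) \<Rightarrow> ('a, 'z) ring_scheme \<Rightarrow> bool"
  where "finitely_generated_algebra k \<iota> A \<longleftrightarrow>
    (\<exists>X. finite X \<and> X \<subseteq> carrier A \<and> generate_ring A (\<iota> ` carrier k \<union> X) = carrier A)"

text \<open>The locale \<^locale>\<open>domain\<close> of the library includes commutativity.\<close>

definition noncommutative_domain :: "('a, 'z) ring_scheme \<Rightarrow> bool"
  where "noncommutative_domain A \<longleftrightarrow>
    \<one>\<^bsub>A\<^esub> \<noteq> \<zero>\<^bsub>A\<^esub> \<and>
    (\<forall>x\<in>carrier A. \<forall>y\<in>carrier A. x \<otimes>\<^bsub>A\<^esub> y = \<zero>\<^bsub>A\<^esub> \<longrightarrow> x = \<zero>\<^bsub>A\<^esub> \<or> y = \<zero>\<^bsub>A\<^esub>)"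


section \<open>The Ext algebra\<close>

text \<open>
  Let \<open>(P, d)\<close> be a projective resolution of \<open>M\<close>. Then \<open>Ext\<^sup>n(M, M)\<close> is the group of chain maps
  \<open>P \<rightarrow> P\<close> lowering the homological degree by \<open>n\<close>, modulo null-homotopic ones, and the Yoneda product
  is induced by composition. An element of the direct sum over \<open>n\<close> is a family \<open>F\<close>, nonzero for only
  finitely many \<open>n\<close>, where \<open>F n m : P (m + n) \<rightarrow> P m\<close>. All maps are linear, not necessarily graded.
  Chain maps commute with \<open>d\<close> strictly; the convention with the sign \<open>(-1)\<^sup>n\<close> gives an isomorphic
  algebra.
\<close>

definition chain_maps ::
    "('a, 'z) ring_scheme \<Rightarrow> (nat \<Rightarrow> ('a, 'p, 'w) module_scheme) \<Rightarrow> (nat \<Rightarrow> 'p \<Rightarrow> 'p) \<Rightarrow>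
     (nat \<Rightarrow> nat \<Rightarrow> 'p \<Rightarrow> 'p) set"
  where "chain_maps A P d =
    {F. (\<forall>n m. F n m \<in> linear_maps A (P (m + n)) (P m) \<inter> extensional (carrier (P (m + n)))) \<and>
        (\<forall>n m. \<forall>x\<in>carrier (P (m + 1 + n)). d m (F n (m + 1) x) = F n m (d (m + n) x)) \<and>
        finite {n. \<exists>m. \<exists>x\<in>carrier (P (m + n)). F n m x \<noteq> \<zero>\<^bsub>P m\<^esub>}}"

text \<open>
  Composition is from left to right: in the product of \<open>F\<close> and \<open>G\<close>, first \<open>F\<close> is applied, then \<open>G\<close>.
\<close>

definition chain_map_ring ::
    "('a, 'z) ring_scheme \<Rightarrow> (nat \<Rightarrow> ('a, 'p, 'w) module_scheme) \<Rightarrow> (nat \<Rightarrow> 'p \<Rightarrow> 'p) \<Rightarrow>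
     (nat \<Rightarrow> nat \<Rightarrow> 'p \<Rightarrow> 'p) ring"
  where "chain_map_ring A P d =
    \<lparr>carrier = chain_maps A P d,
     mult = (\<lambda>F G n m. \<lambda>x\<in>carrier (P (m + n)).
        \<Oplus>\<^bsub>P m\<^esub>i\<in>{..n}. G (n - i) m (F i (m + (n - i)) x)),
     one = (\<lambda>n m. \<lambda>x\<in>carrier (P (m + n)). if n = 0 then x else \<zero>\<^bsub>P m\<^esub>),
     zero = (\<lambda>n m. \<lambda>x\<in>carrier (P (m + n)). \<zero>\<^bsub>P m\<^esub>),
     add = (\<lambda>F G n m. \<lambda>x\<in>carrier (P (m + n)). F n m x \<oplus>\<^bsub>P m\<^esub> G n m x)\<rparr>"

text \<open>
  The homotopy \<open>h n\<close> has components \<open>h n p : P p \<rightarrow> P (p + 1 - n)\<close> for \<open>p + 1 \<ge> n\<close>, and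
  \<open>F n m = d m \<circ> h n (m + n) + h n (m + n - 1) \<circ> d (m + n - 1)\<close>, the second term being absent when
  \<open>m + n = 0\<close>.
\<close>

definition null_homotopic ::
    "('a, 'z) ring_scheme \<Rightarrow> (nat \<Rightarrow> ('a, 'p, 'w) module_scheme) \<Rightarrow> (nat \<Rightarrow> 'p \<Rightarrow> 'p) \<Rightarrow>
     (nat \<Rightarrow> nat \<Rightarrow> 'p \<Rightarrow> 'p) set"
  where "null_homotopic A P d =
    {F \<in> chain_maps A P d. \<exists>h.
        (\<forall>n p. n \<le> p + 1 \<longrightarrow> h n p \<in> linear_maps A (P p) (P (p + 1 - n))) \<and>
        (\<forall>n m. \<forall>x\<in>carrier (P (m + n)). F n m x =
           d m (h n (m + n) x) \<oplus>\<^bsub>P m\<^esub>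
           (if m + n = 0 then \<zero>\<^bsub>P m\<^esub> else h n (m + n - 1) (d (m + n - 1) x)))}"

definition ext_algebra ::
    "('a, 'z) ring_scheme \<Rightarrow> (nat \<Rightarrow> ('a, 'p, 'w) module_scheme) \<Rightarrow> (nat \<Rightarrow> 'p \<Rightarrow> 'p) \<Rightarrow>
     (nat \<Rightarrow> nat \<Rightarrow> 'p \<Rightarrow> 'p) set graded_ring"
  where "ext_algebra A P d =
    (let Z = chain_map_ring A P d; B = null_homotopic A P d; E = Z Quot B in
     \<lparr>carrier = carrier E, mult = mult E, one = one E, zero = zero E, add = add E,
      component = (\<lambda>n. {B +>\<^bsub>Z\<^esub> F | F. F \<in> carrier Z \<and> (\<forall>n'. n' \<noteq> n \<longrightarrow> F n' = \<zero>\<^bsub>Z\<^esub> n')})\<rparr>)"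

end

theory Submission
 imports Defs
begin

text \<open>
Let \<open>R\<close> be the opposite of the Ext algebra. For a graded left \<open>R\<close>-module \<open>M\<close> consider the complexes
\<open>Hom\<^sub>k(M\<^sub>j, A\<^sub>m) \<rightarrow> Hom\<^sub>k(M\<^bsub>j-1\<^esub>, A\<^bsub>m+1\<^esub>)\<close>, \<open>f \<mapsto> (x \<mapsto> \<Sum>\<^sub>s f(\<epsilon>\<^sub>s x) e\<^sub>s)\<close>, where \<open>e\<^sub>s\<close> is a
basis of \<open>A\<^sub>1\<close> and \<open>\<epsilon>\<^sub>s\<close> the dual basis of \<open>R\<^sub>1\<close>. They compute Ext from \<open>M\<close> to the trivial module, and
they are elementary: no derived functor is needed. Three facts carry the proof.

(1) For \<open>M = R\<close> the complex is the minimal resolution of the trivial \<open>A\<close>-module. As \<open>A\<close> is Koszul, this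
resolution is linear, so that an Ext class of degree \<open>n\<close> is determined by its values on the basis of
the \<open>n\<close>-th term; the Yoneda product then turns the differential of the resolution into the map above
(\<open>comp_mult_eq\<close>, \<open>koszul_dual_opposite\<close>). Hence the complex is exact for every free module outside
its degree of generation (\<open>free_exact\<close>), and dimension shifting along a free presentation is possible.

(2) A module \<open>M\<close> with finite-dimensional components and \<open>M\<^sub>n = 0\<close> for \<open>n < 0\<close> is Koszul iff its
complexes are exact at \<open>M\<^sub>j\<close> for all \<open>j > 0\<close> (\<open>lin_koszul\<close>, \<open>koszul_exact\<close>).

(3) For the syzygy \<open>N = \<Omega>\<^sup>i k\<close>, which starts in degree \<open>i\<close>, the cohomology at the lowest degree of
\<open>Hom\<^sub>k(N, A)\<close> is the shifted left module \<open>A\<^bsub>m+i\<^esub>\<close> (\<open>bottom_kernel\<close>, \<open>syzygy_lin_bottom\<close>).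

A map \<open>f : N(i) \<rightarrow> k\<close> is a functional on \<open>N\<^sub>i\<close>, hence corresponds by (3) to an element \<open>b \<in> A\<^sub>i\<close>, and every
\<open>b\<close> occurs. Its kernel differs from \<open>N(i)\<close> only in degree \<open>0\<close>, so by (2) only exactness in degree \<open>1\<close> is
in question. A cochain on \<open>N\<^bsub>i+1\<^esub>\<close> is a cocycle for the kernel iff its differential is \<open>a f\<close> for some \<open>a\<close>,
and \<open>a f\<close> is a coboundary iff \<open>a b = 0\<close>. Therefore \<open>ker f\<close> is Koszul iff \<open>a b = 0\<close> implies \<open>a = 0\<close> for
homogeneous \<open>a\<close> of positive degree (\<open>kernel_koszul_iff\<close>). Requiring this for all \<open>b \<noteq> 0\<close> says that \<open>A\<close>
has no homogeneous zero divisors, which for graded rings means that \<open>A\<close> is a domain.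
\<close>

abbreviation tup :: "nat => 'b set => (nat => 'b) set" where "tup n S \<equiv> {..<n} \<rightarrow> S"

section \<open>Finite sums and subgroups\<close>

lemma finsum_struct:
 assumes "carrier G = carrier H" "add G = add H" "zero G = zero H"
 shows "finsum G f S = finsum H f S"
 using assms by (simp add: finsum_def finprod_def)

lemma (in abelian_group) finsum_single:
 assumes "finite S" "j : S" "!!i. [|i : S; i ~= j|] ==> f i = \<zero>" "f j : carrier G"
 shows "finsum G f S = f j"
proof -
 have "finsum G f S = finsum G (%i. if j = i then f j else \<zero>) S"
  using assms by (intro finsum_cong') auto
 also have "... = f j"
  using assms(1,2,4) add.finprod_singleton[of j S "%_. f j"] by auto
 finally show ?thesis .
qed

lemma (in abelian_group) finsum_lessThan_Suc:
 assumes "f : {..<Suc n} \<rightarrow> carrier G"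
 shows "finsum G f {..<Suc n} = finsum G f {..<n} \<oplus> f n"
proof -
 have "finsum G f {..<Suc n} = f n \<oplus> finsum G f {..<n}"
  unfolding lessThan_Suc using assms by (subst finsum_insert) auto
 then show ?thesis using assms by (simp add: Pi_def a_comm)
qed

lemma (in abelian_group) finsum_swap:
 assumes "finite S" "finite T" "!!s t. [|s : S; t : T|] ==> f s t : carrier G"
 shows "(\<Oplus>s\<in>S. \<Oplus>t\<in>T. f s t) = (\<Oplus>t\<in>T. \<Oplus>s\<in>S. f s t)"
 using assms(1,3)
proof (induction S rule: finite_induct)
 case empty
 then show ?case by (simp add: finsum_zero)
next
 case (insert s S)
 have "(\<Oplus>u\<in>insert s S. \<Oplus>t\<in>T. f u t) = (\<Oplus>t\<in>T. f s t) \<oplus> (\<Oplus>u\<in>S. \<Oplus>t\<in>T. f u t)"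
  using insert by (subst finsum_insert) (auto intro!: finsum_closed)
 also have "(\<Oplus>u\<in>S. \<Oplus>t\<in>T. f u t) = (\<Oplus>t\<in>T. \<Oplus>u\<in>S. f u t)"
  using insert by auto
 also have "(\<Oplus>t\<in>T. f s t) \<oplus> (\<Oplus>t\<in>T. \<Oplus>u\<in>S. f u t) = (\<Oplus>t\<in>T. f s t \<oplus> (\<Oplus>u\<in>S. f u t))"
  using insert by (intro finsum_addf[symmetric]) (auto intro!: finsum_closed)
 also have "... = (\<Oplus>t\<in>T. \<Oplus>u\<in>insert s S. f u t)"
  using insert by (intro finsum_cong' refl) (auto intro!: finsum_closed simp: Pi_def)
 finally show ?case .
qed

lemma subgroup_addI:
 assumes "abelian_group G" "W \<subseteq> carrier G" "\<zero>\<^bsub>G\<^esub> : W"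
  "!!x y. [|x : W; y : W|] ==> x \<oplus>\<^bsub>G\<^esub> y : W" "!!x. x : W ==> \<ominus>\<^bsub>G\<^esub> x : W"
 shows "subgroup W (add_monoid G)"
 using assms by (auto intro!: subgroup.intro simp: a_inv_def)

lemma subgroup_addD:
 assumes "abelian_group G" "subgroup W (add_monoid G)"
 shows "W \<subseteq> carrier G" "\<zero>\<^bsub>G\<^esub> : W"
  "!!x y. [|x : W; y : W|] ==> x \<oplus>\<^bsub>G\<^esub> y : W" "!!x. x : W ==> \<ominus>\<^bsub>G\<^esub> x : W"
 using subgroup.subset[OF assms(2)] subgroup.one_closed[OF assms(2)] subgroup.m_closed[OF assms(2)]
  subgroup.m_inv_closed[OF assms(2)] by (auto simp: a_inv_def)

lemma subgroup_finsum:
 assumes "abelian_group G" "subgroup W (add_monoid G)" "g : S \<rightarrow> W"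
 shows "finsum G g S : W"
proof -
 interpret abelian_group G by fact
 note W = subgroup_addD[OF assms(1,2)]
 show ?thesis
 proof (cases "finite S")
  case True
  then show ?thesis using assms(3)
  proof (induction S rule: finite_induct)
   case (insert s S)
   then show ?case using W(1,3) by (subst finsum_insert) (auto simp: Pi_def)
  qed (simp add: W(2))
 qed (simp add: W(2))
qed

lemma additive_zero:
 assumes "abelian_group G" "abelian_group H" "subgroup W (add_monoid G)"
  "f : W \<rightarrow> carrier H" "!!x y. [|x : W; y : W|] ==> f (x \<oplus>\<^bsub>G\<^esub> y) = f x \<oplus>\<^bsub>H\<^esub> f y"
 shows "f \<zero>\<^bsub>G\<^esub> = \<zero>\<^bsub>H\<^esub>"
proof -
 interpret G: abelian_group G by fact
 interpret H: abelian_group H by fact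
 note W = subgroup_addD[OF assms(1,3)]
 have "f \<zero>\<^bsub>G\<^esub> \<oplus>\<^bsub>H\<^esub> f \<zero>\<^bsub>G\<^esub> = f \<zero>\<^bsub>G\<^esub> \<oplus>\<^bsub>H\<^esub> \<zero>\<^bsub>H\<^esub>"
  using assms(4) assms(5)[of "\<zero>\<^bsub>G\<^esub>" "\<zero>\<^bsub>G\<^esub>"] W by (auto simp: Pi_def)
 moreover have "f \<zero>\<^bsub>G\<^esub> : carrier H" using assms(4) W(2) by auto
 ultimately show ?thesis by (metis H.add.r_cancel_one' H.add.m_comm H.zero_closed H.r_zero)
qed

lemma additive_minus:
 assumes "abelian_group G" "abelian_group H" "subgroup W (add_monoid G)"
  "f : W \<rightarrow> carrier H" "!!x y. [|x : W; y : W|] ==> f (x \<oplus>\<^bsub>G\<^esub> y) = f x \<oplus>\<^bsub>H\<^esub> f y" "x : W"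
 shows "f (\<ominus>\<^bsub>G\<^esub> x) = \<ominus>\<^bsub>H\<^esub> f x"
proof -
 interpret G: abelian_group G by fact
 interpret H: abelian_group H by fact
 note W = subgroup_addD[OF assms(1,3)]
 have "f (\<ominus>\<^bsub>G\<^esub> x) \<oplus>\<^bsub>H\<^esub> f x = \<zero>\<^bsub>H\<^esub>"
  using assms(5)[OF W(4)[OF assms(6)] assms(6)] additive_zero[OF assms(1-5)] W(1) assms(6)
  by (auto simp: G.l_neg)
 then show ?thesis
  using H.minus_equality[of "f (\<ominus>\<^bsub>G\<^esub> x)" "f x"] assms(4,6) W(4) by (metis Pi_mem)
qed

lemma additive_finsum:
 assumes "abelian_group G" "abelian_group H" "subgroup W (add_monoid G)"
  "f : W \<rightarrow> carrier H" "!!x y. [|x : W; y : W|] ==> f (x \<oplus>\<^bsub>G\<^esub> y) = f x \<oplus>\<^bsub>H\<^esub> f y" "g : S \<rightarrow> W"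
 shows "f (finsum G g S) = finsum H (%s. f (g s)) S"
proof -
 interpret G: abelian_group G by fact
 interpret H: abelian_group H by fact
 note W = subgroup_addD[OF assms(1,3)]
 show ?thesis
 proof (cases "finite S")
  case True
  then show ?thesis using assms(6)
  proof (induction S rule: finite_induct)
   case empty
   then show ?case by (simp add: additive_zero[OF assms(1-5)])
  next
   case (insert s S)
   have "finsum G g S : W" using insert by (intro subgroup_finsum[OF assms(1,3)]) auto
   moreover have "g : S \<rightarrow> carrier G" "g s : carrier G" "g s : W"
    using insert W(1) by (auto simp: Pi_def)
   moreover have "(%s. f (g s)) : S \<rightarrow> carrier H" "f (g s) : carrier H"
    using insert assms(4) by (auto simp: Pi_def)
   ultimately show ?case using insert assms(5) by (simp add: Pi_def)
  qed
 qed (simp add: additive_zero[OF assms(1-5)])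
qed

lemma carrier_subgroup_add: "abelian_group G ==> subgroup (carrier G) (add_monoid G)"
 by (auto intro!: subgroup_addI simp: abelian_group.a_inv_closed abelian_monoid.zero_closed
   abelian_monoid.a_closed abelian_group.axioms)

section \<open>Direct sums\<close>

definition hcomp :: "('m, 'z) ring_scheme => ('i => 'm set) => 'm => 'i => 'm" where
 "hcomp G C x = (THE c. c : (\<Pi>\<^sub>E i\<in>UNIV. C i) & finite {i : UNIV. c i ~= \<zero>\<^bsub>G\<^esub>} \<and>
    x = (\<Oplus>\<^bsub>G\<^esub>i\<in>{i : UNIV. c i ~= \<zero>\<^bsub>G\<^esub>}. c i))"

locale direct_sum = abelian_group G for G :: "('m, 'z) ring_scheme" (structure) +
 fixes C :: "'i => 'm set"
 assumes ids: "internal_direct_sum G UNIV C"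
begin

lemma C_sub: "subgroup (C i) (add_monoid G)"
 using ids by (auto simp: internal_direct_sum_def)

lemmas C_subD = subgroup_addD[OF abelian_group_axioms C_sub]

lemma C_closed: "x : C i ==> x : carrier G"
 using C_subD(1) by auto

lemma hcomp_props:
 assumes "x : carrier G"
 shows "hcomp G C x i : C i" "finite {i. hcomp G C x i ~= \<zero>}"
  "x = (\<Oplus>i\<in>{i. hcomp G C x i ~= \<zero>}. hcomp G C x i)"
proof -
 have "\<exists>!c. c : (\<Pi>\<^sub>E i\<in>UNIV. C i) & finite {i : UNIV. c i ~= \<zero>} \<and>
    x = (\<Oplus>i\<in>{i : UNIV. c i ~= \<zero>}. c i)"
  using ids assms unfolding internal_direct_sum_def by blast
 from theI'[OF this] show "hcomp G C x i : C i" "finite {i. hcomp G C x i ~= \<zero>}"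
  "x = (\<Oplus>i\<in>{i. hcomp G C x i ~= \<zero>}. hcomp G C x i)"
  unfolding hcomp_def[symmetric] by auto
qed

lemma hcomp_carrier: "x : carrier G ==> hcomp G C x i : carrier G"
 using hcomp_props(1) C_closed by blast

lemma hcomp_unique:
 assumes "!!i. c i : C i" "finite S" "!!i. i \<notin> S ==> c i = \<zero>" "x = (\<Oplus>i\<in>S. c i)"
 shows "hcomp G C x = c"
proof -
 have cc: "c i : carrier G" for i using assms(1) C_closed by blast
 have x: "x : carrier G" using assms cc by (auto intro!: finsum_closed)
 have fin: "finite {i. c i ~= \<zero>}" using assms by (auto intro: finite_subset[of _ S])
 have "finsum G c S = finsum G c {i. c i ~= \<zero>}"
  using assms cc by (intro add.finprod_mono_neutral_cong_right) auto
 then have "c : (\<Pi>\<^sub>E i\<in>UNIV. C i) & finite {i : UNIV. c i ~= \<zero>} \<and>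
    x = (\<Oplus>i\<in>{i : UNIV. c i ~= \<zero>}. c i)" using assms fin by auto
 moreover have "\<exists>!c. c : (\<Pi>\<^sub>E i\<in>UNIV. C i) & finite {i : UNIV. c i ~= \<zero>} \<and>
    x = (\<Oplus>i\<in>{i : UNIV. c i ~= \<zero>}. c i)"
  using ids x unfolding internal_direct_sum_def by blast
 ultimately show ?thesis unfolding hcomp_def by (rule the1_equality[rotated])
qed

lemma hcomp_sum:
 assumes "x : carrier G" "finite S" "!!i. i \<notin> S ==> hcomp G C x i = \<zero>"
 shows "x = (\<Oplus>i\<in>S. hcomp G C x i)"
proof -
 have "finsum G (hcomp G C x) S = finsum G (hcomp G C x) {i. hcomp G C x i ~= \<zero>}"
  using assms hcomp_carrier by (intro add.finprod_mono_neutral_cong_right) auto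
 then show ?thesis using hcomp_props(3)[OF assms(1)] by (rule trans[OF _ sym, rotated])
qed

lemma hcomp_add:
 assumes "x : carrier G" "y : carrier G"
 shows "hcomp G C (x \<oplus> y) i = hcomp G C x i \<oplus> hcomp G C y i"
proof -
 define S where "S = {i. hcomp G C x i ~= \<zero>} \<union> {i. hcomp G C y i ~= \<zero>}"
 have "x \<oplus> y = (\<Oplus>i\<in>S. hcomp G C x i) \<oplus> (\<Oplus>i\<in>S. hcomp G C y i)"
  by (intro arg_cong2[where f = "add G"] hcomp_sum assms)
   (auto simp: S_def hcomp_props(2)[OF assms(1)] hcomp_props(2)[OF assms(2)])
 also have "... = (\<Oplus>i\<in>S. hcomp G C x i \<oplus> hcomp G C y i)"
  using hcomp_carrier assms by (intro finsum_addf[symmetric]) auto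
 finally have "hcomp G C (x \<oplus> y) = (%i. hcomp G C x i \<oplus> hcomp G C y i)"
  using hcomp_props(1,2) assms C_subD(3) 
  by (intro hcomp_unique[of _ S]) (auto simp: S_def)
 then show ?thesis by simp
qed

lemma hcomp_homog:
 assumes "x : C i"
 shows "hcomp G C x j = (if j = i then x else \<zero>)"
proof -
 have "hcomp G C x = (%j. if j = i then x else \<zero>)"
  using assms C_subD(2) C_closed by (intro hcomp_unique[of _ "{i}"]) (auto simp: Pi_def)
 then show ?thesis by simp
qed

lemma hcomp_zero: "hcomp G C \<zero> j = \<zero>"
 using hcomp_homog[OF C_subD(2)] by simp

lemma hcomp_additive: "(%x. hcomp G C x i) : carrier G \<rightarrow> carrier G"
 using hcomp_carrier by auto

lemma hcomp_neg: "x : carrier G ==> hcomp G C (\<ominus> x) i = \<ominus> hcomp G C x i"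
 using additive_minus[OF abelian_group_axioms abelian_group_axioms carrier_subgroup_add
  [OF abelian_group_axioms], of "%x. hcomp G C x i"] hcomp_additive hcomp_add by auto

lemma hcomp_finsum: "g : S \<rightarrow> carrier G ==> hcomp G C (finsum G g S) i = (\<Oplus>s\<in>S. hcomp G C (g s) i)"
 using additive_finsum[OF abelian_group_axioms abelian_group_axioms carrier_subgroup_add
  [OF abelian_group_axioms], of "%x. hcomp G C x i"] hcomp_additive hcomp_add by auto

lemma hcomp_eqI:
 assumes "x : carrier G" "y : carrier G" "!!i. hcomp G C x i = hcomp G C y i"
 shows "x = y"
proof -
 have "hcomp G C x = hcomp G C y" using assms(3) by auto
 then show ?thesis using hcomp_props(3)[OF assms(1)] hcomp_props(3)[OF assms(2)] by metis
qed

end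

text \<open>A direct sum decomposition is a compatible family of projections; uniqueness of the components follows
by applying the projections to a given sum.\<close>

lemma ids_intro:
 assumes "abelian_group G" "!!i. subgroup (C i) (add_monoid G)"
  "!!x i. x : carrier G ==> p i x : C i"
  "!!x. x : carrier G ==> finite {i. p i x ~= \<zero>\<^bsub>G\<^esub>}"
  "!!x. x : carrier G ==> x = (\<Oplus>\<^bsub>G\<^esub>i\<in>{i. p i x ~= \<zero>\<^bsub>G\<^esub>}. p i x)"
  "!!i x y. [|x : carrier G; y : carrier G|] ==> p i (x \<oplus>\<^bsub>G\<^esub> y) = p i x \<oplus>\<^bsub>G\<^esub> p i y"
  "!!i j x. x : C i ==> p j x = (if j = i then x else \<zero>\<^bsub>G\<^esub>)"
 shows "internal_direct_sum G UNIV C"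
 unfolding internal_direct_sum_def
proof (intro conjI ballI)
 interpret abelian_group G by fact
 note Cs = subgroup_addD[OF assms(1) assms(2)]
 fix x assume x: "x : carrier G"
 let ?P = "%c. c : (\<Pi>\<^sub>E i\<in>UNIV. C i) & finite {i : UNIV. c i ~= \<zero>\<^bsub>G\<^esub>} \<and>
    x = (\<Oplus>\<^bsub>G\<^esub>i\<in>{i : UNIV. c i ~= \<zero>\<^bsub>G\<^esub>}. c i)"
 show "\<exists>!c. ?P c"
 proof (rule ex1I[of _ "%i. p i x"])
  show "?P (%i. p i x)" using assms(3,4,5) x by auto
 next
  fix c assume c: "?P c"
  show "c = (%i. p i x)"
  proof
   fix i
   have cC: "c j : C j" "c j : carrier G" for j using c Cs(1) by (auto simp: PiE_def Pi_def)
   have "p i x = p i (\<Oplus>\<^bsub>G\<^esub>i\<in>{i. c i ~= \<zero>\<^bsub>G\<^esub>}. c i)" using c by simp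
   also have "... = (\<Oplus>\<^bsub>G\<^esub>j\<in>{i. c i ~= \<zero>\<^bsub>G\<^esub>}. p i (c j))"
    using assms(3,6) Cs(1) cC
    by (intro additive_finsum[OF assms(1,1) carrier_subgroup_add[OF assms(1)]])
     (auto intro: subsetD[OF Cs(1) assms(3)])
   also have "... = (\<Oplus>\<^bsub>G\<^esub>j\<in>{i. c i ~= \<zero>\<^bsub>G\<^esub>}. if i = j then c i else \<zero>\<^bsub>G\<^esub>)"
    using assms(7)[OF cC(1)] cC(2) by (intro finsum_cong') auto
   also have "... = c i"
   proof (cases "c i = \<zero>\<^bsub>G\<^esub>")
    case True
    then show ?thesis by (auto intro!: add.finprod_one_eqI)
   next
    case False
    then show ?thesis using c cC(2) by (subst finsum_single[of _ i]) auto
   qed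
   finally show "c i = p i x" by simp
  qed
 qed
qed (use assms in auto)

section \<open>Modules and linear maps\<close>

context left_module
begin

lemma M_group: "abelian_group M" by (rule M.abelian_group_axioms)
lemma R_ring: "ring R" by (rule R.ring_axioms)
lemma R_group: "abelian_group R" by (rule R.abelian_group_axioms)

lemma finsum_smult_r:
 "[|a : carrier R; f : S \<rightarrow> carrier M|] ==> a \<odot>\<^bsub>M\<^esub> finsum M f S = finsum M (%s. a \<odot>\<^bsub>M\<^esub> f s) S"
 using additive_finsum[OF M_group M_group carrier_subgroup_add[OF M_group], of "%x. a \<odot>\<^bsub>M\<^esub> x"]
 by (auto simp: smult_closed smult_r_distr)

lemma finsum_smult_l:
 "[|x : carrier M; f : S \<rightarrow> carrier R|] ==> finsum R f S \<odot>\<^bsub>M\<^esub> x = finsum M (%s. f s \<odot>\<^bsub>M\<^esub> x) S"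
 using additive_finsum[OF R_group M_group carrier_subgroup_add[OF R_group], of "%a. a \<odot>\<^bsub>M\<^esub> x"]
 by (auto simp: smult_closed smult_l_distr)

lemma smult_zero_l: "x : carrier M ==> \<zero>\<^bsub>R\<^esub> \<odot>\<^bsub>M\<^esub> x = \<zero>\<^bsub>M\<^esub>"
 using additive_zero[OF R_group M_group carrier_subgroup_add[OF R_group], of "%a. a \<odot>\<^bsub>M\<^esub> x"]
 by (auto simp: smult_closed smult_l_distr)

lemma smult_zero_r: "a : carrier R ==> a \<odot>\<^bsub>M\<^esub> \<zero>\<^bsub>M\<^esub> = \<zero>\<^bsub>M\<^esub>"
 using additive_zero[OF M_group M_group carrier_subgroup_add[OF M_group], of "%x. a \<odot>\<^bsub>M\<^esub> x"]
 by (auto simp: smult_closed smult_r_distr)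

lemma smult_minus_l: "[|a : carrier R; x : carrier M|] ==> (\<ominus>\<^bsub>R\<^esub> a) \<odot>\<^bsub>M\<^esub> x = \<ominus>\<^bsub>M\<^esub> (a \<odot>\<^bsub>M\<^esub> x)"
 using additive_minus[OF R_group M_group carrier_subgroup_add[OF R_group], of "%a. a \<odot>\<^bsub>M\<^esub> x"]
 by (auto simp: smult_closed smult_l_distr)

lemma smult_minus_r: "[|a : carrier R; x : carrier M|] ==> a \<odot>\<^bsub>M\<^esub> (\<ominus>\<^bsub>M\<^esub> x) = \<ominus>\<^bsub>M\<^esub> (a \<odot>\<^bsub>M\<^esub> x)"
 using additive_minus[OF M_group M_group carrier_subgroup_add[OF M_group], of "%x. a \<odot>\<^bsub>M\<^esub> x"]
 by (auto simp: smult_closed smult_r_distr)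

lemma carrier_submodule: "submodule (carrier M) R M"
 by (auto simp: submodule_def submodule_axioms_def smult_closed carrier_subgroup_add[OF M_group])

end

text \<open>Linearity is imposed on a subset \<open>W\<close> only, so that maps on a single homogeneous component need no
separate module structure.\<close>

definition linear_on ::
  "('a, 'y) ring_scheme => ('a, 'm, 'z) module_scheme => ('a, 'n, 'w) module_scheme => 'm set => ('m => 'n) => bool"
 where "linear_on R M N W f \<longleftrightarrow> f : W \<rightarrow> carrier N \<and>
  (ALL x:W. ALL y:W. f (x \<oplus>\<^bsub>M\<^esub> y) = f x \<oplus>\<^bsub>N\<^esub> f y) \<and>
  (ALL a:carrier R. ALL x:W. f (a \<odot>\<^bsub>M\<^esub> x) = a \<odot>\<^bsub>N\<^esub> f x)"

lemma linear_maps_iff: "f : linear_maps R M N \<longleftrightarrow> linear_on R M N (carrier M) f"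
 by (auto simp: linear_maps_def linear_on_def hom_def)

definition lc :: "('a, 'm, 'z) module_scheme => nat => (nat => 'a) => (nat => 'm) => 'm" where
 "lc M d r x = (\<Oplus>\<^bsub>M\<^esub>i\<in>{..<d}. r i \<odot>\<^bsub>M\<^esub> x i)"

lemma submoduleD:
 assumes "abelian_group M" "submodule W R M"
 shows "W \<subseteq> carrier M" "\<zero>\<^bsub>M\<^esub> : W" "!!x y. [|x : W; y : W|] ==> x \<oplus>\<^bsub>M\<^esub> y : W"
  "!!x. x : W ==> \<ominus>\<^bsub>M\<^esub> x : W" "!!a x. [|a : carrier R; x : W|] ==> a \<odot>\<^bsub>M\<^esub> x : W"
  "subgroup W (add_monoid M)"
 using assms subgroup_addD[of M W] unfolding submodule_def submodule_axioms_def by auto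

lemma submoduleI':
 assumes "left_module R M" "W \<subseteq> carrier M" "\<zero>\<^bsub>M\<^esub> : W"
  "!!x y. [|x : W; y : W|] ==> x \<oplus>\<^bsub>M\<^esub> y : W"
  "!!a x. [|a : carrier R; x : W|] ==> a \<odot>\<^bsub>M\<^esub> x : W"
 shows "submodule W R M"
proof -
 interpret left_module R M by fact
 have "\<ominus>\<^bsub>M\<^esub> x : W" if "x : W" for x
 proof -
  have "(\<ominus>\<^bsub>R\<^esub> \<one>\<^bsub>R\<^esub>) \<odot>\<^bsub>M\<^esub> x = \<ominus>\<^bsub>M\<^esub> x"
   using that assms(2) by (subst smult_minus_l) (auto simp: smult_one)
  then show ?thesis using assms(5)[of "\<ominus>\<^bsub>R\<^esub> \<one>\<^bsub>R\<^esub>" x] that by simp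
 qed
 then show ?thesis using assms subgroup_addI[OF M_group, of W]
  by (auto simp: submodule_def submodule_axioms_def)
qed

context
 fixes R :: "('a, 'y) ring_scheme" and M :: "('a, 'm, 'z) module_scheme" and N :: "('a, 'n, 'w) module_scheme"
  and W f
 assumes M: "left_module R M" and N: "left_module R N" and W: "submodule W R M" and f: "linear_on R M N W f"
begin

interpretation M: left_module R M by fact
interpretation N: left_module R N by fact

private lemma W': "subgroup W (add_monoid M)" using submoduleD(6)[OF M.M_group W] .
private lemma f': "f : W \<rightarrow> carrier N" "!!x y. [|x : W; y : W|] ==> f (x \<oplus>\<^bsub>M\<^esub> y) = f x \<oplus>\<^bsub>N\<^esub> f y"
 using f by (auto simp: linear_on_def)

lemma linear_on_zero: "f \<zero>\<^bsub>M\<^esub> = \<zero>\<^bsub>N\<^esub>"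
 by (rule additive_zero[OF M.M_group N.M_group W' f'])

lemma linear_on_minus: "x : W ==> f (\<ominus>\<^bsub>M\<^esub> x) = \<ominus>\<^bsub>N\<^esub> f x"
 by (rule additive_minus[OF M.M_group N.M_group W' f'])

lemma linear_on_diff: "[|x : W; y : W|] ==> f (x \<ominus>\<^bsub>M\<^esub> y) = f x \<ominus>\<^bsub>N\<^esub> f y"
 using linear_on_minus submoduleD(4)[OF M.M_group W] f' by (simp add: a_minus_def)

lemma linear_on_finsum: "g : S \<rightarrow> W ==> f (finsum M g S) = finsum N (%s. f (g s)) S"
 by (rule additive_finsum[OF M.M_group N.M_group W' f'])

lemma linear_on_lc:
 assumes "r : tup d (carrier R)" "x : tup d W"
 shows "f (lc M d r x) = lc N d r (%i. f (x i))"
proof -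
 have "f (lc M d r x) = (\<Oplus>\<^bsub>N\<^esub>i\<in>{..<d}. f (r i \<odot>\<^bsub>M\<^esub> x i))"
  unfolding lc_def using assms submoduleD(5)[OF M.M_group W] by (intro linear_on_finsum) auto
 also have "... = lc N d r (%i. f (x i))"
  unfolding lc_def using assms f f'(1) by (intro N.finsum_cong') (auto simp: linear_on_def Pi_def N.smult_closed)
 finally show ?thesis .
qed

lemma linear_on_inj: 
 assumes "!!x. [|x : W; f x = \<zero>\<^bsub>N\<^esub>|] ==> x = \<zero>\<^bsub>M\<^esub>"
 shows "inj_on f W"
proof (rule inj_onI)
 fix x y assume xy: "x : W" "y : W" "f x = f y"
 have fxy: "f y : carrier N" using f'(1) xy by auto
 have "f (x \<ominus>\<^bsub>M\<^esub> y) = \<zero>\<^bsub>N\<^esub>"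
  using linear_on_diff[of x y] xy fxy by (simp add: a_minus_def N.r_neg)
 moreover have "x \<ominus>\<^bsub>M\<^esub> y : W" using xy submoduleD(3,4)[OF M.M_group W] by (auto simp: a_minus_def)
 ultimately have "x \<ominus>\<^bsub>M\<^esub> y = \<zero>\<^bsub>M\<^esub>" using assms by blast
 moreover have "x : carrier M" "y : carrier M" using xy submoduleD(1)[OF M.M_group W] by auto
 ultimately show "x = y" using M.minus_equality[of x "\<ominus>\<^bsub>M\<^esub> y"] by (simp add: a_minus_def)
qed

end

context left_module
begin

lemma lc_closed:
 "[|r : tup d (carrier R); x : {..<d} \<rightarrow> carrier M|] ==> lc M d r x : carrier M"
 unfolding lc_def by (intro finsum_closed) (auto simp: smult_closed Pi_def)

lemma lc_in:
 "[|submodule W R M; r : tup d (carrier R); x : {..<d} \<rightarrow> W|] ==> lc M d r x : W"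
 unfolding lc_def by (intro subgroup_finsum[OF M_group] submoduleD(6)[OF M_group])
  (auto intro!: submoduleD(5)[OF M_group])

lemma lc_cong:
 assumes "x : tup d (carrier M)" "r : tup d (carrier R)" "!!i. i < d ==> r i = s i" "!!i. i < d ==> x i = y i"
 shows "lc M d r x = lc M d s y"
proof -
 have "s i : carrier R & y i : carrier M" if "i < d" for i using assms that by (metis PiE lessThan_iff)
 then show ?thesis unfolding lc_def using assms(3,4) by (intro finsum_cong') (auto simp: smult_closed)
qed

lemma lc_add:
 "[|r : tup d (carrier R); s : tup d (carrier R); x : {..<d} \<rightarrow> carrier M|] ==>
  lc M d (%i. r i \<oplus>\<^bsub>R\<^esub> s i) x = lc M d r x \<oplus>\<^bsub>M\<^esub> lc M d s x"
proof -
 assume a: "r : tup d (carrier R)" "s : tup d (carrier R)" "x : tup d (carrier M)"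
 have "lc M d r x \<oplus>\<^bsub>M\<^esub> lc M d s x = (\<Oplus>\<^bsub>M\<^esub>i\<in>{..<d}. r i \<odot>\<^bsub>M\<^esub> x i \<oplus>\<^bsub>M\<^esub> s i \<odot>\<^bsub>M\<^esub> x i)"
  unfolding lc_def using a by (intro finsum_addf[symmetric]) (auto simp: smult_closed Pi_def)
 also have "... = lc M d (%i. r i \<oplus>\<^bsub>R\<^esub> s i) x"
  unfolding lc_def using a by (intro finsum_cong') (auto simp: smult_closed smult_l_distr Pi_def)
 finally show ?thesis by simp
qed

lemma lc_smult:
 "[|a : carrier R; r : tup d (carrier R); x : {..<d} \<rightarrow> carrier M|] ==>
  lc M d (%i. a \<otimes>\<^bsub>R\<^esub> r i) x = a \<odot>\<^bsub>M\<^esub> lc M d r x"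
 unfolding lc_def by (subst finsum_smult_r) (auto intro!: finsum_cong' simp: smult_assoc smult_closed Pi_def)

lemma lc_zero: "x : tup d (carrier M) ==> lc M d (%i. \<zero>\<^bsub>R\<^esub>) x = \<zero>\<^bsub>M\<^esub>"
 unfolding lc_def by (rule add.finprod_one_eqI) (auto simp: smult_zero_l Pi_def)

lemma lc_delta:
 assumes "x : tup d (carrier M)" "j < d"
 shows "lc M d (%i. if i = j then \<one>\<^bsub>R\<^esub> else \<zero>\<^bsub>R\<^esub>) x = x j"
proof -
 have "x j : carrier M" using assms by auto
 then show ?thesis unfolding lc_def
  using assms by (subst finsum_single[of _ j]) (auto simp: smult_zero_l smult_one Pi_def)
qed

lemma lc_Suc:
 "[|r : tup (Suc d) (carrier R); x : {..<Suc d} \<rightarrow> carrier M|] ==>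
  lc M (Suc d) r x = lc M d r x \<oplus>\<^bsub>M\<^esub> r d \<odot>\<^bsub>M\<^esub> x d"
 unfolding lc_def by (subst finsum_lessThan_Suc) (auto simp: smult_closed Pi_def)

lemma lc_0: "lc M 0 r x = \<zero>\<^bsub>M\<^esub>"
 by (simp add: lc_def)

lemma lc_minus:
 "[|r : tup d (carrier R); x : {..<d} \<rightarrow> carrier M|] ==>
  lc M d (%i. \<ominus>\<^bsub>R\<^esub> r i) x = \<ominus>\<^bsub>M\<^esub> lc M d r x"
proof -
 assume a: "r : tup d (carrier R)" "x : tup d (carrier M)"
 have "lc M d (%i. \<ominus>\<^bsub>R\<^esub> r i) x = lc M d (%i. (\<ominus>\<^bsub>R\<^esub> \<one>\<^bsub>R\<^esub>) \<otimes>\<^bsub>R\<^esub> r i) x"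
  using a by (intro lc_cong) (auto simp: R.l_minus Pi_def)
 also have "... = (\<ominus>\<^bsub>R\<^esub> \<one>\<^bsub>R\<^esub>) \<odot>\<^bsub>M\<^esub> lc M d r x" using a by (intro lc_smult) auto
 also have "... = \<ominus>\<^bsub>M\<^esub> lc M d r x" using lc_closed[OF a] by (simp add: smult_minus_l smult_one)
 finally show ?thesis .
qed

definition span :: "nat => (nat => 'm) => 'm set" where
 "span d x = {lc M d r x | r. r : {..<d} \<rightarrow> carrier R}"

lemma span_submodule:
 assumes x: "x : tup d (carrier M)"
 shows "submodule (span d x) R M"
proof (rule submoduleI'[OF left_module_axioms])
 show "span d x \<subseteq> carrier M" using lc_closed x by (auto simp: span_def)
 show "\<zero>\<^bsub>M\<^esub> : span d x" unfolding span_def using lc_zero[OF x] by (force intro!: exI[of _ "%i. \<zero>\<^bsub>R\<^esub>"])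
next
 fix u v assume "u : span d x" "v : span d x"
 then obtain r s where "u = lc M d r x" "v = lc M d s x" "r : tup d (carrier R)" "s : tup d (carrier R)"
  by (auto simp: span_def)
 then show "u \<oplus>\<^bsub>M\<^esub> v : span d x" unfolding span_def
  using lc_add[of r d s x] x by (intro CollectI exI[of _ "%i. r i \<oplus>\<^bsub>R\<^esub> s i"]) (auto simp: Pi_def)
next
 fix a u assume "a : carrier R" "u : span d x"
 then obtain r where "u = lc M d r x" "r : tup d (carrier R)" by (auto simp: span_def)
 then show "a \<odot>\<^bsub>M\<^esub> u : span d x" unfolding span_def
  using lc_smult[of a r d x] x \<open>a : carrier R\<close> by (intro CollectI exI[of _ "%i. a \<otimes>\<^bsub>R\<^esub> r i"]) (auto simp: Pi_def)
qed

lemma span_gen: "[|x : tup d (carrier M); i < d|] ==> x i : span d x"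
 unfolding span_def using lc_delta[of x d i] by (intro CollectI exI[of _ "%j. if j = i then \<one>\<^bsub>R\<^esub> else \<zero>\<^bsub>R\<^esub>"]) auto

end

definition basis_of :: "('a, 'y) ring_scheme => ('a, 'm, 'z) module_scheme => 'm set => nat => (nat => 'm) => bool" where
 "basis_of R M W d x \<equiv> x : tup d W \<and>
  (ALL y:W. EX r:{..<d} \<rightarrow> carrier R. y = lc M d r x) \<and>
  (ALL r:{..<d} \<rightarrow> carrier R. lc M d r x = \<zero>\<^bsub>M\<^esub> --> (ALL i<d. r i = \<zero>\<^bsub>R\<^esub>))"

definition coord :: "('a, 'y) ring_scheme => ('a, 'm, 'z) module_scheme => nat => (nat => 'm) => 'm => nat => 'a" where
 "coord R M d x y = (SOME r. r : tup d (carrier R) & y = lc M d r x)"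

context left_module
begin

lemma lc_eq_imp:
 assumes b: "basis_of R M W d x" and W: "W \<subseteq> carrier M"
  and r: "r : tup d (carrier R)" and s: "s : tup d (carrier R)"
  and eq: "lc M d r x = lc M d s x" and i: "i < d"
 shows "r i = s i"
proof -
 have x: "x : tup d (carrier M)" using b W by (auto simp: basis_of_def)
 have "lc M d (%i. r i \<oplus>\<^bsub>R\<^esub> (\<ominus>\<^bsub>R\<^esub> s i)) x = lc M d r x \<oplus>\<^bsub>M\<^esub> \<ominus>\<^bsub>M\<^esub> lc M d s x"
  using lc_add[of r d "%i. \<ominus>\<^bsub>R\<^esub> s i" x] lc_minus[OF s x] r s x by (auto simp: Pi_def)
 also have "... = \<zero>\<^bsub>M\<^esub>" using eq lc_closed[OF s x] by (simp add: r_neg)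
 finally have "r i \<oplus>\<^bsub>R\<^esub> (\<ominus>\<^bsub>R\<^esub> s i) = \<zero>\<^bsub>R\<^esub>"
  using b r s i unfolding basis_of_def by (auto simp: Pi_iff)
 moreover have "r i : carrier R" "s i : carrier R" using r s i by auto
 ultimately show ?thesis by (metis R.minus_equality R.minus_minus R.a_inv_closed)
qed

lemma coord_props:
 assumes "basis_of R M W d x" "y : W"
 shows "coord R M d x y : tup d (carrier R)" "lc M d (coord R M d x y) x = y"
proof -
 have "EX r. r : tup d (carrier R) & y = lc M d r x"
  using assms unfolding basis_of_def by blast
 from someI_ex[OF this] show "coord R M d x y : tup d (carrier R)" "lc M d (coord R M d x y) x = y"
  unfolding coord_def[symmetric] by auto
qed

lemma coord_closed: "[|basis_of R M W d x; y : W; i < d|] ==> coord R M d x y i : carrier R"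
 using coord_props(1) by blast

lemma coord_unique:
 assumes "basis_of R M W d x" "submodule W R M" "r : tup d (carrier R)" "y = lc M d r x" "i < d"
 shows "coord R M d x y i = r i"
proof -
 have "x : tup d W" using assms by (auto simp: basis_of_def)
 then have "y : W" using assms lc_in by auto
 then show ?thesis using assms submoduleD(1)[OF M_group assms(2)] coord_props[OF assms(1)]
  by (intro lc_eq_imp[OF assms(1)]) auto
qed

lemma coord_add:
 assumes b: "basis_of R M W d x" and W: "submodule W R M" and "y : W" "z : W" "i < d"
 shows "coord R M d x (y \<oplus>\<^bsub>M\<^esub> z) i = coord R M d x y i \<oplus>\<^bsub>R\<^esub> coord R M d x z i"
proof -
 have "x : tup d (carrier M)" using b submoduleD(1)[OF M_group W] by (auto simp: basis_of_def)
 then show ?thesis using assms lc_add[of "coord R M d x y" d "coord R M d x z" x]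
   coord_props[OF b] by (intro coord_unique[OF b W]) (auto simp: Pi_def)
qed

lemma coord_smult:
 assumes b: "basis_of R M W d x" and W: "submodule W R M" and "y : W" "a : carrier R" "i < d"
 shows "coord R M d x (a \<odot>\<^bsub>M\<^esub> y) i = a \<otimes>\<^bsub>R\<^esub> coord R M d x y i"
proof -
 have "x : tup d (carrier M)" using b submoduleD(1)[OF M_group W] by (auto simp: basis_of_def)
 then show ?thesis using assms lc_smult[of a "coord R M d x y" d x]
   coord_props[OF b] by (intro coord_unique[OF b W]) (auto simp: Pi_def)
qed

lemma coord_basis:
 assumes b: "basis_of R M W d x" and W: "submodule W R M" and "j < d" "i < d"
 shows "coord R M d x (x j) i = (if i = j then \<one>\<^bsub>R\<^esub> else \<zero>\<^bsub>R\<^esub>)"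
proof -
 have "x : tup d (carrier M)" using b submoduleD(1)[OF M_group W] by (auto simp: basis_of_def)
 then show ?thesis using assms lc_delta[of x d j] by (intro coord_unique[OF b W]) auto
qed

end

lemma basis_extend_linear:
 assumes "left_module R M" "left_module R N" "basis_of R M W d x" "submodule W R M" "y : tup d (carrier N)"
 shows "linear_on R M N W (%z. lc N d (coord R M d x z) y)"
  and "!!i. i < d ==> lc N d (coord R M d x (x i)) y = y i"
proof -
 interpret M: left_module R M by fact
 interpret N: left_module R N by fact
 show "linear_on R M N W (%z. lc N d (coord R M d x z) y)"
  unfolding linear_on_def
 proof (intro conjI ballI)
  show "(%z. lc N d (coord R M d x z) y) : W \<rightarrow> carrier N"
   using M.coord_props(1)[OF assms(3)] assms(5) N.lc_closed by blast
 next
  fix u v assume "u : W" "v : W"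
  then show "lc N d (coord R M d x (u \<oplus>\<^bsub>M\<^esub> v)) y = lc N d (coord R M d x u) y \<oplus>\<^bsub>N\<^esub> lc N d (coord R M d x v) y"
   using assms(5) M.coord_props(1)[OF assms(3)] submoduleD(3)[OF M.M_group assms(4)]
   by (subst N.lc_add[symmetric]) (auto intro!: N.lc_cong M.coord_add[OF assms(3,4)])
 next
  fix a u assume "a : carrier R" "u : W"
  then show "lc N d (coord R M d x (a \<odot>\<^bsub>M\<^esub> u)) y = a \<odot>\<^bsub>N\<^esub> lc N d (coord R M d x u) y"
   using assms(5) M.coord_props(1)[OF assms(3)] submoduleD(5)[OF M.M_group assms(4)]
   by (subst N.lc_smult[symmetric]) (auto intro!: N.lc_cong M.coord_smult[OF assms(3,4)])
 qed
 fix i assume i: "i < d"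
 have "x i : W" using assms(3) i by (auto simp: basis_of_def)
 then have "lc N d (coord R M d x (x i)) y = lc N d (%j. if j = i then \<one>\<^bsub>R\<^esub> else \<zero>\<^bsub>R\<^esub>) y"
  using assms(5) M.coord_props(1)[OF assms(3)] i by (intro N.lc_cong M.coord_basis[OF assms(3,4)]) auto
 then show "lc N d (coord R M d x (x i)) y = y i" using N.lc_delta[OF assms(5) i] by simp
qed

section \<open>Vector spaces of finite dimension\<close>

lemma (in abelian_group) diff_zero_imp_eq:
 "[|x : carrier G; y : carrier G; x \<ominus> y = \<zero>|] ==> x = y"
 using minus_equality[of x "\<ominus> y"] by (simp add: a_minus_def)

definition reg :: "('a, 'z) ring_scheme => ('a, 'a) module" where
 "reg R = \<lparr>carrier = carrier R, mult = mult R, one = one R, zero = zero R, add = add R, smult = mult R\<rparr>"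

text \<open>Restriction of scalars along \<open>\<kappa>\<close>; for \<open>\<kappa> : k \<rightarrow> R\<^sub>0\<close> it turns the components of an \<open>R\<close>-module into vector
spaces over \<open>k\<close>.\<close>

definition scal :: "('k => 'a) => ('a, 'm, 'z) module_scheme => ('k, 'm) module" where
 "scal \<kappa> M = \<lparr>carrier = carrier M, mult = mult M, one = one M, zero = zero M, add = add M,
   smult = (%c x. \<kappa> c \<odot>\<^bsub>M\<^esub> x)\<rparr>"

lemma reg_simps [simp]: "carrier (reg R) = carrier R" "zero (reg R) = zero R" "add (reg R) = add R" "smult (reg R) = mult R"
 by (simp_all add: reg_def)

lemma scal_simps [simp]: "carrier (scal \<kappa> M) = carrier M" "zero (scal \<kappa> M) = zero M" "add (scal \<kappa> M) = add M"
 "smult (scal \<kappa> M) = (%c x. \<kappa> c \<odot>\<^bsub>M\<^esub> x)"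
 by (simp_all add: scal_def)

lemma abelian_group_struct:
 assumes "abelian_group G" "carrier G = carrier H" "add G = add H" "zero G = zero H"
 shows "abelian_group H"
 using abelian_groupE[OF assms(1)] assms(2-4) by (intro abelian_groupI) auto

lemma a_inv_struct:
 assumes "carrier G = carrier H" "add G = add H" "zero G = zero H"
 shows "\<ominus>\<^bsub>G\<^esub> x = \<ominus>\<^bsub>H\<^esub> x"
 using assms by (simp add: a_inv_def m_inv_def)

lemma subgroup_struct:
 assumes "carrier G = carrier H" "add G = add H" "zero G = zero H"
 shows "subgroup W (add_monoid G) \<longleftrightarrow> subgroup W (add_monoid H)"
 using assms by (simp add: subgroup_def m_inv_def)

lemma reg_module: "ring R ==> left_module R (reg R)"
proof -
 assume "ring R"
 then interpret ring R .
 have "abelian_group (reg R)" by (rule abelian_group_struct[OF abelian_group_axioms]) simp_all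
 then show ?thesis using \<open>ring R\<close>
  by (auto intro!: left_module.intro left_module_axioms.intro simp: l_distr r_distr m_assoc)
qed

lemma scal_module:
 assumes "ring k" "\<kappa> : ring_hom k R" "left_module R M"
 shows "left_module k (scal \<kappa> M)"
proof -
 interpret left_module R M by fact
 have "abelian_group (scal \<kappa> M)" by (rule abelian_group_struct[OF M_group]) simp_all
 then show ?thesis using assms(1) ring_hom_closed[OF assms(2)] ring_hom_mult[OF assms(2)]
   ring_hom_add[OF assms(2)] ring_hom_one[OF assms(2)]
  by (auto intro!: left_module.intro left_module_axioms.intro
    simp: smult_closed smult_l_distr smult_r_distr smult_assoc smult_one)
qed

lemma lc_scal: "lc (scal \<kappa> M) d c x = lc M d (%i. \<kappa> (c i)) x"
 unfolding lc_def by (simp add: finsum_struct[of "scal \<kappa> M" M])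

lemma linear_on_comp:
 assumes "linear_on R L M U f" "linear_on R M N W g" "f : U \<rightarrow> W"
 shows "linear_on R L N U (%x. g (f x))"
 using assms unfolding linear_on_def by (auto simp: Pi_iff)

lemma linear_on_subset: "[|linear_on R M N W f; U \<subseteq> W|] ==> linear_on R M N U f"
 unfolding linear_on_def by blast

lemma linear_on_cong:
 assumes "linear_on R M N W f" "submodule W R M" "abelian_group M" "!!x. x : W ==> f x = g x"
 shows "linear_on R M N W g"
 using assms(1,4) submoduleD(3,5)[OF assms(3,2)] unfolding linear_on_def by (auto simp: Pi_iff)

lemma linear_on_sub:
 assumes "left_module R M" "left_module R N" "submodule W R M" "linear_on R M N W f" "linear_on R M N W g"
 shows "linear_on R M N W (%x. f x \<ominus>\<^bsub>N\<^esub> g x)"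
proof -
 interpret N: left_module R N by fact
 interpret M: left_module R M by fact
 have f: "f x : carrier N" "g x : carrier N" if "x : W" for x
  using assms that by (auto simp: linear_on_def)
 show ?thesis unfolding linear_on_def a_minus_def
 proof (intro conjI ballI)
  show "(%x. f x \<oplus>\<^bsub>N\<^esub> \<ominus>\<^bsub>N\<^esub> g x) : W \<rightarrow> carrier N" using f by auto
  fix x y assume xy: "x : W" "y : W"
  show "f (x \<oplus>\<^bsub>M\<^esub> y) \<oplus>\<^bsub>N\<^esub> \<ominus>\<^bsub>N\<^esub> g (x \<oplus>\<^bsub>M\<^esub> y) = f x \<oplus>\<^bsub>N\<^esub> \<ominus>\<^bsub>N\<^esub> g x \<oplus>\<^bsub>N\<^esub> (f y \<oplus>\<^bsub>N\<^esub> \<ominus>\<^bsub>N\<^esub> g y)"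
   using xy f assms(4,5) unfolding linear_on_def by (simp add: N.minus_add N.a_ac)
 next
  fix a x assume ax: "a : carrier R" "x : W"
  show "f (a \<odot>\<^bsub>M\<^esub> x) \<oplus>\<^bsub>N\<^esub> \<ominus>\<^bsub>N\<^esub> g (a \<odot>\<^bsub>M\<^esub> x) = a \<odot>\<^bsub>N\<^esub> (f x \<oplus>\<^bsub>N\<^esub> \<ominus>\<^bsub>N\<^esub> g x)"
   using ax f assms(4,5) unfolding linear_on_def by (simp add: N.smult_r_distr N.smult_minus_r)
 qed
qed

definition fspan :: "('k, 'y) ring_scheme => ('k, 'm, 'z) module_scheme => 'm set => bool" where
 "fspan k V W \<equiv> (EX d w. w : tup d W & (ALL y:W. EX c:{..<d} \<rightarrow> carrier k. y = lc V d c w))"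

locale vspace = left_module k V + field k for k :: "('k, 'y) ring_scheme" and V :: "('k, 'm, 'z) module_scheme" (structure)
begin

lemma smult_cancel:
 assumes "submodule U k V" "c : carrier k" "c ~= \<zero>\<^bsub>k\<^esub>" "x : carrier V" "c \<odot> x : U"
 shows "x : U"
proof -
 have c: "c : Units k" using assms field_Units by auto
 have "x = inv\<^bsub>k\<^esub> c \<odot> (c \<odot> x)"
  using assms c by (subst smult_assoc[symmetric]) (auto simp: Units_l_inv smult_one Units_inv_closed)
 then show ?thesis using submoduleD(5)[OF M_group assms(1), of "inv\<^bsub>k\<^esub> c"] assms(5) c
  by (metis Units_inv_closed)
qed

definition adjoin :: "'m set => 'm => 'm set" where
 "adjoin U v = {u \<oplus> c \<odot> v | u c. u : U & c : carrier k}"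

lemma adjoin_unique:
 assumes U: "submodule U k V" and v: "v : carrier V" "v \<notin> U"
  and uc: "u : U" "u' : U" "c : carrier k" "c' : carrier k"
  and eq: "u \<oplus> c \<odot> v = u' \<oplus> c' \<odot> v"
 shows "u = u' & c = c'"
proof -
 note UD = submoduleD[OF M_group U]
 have car: "u : carrier V" "u' : carrier V" using uc UD(1) by auto
 have "(c \<ominus>\<^bsub>k\<^esub> c') \<odot> v = c \<odot> v \<oplus> \<ominus> (c' \<odot> v)"
  using uc v by (simp add: a_minus_def smult_l_distr smult_minus_l)
 also have "... = (\<ominus> u \<oplus> (u \<oplus> c \<odot> v)) \<oplus> \<ominus> (c' \<odot> v)"
  using uc v car by (simp add: smult_closed M.a_assoc[symmetric] M.l_neg)
 also have "... = \<ominus> u \<oplus> u'"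
  unfolding eq using uc v car by (simp add: smult_closed M.a_assoc M.r_neg)
 finally have e: "(c \<ominus>\<^bsub>k\<^esub> c') \<odot> v = \<ominus> u \<oplus> u'" .
 have "c = c'"
 proof (rule ccontr)
  assume "c ~= c'"
  then have "c \<ominus>\<^bsub>k\<^esub> c' ~= \<zero>\<^bsub>k\<^esub>" using uc by simp
  moreover have "\<ominus> u \<oplus> u' : U" using uc UD(3,4) by auto
  ultimately show False using smult_cancel[OF U, of "c \<ominus>\<^bsub>k\<^esub> c'" v] v uc e by auto
 qed
 moreover have "u = u'" using eq car uc v unfolding \<open>c = c'\<close> by (simp add: smult_closed)
 ultimately show ?thesis by simp
qed

lemma adjoin_submodule:
 assumes U: "submodule U k V" and v: "v : carrier V"
 shows "submodule (adjoin U v) k V" "U \<subseteq> adjoin U v" "v : adjoin U v"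
proof -
 note UD = submoduleD[OF M_group U]
 show "submodule (adjoin U v) k V"
 proof (rule submoduleI'[OF left_module_axioms])
  show "adjoin U v \<subseteq> carrier V" using UD(1) v by (auto simp: adjoin_def smult_closed)
  show "\<zero> : adjoin U v" unfolding adjoin_def
   by (intro CollectI exI[of _ \<zero>] exI[of _ "\<zero>\<^bsub>k\<^esub>"]) (simp add: v UD smult_zero_l)
 next
  fix x y assume "x : adjoin U v" "y : adjoin U v"
  then obtain u c u' c' where x: "x = u \<oplus> c \<odot> v" "y = u' \<oplus> c' \<odot> v" "u : U" "u' : U" "c : carrier k" "c' : carrier k"
   by (auto simp: adjoin_def)
  have "u : carrier V" "u' : carrier V" using x UD(1) by auto
  then have "x \<oplus> y = (u \<oplus> u') \<oplus> (c \<oplus>\<^bsub>k\<^esub> c') \<odot> v"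
   using x v by (simp add: smult_l_distr smult_closed M.a_ac)
  then show "x \<oplus> y : adjoin U v" using x UD(3)
   by (auto simp: adjoin_def intro!: exI[of _ "u \<oplus> u'"] exI[of _ "c \<oplus>\<^bsub>k\<^esub> c'"])
 next
  fix a x assume a: "a : carrier k" and "x : adjoin U v"
  then obtain u c where x: "x = u \<oplus> c \<odot> v" "u : U" "c : carrier k"
   by (auto simp: adjoin_def)
  have "u : carrier V" using x UD(1) by auto
  then have "a \<odot> x = a \<odot> u \<oplus> (a \<otimes>\<^bsub>k\<^esub> c) \<odot> v"
   using x v a by (simp add: smult_r_distr smult_closed smult_assoc)
  then show "a \<odot> x : adjoin U v" using x UD(5) a
   by (auto simp: adjoin_def intro!: exI[of _ "a \<odot> u"] exI[of _ "a \<otimes>\<^bsub>k\<^esub> c"])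
 qed
 show "U \<subseteq> adjoin U v"
 proof
  fix u assume "u : U"
  then show "u : adjoin U v" unfolding adjoin_def using UD(1)
   by (intro CollectI exI[of _ u] exI[of _ "\<zero>\<^bsub>k\<^esub>"]) (auto simp: v smult_zero_l)
 qed
 show "v : adjoin U v" unfolding adjoin_def using UD(2) v
  by (intro CollectI exI[of _ \<zero>] exI[of _ "\<one>\<^bsub>k\<^esub>"]) (auto simp: smult_one)
qed

lemma adjoin_in: "[|submodule U k V; v : U|] ==> adjoin U v = U"
 using adjoin_submodule(2)[of U v] submoduleD[OF M_group, of U k] by (auto simp: adjoin_def)

lemma span_Suc:
 assumes w: "w : tup (Suc d) (carrier V)"
 shows "span (Suc d) w = adjoin (span d w) (w d)"
proof (rule subset_antisym; rule subsetI)
 fix y assume "y : span (Suc d) w"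
 then obtain c where "c : tup (Suc d) (carrier k)" "y = lc V (Suc d) c w" by (auto simp: span_def)
 then show "y : adjoin (span d w) (w d)"
  using lc_Suc[OF _ w, of c] unfolding adjoin_def span_def
  by (intro CollectI exI[of _ "lc V d c w"] exI[of _ "c d"]) (auto simp: Pi_def)
next
 fix y assume "y : adjoin (span d w) (w d)"
 then obtain c a where y: "c : tup d (carrier k)" "a : carrier k" "y = lc V d c w \<oplus> a \<odot> w d"
  by (auto simp: adjoin_def span_def)
 let ?c = "c(d := a)"
 have "lc V d ?c w = lc V d c w" using y w by (intro lc_cong) auto
 then have "y = lc V (Suc d) ?c w" using lc_Suc[OF _ w, of ?c] y by (auto simp: Pi_def less_Suc_eq)
 then show "y : span (Suc d) w" using y by (auto simp: span_def Pi_def less_Suc_eq intro!: exI[of _ ?c])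
qed

lemma projection_adjoin:
 assumes L: "submodule L k V" and U: "submodule U k V" and v: "v : carrier V" and LU: "L \<subseteq> U"
  and p: "linear_on k V V U p" "p : U \<rightarrow> L" "!!x. x : L ==> p x = x"
 shows "EX p. linear_on k V V (adjoin U v) p & p : adjoin U v \<rightarrow> L & (ALL x:L. p x = x)"
proof (cases "v : U")
 case True
 then show ?thesis using p adjoin_in[OF U True] by auto
next
 case False
 note UD = submoduleD[OF M_group U]
 define q where "q z = p (SOME u. u : U & (EX c:carrier k. z = u \<oplus> c \<odot> v))" for z
 have q: "q (u \<oplus> c \<odot> v) = p u" if "u : U" "c : carrier k" for u c
 proof -
  have "(SOME u'. u' : U & (EX c':carrier k. u \<oplus> c \<odot> v = u' \<oplus> c' \<odot> v)) = u"
   using that adjoin_unique[OF U v False] by (intro some_equality) auto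
  then show ?thesis by (simp add: q_def)
 qed
 have qL: "q x = x" if "x : L" for x
 proof -
  have "x : U" "x : carrier V" using LU UD(1) that by auto
  then show ?thesis using q[of x "\<zero>\<^bsub>k\<^esub>"] p(3)[OF that] v by (simp add: smult_zero_l)
 qed
 have "linear_on k V V (adjoin U v) q"
  unfolding linear_on_def
 proof (intro conjI ballI)
  show "q : adjoin U v \<rightarrow> carrier V" using q p(1) by (auto simp: adjoin_def linear_on_def)
 next
  fix x y assume "x : adjoin U v" "y : adjoin U v"
  then obtain u c u' c' where x: "x = u \<oplus> c \<odot> v" "y = u' \<oplus> c' \<odot> v" "u : U" "u' : U" "c : carrier k" "c' : carrier k"
   by (auto simp: adjoin_def)
  have "u : carrier V" "u' : carrier V" using x UD(1) by auto
  then have "x \<oplus> y = (u \<oplus> u') \<oplus> (c \<oplus>\<^bsub>k\<^esub> c') \<odot> v"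
   using x v by (simp add: smult_l_distr smult_closed M.a_ac)
  then have "q (x \<oplus> y) = p (u \<oplus> u')" using q[of "u \<oplus> u'" "c \<oplus>\<^bsub>k\<^esub> c'"] x UD(3) by simp
  then show "q (x \<oplus> y) = q x \<oplus> q y" using q x p(1) by (simp add: linear_on_def)
 next
  fix a x assume a: "a : carrier k" and "x : adjoin U v"
  then obtain u c where x: "x = u \<oplus> c \<odot> v" "u : U" "c : carrier k"
   by (auto simp: adjoin_def)
  have "u : carrier V" using x UD(1) by auto
  then have "a \<odot> x = a \<odot> u \<oplus> (a \<otimes>\<^bsub>k\<^esub> c) \<odot> v"
   using x v a by (simp add: smult_r_distr smult_closed smult_assoc)
  then have "q (a \<odot> x) = p (a \<odot> u)" using q[of "a \<odot> u" "a \<otimes>\<^bsub>k\<^esub> c"] x UD(5) a by simp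
  then show "q (a \<odot> x) = a \<odot> q x" using q x p(1) a by (simp add: linear_on_def)
 qed
 moreover have "q : adjoin U v \<rightarrow> L" using q p(2) by (auto simp: adjoin_def)
 ultimately show ?thesis using qL by auto
qed

text \<open>A linear projection of \<open>W\<close> onto \<open>L\<close> is built by adjoining the finitely many spanning vectors of \<open>W\<close> one at
a time. This single construction yields complements, extension of linear maps, and separation of
points from subspaces.\<close>

lemma projection:
 assumes L: "submodule L k V" and W: "submodule W k V" and LW: "L \<subseteq> W" and fin: "fspan k V W"
 obtains p where "linear_on k V V W p" "p : W \<rightarrow> L" "!!x. x : L ==> p x = x"
proof -
 note LD = submoduleD[OF M_group L]
 obtain d w where w: "w : tup d W" and sp: "ALL y:W. EX c:{..<d} \<rightarrow> carrier k. y = lc V d c w"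
  using fin by (auto simp: fspan_def)
 have wc: "w : tup d (carrier V)" using w submoduleD(1)[OF M_group W] by auto
 have "EX U p. submodule U k V & L \<subseteq> U & span n w \<subseteq> U & linear_on k V V U p & p : U \<rightarrow> L & (ALL x:L. p x = x)"
  if "n \<le> d" for n using that
 proof (induction n)
  case 0
  have "span 0 w = {\<zero>}" by (auto simp: span_def lc_0)
  then show ?case using L LD
   by (intro exI[of _ L] exI[of _ "%x. x"]) (auto simp: linear_on_def)
 next
  case (Suc n)
  then obtain U p where U: "submodule U k V" "L \<subseteq> U" "span n w \<subseteq> U" 
   "linear_on k V V U p" "p : U \<rightarrow> L" "ALL x:L. p x = x" by auto
  have wn: "w : {..<Suc n} \<rightarrow> carrier V" "w n : carrier V" using wc Suc.prems by auto
  have "span (Suc n) w \<subseteq> adjoin U (w n)"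
   unfolding span_Suc[OF wn(1)] using U(3) by (auto simp: adjoin_def)
  moreover obtain q where "linear_on k V V (adjoin U (w n)) q" "q : adjoin U (w n) \<rightarrow> L" "ALL x:L. q x = x"
   using projection_adjoin[OF L U(1) wn(2) U(2,4,5)] U(6) by auto
  ultimately show ?case using adjoin_submodule[OF U(1) wn(2)] U(2) by blast
 qed
 then obtain U p where U: "submodule U k V" "L \<subseteq> U" "span d w \<subseteq> U" 
   "linear_on k V V U p" "p : U \<rightarrow> L" "ALL x:L. p x = x" by blast
 have "W \<subseteq> U" using sp U(3) by (auto simp: span_def)
 then show ?thesis using that[of p] U linear_on_subset by blast
qed

lemma span_basis:
 assumes "w : tup d (carrier V)"
 shows "EX d' b. basis_of k V (span d w) d' b"
 using assms
proof (induction d)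
 case 0
 have "basis_of k V (span 0 w) 0 w" by (auto simp: basis_of_def span_def)
 then show ?case by blast
next
 case (Suc d)
 then obtain d' b where b: "basis_of k V (span d w) d' b" by (auto simp: Pi_def)
 have w: "w : tup d (carrier V)" "w d : carrier V" using Suc.prems by auto
 note S = span_submodule[OF w(1)]
 show ?case
 proof (cases "w d : span d w")
  case True
  then show ?thesis using b span_Suc[OF Suc.prems] adjoin_in[OF S True] by auto
 next
  case False
  let ?b = "b(d' := w d)"
  have bc: "b : {..<d'} \<rightarrow> carrier V" "b : {..<d'} \<rightarrow> span d w"
   using b submoduleD(1)[OF M_group S] by (auto simp: basis_of_def)
  have bc': "?b : {..<Suc d'} \<rightarrow> carrier V" using bc w by (auto simp: less_Suc_eq Pi_def)
  have lcb: "lc V (Suc d') c ?b = lc V d' c b \<oplus> c d' \<odot> w d" if "c : {..<Suc d'} \<rightarrow> carrier k" for c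
  proof -
   have "lc V d' c ?b = lc V d' c b" using that bc by (intro lc_cong) (auto simp: Pi_def)
   then show ?thesis using lc_Suc[OF that bc'] by simp
  qed
  have "basis_of k V (adjoin (span d w) (w d)) (Suc d') ?b"
   unfolding basis_of_def
  proof (intro conjI ballI impI allI)
   show "?b : {..<Suc d'} \<rightarrow> adjoin (span d w) (w d)"
    using adjoin_submodule(2,3)[OF S w(2)] bc by (auto simp: less_Suc_eq Pi_def)
  next
   fix y assume "y : adjoin (span d w) (w d)"
   then obtain u a where u: "u : span d w" "a : carrier k" "y = u \<oplus> a \<odot> w d" by (auto simp: adjoin_def)
   then obtain c where c: "c : {..<d'} \<rightarrow> carrier k" "u = lc V d' c b" using b by (auto simp: basis_of_def)
   have "lc V d' (c(d' := a)) b = lc V d' c b" using c bc by (intro lc_cong) (auto simp: Pi_def)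
   then have "y = lc V (Suc d') (c(d' := a)) ?b"
    using u c by (subst lcb) (auto simp: Pi_def less_Suc_eq)
   then show "EX r:{..<Suc d'} \<rightarrow> carrier k. y = lc V (Suc d') r ?b"
    using c u by (intro bexI[of _ "c(d' := a)"]) (auto simp: Pi_def less_Suc_eq)
  next
   fix c i assume c: "c : {..<Suc d'} \<rightarrow> carrier k" "lc V (Suc d') c ?b = \<zero>" "i < Suc d'"
   have in_span: "lc V d' c b : span d w"
    using lc_in[OF S _ bc(2), of c] c(1) by (auto simp: Pi_def)
   have e: "lc V d' c b \<oplus> c d' \<odot> w d = \<zero> \<oplus> \<zero>\<^bsub>k\<^esub> \<odot> w d"
    using lcb[OF c(1), symmetric] c(2) w by (simp add: smult_zero_l)
   have "lc V d' c b = \<zero> & c d' = \<zero>\<^bsub>k\<^esub>"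
    using adjoin_unique[OF S w(2) False in_span submoduleD(2)[OF M_group S] _ _ e] c(1)
    by auto
   then show "c i = \<zero>\<^bsub>k\<^esub>" using b c unfolding basis_of_def by (auto simp: less_Suc_eq Pi_iff)
  qed
  then show ?thesis using span_Suc[OF Suc.prems] by auto
 qed
qed

lemma fspan_eq_span:
 assumes "submodule W k V" "w : tup d W" "ALL y:W. EX c:{..<d} \<rightarrow> carrier k. y = lc V d c w"
 shows "W = span d w"
 using assms lc_in[OF assms(1) _ assms(2)] by (auto simp: span_def)

lemma fspan_basis:
 assumes "submodule W k V" "fspan k V W"
 obtains d b where "basis_of k V W d b"
proof -
 obtain d w where w: "w : tup d W" "ALL y:W. EX c:{..<d} \<rightarrow> carrier k. y = lc V d c w"
  using assms(2) by (auto simp: fspan_def)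
 then have "w : tup d (carrier V)" using submoduleD(1)[OF M_group assms(1)] by auto
 from span_basis[OF this] show ?thesis using that fspan_eq_span[OF assms(1) w] by auto
qed

end

lemma basis_fspan: "basis_of k V W d b ==> fspan k V W"
 unfolding basis_of_def fspan_def by blast

lemma fspan_image:
 assumes "left_module k V" "left_module k V'" "submodule W k V" "linear_on k V V' W f" "fspan k V W"
 shows "fspan k V' (f ` W)"
proof -
 obtain d w where w: "w : tup d W" "ALL y:W. EX c:{..<d} \<rightarrow> carrier k. y = lc V d c w"
  using assms(5) by (auto simp: fspan_def)
 have "EX c:{..<d} \<rightarrow> carrier k. f y = lc V' d c (%i. f (w i))" if "y : W" for y
  using w(2) that linear_on_lc[OF assms(1-4) _ w(1)] by metis
 then show ?thesis unfolding fspan_def using w(1)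
  by (intro exI[of _ d] exI[of _ "%i. f (w i)"]) auto
qed

context vspace
begin

lemma fspan_sub:
 assumes "submodule L k V" "submodule W k V" "L \<subseteq> W" "fspan k V W"
 shows "fspan k V L"
proof -
 obtain p where p: "linear_on k V V W p" "p : W \<rightarrow> L" "!!x. x : L ==> p x = x"
  using projection[OF assms] by blast
 have "p ` W = L" using p(2,3) assms(3) by force
 then show ?thesis using fspan_image[OF left_module_axioms left_module_axioms assms(2) p(1) assms(4)] by simp
qed

lemma extend_linear:
 assumes "submodule L k V" "submodule W k V" "L \<subseteq> W" "fspan k V W" "linear_on k V N L f" "f : L \<rightarrow> T"
 obtains g where "linear_on k V N W g" "g : W \<rightarrow> T" "!!x. x : L ==> g x = f x"
proof -
 obtain p where p: "linear_on k V V W p" "p : W \<rightarrow> L" "!!x. x : L ==> p x = x"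
  using projection[OF assms(1-4)] by blast
 show ?thesis
  by (rule that[of "%x. f (p x)"]) (use p assms(6) linear_on_comp[OF p(1) assms(5) p(2)] in auto)
qed

lemma separate:
 assumes L: "submodule L k V" and W: "submodule W k V" and LW: "L \<subseteq> W" and fin: "fspan k V W"
  and y: "y : W" "y \<notin> L"
 obtains f where "linear_on k V (reg k) W f" "!!x. x : L ==> f x = \<zero>\<^bsub>k\<^esub>" "f y ~= \<zero>\<^bsub>k\<^esub>"
proof -
 note WD = submoduleD[OF M_group W] and LD = submoduleD[OF M_group L]
 obtain p where p: "linear_on k V V W p" "p : W \<rightarrow> L" "!!x. x : L ==> p x = x"
  using projection[OF L W LW fin] by blast
 obtain d b where b: "basis_of k V W d b" using fspan_basis[OF W fin] .
 define q where "q x = x \<ominus> p x" for x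
 have idl: "linear_on k V V W (%x. x)" using WD(1) by (auto simp: linear_on_def)
 have q: "linear_on k V V W q" unfolding q_def
  using linear_on_sub[OF left_module_axioms left_module_axioms W idl p(1)] .
 have qW: "q : W \<rightarrow> W" using p(2) LW WD(3,4) by (auto simp: q_def a_minus_def)
 have qy: "q y ~= \<zero>"
 proof
  assume "q y = \<zero>"
  moreover have "y : carrier V" "p y : carrier V" using y(1) p(1) WD(1) by (auto simp: linear_on_def)
  ultimately have "y = p y" using M.diff_zero_imp_eq by (simp add: q_def)
  then show False using y p(2) by (metis Pi_mem)
 qed
 have bc: "b : tup d (carrier V)" using b WD(1) by (auto simp: basis_of_def)
 have "EX i<d. coord k V d b (q y) i ~= \<zero>\<^bsub>k\<^esub>"
 proof (rule ccontr)
  assume "\<not> ?thesis"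
  then have "lc V d (coord k V d b (q y)) b = lc V d (%_. \<zero>\<^bsub>k\<^esub>) b"
   using bc by (intro lc_cong) auto
  then show False using qy coord_props(2)[OF b, of "q y"] qW y(1) lc_zero[OF bc] by auto
 qed
 then obtain i where i: "i < d" "coord k V d b (q y) i ~= \<zero>\<^bsub>k\<^esub>" by blast
 have cl: "linear_on k V (reg k) W (%z. coord k V d b z i)"
  unfolding linear_on_def using coord_closed[OF b] coord_add[OF b W] coord_smult[OF b W] i(1) by auto
 show ?thesis
 proof (rule that[of "%x. coord k V d b (q x) i"])
  show "linear_on k V (reg k) W (%x. coord k V d b (q x) i)" using linear_on_comp[OF q cl qW] .
  fix x assume x: "x : L"
  have "x : carrier V" using x LD(1) by auto
  then have "q x = \<zero>" using p(3)[OF x] by (simp add: q_def a_minus_def r_neg)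
  then show "coord k V d b (q x) i = \<zero>\<^bsub>k\<^esub>"
   using coord_unique[OF b W, of "%_. \<zero>\<^bsub>k\<^esub>" \<zero> i] lc_zero[OF bc] i(1) by simp
 qed (rule i(2))
qed

end

section \<open>Graded modules\<close>

abbreviation grmod where "grmod \<equiv> graded_left_module"

abbreviation deg :: "('a, 'm, 'z) graded_module_scheme => int => 'm set" where
 "deg \<equiv> mcomponent"

type_synonym ('a, 'x) list_module = "('a, ('a + 'x) list) graded_module"

abbreviation mcomp :: "('a, 'm, 'z) graded_module_scheme => 'm => int => 'm" where
 "mcomp M \<equiv> hcomp M (deg M)"

abbreviation rcomp :: "('a, 'z) graded_ring_scheme => 'a => nat => 'a" where
 "rcomp R \<equiv> hcomp R (component R)"

text \<open>Integer degrees, with zero in negative degrees: a coefficient of a homogeneous element of degree \<open>n\<close>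
in a free module generated in degree \<open>t\<close> has degree \<open>n - t\<close>, which may be negative.\<close>

definition zcomponent :: "('a, 'z) graded_ring_scheme => int => 'a set" where
 "zcomponent R z = (if z \<ge> 0 then component R (nat z) else {\<zero>\<^bsub>R\<^esub>})"

definition zcomp :: "('a, 'z) graded_ring_scheme => 'a => int => 'a" where
 "zcomp R a z = (if z \<ge> 0 then rcomp R a (nat z) else \<zero>\<^bsub>R\<^esub>)"

sublocale graded_ring \<subseteq> RG: direct_sum R "component R"
 by (simp add: direct_sum_def direct_sum_axioms_def decomposition abelian_group_axioms)

sublocale graded_left_module \<subseteq> MG: direct_sum M "deg M"
 by (simp add: direct_sum_def direct_sum_axioms_def mdecomposition M_group)

context graded_ring
begin

lemma zcomponent_sub: "subgroup (zcomponent R z) (add_monoid R)"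
 using RG.C_sub subgroup_addI[OF abelian_group_axioms, of "{\<zero>}"] by (auto simp: zcomponent_def)

lemmas zcomponent_D = subgroup_addD[OF abelian_group_axioms zcomponent_sub]

lemma zcomponent_closed: "a : zcomponent R z ==> a : carrier R"
 using zcomponent_D(1) by auto

lemma zcomp_in: "a : carrier R ==> zcomp R a z : zcomponent R z"
 by (simp add: zcomp_def zcomponent_def RG.hcomp_props)

lemma zcomp_closed: "a : carrier R ==> zcomp R a z : carrier R"
 by (rule zcomponent_closed[OF zcomp_in])

lemma zcomponent_mult:
 "[|a : component R m; b : zcomponent R z|] ==> a \<otimes> b : zcomponent R (int m + z)"
 using component_mult[of a m b "nat z"] RG.C_closed[of a m] RG.C_subD(2)
 by (auto simp: zcomponent_def nat_add_distrib split: if_splits)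

lemma rcomp_mult_l:
 assumes a: "a : component R m" and b: "b : carrier R"
 shows "rcomp R (a \<otimes> b) (m + n) = a \<otimes> rcomp R b n"
proof -
 have ac: "a : carrier R" using RG.C_closed[OF a] .
 define S where "S = {i. rcomp R b i ~= \<zero>}"
 have fin: "finite S" using RG.hcomp_props(2)[OF b] by (simp add: S_def)
 have bc: "rcomp R b i : carrier R" "rcomp R b i : component R i" for i
  using RG.hcomp_carrier[OF b] RG.hcomp_props(1)[OF b] by auto
 have "a \<otimes> b = a \<otimes> (\<Oplus>i\<in>S. rcomp R b i)" unfolding S_def using RG.hcomp_props(3)[OF b] by (rule arg_cong)
 also have "... = (\<Oplus>i\<in>S. a \<otimes> rcomp R b i)" using fin ac bc by (intro finsum_rdistr) auto
 finally have "rcomp R (a \<otimes> b) (m + n) = (\<Oplus>i\<in>S. rcomp R (a \<otimes> rcomp R b i) (m + n))"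
  using ac bc by (simp add: RG.hcomp_finsum)
 also have "... = (\<Oplus>i\<in>S. if n = i then a \<otimes> rcomp R b i else \<zero>)"
  using RG.hcomp_homog[OF component_mult[OF a bc(2)]] ac bc by (intro finsum_cong') auto
 also have "... = a \<otimes> rcomp R b n"
 proof (cases "n : S")
  case True
  then show ?thesis using fin ac bc by (subst finsum_single[of _ n]) auto
 next
  case False
  then have "rcomp R b n = \<zero>" by (simp add: S_def)
  then show ?thesis using False ac by (auto intro!: add.finprod_one_eqI)
 qed
 finally show ?thesis .
qed

lemma rcomp_mult_r:
 assumes a: "a : component R m" and b: "b : carrier R"
 shows "rcomp R (b \<otimes> a) (n + m) = rcomp R b n \<otimes> a"
proof -
 have ac: "a : carrier R" using RG.C_closed[OF a] .
 define S where "S = {i. rcomp R b i ~= \<zero>}"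
 have fin: "finite S" using RG.hcomp_props(2)[OF b] by (simp add: S_def)
 have bc: "rcomp R b i : carrier R" "rcomp R b i : component R i" for i
  using RG.hcomp_carrier[OF b] RG.hcomp_props(1)[OF b] by auto
 have "b \<otimes> a = (\<Oplus>i\<in>S. rcomp R b i) \<otimes> a" unfolding S_def using RG.hcomp_props(3)[OF b] by (rule arg_cong)
 also have "... = (\<Oplus>i\<in>S. rcomp R b i \<otimes> a)" using fin ac bc by (intro finsum_ldistr) auto
 finally have "rcomp R (b \<otimes> a) (n + m) = (\<Oplus>i\<in>S. rcomp R (rcomp R b i \<otimes> a) (n + m))"
  using ac bc by (simp add: RG.hcomp_finsum)
 also have "... = (\<Oplus>i\<in>S. if n = i then rcomp R b i \<otimes> a else \<zero>)"
  using RG.hcomp_homog[OF component_mult[OF bc(2) a]] ac bc by (intro finsum_cong') auto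
 also have "... = rcomp R b n \<otimes> a"
 proof (cases "n : S")
  case True
  then show ?thesis using fin ac bc by (subst finsum_single[of _ n]) auto
 next
  case False
  then have "rcomp R b n = \<zero>" by (simp add: S_def)
  then show ?thesis using False ac by (auto intro!: add.finprod_one_eqI)
 qed
 finally show ?thesis .
qed

end

context graded_left_module
begin

lemma smult_zcomponent:
 "[|a : zcomponent R z; x : deg M n|] ==> a \<odot>\<^bsub>M\<^esub> x : deg M (z + n)"
 using component_smult[of a "nat z" x n] MG.C_subD(2) MG.C_closed[of x n]
 by (auto simp: zcomponent_def smult_zero_l split: if_splits)

lemma mcomp_smult:
 assumes a: "a : component R m" and x: "x : carrier M"
 shows "mcomp M (a \<odot>\<^bsub>M\<^esub> x) n = a \<odot>\<^bsub>M\<^esub> mcomp M x (n - int m)"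
proof -
 have ac: "a : carrier R" using RG.C_closed[OF a] .
 define S where "S = {i. mcomp M x i ~= \<zero>\<^bsub>M\<^esub>}"
 have fin: "finite S" using MG.hcomp_props(2)[OF x] by (simp add: S_def)
 have xc: "mcomp M x i : carrier M" "mcomp M x i : deg M i" for i
  using MG.hcomp_carrier[OF x] MG.hcomp_props(1)[OF x] by auto
 have "a \<odot>\<^bsub>M\<^esub> x = a \<odot>\<^bsub>M\<^esub> (\<Oplus>\<^bsub>M\<^esub>i\<in>S. mcomp M x i)" unfolding S_def using MG.hcomp_props(3)[OF x] by (rule arg_cong)
 also have "... = (\<Oplus>\<^bsub>M\<^esub>i\<in>S. a \<odot>\<^bsub>M\<^esub> mcomp M x i)" using fin ac xc by (intro finsum_smult_r) auto
 finally have "mcomp M (a \<odot>\<^bsub>M\<^esub> x) n = (\<Oplus>\<^bsub>M\<^esub>i\<in>S. mcomp M (a \<odot>\<^bsub>M\<^esub> mcomp M x i) n)"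
  using ac xc by (simp add: MG.hcomp_finsum smult_closed)
 also have "... = (\<Oplus>\<^bsub>M\<^esub>i\<in>S. if n - int m = i then a \<odot>\<^bsub>M\<^esub> mcomp M x i else \<zero>\<^bsub>M\<^esub>)"
  using MG.hcomp_homog[OF component_smult[OF a xc(2)]] ac xc
  by (intro M.finsum_cong') (auto simp: smult_closed)
 also have "... = a \<odot>\<^bsub>M\<^esub> mcomp M x (n - int m)"
 proof (cases "n - int m : S")
  case True
  then show ?thesis using fin ac xc by (subst M.finsum_single[of _ "n - int m"]) (auto simp: smult_closed)
 next
  case False
  then have "mcomp M x (n - int m) = \<zero>\<^bsub>M\<^esub>" by (simp add: S_def)
  then show ?thesis using False ac by (auto intro!: M.add.finprod_one_eqI simp: smult_zero_r)
 qed
 finally show ?thesis .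
qed

lemma mcomp_smult_homog:
 assumes a: "a : carrier R" and x: "x : deg M t"
 shows "mcomp M (a \<odot>\<^bsub>M\<^esub> x) n = zcomp R a (n - t) \<odot>\<^bsub>M\<^esub> x"
proof -
 have xc: "x : carrier M" using MG.C_closed[OF x] .
 define S where "S = {i. rcomp R a i ~= \<zero>\<^bsub>R\<^esub>}"
 have fin: "finite S" using RG.hcomp_props(2)[OF a] by (simp add: S_def)
 have ac: "rcomp R a i : carrier R" "rcomp R a i : component R i" for i
  using RG.hcomp_carrier[OF a] RG.hcomp_props(1)[OF a] by auto
 have "a \<odot>\<^bsub>M\<^esub> x = (\<Oplus>\<^bsub>R\<^esub>i\<in>S. rcomp R a i) \<odot>\<^bsub>M\<^esub> x" unfolding S_def using RG.hcomp_props(3)[OF a] by (rule arg_cong)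
 also have "... = (\<Oplus>\<^bsub>M\<^esub>i\<in>S. rcomp R a i \<odot>\<^bsub>M\<^esub> x)" using fin ac xc by (intro finsum_smult_l) auto
 finally have "mcomp M (a \<odot>\<^bsub>M\<^esub> x) n = (\<Oplus>\<^bsub>M\<^esub>i\<in>S. mcomp M (rcomp R a i \<odot>\<^bsub>M\<^esub> x) n)"
  using ac xc by (simp add: MG.hcomp_finsum smult_closed)
 also have "... = (\<Oplus>\<^bsub>M\<^esub>i\<in>S. if n - t = int i then rcomp R a i \<odot>\<^bsub>M\<^esub> x else \<zero>\<^bsub>M\<^esub>)"
  using MG.hcomp_homog[OF component_smult[OF ac(2) x]] ac xc
  by (intro M.finsum_cong') (auto simp: smult_closed)
 also have "... = zcomp R a (n - t) \<odot>\<^bsub>M\<^esub> x"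
 proof (cases "n - t \<ge> 0 & nat (n - t) : S")
  case True
  then show ?thesis using fin ac xc
   by (subst M.finsum_single[of _ "nat (n - t)"]) (auto simp: smult_closed zcomp_def)
 next
  case False
  then have "zcomp R a (n - t) = \<zero>\<^bsub>R\<^esub>" by (auto simp: S_def zcomp_def)
  then show ?thesis using False xc by (auto intro!: M.add.finprod_one_eqI simp: smult_zero_l)
 qed
 finally show ?thesis .
qed

lemma mcomp_lc:
 assumes r: "r : tup d (carrier R)" and x: "x : {..<d} \<rightarrow> deg M t"
 shows "mcomp M (lc M d r x) n = lc M d (%i. zcomp R (r i) (n - t)) x"
proof -
 have xc: "x i : carrier M" if "i < d" for i using MG.C_closed x that by blast
 have "mcomp M (lc M d r x) n = (\<Oplus>\<^bsub>M\<^esub>i\<in>{..<d}. mcomp M (r i \<odot>\<^bsub>M\<^esub> x i) n)"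
  unfolding lc_def using r xc by (intro MG.hcomp_finsum) (auto simp: smult_closed Pi_def)
 also have "... = lc M d (%i. zcomp R (r i) (n - t)) x"
  unfolding lc_def using r x xc
  by (intro M.finsum_cong') (auto simp: smult_closed Pi_def mcomp_smult_homog zcomp_closed)
 finally show ?thesis .
qed

lemma lc_homog:
 assumes r: "r : {..<d} \<rightarrow> zcomponent R z" and x: "x : {..<d} \<rightarrow> deg M t"
 shows "lc M d r x : deg M (z + t)"
 unfolding lc_def using r x
 by (intro subgroup_finsum[OF M_group MG.C_sub]) (auto intro!: smult_zcomponent)

lemma coord_homog:
 assumes b: "basis_of R M (carrier M) d x" and x: "x : {..<d} \<rightarrow> deg M t"
  and y: "y : deg M n" and i: "i < d"
 shows "coord R M d x y i : zcomponent R (n - t)"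
proof -
 have yc: "y : carrier M" using MG.C_closed[OF y] .
 note c = coord_props[OF b yc]
 have "y = mcomp M (lc M d (coord R M d x y) x) n" using c(2) MG.hcomp_homog[OF y] by simp
 also have "... = lc M d (%i. zcomp R (coord R M d x y i) (n - t)) x" by (rule mcomp_lc[OF c(1) x])
 finally have "coord R M d x y i = zcomp R (coord R M d x y i) (n - t)"
  using c(1) by (intro coord_unique[OF b carrier_submodule _ _ i]) (auto simp: zcomp_closed Pi_def)
 then show ?thesis using zcomp_in[of "coord R M d x y i" "n - t"] c(1) i by (simp add: Pi_iff)
qed

end

lemma graded_hom_linear: "f : graded_hom R M N ==> linear_on R M N (carrier M) f"
 by (auto simp: graded_hom_def linear_maps_iff)

lemma graded_hom_comp:
 assumes "f : graded_hom R L M" "g : graded_hom R M N"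
 shows "(%x. g (f x)) : graded_hom R L N"
 using assms linear_on_comp[of R L M "carrier L" f N "carrier M" g] unfolding graded_hom_def linear_maps_iff
 by (auto simp: linear_on_def image_subset_iff)

lemma graded_hom_mcomp:
 assumes "grmod R M" "grmod R N" "f : graded_hom R M N" "x : carrier M"
 shows "f (mcomp M x n) = mcomp N (f x) n"
proof -
 interpret M: graded_left_module R M by fact
 interpret N: graded_left_module R N by fact
 have fl: "linear_on R M N (carrier M) f" and fc: "f ` deg M n \<subseteq> deg N n" for n
  using assms(3) by (auto simp: graded_hom_def linear_maps_iff)
 define S where "S = {i. mcomp M x i ~= \<zero>\<^bsub>M\<^esub>}"
 have "f x = f (\<Oplus>\<^bsub>M\<^esub>i\<in>S. mcomp M x i)" unfolding S_def using M.MG.hcomp_props(3)[OF assms(4)] by (rule arg_cong)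
 also have "... = (\<Oplus>\<^bsub>N\<^esub>i\<in>S. f (mcomp M x i))"
  using M.MG.hcomp_carrier[OF assms(4)]
  by (intro linear_on_finsum[OF M.left_module_axioms N.left_module_axioms M.carrier_submodule fl]) auto
 finally have "mcomp N (f x) = (%i. f (mcomp M x i))"
  using M.MG.hcomp_props(1,2)[OF assms(4)] fc
   linear_on_zero[OF M.left_module_axioms N.left_module_axioms M.carrier_submodule fl]
  by (intro N.MG.hcomp_unique[of _ S]) (auto simp: S_def)
 then show ?thesis by simp
qed

lemma graded_surj_comp:
 assumes "grmod R M" "grmod R N" "f : graded_hom R M N"
  "f ` carrier M = carrier N" "y : deg N n"
 obtains x where "x : deg M n" "f x = y"
proof -
 interpret M: graded_left_module R M by fact
 interpret N: graded_left_module R N by fact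
 have "y : carrier N" using N.MG.C_closed[OF assms(5)] .
 then have "y : f ` carrier M" using assms(4) by simp
 then obtain x where x: "x : carrier M" "f x = y" by (elim imageE) simp
 have "f (mcomp M x n) = mcomp N y n" using graded_hom_mcomp[OF assms(1-3) x(1), of n] x(2) by simp
 also have "... = y" using N.MG.hcomp_homog[OF assms(5), of n] by simp
 finally show ?thesis by (rule that[OF M.MG.hcomp_props(1)[OF x(1)]])
qed

lemma restrict_simps [simp]:
 "carrier (restrict_module M U) = U" "zero (restrict_module M U) = zero M" "add (restrict_module M U) = add M"
 "smult (restrict_module M U) = smult M" "deg (restrict_module M U) = (%n. deg M n \<inter> U)"
 by (simp_all add: restrict_module_def)

lemma restrict_group:
 assumes "left_module R M" "submodule U R M"
 shows "abelian_group (restrict_module M U)"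
proof -
 interpret left_module R M by fact
 note UD = submoduleD[OF M_group assms(2)]
 show ?thesis
 proof (rule abelian_groupI)
  fix x assume "x : carrier (restrict_module M U)"
  then show "EX y:carrier (restrict_module M U). y \<oplus>\<^bsub>restrict_module M U\<^esub> x = \<zero>\<^bsub>restrict_module M U\<^esub>"
   using UD(1,4) by (intro bexI[of _ "\<ominus>\<^bsub>M\<^esub> x"]) (auto simp: M.l_neg)
 qed (use UD in \<open>auto simp: M.a_ac subset_iff\<close>)
qed

lemma restrict_finsum:
 assumes "left_module R M" "submodule U R M" "f : S \<rightarrow> U"
 shows "finsum (restrict_module M U) f S = finsum M f S"
proof -
 interpret left_module R M by fact
 note g = restrict_group[OF assms(1,2)]
 show ?thesis
  using additive_finsum[OF g M_group carrier_subgroup_add[OF g], of "%x. x" f S] assms(3)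
   submoduleD(1)[OF M_group assms(2)] by auto
qed

lemma restrict_minus:
 assumes "left_module R M" "submodule U R M" "x : U"
 shows "\<ominus>\<^bsub>restrict_module M U\<^esub> x = \<ominus>\<^bsub>M\<^esub> x"
proof -
 interpret left_module R M by fact
 note g = restrict_group[OF assms(1,2)]
 show ?thesis
  using additive_minus[OF g M_group carrier_subgroup_add[OF g], of "%x. x" x] assms(3)
   submoduleD(1)[OF M_group assms(2)] by auto
qed

lemma restrict_lc:
 assumes "left_module R M" "submodule U R M" "r : tup d (carrier R)" "x : tup d U"
 shows "lc (restrict_module M U) d r x = lc M d r x"
proof -
 interpret left_module R M by fact
 show ?thesis unfolding lc_def
  using assms restrict_finsum[OF assms(1,2), of "%i. r i \<odot>\<^bsub>M\<^esub> x i" "{..<d}"]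
   submoduleD(5)[OF M_group assms(2)] by (auto simp: Pi_def)
qed

lemma graded_submoduleI:
 assumes "grmod R M" "submodule U R M" "!!x n. x : U ==> mcomp M x n : U"
 shows "grmod R (restrict_module M U)" "graded_submodule R U M"
  "!!x n. x : U ==> mcomp (restrict_module M U) x n = mcomp M x n"
proof -
 interpret graded_left_module R M by fact
 note UD = submoduleD[OF M_group assms(2)]
 note g = restrict_group[OF left_module_axioms assms(2)]
 have ids: "internal_direct_sum (restrict_module M U) UNIV (%n. deg M n \<inter> U)"
 proof (rule ids_intro[OF g, where p = "%n x. mcomp M x n"], goal_cases)
  case (1 i)
  then show ?case using UD MG.C_subD restrict_minus[OF left_module_axioms assms(2)]
   by (intro subgroup_addI[OF g]) auto
 next
  case (2 x i) then show ?case using assms(3) MG.hcomp_props(1) UD(1) by auto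
 next
  case (3 x) then show ?case using MG.hcomp_props(2) UD(1) by auto
 next
  case (4 x)
  then have x: "x : U" "x : carrier M" using UD(1) by auto
  have "(\<Oplus>\<^bsub>restrict_module M U\<^esub>i\<in>{i. mcomp M x i ~= \<zero>\<^bsub>M\<^esub>}. mcomp M x i) = x"
   using MG.hcomp_props(3)[OF x(2), symmetric] assms(3)[OF x(1)]
   by (subst restrict_finsum[OF left_module_axioms assms(2)]) auto
  then show ?case by simp
 next
  case (5 i x y) then show ?case using MG.hcomp_add UD(1) by auto
 next
  case (6 i j x) then show ?case using MG.hcomp_homog by auto
 qed
 then show "graded_submodule R U M" using assms(2) by (simp add: graded_submodule_def)
 show gl: "grmod R (restrict_module M U)"
  unfolding graded_left_module_def graded_left_module_axioms_def left_module_def left_module_axioms_def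
  using ids g UD graded_ring_axioms R_ring component_smult
  by (auto simp: subset_iff smult_l_distr smult_r_distr smult_assoc smult_one RG.C_closed)
 interpret r: graded_left_module R "restrict_module M U" by fact
 fix x n assume x: "x : U"
 have xc: "x : carrier M" using x UD(1) by auto
 have "mcomp (restrict_module M U) x = mcomp M x"
  using MG.hcomp_props(1,2)[OF xc] MG.hcomp_props(3)[OF xc, symmetric] assms(3)[OF x] x
  by (intro r.MG.hcomp_unique[of _ "{i. mcomp M x i ~= \<zero>\<^bsub>M\<^esub>}"])
   (auto simp: restrict_finsum[OF left_module_axioms assms(2)])
 then show "mcomp (restrict_module M U) x n = mcomp M x n" by simp
qed

lemma graded_submodule_mcomp:
 assumes "grmod R M" "graded_submodule R U M" "x : U"
 shows "mcomp M x n : U"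
proof -
 interpret graded_left_module R M by fact
 have U: "submodule U R M" using assms(2) by (simp add: graded_submodule_def)
 note UD = submoduleD[OF M_group U]
 note g = restrict_group[OF left_module_axioms U]
 interpret d: direct_sum "restrict_module M U" "%n. deg M n \<inter> U"
  using g assms(2) by (simp add: direct_sum_def direct_sum_axioms_def graded_submodule_def)
 define c where "c = hcomp (restrict_module M U) (%n. deg M n \<inter> U) x"
 have c: "c n : deg M n \<inter> U" "finite {n. c n ~= \<zero>\<^bsub>M\<^esub>}" for n
  using d.hcomp_props[of x] assms(3) by (auto simp: c_def)
 have "x = (\<Oplus>\<^bsub>M\<^esub>i\<in>{i. c i ~= \<zero>\<^bsub>M\<^esub>}. c i)"
  using d.hcomp_props(3)[of x, folded c_def] assms(3) c(1)
  by (subst restrict_finsum[OF left_module_axioms U, symmetric]) simp_all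
 then have "mcomp M x = c" using c by (intro MG.hcomp_unique) auto
 then show ?thesis using c(1) by auto
qed

lemma a_kernel_iff: "x : a_kernel M N f \<longleftrightarrow> x : carrier M & f x = \<zero>\<^bsub>N\<^esub>"
 by (simp add: a_kernel_def kernel_def)

lemma kernel_submodule:
 assumes "left_module R M" "left_module R N" "linear_on R M N (carrier M) f"
 shows "submodule (a_kernel M N f) R M"
proof -
 interpret M: left_module R M by fact
 interpret N: left_module R N by fact
 show ?thesis
  using assms(3) linear_on_zero[OF assms(1,2) M.carrier_submodule assms(3)]
  by (intro submoduleI'[OF assms(1)])
   (auto simp: a_kernel_iff linear_on_def M.smult_closed N.smult_zero_r)
qed

lemma kernel_graded:
 assumes "grmod R M" "grmod R N" "f : graded_hom R M N"
 shows "grmod R (kernel_module M N f)"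
  "graded_submodule R (a_kernel M N f) M"
  "!!x n. [|x : carrier M; f x = \<zero>\<^bsub>N\<^esub>|] ==> mcomp (kernel_module M N f) x n = mcomp M x n"
proof -
 interpret M: graded_left_module R M by fact
 interpret N: graded_left_module R N by fact
 have s: "submodule (a_kernel M N f) R M"
  using kernel_submodule[OF M.left_module_axioms N.left_module_axioms graded_hom_linear[OF assms(3)]] .
 have c: "mcomp M x n : a_kernel M N f" if "x : a_kernel M N f" for x n
  using graded_hom_mcomp[OF assms, of x n] that M.MG.hcomp_carrier N.MG.hcomp_zero
  by (auto simp: a_kernel_iff)
 note * = graded_submoduleI[OF assms(1) s c]
 show "grmod R (kernel_module M N f)" "graded_submodule R (a_kernel M N f) M"
  using *(1,2) by (auto simp: kernel_module_def)
 fix x n assume "x : carrier M" "f x = \<zero>\<^bsub>N\<^esub>"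
 then show "mcomp (kernel_module M N f) x n = mcomp M x n"
  using *(3) by (auto simp: kernel_module_def a_kernel_iff)
qed

lemma kernel_simps [simp]:
 "carrier (kernel_module M N f) = {x : carrier M. f x = \<zero>\<^bsub>N\<^esub>}" "zero (kernel_module M N f) = zero M"
 "add (kernel_module M N f) = add M" "smult (kernel_module M N f) = smult M"
 "deg (kernel_module M N f) = (%n. deg M n \<inter> {x : carrier M. f x = \<zero>\<^bsub>N\<^esub>})"
 by (auto simp: kernel_module_def a_kernel_iff)

section \<open>Connected graded rings\<close>

locale connected = graded_ring R + K: field k
 for k :: "('k, 'y) ring_scheme" and \<kappa> :: "'k => 'a" and R :: "('a, 'z) graded_ring_scheme" (structure) +
 assumes \<kappa>_hom: "\<kappa> : ring_hom k R" and \<kappa>_bij: "bij_betw \<kappa> (carrier k) (component R 0)"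
begin

lemma \<kappa>_in: "c : carrier k ==> \<kappa> c : component R 0"
 using \<kappa>_bij by (auto simp: bij_betw_def)

lemma \<kappa>_closed: "c : carrier k ==> \<kappa> c : carrier R"
 using ring_hom_closed[OF \<kappa>_hom] .

lemma \<kappa>_surj: "a : component R 0 ==> EX c:carrier k. a = \<kappa> c"
 using \<kappa>_bij by (auto simp: bij_betw_def)

lemma \<kappa>_zero: "\<kappa> \<zero>\<^bsub>k\<^esub> = \<zero>"
 using ring_hom_zero[OF \<kappa>_hom] ring_axioms K.field_axioms by (auto simp: field_def domain_def cring_def)

lemma \<kappa>_one: "\<kappa> \<one>\<^bsub>k\<^esub> = \<one>"
 using ring_hom_one[OF \<kappa>_hom] .

lemma \<kappa>_eq_zero: "[|c : carrier k; \<kappa> c = \<zero>|] ==> c = \<zero>\<^bsub>k\<^esub>"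
 using inj_onD[OF bij_betw_imp_inj_on[OF \<kappa>_bij], of c "\<zero>\<^bsub>k\<^esub>"] \<kappa>_zero by simp

lemma k_ring: "ring k" using K.field_axioms by (auto simp: field_def domain_def cring_def)

lemma scal_vspace: "left_module R M ==> vspace k (scal \<kappa> M)"
 using scal_module[OF k_ring \<kappa>_hom] K.field_axioms by (simp add: vspace_def)

lemma scal_submodule:
 assumes "grmod R M"
 shows "submodule (deg M n) k (scal \<kappa> M)"
proof -
 interpret M: graded_left_module R M by fact
 interpret v: vspace k "scal \<kappa> M" by (rule scal_vspace) (rule M.left_module_axioms)
 show ?thesis
  using M.MG.C_subD M.component_smult[OF \<kappa>_in] by (intro submoduleI'[OF v.left_module_axioms]) auto
qed

lemma scal_submodule_of:
 assumes "left_module R M" "submodule U R M"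
 shows "submodule U k (scal \<kappa> M)"
proof -
 interpret M: left_module R M by fact
 interpret v: vspace k "scal \<kappa> M" by (rule scal_vspace) (rule M.left_module_axioms)
 show ?thesis
  using submoduleD[OF M.M_group assms(2)] \<kappa>_closed by (intro submoduleI'[OF v.left_module_axioms]) auto
qed

end

section \<open>Free graded modules\<close>

text \<open>Coefficient tuples are encoded as lists over \<open>'a + 'x\<close>, because projectivity is tested on modules
carried by such lists and resolutions and syzygies are required to live there.\<close>

definition emb :: "nat => (nat => 'a) => ('a + 'x) list" where
 "emb d r = map (%i. Inl (r i)) [0..<d]"

definition cf :: "('a + 'x) list => nat => 'a" where
 "cf u i = projl (u ! i)"

lemma cf_emb [simp]: "i < d ==> cf (emb d r) i = r i"
 by (simp add: cf_def emb_def)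

lemma emb_eqI: "(!!i. i < d ==> r i = s i) ==> emb d r = emb d s"
 by (simp add: emb_def)

lemma emb_cf: "u : emb d ` S ==> emb d (cf u) = u"
 by (auto intro: emb_eqI)

definition free_module :: "('a, 'z) graded_ring_scheme => nat => int => ('a, 'x) list_module" where
 "free_module R d t = \<lparr>carrier = emb d ` (tup d (carrier R)), mult = undefined, one = undefined,
   zero = emb d (%_. \<zero>\<^bsub>R\<^esub>), add = (%u v. emb d (%i. cf u i \<oplus>\<^bsub>R\<^esub> cf v i)),
   smult = (%a u. emb d (%i. a \<otimes>\<^bsub>R\<^esub> cf u i)),
   mcomponent = (%n. emb d ` ({..<d} \<rightarrow> zcomponent R (n - t)))\<rparr>"

lemma free_simps [simp]:
 "carrier (free_module R d t) = emb d ` (tup d (carrier R))"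
 "zero (free_module R d t) = emb d (%_. \<zero>\<^bsub>R\<^esub>)"
 "add (free_module R d t) = (%u v. emb d (%i. cf u i \<oplus>\<^bsub>R\<^esub> cf v i))"
 "smult (free_module R d t) = (%a u. emb d (%i. a \<otimes>\<^bsub>R\<^esub> cf u i))"
 "deg (free_module R d t) = (%n. emb d ` ({..<d} \<rightarrow> zcomponent R (n - t)))"
 by (simp_all add: free_module_def)

definition unit_vec :: "('a, 'z) graded_ring_scheme => nat => nat => ('a + 'x) list" where
 "unit_vec R d i = emb d (%j. if j = i then \<one>\<^bsub>R\<^esub> else \<zero>\<^bsub>R\<^esub>)"

context graded_ring
begin

lemma zcomp_sum:
 assumes a: "a : carrier R" and S: "finite S" "!!n. n \<notin> S ==> zcomp R a (n - t) = \<zero>"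
 shows "(\<Oplus>n\<in>S. zcomp R a (n - t)) = a"
proof (rule RG.hcomp_eqI)
 show "(\<Oplus>n\<in>S. zcomp R a (n - t)) : carrier R" using zcomp_closed[OF a] by (auto intro!: finsum_closed)
 fix m
 have z: "rcomp R (zcomp R a z) m = (if z = int m then rcomp R a m else \<zero>)" for z
  using RG.hcomp_homog[OF RG.hcomp_props(1)[OF a]] RG.hcomp_zero by (auto simp: zcomp_def)
 have "rcomp R (\<Oplus>n\<in>S. zcomp R a (n - t)) m = (\<Oplus>n\<in>S. rcomp R (zcomp R a (n - t)) m)"
  using zcomp_closed[OF a] by (intro RG.hcomp_finsum) auto
 also have "... = (\<Oplus>n\<in>S. if n = int m + t then rcomp R a m else \<zero>)"
  using RG.hcomp_carrier[OF a] by (intro finsum_cong') (auto simp: z)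
 also have "... = rcomp R a m"
 proof (cases "int m + t : S")
  case True
  then show ?thesis using S(1) RG.hcomp_carrier[OF a] by (subst finsum_single[of _ "int m + t"]) auto
 next
  case False
  then have "rcomp R a m = \<zero>" using S(2)[OF False] by (simp add: zcomp_def)
  then show ?thesis by (auto intro!: add.finprod_one_eqI)
 qed
 finally show "rcomp R (\<Oplus>n\<in>S. zcomp R a (n - t)) m = rcomp R a m" .
qed (rule a)

lemma zcomp_add: "[|a : carrier R; b : carrier R|] ==> zcomp R (a \<oplus> b) z = zcomp R a z \<oplus> zcomp R b z"
 by (simp add: zcomp_def RG.hcomp_add)

lemma zcomp_fin: "a : carrier R ==> finite {n. zcomp R a (n - t) ~= \<zero>}"
proof -
 assume a: "a : carrier R"
 have "{n. zcomp R a (n - t) ~= \<zero>} \<subseteq> (%m. int m + t) ` {m. rcomp R a m ~= \<zero>}"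
  by (auto simp: zcomp_def image_iff split: if_splits intro!: exI[of _ "nat (_ - t)"])
 then show ?thesis using RG.hcomp_props(2)[OF a] finite_subset by blast
qed

lemma free_group: "abelian_group (free_module R d t :: ('a, 'x) list_module)"
proof (rule abelian_groupI)
 let ?F = "free_module R d t :: ('a, 'x) list_module"
 fix u assume "u : carrier ?F"
 then show "EX v:carrier ?F. v \<oplus>\<^bsub>?F\<^esub> u = \<zero>\<^bsub>?F\<^esub>"
  by (intro bexI[of _ "emb d (%i. \<ominus> cf u i)"]) (auto simp: l_neg Pi_def intro!: emb_eqI)
next
 let ?F = "free_module R d t :: ('a, 'x) list_module"
 fix u assume u: "u : carrier ?F"
 have "emb d (%i. \<zero> \<oplus> cf u i) = emb d (cf u)" using u by (auto intro!: emb_eqI simp: Pi_iff)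
 then show "\<zero>\<^bsub>?F\<^esub> \<oplus>\<^bsub>?F\<^esub> u = u"
  using u emb_cf[of u d] by (auto intro!: emb_eqI simp: Pi_iff)
qed (auto intro!: emb_eqI imageI simp: Pi_iff a_ac)

lemma free_minus:
 assumes "u : carrier (free_module R d t :: ('a, 'x) list_module)"
 shows "\<ominus>\<^bsub>free_module R d t\<^esub> u = emb d (%i. \<ominus> cf u i)"
proof -
 let ?F = "free_module R d t :: ('a, 'x) list_module"
 interpret F: abelian_group ?F by (rule free_group)
 have "emb d (%i. \<ominus> cf u i) \<oplus>\<^bsub>?F\<^esub> u = \<zero>\<^bsub>?F\<^esub>"
  using assms by (auto simp: l_neg Pi_iff intro!: emb_eqI)
 then show ?thesis using assms by (intro F.minus_equality) (auto simp: Pi_iff)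
qed

lemma cf_finsum:
 assumes "f : S \<rightarrow> carrier (free_module R d t :: ('a, 'x) list_module)" "i < d"
 shows "cf (finsum (free_module R d t) f S) i = (\<Oplus>s\<in>S. cf (f s) i)"
 using assms
 by (intro additive_finsum[OF free_group abelian_group_axioms carrier_subgroup_add[OF free_group],
    of "%u. cf u i"]) (auto simp: Pi_iff)

lemma free_eqI:
 assumes "u : carrier (free_module R d t :: ('a, 'x) list_module)"
  "v : carrier (free_module R d t :: ('a, 'x) list_module)" "!!i. i < d ==> cf u i = cf v i"
 shows "u = v"
proof -
 have "u = emb d (cf u)" using assms(1) by (intro emb_cf[symmetric]) simp
 also have "... = emb d (cf v)" using assms(3) by (rule emb_eqI)
 also have "... = v" using assms(2) by (intro emb_cf) simp
 finally show ?thesis .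
qed

lemma free_graded: "grmod R (free_module R d t :: ('a, 'x) list_module)"
proof -
 let ?F = "free_module R d t :: ('a, 'x) list_module"
 interpret F: abelian_group ?F by (rule free_group)
 have lm: "left_module R ?F"
  by (intro left_module.intro left_module_axioms.intro ring_axioms free_group)
   (auto intro!: emb_eqI imageI simp: Pi_iff l_distr r_distr m_assoc)
 have "internal_direct_sum ?F UNIV (deg ?F)"
 proof (rule ids_intro[OF free_group, where p = "%n u. emb d (%i. zcomp R (cf u i) (n - t))"], goal_cases)
  case (1 n)
  show ?case
  proof (rule subgroup_addI[OF free_group])
   fix u assume u: "u : deg ?F n"
   then have "u : carrier ?F" using zcomponent_D(1) by (auto simp: Pi_iff)
   then show "\<ominus>\<^bsub>?F\<^esub> u : deg ?F n"
    using free_minus[of u d t] u zcomponent_D by (auto intro!: imageI simp: Pi_iff)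
  qed (use zcomponent_D(2,3) in \<open>auto intro!: imageI intro: zcomponent_closed simp: Pi_iff\<close>)
 next
  case (2 x i)
  then show ?case using zcomp_in by (auto simp: Pi_iff)
 next
  case (3 x)
  have "{n. emb d (%i. zcomp R (cf x i) (n - t)) ~= \<zero>\<^bsub>?F\<^esub>} \<subseteq> (\<Union>i<d. {n. zcomp R (cf x i) (n - t) ~= \<zero>})"
   by (auto intro!: emb_eqI)
  moreover have "finite (\<Union>i<d. {n. zcomp R (cf x i) (n - t) ~= \<zero>})"
   using 3 zcomp_fin by (auto simp: Pi_iff)
  ultimately show ?case by (rule finite_subset)
 next
  case (4 x)
  let ?S = "{n. emb d (%i. zcomp R (cf x i) (n - t)) ~= \<zero>\<^bsub>?F\<^esub>}"
  let ?T = "\<Union>i<d. {n. zcomp R (cf x i) (n - t) ~= \<zero>}"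
  have fin: "finite ?T" using 4 zcomp_fin by (auto simp: Pi_iff)
  have pc: "emb d (%i. zcomp R (cf x i) (n - t)) : carrier ?F" for n
   using 4 zcomp_closed by (auto simp: Pi_iff)
  have ST: "?S \<subseteq> ?T" by (auto intro!: emb_eqI)
  have "(\<Oplus>\<^bsub>?F\<^esub>n\<in>?S. emb d (%i. zcomp R (cf x i) (n - t))) = (\<Oplus>\<^bsub>?F\<^esub>n\<in>?T. emb d (%i. zcomp R (cf x i) (n - t)))"
   using fin ST pc by (intro F.add.finprod_mono_neutral_cong_left) auto
  also have "... = x"
  proof (rule free_eqI[of _ d t])
   show "(\<Oplus>\<^bsub>?F\<^esub>n\<in>?T. emb d (%i. zcomp R (cf x i) (n - t))) : carrier ?F" using pc by (intro F.finsum_closed) auto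
   fix i assume i: "i < d"
   have "cf (\<Oplus>\<^bsub>?F\<^esub>n\<in>?T. emb d (%i. zcomp R (cf x i) (n - t))) i = (\<Oplus>n\<in>?T. zcomp R (cf x i) (n - t))"
    using pc i by (subst cf_finsum) (auto simp del: free_simps)
   also have "... = cf x i" using 4 i fin by (intro zcomp_sum) auto
   finally show "cf (\<Oplus>\<^bsub>?F\<^esub>n\<in>?T. emb d (%i. zcomp R (cf x i) (n - t))) i = cf x i" .
  qed (rule 4)
  finally show ?case by simp
 next
  case (5 i x y)
  then show ?case by (auto intro!: emb_eqI simp: zcomp_add Pi_iff)
 next
  case (6 i j x)
  have "zcomp R (cf x l) (j - t) = (if j = i then cf x l else \<zero>)" if "l < d" for l
  proof -
   have "cf x l : zcomponent R (i - t)" using 6 that by auto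
   then show ?thesis using RG.hcomp_homog RG.hcomp_zero by (auto simp: zcomp_def zcomponent_def split: if_splits)
  qed
  then show ?case using 6 emb_cf[of x d] by (auto intro!: emb_eqI)
 qed
 moreover have "a \<odot>\<^bsub>?F\<^esub> u : deg ?F (int m + n)" if "a : component R m" "u : deg ?F n" for a u m n
  using that zcomponent_mult[of a m _ "n - t"] by (auto simp: Pi_iff algebra_simps intro!: imageI)
 ultimately show ?thesis
  by (intro graded_left_module.intro graded_left_module_axioms.intro lm graded_ring_axioms)
qed

lemma unit_vec_in: "i < d ==> unit_vec R d i : deg (free_module R d t :: ('a, 'x) list_module) t"
 using RG.C_subD(2) one_component by (auto simp: unit_vec_def zcomponent_def)

lemma lc_unit_vec:
 assumes "r : tup d (carrier R)"
 shows "lc (free_module R d t :: ('a, 'x) list_module) d r (unit_vec R d) = emb d r"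
proof -
 let ?F = "free_module R d t :: ('a, 'x) list_module"
 let ?u = "unit_vec R d :: nat => ('a + 'x) list"
 interpret F: graded_left_module R ?F by (rule free_graded)
 have u: "?u : tup d (carrier ?F)"
  using unit_vec_in F.MG.C_closed by blast
 show ?thesis
 proof (rule free_eqI[of _ d t])
  show "lc ?F d r ?u : carrier ?F" using F.lc_closed[OF assms u] .
  show "emb d r : carrier ?F" using assms by auto
  fix i assume i: "i < d"
  have "(%j. r j \<odot>\<^bsub>?F\<^esub> ?u j) : tup d (carrier ?F)" using assms u F.smult_closed by (auto simp: Pi_iff simp del: free_simps)
  from cf_finsum[OF this i] have "cf (lc ?F d r ?u) i = (\<Oplus>j\<in>{..<d}. cf (r j \<odot>\<^bsub>?F\<^esub> ?u j) i)"
   unfolding lc_def .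
  also have "... = r i" using assms i
   by (subst finsum_single[of _ i]) (auto simp: unit_vec_def Pi_iff)
  finally show "cf (lc ?F d r ?u) i = cf (emb d r :: ('a + 'x) list) i" using i by simp
 qed
qed

lemma free_basis: 
 "basis_of R (free_module R d t :: ('a, 'x) list_module) (carrier (free_module R d t)) d (unit_vec R d)"
proof -
 let ?F = "free_module R d t :: ('a, 'x) list_module"
 let ?u = "unit_vec R d :: nat => ('a + 'x) list"
 interpret F: graded_left_module R ?F by (rule free_graded)
 show ?thesis
 unfolding basis_of_def
 proof (intro conjI ballI impI allI)
  show "?u : tup d (carrier ?F)" 
   using unit_vec_in F.MG.C_closed by blast
 next
  fix y assume "y : carrier ?F"
  then obtain r where r: "r : tup d (carrier R)" "y = emb d r" by auto
  then show "EX r:{..<d} \<rightarrow> carrier R. y = lc ?F d r ?u"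
   using lc_unit_vec[OF r(1), where 'x = 'x, of t] by (intro bexI[of _ r]) auto
 next
  fix r i assume r: "r : tup d (carrier R)" "lc ?F d r ?u = \<zero>\<^bsub>?F\<^esub>" "i < d"
  have "emb d r = (emb d (%_. \<zero>) :: ('a + 'x) list)" using r(2) lc_unit_vec[OF r(1), where 'x = 'x, of t] by simp
  then have "cf (emb d r :: ('a + 'x) list) i = cf (emb d (%_. \<zero>) :: ('a + 'x) list) i" by simp
  then show "r i = \<zero>" using r(3) by simp
 qed
qed

end

lemma basis_graded_hom:
 assumes "grmod R P" "grmod R N" "basis_of R P (carrier P) d x"
  "x : {..<d} \<rightarrow> deg P t" "y : {..<d} \<rightarrow> deg N t"
 obtains f where "f : graded_hom R P N" "!!i. i < d ==> f (x i) = y i"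
  "!!r. r : tup d (carrier R) ==> f (lc P d r x) = lc N d r y"
proof -
 interpret P: graded_left_module R P by fact
 interpret N: graded_left_module R N by fact
 have yc: "y : tup d (carrier N)" and xc: "x : tup d (carrier P)"
  using assms(4,5) by (auto simp: Pi_iff intro: N.MG.C_closed P.MG.C_closed)
 let ?f = "%z. lc N d (coord R P d x z) y"
 note l = basis_extend_linear[OF P.left_module_axioms N.left_module_axioms assms(3) P.carrier_submodule yc]
 have "?f ` deg P n \<subseteq> deg N n" for n
 proof
  fix v assume "v : ?f ` deg P n"
  then obtain u where u: "u : deg P n" "v = ?f u" by auto
  have "coord R P d x u : {..<d} \<rightarrow> zcomponent R (n - t)" using P.coord_homog[OF assms(3,4) u(1)] by auto
  from N.lc_homog[OF this assms(5)] show "v : deg N n" using u(2) by simp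
 qed
 then have "?f : graded_hom R P N" using l(1) by (simp add: graded_hom_def linear_maps_iff)
 moreover have "?f (lc P d r x) = lc N d r y" if "r : tup d (carrier R)" for r
  using linear_on_lc[OF P.left_module_axioms N.left_module_axioms P.carrier_submodule l(1) that xc]
   l(2) N.lc_cong[of "%i. ?f (x i)" d r r y] that yc by (auto simp: Pi_iff)
 ultimately show ?thesis using that[of ?f] l(2) by auto
qed

lemma basis_bounded:
 assumes "grmod R P" "basis_of R P (carrier P) d x" "x : {..<d} \<rightarrow> deg P t" "n < t"
 shows "deg P n = {\<zero>\<^bsub>P\<^esub>}"
proof -
 interpret P: graded_left_module R P by fact
 have xc: "x : tup d (carrier P)" using assms(3) by (auto simp: Pi_iff intro: P.MG.C_closed)
 have "y = \<zero>\<^bsub>P\<^esub>" if y: "y : deg P n" for y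
 proof -
  note c = P.coord_props[OF assms(2) P.MG.C_closed[OF y]]
  have "coord R P d x y i = \<zero>\<^bsub>R\<^esub>" if "i < d" for i
   using P.coord_homog[OF assms(2,3) y that] assms(4) by (simp add: zcomponent_def)
  then have "lc P d (coord R P d x y) x = lc P d (%_. \<zero>\<^bsub>R\<^esub>) x" using c xc by (intro P.lc_cong) auto
  then show ?thesis using c(2) P.lc_zero[OF xc] by simp
 qed
 then show ?thesis using P.MG.C_subD(2) by auto
qed

lemma basis_projective:
 assumes "grmod R P" "basis_of R P (carrier P) d x" "x : {..<d} \<rightarrow> deg P t"
 shows "graded_projective R P"
 unfolding graded_projective_def
proof (intro conjI allI impI)
 show "left_bounded P" unfolding left_bounded_def using basis_bounded[OF assms] by blast
 fix X Y :: "('a, ('a + 'c) list) graded_module" and g h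
 assume a: "grmod R X & left_bounded X & grmod R Y & left_bounded Y \<and>
    g : graded_hom R X Y & g ` carrier X = carrier Y & h : graded_hom R P Y"
 interpret P: graded_left_module R P by fact
 interpret X: graded_left_module R X using a by blast
 interpret Y: graded_left_module R Y using a by blast
 have hx: "h (x i) : deg Y t" if "i < d" for i
  using a assms(3) that by (auto simp: graded_hom_def image_subset_iff Pi_iff)
 have "EX z. z : deg X t & g z = h (x i)" if "i < d" for i
  using graded_surj_comp[of R X Y g, OF _ _ _ _ hx[OF that]] a by metis
 then obtain y where y: "!!i. i < d ==> y i : deg X t & g (y i) = h (x i)" by metis
 then have yc: "y : {..<d} \<rightarrow> deg X t" by auto
 have yX: "y : tup d (carrier X)" and xP: "x : tup d (carrier P)"
  using yc assms(3) by (auto simp: Pi_iff intro: X.MG.C_closed P.MG.C_closed)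
 obtain f where f: "f : graded_hom R P X" "!!r. r : tup d (carrier R) ==> f (lc P d r x) = lc X d r y"
  using basis_graded_hom[OF assms(1) X.graded_left_module_axioms assms(2,3) yc] by metis
 have gl: "linear_on R X Y (carrier X) g" and hl: "linear_on R P Y (carrier P) h"
  using a graded_hom_linear by auto
 have "g (f z) = h z" if z: "z : carrier P" for z
 proof -
  note c = P.coord_props[OF assms(2) z]
  have "g (f z) = lc Y d (coord R P d x z) (%i. g (y i))"
   using f(2)[OF c(1)] c(2) 
    linear_on_lc[OF X.left_module_axioms Y.left_module_axioms X.carrier_submodule gl c(1) yX] by simp
  also have "... = lc Y d (coord R P d x z) (%i. h (x i))"
   using y c(1) Y.MG.C_closed[OF hx] by (intro Y.lc_cong) auto
  also have "... = h z"
   using c(2) linear_on_lc[OF P.left_module_axioms Y.left_module_axioms P.carrier_submodule hl c(1) xP] by simp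
  finally show ?thesis .
 qed
 then show "EX l:graded_hom R P X. ALL x:carrier P. g (l x) = h x" using f(1) by blast
qed (rule assms(1))

text \<open>An isomorphic copy on the type of lists. It makes an arbitrary module available as a test module for
projectivity, and starts the sequence of syzygies.\<close>

definition copy_module :: "('a, 'p) graded_module => ('a, 'p) list_module" where
 "copy_module P = (let l = (%u. projr (hd u)); j = (%x. [Inr x]) in
  \<lparr>carrier = j ` carrier P, mult = undefined, one = undefined, zero = j \<zero>\<^bsub>P\<^esub>,
   add = (%u v. j (l u \<oplus>\<^bsub>P\<^esub> l v)), smult = (%a u. j (a \<odot>\<^bsub>P\<^esub> l u)), mcomponent = (%n. j ` deg P n)\<rparr>)"

lemma copy_simps [simp]:
 "carrier (copy_module P) = (%x. [Inr x]) ` carrier P" "zero (copy_module P) = [Inr \<zero>\<^bsub>P\<^esub>]"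
 "add (copy_module P) = (%u v. [Inr (projr (hd u) \<oplus>\<^bsub>P\<^esub> projr (hd v))])"
 "smult (copy_module P) = (%a u. [Inr (a \<odot>\<^bsub>P\<^esub> projr (hd u))])"
 "deg (copy_module P) = (%n. (%x. [Inr x]) ` deg P n)"
 by (simp_all add: copy_module_def Let_def)

lemma copy_graded:
 assumes "grmod R P"
 shows "grmod R (copy_module P)"
  and "(%x. [Inr x]) : graded_hom R P (copy_module P)"
proof -
 interpret P: graded_left_module R P by fact
 let ?C = "copy_module P" and ?j = "%x. [Inr x]"
 have g: "abelian_group ?C"
 proof (rule abelian_groupI)
  fix u assume "u : carrier ?C"
  then show "EX v:carrier ?C. v \<oplus>\<^bsub>?C\<^esub> u = \<zero>\<^bsub>?C\<^esub>"
   by (intro bexI[of _ "?j (\<ominus>\<^bsub>P\<^esub> projr (hd u))"]) (auto simp: P.M.l_neg)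
 qed (auto simp: P.M.a_ac)
 have lm: "left_module R ?C"
  by (intro left_module.intro left_module_axioms.intro P.ring_axioms g)
   (auto simp: P.smult_l_distr P.smult_r_distr P.smult_assoc P.smult_one P.smult_closed)
 have jsum: "?j (finsum P f S) = finsum ?C (%s. ?j (f s)) S" if "f : S \<rightarrow> carrier P" for f :: "'z => _" and S
  using that by (intro additive_finsum[OF P.M_group g carrier_subgroup_add[OF P.M_group]]) auto
 have "internal_direct_sum ?C UNIV (deg ?C)"
 proof (rule ids_intro[OF g, where p = "%n u. ?j (mcomp P (projr (hd u)) n)"], goal_cases)
  case (1 n)
  show ?case using P.MG.C_subD P.MG.C_closed
  proof (intro subgroup_addI[OF g], goal_cases)
   case (4 u)
   then obtain x where x: "u = ?j x" "x : deg P n" by auto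
   have "\<ominus>\<^bsub>?C\<^esub> u = ?j (\<ominus>\<^bsub>P\<^esub> x)" unfolding x(1)
    using P.MG.C_closed[OF x(2)]
    by (intro additive_minus[OF P.M_group g carrier_subgroup_add[OF P.M_group], symmetric]) auto
   then show ?case using P.MG.C_subD(4)[OF x(2)] by auto
  qed auto
 next
  case (2 u i) then show ?case using P.MG.hcomp_props(1) by auto
 next
  case (3 u) then show ?case using P.MG.hcomp_props(2) by auto
 next
  case (4 u)
  then obtain x where x: "x : carrier P" "u = ?j x" by auto
  have "?j x = ?j (\<Oplus>\<^bsub>P\<^esub>i\<in>{i. mcomp P x i ~= \<zero>\<^bsub>P\<^esub>}. mcomp P x i)"
   using P.MG.hcomp_props(3)[OF x(1)] by (rule arg_cong)
  also have "... = (\<Oplus>\<^bsub>?C\<^esub>i\<in>{i. mcomp P x i ~= \<zero>\<^bsub>P\<^esub>}. ?j (mcomp P x i))"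
   using P.MG.hcomp_carrier[OF x(1)] by (intro jsum) auto
  finally have e: "?j x = (\<Oplus>\<^bsub>?C\<^esub>i\<in>{i. mcomp P x i ~= \<zero>\<^bsub>P\<^esub>}. ?j (mcomp P x i))" .
  show ?case unfolding x(2) by (rule trans[OF e]) simp
 next
  case (5 i x y) then show ?case using P.MG.hcomp_add by auto
 next
  case (6 i j x) then show ?case using P.MG.hcomp_homog by auto
 qed
 moreover have "a \<odot>\<^bsub>?C\<^esub> u : deg ?C (int m + n)" if "a : component R m" "u : deg ?C n" for a u m n
  using that P.component_smult by auto
 ultimately show "grmod R ?C"
  by (intro graded_left_module.intro graded_left_module_axioms.intro lm P.graded_ring_axioms)
 show "?j : graded_hom R P ?C" by (auto simp: graded_hom_def linear_maps_iff linear_on_def)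
qed

section \<open>Projective covers\<close>

lemma (in left_module) span_iff: "u : span d x \<longleftrightarrow> (EX r:{..<d} \<rightarrow> carrier R. u = lc M d r x)"
 unfolding span_def by blast

lemma cover_D:
 assumes "projective_cover R P N \<pi>"
 shows "grmod R P" "grmod R N" "\<pi> : graded_hom R P N"
  "\<pi> ` carrier P = carrier N" "left_bounded P" "graded_projective R P"
  "!!U. [|graded_submodule R U P; \<pi> ` U = carrier N|] ==> U = carrier P"
proof -
 have g: "graded_projective R P" using assms unfolding projective_cover_def by simp
 show "graded_projective R P" by (rule g)
 show "grmod R P" "left_bounded P" 
  using g unfolding graded_projective_def by simp_all
qed (use assms in \<open>simp_all add: projective_cover_def\<close>)

lemma projective_lift:
 fixes P :: "('a, 'p) graded_module" and X Y :: "('a, 'p) list_module"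
 assumes pr: "graded_projective R P" and "grmod R X" "left_bounded X"
  "grmod R Y" "left_bounded Y" "g : graded_hom R X Y" "g ` carrier X = carrier Y" "h : graded_hom R P Y"
 shows "EX l:graded_hom R P X. ALL x:carrier P. g (l x) = h x"
proof -
 have *: "\<forall>(X :: ('a, 'p) list_module) (Y :: ('a, 'p) list_module) g h.
    grmod R X & left_bounded X & grmod R Y & left_bounded Y \<and>
    g : graded_hom R X Y & g ` carrier X = carrier Y & h : graded_hom R P Y -->
    (EX l:graded_hom R P X. ALL x:carrier P. g (l x) = h x)"
  using pr unfolding graded_projective_def by (elim conjE)
 show ?thesis
  by (rule *[THEN spec[of _ X], THEN spec[of _ Y], THEN spec[of _ g], THEN spec[of _ h], THEN mp])
   (intro conjI assms)
qed

lemma image_submodule: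
 assumes "left_module R M" "left_module R N" "linear_on R M N (carrier M) f" "submodule U R M"
 shows "submodule (f ` U) R N"
proof -
 interpret M: left_module R M by fact
 interpret N: left_module R N by fact
 note UD = submoduleD[OF M.M_group assms(4)]
 show ?thesis
 proof (rule submoduleI'[OF assms(2)])
  show "f ` U \<subseteq> carrier N" using assms(3) UD(1) by (auto simp: linear_on_def)
  show "\<zero>\<^bsub>N\<^esub> : f ` U"
   using linear_on_zero[OF assms(1,2) M.carrier_submodule assms(3)] UD(2) by force
 next
  fix u v assume "u : f ` U" "v : f ` U"
  then obtain x y where "x : U" "y : U" "u = f x" "v = f y" by auto
  then show "u \<oplus>\<^bsub>N\<^esub> v : f ` U" using UD(1,3) assms(3)
   by (intro image_eqI[of _ _ "x \<oplus>\<^bsub>M\<^esub> y"]) (auto simp: linear_on_def subset_iff)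
 next
  fix a u assume "a : carrier R" "u : f ` U"
  then obtain x where "x : U" "u = f x" by auto
  then show "a \<odot>\<^bsub>N\<^esub> u : f ` U" using UD(1,5) assms(3) \<open>a : carrier R\<close>
   by (intro image_eqI[of _ _ "a \<odot>\<^bsub>M\<^esub> x"]) (auto simp: linear_on_def subset_iff)
 qed
qed

lemma vimage_submodule:
 assumes "left_module R M" "left_module R N" "linear_on R M N (carrier M) f" "submodule U R N"
 shows "submodule {x : carrier M. f x : U} R M"
proof -
 interpret M: left_module R M by fact
 interpret N: left_module R N by fact
 note UD = submoduleD[OF N.M_group assms(4)]
 show ?thesis
  using assms(3) UD linear_on_zero[OF assms(1,2) M.carrier_submodule assms(3)]
  by (intro submoduleI'[OF assms(1)]) (auto simp: linear_on_def M.smult_closed)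
qed

lemma generated_image:
 assumes "grmod R M" "grmod R N" "f : graded_hom R M N"
  "f ` carrier M = carrier N" "generated_in_degree R M t"
 shows "generated_in_degree R N t"
 unfolding generated_in_degree_def
proof (intro allI impI)
 fix U assume U: "submodule U R N & deg N t \<subseteq> U"
 interpret M: graded_left_module R M by fact
 interpret N: graded_left_module R N by fact
 note l = graded_hom_linear[OF assms(3)]
 have "submodule {x : carrier M. f x : U} R M"
  using vimage_submodule[OF M.left_module_axioms N.left_module_axioms l] U by blast
 moreover have "deg M t \<subseteq> {x : carrier M. f x : U}"
 proof
  fix x assume x: "x : deg M t"
  have "f x : deg N t" using x assms(3) unfolding graded_hom_def by blast
  then show "x : {x : carrier M. f x : U}" using M.MG.C_closed[OF x] U by blast
 qed
 ultimately have "{x : carrier M. f x : U} = carrier M" using assms(5) unfolding generated_in_degree_def by blast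
 then have "f ` carrier M \<subseteq> U" by blast
 then have "carrier N \<subseteq> U" using assms(4) by simp
 then show "U = carrier N" using submoduleD(1)[OF N.M_group, of U] U by auto
qed

context connected
begin

lemma basis_component:
 assumes "grmod R N" "basis_of k (scal \<kappa> N) (deg N t) d b" "y : deg N t"
 shows "EX c:{..<d} \<rightarrow> carrier k. y = lc N d (%i. \<kappa> (c i)) b"
 using assms(2,3) unfolding basis_of_def lc_scal by blast

lemma basis_component_unique:
 assumes N: "grmod R N" and b: "basis_of k (scal \<kappa> N) (deg N t) d b"
  and r: "r : {..<d} \<rightarrow> component R 0" and eq: "lc N d r b = b j" and j: "j < d" and i: "i < d"
 shows "r i = (if i = j then \<one> else \<zero>)"
proof -
 interpret N: graded_left_module R N by fact
 interpret v: vspace k "scal \<kappa> N" by (rule scal_vspace) (rule N.left_module_axioms)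
 have bc: "b : tup d (carrier N)" using b by (auto simp: basis_of_def Pi_iff intro: N.MG.C_closed)
 have "ALL l. EX c. l < d --> c : carrier k & r l = \<kappa> c" using r \<kappa>_surj by (metis PiE lessThan_iff)
 then obtain c where c: "!!l. l < d ==> c l : carrier k & r l = \<kappa> (c l)" by metis
 have "lc N d (%i. \<kappa> (c i)) b = b j"
 proof -
  have "r : tup d (carrier R)" using r by (auto simp: Pi_iff intro: RG.C_closed)
  from N.lc_cong[OF bc this, of "%i. \<kappa> (c i)" b] show ?thesis using eq c by metis
 qed
 then have "coord k (scal \<kappa> N) d b (b j) i = c i"
  using c by (intro v.coord_unique[OF b scal_submodule[OF N] _ _ i]) (auto simp: lc_scal)
 then have "c i = (if i = j then \<one>\<^bsub>k\<^esub> else \<zero>\<^bsub>k\<^esub>)"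
  using v.coord_basis[OF b scal_submodule[OF N] j i] by simp
 then show ?thesis using c[OF i] \<kappa>_one \<kappa>_zero by simp
qed

lemma basis_component_carrier:
 assumes "grmod R N" "basis_of k (scal \<kappa> N) (deg N t) d b"
 shows "b : {..<d} \<rightarrow> deg N t" "b : tup d (carrier N)"
proof -
 interpret N: graded_left_module R N by fact
 show "b : {..<d} \<rightarrow> deg N t" using assms(2) by (auto simp: basis_of_def)
 then show "b : tup d (carrier N)" by (auto simp: Pi_iff intro: N.MG.C_closed)
qed

lemma generated_surj:
 assumes P: "grmod R P" and N: "grmod R N" and f: "f : graded_hom R P N"
  and b: "basis_of k (scal \<kappa> N) (deg N t) d b" and gen: "generated_in_degree R N t"
  and x: "x : tup d (carrier P)" "!!i. i < d ==> f (x i) = b i"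
  and U: "submodule U R P" "x : tup d U"
 shows "f ` U = carrier N"
proof -
 interpret P: graded_left_module R P by fact
 interpret N: graded_left_module R N by fact
 note l = graded_hom_linear[OF f]
 have s: "submodule (f ` U) R N" 
  by (rule image_submodule[OF P.left_module_axioms N.left_module_axioms l U(1)])
 have "deg N t \<subseteq> f ` U"
 proof
  fix y assume "y : deg N t"
  then obtain c where c: "c : tup d (carrier k)" "y = lc N d (%i. \<kappa> (c i)) b"
   using basis_component[OF N b] by blast
  have kc: "(%i. \<kappa> (c i)) : tup d (carrier R)" using c(1) \<kappa>_closed by auto
  have "f (lc P d (%i. \<kappa> (c i)) x) = lc N d (%i. \<kappa> (c i)) (%i. f (x i))"
   by (rule linear_on_lc[OF P.left_module_axioms N.left_module_axioms P.carrier_submodule l kc x(1)])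
  also have "... = y" unfolding c(2) using kc x basis_component_carrier(2)[OF N b] 
   by (intro N.lc_cong) (auto simp: Pi_iff)
  finally show "y : f ` U" using P.lc_in[OF U(1) kc U(2)] by force
 qed
 then show ?thesis using gen s by (auto simp: generated_in_degree_def)
qed

lemma generated_bounded:
 assumes N: "grmod R N" and b: "basis_of k (scal \<kappa> N) (deg N t) d b"
  and gen: "generated_in_degree R N t" and n: "n < t"
 shows "deg N n = {\<zero>\<^bsub>N\<^esub>}"
proof -
 interpret N: graded_left_module R N by fact
 let ?F = "free_module R d t :: ('a, ('a + 'a) list) graded_module"
 let ?u = "unit_vec R d :: nat => ('a + 'a) list"
 interpret F: graded_left_module R ?F by (rule free_graded)
 have u: "?u : {..<d} \<rightarrow> deg ?F t" "?u : tup d (carrier ?F)"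
  using unit_vec_in F.MG.C_closed by blast+
 obtain f where f: "f : graded_hom R ?F N" "!!i. i < d ==> f (?u i) = b i"
  using basis_graded_hom[OF F.graded_left_module_axioms N free_basis u(1) basis_component_carrier(1)[OF N b]] by metis
 have s: "f ` carrier ?F = carrier N"
  by (rule generated_surj[OF F.graded_left_module_axioms N f(1) b gen u(2) f(2) F.carrier_submodule u(2)])
 have "y = \<zero>\<^bsub>N\<^esub>" if y: "y : deg N n" for y
 proof -
  obtain x where "x : deg ?F n" "f x = y"
   using graded_surj_comp[OF F.graded_left_module_axioms N f(1) s y] .
  then show ?thesis using basis_bounded[OF F.graded_left_module_axioms free_basis u(1) n]
   linear_on_zero[OF F.left_module_axioms N.left_module_axioms F.carrier_submodule graded_hom_linear[OF f(1)]]
   by simp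
 qed
 then show ?thesis using N.MG.C_subD(2) by auto
qed

text \<open>The kernel is superfluous by a graded Nakayama argument: a graded submodule mapping onto \<open>N\<close> contains
lifts of the basis \<open>b\<close> in degree \<open>t\<close>, and the only such lifts are the basis elements \<open>x i\<close>, because in
degree \<open>t\<close> the map is injective.\<close>

lemma coverI:
 assumes P: "grmod R P" and N: "grmod R N" and f: "f : graded_hom R P N"
  and b: "basis_of k (scal \<kappa> N) (deg N t) d b" and gen: "generated_in_degree R N t"
  and x: "basis_of R P (carrier P) d x" "x : {..<d} \<rightarrow> deg P t" "!!i. i < d ==> f (x i) = b i"
 shows "projective_cover R P N f"
 unfolding projective_cover_def
proof (intro conjI allI impI)
 interpret P: graded_left_module R P by fact
 interpret N: graded_left_module R N by fact
 have xc: "x : tup d (carrier P)" using x(2) by (auto simp: Pi_iff intro: P.MG.C_closed)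
 note l = graded_hom_linear[OF f]
 show "graded_projective R P" by (rule basis_projective[OF P x(1,2)])
 show "left_bounded N" unfolding left_bounded_def using generated_bounded[OF N b gen] by blast
 show "f ` carrier P = carrier N" by (rule generated_surj[OF P N f b gen xc x(3) P.carrier_submodule xc])
 fix U assume U: "graded_submodule R U P & f ` U = carrier N"
 then have Us: "submodule U R P" by (simp add: graded_submodule_def)
 have "x i : U" if i: "i < d" for i
 proof -
  have bi: "b i : deg N t" using basis_component_carrier(1)[OF N b] i by auto
  then have "b i : f ` U" using U N.MG.C_closed by auto
  then obtain u where u: "u : U" "f u = b i" by force
  define v where "v = mcomp P u t"
  have uc: "u : carrier P" using u(1) submoduleD(1)[OF P.M_group Us] by auto
  have v: "v : U" "v : deg P t" "v : carrier P" using graded_submodule_mcomp[OF P _ u(1)] U P.MG.hcomp_props(1)[OF uc]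
   P.MG.hcomp_carrier[OF uc] by (auto simp: v_def)
  have fv: "f v = b i" using graded_hom_mcomp[OF P N f uc] u(2) N.MG.hcomp_homog[OF bi] by (simp add: v_def)
  define r where "r = coord R P d x v"
  have r: "r : tup d (carrier R)" "lc P d r x = v" using P.coord_props[OF x(1) v(3)] by (auto simp: r_def)
  have r0: "r : {..<d} \<rightarrow> component R 0"
   using P.coord_homog[OF x(1,2) v(2)] by (auto simp: r_def zcomponent_def)
  have "lc N d r b = lc N d r (%i. f (x i))" using r basis_component_carrier(2)[OF N b] x(3)
   by (intro N.lc_cong) (auto simp: Pi_iff)
  also have "... = b i" using fv r(2) linear_on_lc[OF P.left_module_axioms N.left_module_axioms P.carrier_submodule l r(1) xc] by simp
  finally have "r j = (if j = i then \<one> else \<zero>)" if "j < d" for j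
   using basis_component_unique[OF N b r0 _ i that] by blast
  then have "lc P d r x = x i" using P.lc_cong[OF xc r(1), of "%j. if j = i then \<one> else \<zero>" x] P.lc_delta[OF xc i] by simp
  then show ?thesis using v(1) r(2) by simp
 qed
 then have xU: "x : tup d U" by auto
 have "y : U" if "y : carrier P" for y
  using P.coord_props[OF x(1) that] P.lc_in[OF Us _ xU, of "coord R P d x y"] by simp
 then show "U = carrier P" using submoduleD(1)[OF P.M_group Us] by auto
qed (use assms in auto)

lemma cover_exists:
 assumes N: "grmod R N" and b: "basis_of k (scal \<kappa> N) (deg N t) d b"
  and gen: "generated_in_degree R N t"
 obtains f where "projective_cover R (free_module R d t :: ('a, 'x) list_module) N f"
proof -
 let ?F = "free_module R d t :: ('a, 'x) list_module"
 let ?u = "unit_vec R d :: nat => ('a + 'x) list"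
 interpret N: graded_left_module R N by fact
 interpret F: graded_left_module R ?F by (rule free_graded)
 have u: "?u : {..<d} \<rightarrow> deg ?F t" using unit_vec_in by blast
 obtain f where f: "f : graded_hom R ?F N" "!!i. i < d ==> f (?u i) = b i"
  using basis_graded_hom[OF F.graded_left_module_axioms N free_basis u(1) basis_component_carrier(1)[OF N b]] by metis
 from that[OF coverI[OF F.graded_left_module_axioms N f(1) b gen free_basis u f(2)]] show ?thesis by blast
qed

text \<open>Lifts \<open>x i\<close> of the basis elements generate \<open>P\<close> as its kernel is superfluous. The resulting surjection from
a free module splits by projectivity, and the splitting sends \<open>x i\<close> to the \<open>i\<close>-th unit vector since this is
forced in degree \<open>t\<close>; hence the \<open>x i\<close> are independent.\<close>

lemma cover_basis:
 fixes P :: "('a, 'p) graded_module"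
 assumes c: "projective_cover R P N \<pi>" and b: "basis_of k (scal \<kappa> N) (deg N t) d b"
  and gen: "generated_in_degree R N t"
 obtains x where "x : {..<d} \<rightarrow> deg P t" "!!i. i < d ==> \<pi> (x i) = b i" "basis_of R P (carrier P) d x"
proof -
 have P: "grmod R P" and N: "grmod R N" and f: "\<pi> : graded_hom R P N"
  and s: "\<pi> ` carrier P = carrier N" and lb: "left_bounded P"
  using cover_D[OF c] by blast+
 interpret P: graded_left_module R P by fact
 interpret N: graded_left_module R N by fact
 note l = graded_hom_linear[OF f]
 have "EX x. x : deg P t & \<pi> x = b i" if "i < d" for i
  using graded_surj_comp[OF P N f s] basis_component_carrier(1)[OF N b] that by (metis PiE lessThan_iff)
 then obtain x where x: "!!i. i < d ==> x i : deg P t & \<pi> (x i) = b i" by metis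
 then have xt: "x : {..<d} \<rightarrow> deg P t" by auto
 then have xc: "x : tup d (carrier P)" by (auto simp: Pi_iff intro: P.MG.C_closed)
 \<comment> \<open>the span of x maps onto N\<close>
 have sp: "submodule (P.span d x) R P" by (rule P.span_submodule[OF xc])
 have "mcomp P u n : P.span d x" if uS: "u : P.span d x" for u n
 proof -
  obtain r where r: "r : tup d (carrier R)" "u = lc P d r x" using uS unfolding P.span_iff by (elim bexE)
  show ?thesis unfolding r(2) P.mcomp_lc[OF r(1) xt] P.span_iff using r(1) zcomp_closed
   by (intro bexI[of _ "%i. zcomp R (r i) (n - t)"]) (auto simp: Pi_iff)
 qed
 then have gs: "graded_submodule R (P.span d x) P" by (rule graded_submoduleI(2)[OF P sp])
 have "\<pi> ` P.span d x = carrier N"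
  using generated_surj[OF P N f b gen xc _ sp] x P.span_gen[OF xc] by blast
 then have full: "P.span d x = carrier P" using cover_D(7)[OF c gs] by blast
 \<comment> \<open>split the free cover\<close>
 let ?F = "free_module R d t :: ('a, 'p) list_module"
 let ?u = "unit_vec R d :: nat => ('a + 'p) list"
 interpret F: graded_left_module R ?F by (rule free_graded)
 have u: "?u : {..<d} \<rightarrow> deg ?F t" using unit_vec_in by blast
 have uc: "?u : tup d (carrier ?F)" using u by (auto simp: Pi_iff simp del: free_simps intro: F.MG.C_closed)
 obtain p where p: "p : graded_hom R ?F P" "!!i. i < d ==> p (?u i) = x i"
  "!!r. r : tup d (carrier R) ==> p (lc ?F d r ?u) = lc P d r x"
  using basis_graded_hom[OF F.graded_left_module_axioms P free_basis u xt] by metis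
 let ?C = "copy_module P"
 note C = copy_graded[OF P]
 have g: "(%z. [Inr (p z)]) : graded_hom R ?F ?C" by (rule graded_hom_comp[OF p(1) C(2)])
 have "p ` carrier ?F = carrier P"
 proof
  show "p ` carrier ?F \<subseteq> carrier P" using graded_hom_linear[OF p(1)] unfolding linear_on_def by blast
  show "carrier P \<subseteq> p ` carrier ?F"
  proof
   fix y assume "y : carrier P"
   then obtain r where r: "r : tup d (carrier R)" "y = lc P d r x" unfolding full[symmetric] P.span_iff by (elim bexE)
   show "y : p ` carrier ?F" using p(3)[OF r(1)] r(2) F.lc_closed[OF r(1) uc] by (metis image_eqI)
  qed
 qed
 then have gs: "(%z. [Inr (p z)]) ` carrier ?F = carrier ?C"
  by (simp add: image_image[symmetric, of "%x. [Inr x]" p] del: free_simps)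
 have lbF: "left_bounded ?F"
  unfolding left_bounded_def using basis_bounded[OF F.graded_left_module_axioms free_basis u] by blast
 have lbC: "left_bounded ?C" using lb unfolding left_bounded_def by auto
 have "EX l:graded_hom R P ?F. ALL z:carrier P. [Inr (p (l z))] = [Inr z]"
  using projective_lift[OF cover_D(6)[OF c] F.graded_left_module_axioms lbF C(1) lbC g gs C(2)]
  by simp
 then obtain \<sigma> where \<sigma>: "\<sigma> : graded_hom R P ?F" "!!z. z : carrier P ==> p (\<sigma> z) = z" by auto
 note \<sigma>l = graded_hom_linear[OF \<sigma>(1)]
 have \<sigma>x: "\<sigma> (x i) = ?u i" if i: "i < d" for i
 proof -
  have xi: "x i : deg P t" "x i : carrier P" using x[OF i] P.MG.C_closed by blast+
  then have st: "\<sigma> (x i) : deg ?F t" using \<sigma>(1) by (auto simp: graded_hom_def simp del: free_simps)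
  then obtain r where r: "r : {..<d} \<rightarrow> component R 0" "\<sigma> (x i) = emb d r" by (auto simp: zcomponent_def)
  have rc: "r : tup d (carrier R)" using r(1) by (auto simp: Pi_iff intro: RG.C_closed)
  have "lc P d r x = x i" using p(3)[OF rc] lc_unit_vec[OF rc, where 'x = 'p, of t] r(2) \<sigma>(2)[OF xi(2)] by simp
  then have "lc N d r (%i. \<pi> (x i)) = b i"
   using linear_on_lc[OF P.left_module_axioms N.left_module_axioms P.carrier_submodule l rc xc] x[OF i] by simp
  then have "lc N d r b = b i"
   using N.lc_cong[of b d r r "%i. \<pi> (x i)"] x rc basis_component_carrier(2)[OF N b] by auto
  from basis_component_unique[OF N b r(1) this i] show ?thesis
   unfolding r(2) unit_vec_def by (intro emb_eqI) auto
 qed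
 have "basis_of R P (carrier P) d x"
  unfolding basis_of_def
 proof (intro conjI ballI impI allI)
  fix y assume "y : carrier P"
  then show "EX r:{..<d} \<rightarrow> carrier R. y = lc P d r x" unfolding full[symmetric] P.span_iff .
 next
  fix r i assume r: "r : tup d (carrier R)" "lc P d r x = \<zero>\<^bsub>P\<^esub>" "i < d"
  have "emb d r = lc ?F d r ?u" using lc_unit_vec[OF r(1), where 'x = 'p, of t] by simp
  also have "... = lc ?F d r (%i. \<sigma> (x i))" using r(1) uc \<sigma>x by (intro F.lc_cong) auto
  also have "... = \<sigma> (lc P d r x)"
   using linear_on_lc[OF P.left_module_axioms F.left_module_axioms P.carrier_submodule \<sigma>l r(1) xc] by simp
  also have "... = \<zero>\<^bsub>?F\<^esub>"
   unfolding r(2) by (rule linear_on_zero[OF P.left_module_axioms F.left_module_axioms P.carrier_submodule \<sigma>l])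
  finally have "cf (emb d r :: ('a + 'p) list) i = cf (\<zero>\<^bsub>?F\<^esub>) i" by simp
  then show "r i = \<zero>" using r(3) by simp
 qed (rule xc)
 then show ?thesis using that xt x by blast
qed

lemma cover_kernel_low:
 assumes c: "projective_cover R P N \<pi>" and b: "basis_of k (scal \<kappa> N) (deg N t) d b"
  and gen: "generated_in_degree R N t" and n: "n \<le> t"
 shows "deg (kernel_module P N \<pi>) n = {\<zero>\<^bsub>P\<^esub>}"
proof -
 have P: "grmod R P" and N: "grmod R N" and f: "\<pi> : graded_hom R P N"
  using cover_D[OF c] by blast+
 interpret P: graded_left_module R P by fact
 interpret N: graded_left_module R N by fact
 interpret v: vspace k "scal \<kappa> N" by (rule scal_vspace) (rule N.left_module_axioms)
 note l = graded_hom_linear[OF f]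
 obtain x where x: "x : {..<d} \<rightarrow> deg P t" "!!i. i < d ==> \<pi> (x i) = b i" "basis_of R P (carrier P) d x"
  using cover_basis[OF c b gen] by blast
 have xc: "x : tup d (carrier P)" using x(1) by (auto simp: Pi_iff intro: P.MG.C_closed)
 note bc = basis_component_carrier(2)[OF N b]
 have "y = \<zero>\<^bsub>P\<^esub>" if y: "y : deg P n" "\<pi> y = \<zero>\<^bsub>N\<^esub>" for y
 proof (cases "n < t")
  case True
  then show ?thesis using basis_bounded[OF P x(3,1) True] y by simp
 next
  case False
  then have nt: "n = t" using n by simp
  have yc: "y : carrier P" using P.MG.C_closed[OF y(1)] .
  note cp = P.coord_props[OF x(3) yc]
  have "ALL i. EX c. i < d --> c : carrier k & coord R P d x y i = \<kappa> c"
   using P.coord_homog[OF x(3,1) y(1)] \<kappa>_surj nt by (auto simp: zcomponent_def)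
  then obtain c where c: "!!i. i < d ==> c i : carrier k & coord R P d x y i = \<kappa> (c i)" by metis
  have "lc (scal \<kappa> N) d c b = lc N d (coord R P d x y) (%i. \<pi> (x i))"
   unfolding lc_scal using c cp(1) x(2) bc by (intro N.lc_cong) (auto simp: \<kappa>_closed)
  also have "... = \<zero>\<^bsub>N\<^esub>"
   using linear_on_lc[OF P.left_module_axioms N.left_module_axioms P.carrier_submodule l cp(1) xc] cp(2) y(2) by simp
  finally have "ALL i<d. c i = \<zero>\<^bsub>k\<^esub>" using b c by (auto simp: basis_of_def)
  then have "lc P d (coord R P d x y) x = lc P d (%_. \<zero>) x" using c cp(1) xc \<kappa>_zero by (intro P.lc_cong) auto
  then show ?thesis using cp(2) P.lc_zero[OF xc] by simp
 qed
 moreover have "\<pi> \<zero>\<^bsub>P\<^esub> = \<zero>\<^bsub>N\<^esub>"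
  by (rule linear_on_zero[OF P.left_module_axioms N.left_module_axioms P.carrier_submodule l])
 ultimately show ?thesis using P.MG.C_subD(2)[of n] P.M.zero_closed unfolding kernel_simps by blast
qed

end

section \<open>Comparison of covers\<close>

lemma graded_iso_inv:
 assumes "grmod R M" "grmod R N" "f : graded_hom R M N"
  "bij_betw f (carrier M) (carrier N)"
 shows "inv_into (carrier M) f : graded_hom R N M" "bij_betw (inv_into (carrier M) f) (carrier N) (carrier M)"
proof -
 interpret M: graded_left_module R M by fact
 interpret N: graded_left_module R N by fact
 let ?g = "inv_into (carrier M) f"
 have s: "f ` carrier M = carrier N" and i: "inj_on f (carrier M)" using assms(4) by (auto simp: bij_betw_def)
 have g: "?g y : carrier M" "f (?g y) = y" if "y : carrier N" for y
  using inv_into_into[of y f "carrier M"] f_inv_into_f[of y f "carrier M"] that unfolding s by auto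
 have gI: "?g y = x" if "x : carrier M" "f x = y" for x y
  using inv_into_f_f[OF i that(1)] that(2) by simp
 note fl = graded_hom_linear[OF assms(3)]
 have "linear_on R N M (carrier N) ?g"
  unfolding linear_on_def
 proof (intro conjI ballI)
  fix y z assume yz: "y : carrier N" "z : carrier N"
  show "?g (y \<oplus>\<^bsub>N\<^esub> z) = ?g y \<oplus>\<^bsub>M\<^esub> ?g z"
   using g[OF yz(1)] g[OF yz(2)] fl by (intro gI) (auto simp: linear_on_def)
 next
  fix a y assume yz: "a : carrier R" "y : carrier N"
  show "?g (a \<odot>\<^bsub>N\<^esub> y) = a \<odot>\<^bsub>M\<^esub> ?g y"
   using g[OF yz(2)] fl yz(1) by (intro gI) (auto simp: linear_on_def M.smult_closed)
 qed (use g in auto)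
 moreover have "?g ` deg N n \<subseteq> deg M n" for n
 proof
  fix x assume "x : ?g ` deg N n"
  then obtain y where y: "y : deg N n" "x = ?g y" by auto
  obtain x' where x': "x' : deg M n" "f x' = y"
   using graded_surj_comp[OF assms(1-3) s y(1)] .
  then show "x : deg M n" using gI[OF M.MG.C_closed[OF x'(1)] x'(2)] y(2) by simp
 qed
 ultimately show "?g : graded_hom R N M" by (simp add: graded_hom_def linear_maps_iff)
 show "bij_betw ?g (carrier N) (carrier M)" using bij_betw_inv_into[OF assms(4)] .
qed

context connected
begin

lemma basis_transport:
 assumes M: "grmod R M" and N: "grmod R N" and f: "f : graded_hom R M N"
  and bij: "bij_betw f (carrier M) (carrier N)" and b: "basis_of k (scal \<kappa> M) (deg M t) d b"
 shows "basis_of k (scal \<kappa> N) (deg N t) d (%i. f (b i))"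
proof -
 interpret M: graded_left_module R M by fact
 interpret N: graded_left_module R N by fact
 note fl = graded_hom_linear[OF f]
 have s: "f ` carrier M = carrier N" and i: "inj_on f (carrier M)" using bij by (auto simp: bij_betw_def)
 note bc = basis_component_carrier[OF M b]
 have flc: "f (lc M d (%i. \<kappa> (c i)) b) = lc N d (%i. \<kappa> (c i)) (%i. f (b i))" if "c : tup d (carrier k)" for c
  using that \<kappa>_closed
  by (intro linear_on_lc[OF M.left_module_axioms N.left_module_axioms M.carrier_submodule fl _ bc(2)]) auto
 show ?thesis unfolding basis_of_def lc_scal
 proof (intro conjI ballI impI allI)
  have "f x : deg N t" if "x : deg M t" for x using f that unfolding graded_hom_def by blast
  then show "(%i. f (b i)) : {..<d} \<rightarrow> deg N t" using bc(1) by (auto simp: Pi_iff)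
 next
  fix y assume "y : deg N t"
  then obtain x where x: "x : deg M t" "f x = y" using graded_surj_comp[OF M N f s] by blast
  then obtain c where c: "c : tup d (carrier k)" "x = lc M d (%i. \<kappa> (c i)) b" using basis_component[OF M b] by blast
  then show "EX r:{..<d} \<rightarrow> carrier k. y = lc N d (%i. \<kappa> (r i)) (%i. f (b i))" using flc[OF c(1)] x(2) c
   by (intro bexI[of _ c]) simp_all
 next
  fix c i assume c: "c : tup d (carrier k)" "lc N d (%i. \<kappa> (c i)) (%i. f (b i)) = \<zero>\<^bsub>scal \<kappa> N\<^esub>" "i < d"
  have m: "lc M d (%i. \<kappa> (c i)) b : carrier M" using c(1) bc(2) \<kappa>_closed by (intro M.lc_closed) auto
  have "f (lc M d (%i. \<kappa> (c i)) b) = f \<zero>\<^bsub>M\<^esub>"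
   using flc[OF c(1)] c(2) linear_on_zero[OF M.left_module_axioms N.left_module_axioms M.carrier_submodule fl] by simp
  then have "lc M d (%i. \<kappa> (c i)) b = \<zero>\<^bsub>M\<^esub>" using inj_onD[OF i _ m] by simp
  then show "c i = \<zero>\<^bsub>k\<^esub>" using b c(1,3) unfolding basis_of_def lc_scal by simp
 qed
qed

text \<open>Both covers have bases lifting corresponding bases of the lowest components, so that coefficients can be
carried from one to the other. This compares an arbitrary minimal resolution with the one whose existence
defines Koszulity.\<close>

lemma cover_unique:
 fixes P :: "('a, 'p) graded_module" and P' :: "('a, 'q) graded_module"
 assumes c: "projective_cover R P N \<pi>" and c': "projective_cover R P' N' \<pi>'"
  and h: "h : graded_hom R N N'" "bij_betw h (carrier N) (carrier N')"
  and b: "basis_of k (scal \<kappa> N) (deg N t) d b" and gen: "generated_in_degree R N t"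
 shows "EX f:graded_hom R (kernel_module P N \<pi>) (kernel_module P' N' \<pi>').
   bij_betw f (carrier (kernel_module P N \<pi>)) (carrier (kernel_module P' N' \<pi>'))"
proof -
 note D = cover_D[OF c] and D' = cover_D[OF c']
 interpret P: graded_left_module R P by (rule D)
 interpret N: graded_left_module R N by (rule D)
 interpret P': graded_left_module R P' by (rule D')
 interpret N': graded_left_module R N' by (rule D')
 note l = graded_hom_linear[OF D(3)] and l' = graded_hom_linear[OF D'(3)] and hl = graded_hom_linear[OF h(1)]
 have hs: "h ` carrier N = carrier N'" and hi: "inj_on h (carrier N)" using h(2) by (auto simp: bij_betw_def)
 have gen': "generated_in_degree R N' t" by (rule generated_image[OF D(2) D'(2) h(1) hs gen])
 note b' = basis_transport[OF D(2) D'(2) h b]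
 obtain x where x: "x : {..<d} \<rightarrow> deg P t" "!!i. i < d ==> \<pi> (x i) = b i" "basis_of R P (carrier P) d x"
  using cover_basis[OF c b gen] by blast
 obtain x' where x': "x' : {..<d} \<rightarrow> deg P' t" "!!i. i < d ==> \<pi>' (x' i) = h (b i)" "basis_of R P' (carrier P') d x'"
  using cover_basis[OF c' b' gen'] by blast
 have xc: "x : tup d (carrier P)" using x(1) by (auto simp: Pi_iff intro: P.MG.C_closed)
 have xc': "x' : {..<d} \<rightarrow> carrier P'" using x'(1) by (auto simp: Pi_iff intro: P'.MG.C_closed)
 note bc = basis_component_carrier(2)[OF D(2) b]
 obtain f where f: "f : graded_hom R P P'" "!!r. r : tup d (carrier R) ==> f (lc P d r x) = lc P' d r x'"
  using basis_graded_hom[OF D(1) D'(1) x(3,1) x'(1)] by metis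
 note fl = graded_hom_linear[OF f(1)]
 have comm: "\<pi>' (lc P' d r x') = h (\<pi> (lc P d r x))" if r: "r : tup d (carrier R)" for r
 proof -
  have "h (\<pi> (lc P d r x)) = h (lc N d r (%i. \<pi> (x i)))"
   using linear_on_lc[OF P.left_module_axioms N.left_module_axioms P.carrier_submodule l r xc] by simp
  also have "lc N d r (%i. \<pi> (x i)) = lc N d r b" using x(2) r bc by (intro N.lc_cong) (auto simp: Pi_iff)
  also have "h (lc N d r b) = lc N' d r (%i. h (b i))"
   by (rule linear_on_lc[OF N.left_module_axioms N'.left_module_axioms N.carrier_submodule hl r bc])
  also have "... = lc N' d r (%i. \<pi>' (x' i))"
   using x'(2) r hl bc by (intro N'.lc_cong) (auto simp: Pi_iff linear_on_def)
  also have "... = \<pi>' (lc P' d r x')"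
   using linear_on_lc[OF P'.left_module_axioms N'.left_module_axioms P'.carrier_submodule l' r xc'] by simp
  finally show ?thesis by simp
 qed
 have h0: "h \<zero>\<^bsub>N\<^esub> = \<zero>\<^bsub>N'\<^esub>" by (rule linear_on_zero[OF N.left_module_axioms N'.left_module_axioms N.carrier_submodule hl])
 have ker: "\<pi>' (lc P' d r x') = \<zero>\<^bsub>N'\<^esub> \<longleftrightarrow> \<pi> (lc P d r x) = \<zero>\<^bsub>N\<^esub>" if r: "r : tup d (carrier R)" for r
 proof -
  have "\<pi> (lc P d r x) : carrier N" using P.lc_closed[OF r xc] l by (auto simp: linear_on_def)
  then have "h (\<pi> (lc P d r x)) = h \<zero>\<^bsub>N\<^esub> \<longleftrightarrow> \<pi> (lc P d r x) = \<zero>\<^bsub>N\<^esub>"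
   using inj_on_eq_iff[OF hi, of "\<pi> (lc P d r x)" "\<zero>\<^bsub>N\<^esub>"] by simp
  then show ?thesis unfolding comm[OF r] h0 .
 qed
 let ?K = "kernel_module P N \<pi>" and ?K' = "kernel_module P' N' \<pi>'"
 have fc: "f z : carrier ?K'" if z: "z : carrier ?K" for z
 proof -
  have zP: "z : carrier P" "\<pi> z = \<zero>\<^bsub>N\<^esub>" using z by auto
  note cz = P.coord_props[OF x(3) zP(1)]
  show ?thesis using f(2)[OF cz(1)] cz ker[OF cz(1)] zP P'.lc_closed[OF cz(1) xc'] by simp
 qed
 have "f : graded_hom R ?K ?K'"
  unfolding graded_hom_def linear_maps_iff
 proof (intro CollectI conjI allI)
  show "linear_on R ?K ?K' (carrier ?K) f"
   unfolding linear_on_def using fl fc by (auto simp: linear_on_def)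
  fix n
  show "f ` deg ?K n \<subseteq> deg ?K' n"
   using fc f(1) unfolding graded_hom_def by auto
 qed
 moreover have "bij_betw f (carrier ?K) (carrier ?K')"
  unfolding bij_betw_def
 proof
  have "inj_on f (carrier P)"
  proof (rule linear_on_inj[OF P.left_module_axioms P'.left_module_axioms P.carrier_submodule fl])
   fix z assume z: "z : carrier P" "f z = \<zero>\<^bsub>P'\<^esub>"
   note cz = P.coord_props[OF x(3) z(1)]
   have "lc P' d (coord R P d x z) x' = \<zero>\<^bsub>P'\<^esub>" using f(2)[OF cz(1)] cz(2) z(2) by simp
   then have "ALL i<d. coord R P d x z i = \<zero>" using x'(3) cz(1) unfolding basis_of_def by blast
   then have "lc P d (coord R P d x z) x = lc P d (%_. \<zero>) x" using cz(1) xc by (intro P.lc_cong) auto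
   then show "z = \<zero>\<^bsub>P\<^esub>" using cz(2) P.lc_zero[OF xc] by simp
  qed
  then show "inj_on f (carrier ?K)" by (rule inj_on_subset) auto
  show "f ` carrier ?K = carrier ?K'"
  proof
   show "f ` carrier ?K \<subseteq> carrier ?K'" using fc by blast
   show "carrier ?K' \<subseteq> f ` carrier ?K"
   proof
    fix z assume z: "z : carrier ?K'"
    then have zP: "z : carrier P'" "\<pi>' z = \<zero>\<^bsub>N'\<^esub>" by auto
    note cz = P'.coord_props[OF x'(3) zP(1)]
    have "lc P d (coord R P' d x' z) x : carrier ?K" using ker[OF cz(1)] cz(2) zP(2) P.lc_closed[OF cz(1) xc] by simp
    moreover have "f (lc P d (coord R P' d x' z) x) = z" using f(2)[OF cz(1)] cz(2) by simp
    ultimately show "z : f ` carrier ?K" by (metis image_eqI)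
   qed
  qed
 qed
 ultimately show ?thesis by blast
qed

end

section \<open>Finiteness of the components\<close>

lemma (in left_module) lc_append:
 assumes "r : tup d (carrier R)" "x : tup d (carrier M)" "s : tup e (carrier R)" "y : tup e (carrier M)"
 shows "lc M (d + e) (%i. if i < d then r i else s (i - d)) (%i. if i < d then x i else y (i - d))
   = lc M d r x \<oplus>\<^bsub>M\<^esub> lc M e s y"
 using assms(3,4)
proof (induction e)
 case 0
 have "lc M d (%i. if i < d then r i else s (i - d)) (%i. if i < d then x i else y (i - d)) = lc M d r x"
  using assms(1,2) by (intro lc_cong) auto
 then show ?case using lc_closed[OF assms(1,2)] by (simp add: lc_0)
next
 case (Suc e)
 have sy: "s : tup e (carrier R)" "y : tup e (carrier M)" "s e : carrier R" "y e : carrier M"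
  using Suc.prems by auto
 let ?r = "%i. if i < d then r i else s (i - d)" and ?x = "%i. if i < d then x i else y (i - d)"
 have c: "?r : {..<Suc (d + e)} \<rightarrow> carrier R" "?x : {..<Suc (d + e)} \<rightarrow> carrier M"
  using assms(1,2) Suc.prems by (auto simp: Pi_iff)
 have "lc M (d + Suc e) ?r ?x = lc M (d + e) ?r ?x \<oplus>\<^bsub>M\<^esub> s e \<odot>\<^bsub>M\<^esub> y e"
  using lc_Suc[OF c] by simp
 also have "... = (lc M d r x \<oplus>\<^bsub>M\<^esub> lc M e s y) \<oplus>\<^bsub>M\<^esub> s e \<odot>\<^bsub>M\<^esub> y e" using Suc.IH[OF sy(1,2)] by simp
 also have "... = lc M d r x \<oplus>\<^bsub>M\<^esub> lc M (Suc e) s y"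
  using lc_Suc[OF Suc.prems] lc_closed[OF assms(1,2)] lc_closed[OF sy(1,2)] sy(3,4)
  by (simp add: M.a_assoc smult_closed)
 finally show ?case .
qed

lemma fspan_sum:
 assumes V: "left_module k V" and W: "W1 \<subseteq> carrier V" "W2 \<subseteq> carrier V" "\<zero>\<^bsub>V\<^esub> : W1" "\<zero>\<^bsub>V\<^esub> : W2"
  and f: "fspan k V W1" "fspan k V W2"
 shows "fspan k V {x \<oplus>\<^bsub>V\<^esub> y | x y. x : W1 & y : W2}"
proof -
 interpret left_module k V by fact
 obtain d w where w: "w : tup d W1" "ALL y:W1. EX c:{..<d} \<rightarrow> carrier k. y = lc V d c w"
  using f(1) by (auto simp: fspan_def)
 obtain e v where v: "v : tup e W2" "ALL y:W2. EX c:{..<e} \<rightarrow> carrier k. y = lc V e c v"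
  using f(2) by (auto simp: fspan_def)
 let ?W = "{x \<oplus>\<^bsub>V\<^esub> y | x y. x : W1 & y : W2}"
 have wv: "w : tup d (carrier V)" "v : tup e (carrier V)" using w(1) v(1) W by auto
 have sub1: "x : ?W" if "x : W1" for x using that W M.r_zero by (intro CollectI exI[of _ x] exI[of _ "\<zero>\<^bsub>V\<^esub>"]) auto
 have sub2: "x : ?W" if "x : W2" for x using that W M.l_zero by (intro CollectI exI[of _ "\<zero>\<^bsub>V\<^esub>"] exI[of _ x]) auto
 let ?u = "%i. if i < d then w i else v (i - d)"
 show ?thesis unfolding fspan_def
 proof (intro exI[of _ "d + e"] exI[of _ ?u] conjI ballI)
  have "w i : ?W" if "i < d" for i using that w(1) by (intro sub1) auto
  moreover have "v i : ?W" if "i < e" for i using that v(1) by (intro sub2) auto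
  ultimately show "?u : {..<d + e} \<rightarrow> ?W" by simp
 next
  fix z assume "z : ?W"
  then obtain x y where xy: "x : W1" "y : W2" "z = x \<oplus>\<^bsub>V\<^esub> y" by blast
  obtain a where a: "a : tup d (carrier k)" "x = lc V d a w" using w(2) xy(1) by blast
  obtain c where c: "c : tup e (carrier k)" "y = lc V e c v" using v(2) xy(2) by blast
  show "EX c:{..<d + e} \<rightarrow> carrier k. z = lc V (d + e) c ?u"
   using lc_append[OF a(1) wv(1) c(1) wv(2)] a c xy(3)
   by (intro bexI[of _ "%i. if i < d then a i else c (i - d)"]) (auto simp: Pi_iff)
 qed
qed

context connected
begin

lemma free_fspan:
 assumes P: "grmod R P" and x: "basis_of R P (carrier P) d x" "x : {..<d} \<rightarrow> deg P t"
  and f: "fspan k (scal \<kappa> (reg R)) (zcomponent R (n - t))"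
 shows "fspan k (scal \<kappa> P) (deg P n)"
proof -
 interpret P: graded_left_module R P by fact
 interpret v: vspace k "scal \<kappa> P" by (rule scal_vspace) (rule P.left_module_axioms)
 interpret r: vspace k "scal \<kappa> (reg R)" by (rule scal_vspace) (rule reg_module[OF ring_axioms])
 let ?Z = "zcomponent R (n - t)"
 have xc: "x : tup d (carrier P)" using x(2) by (auto simp: Pi_iff intro: P.MG.C_closed)
 have Zc: "?Z \<subseteq> carrier R" using zcomponent_closed by blast
 have Zs: "submodule ?Z k (scal \<kappa> (reg R))"
  using zcomponent_D zcomponent_mult[OF \<kappa>_in] by (intro submoduleI'[OF r.left_module_axioms]) auto
 define W where "W e = {lc P e r x | r. r : {..<e} \<rightarrow> ?Z}" for e
 have "fspan k (scal \<kappa> P) (W e)" if "e \<le> d" for e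
  using that
 proof (induction e)
  case 0
  have "W 0 = {\<zero>\<^bsub>P\<^esub>}" by (auto simp: W_def P.lc_0)
  then show ?case unfolding fspan_def by (intro exI[of _ 0]) (simp add: v.lc_0)
 next
  case (Suc e)
  have xe: "x e : carrier P" "x : tup e (carrier P)" "x : {..<Suc e} \<rightarrow> carrier P" using xc Suc.prems by auto
  have "linear_on k (scal \<kappa> (reg R)) (scal \<kappa> P) ?Z (%r. r \<odot>\<^bsub>P\<^esub> x e)"
   using xe Zc \<kappa>_closed by (auto simp: linear_on_def P.smult_closed P.smult_l_distr P.smult_assoc subset_iff)
  from fspan_image[OF r.left_module_axioms v.left_module_axioms Zs this f]
  have "fspan k (scal \<kappa> P) ((%r. r \<odot>\<^bsub>P\<^esub> x e) ` ?Z)" .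
  moreover have "W e \<subseteq> carrier P" using xe(2) Zc P.lc_closed unfolding W_def by blast
  moreover have "\<zero>\<^bsub>P\<^esub> : W e" unfolding W_def using P.lc_zero[OF xe(2)] zcomponent_D(2)
   by (intro CollectI exI[of _ "%_. \<zero>"]) auto
  moreover have "\<zero>\<^bsub>P\<^esub> : (%r. r \<odot>\<^bsub>P\<^esub> x e) ` ?Z"
   using P.smult_zero_l[OF xe(1)] zcomponent_D(2)[of "n - t"] by (metis image_eqI)
  moreover have "(%r. r \<odot>\<^bsub>P\<^esub> x e) ` ?Z \<subseteq> carrier P" using xe(1) Zc P.smult_closed by blast
  ultimately have "fspan k (scal \<kappa> P) {u \<oplus>\<^bsub>scal \<kappa> P\<^esub> v | u v. u : W e & v : (%r. r \<odot>\<^bsub>P\<^esub> x e) ` ?Z}"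
   using Suc by (intro fspan_sum[OF v.left_module_axioms]) auto
  moreover have "{u \<oplus>\<^bsub>scal \<kappa> P\<^esub> v | u v. u : W e & v : (%r. r \<odot>\<^bsub>P\<^esub> x e) ` ?Z} = W (Suc e)"
  proof (intro subset_antisym subsetI)
   fix y assume "y : {u \<oplus>\<^bsub>scal \<kappa> P\<^esub> v | u v. u : W e & v : (%r. r \<odot>\<^bsub>P\<^esub> x e) ` ?Z}"
   then obtain r a where ra: "r : tup e ?Z" "a : ?Z" "y = lc P e r x \<oplus>\<^bsub>P\<^esub> a \<odot>\<^bsub>P\<^esub> x e"
    unfolding W_def by auto
   let ?r = "r(e := a)"
   have rZ: "?r : {..<Suc e} \<rightarrow> ?Z" using ra by (auto simp: Pi_iff less_Suc_eq)
   have "lc P e r x = lc P e ?r x" using ra xe Zc by (intro P.lc_cong) auto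
   have rc: "?r : {..<Suc e} \<rightarrow> carrier R" using rZ Zc by blast
   have "y = lc P (Suc e) ?r x" unfolding P.lc_Suc[OF rc xe(3)] ra(3) \<open>lc P e r x = lc P e ?r x\<close> by simp
   then show "y : W (Suc e)" using rZ unfolding W_def by blast
  next
   fix y assume "y : W (Suc e)"
   then obtain r where r: "r : {..<Suc e} \<rightarrow> ?Z" "y = lc P (Suc e) r x" unfolding W_def by blast
   have rc: "r : {..<Suc e} \<rightarrow> carrier R" using r(1) Zc by blast
   have "y = lc P e r x \<oplus>\<^bsub>P\<^esub> r e \<odot>\<^bsub>P\<^esub> x e" unfolding r(2) by (rule P.lc_Suc[OF rc xe(3)])
   then show "y : {u \<oplus>\<^bsub>scal \<kappa> P\<^esub> v | u v. u : W e & v : (%r. r \<odot>\<^bsub>P\<^esub> x e) ` ?Z}"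
    using r(1) unfolding W_def
    by (intro CollectI exI[of _ "lc P e r x"] exI[of _ "r e \<odot>\<^bsub>P\<^esub> x e"]) (auto simp: Pi_iff)
  qed
  ultimately show ?case by simp
 qed
 moreover have "W d = deg P n"
 proof (intro subset_antisym subsetI)
  fix y assume "y : W d"
  then show "y : deg P n" using P.lc_homog[OF _ x(2), of _ "n - t"] unfolding W_def by auto
 next
  fix y assume y: "y : deg P n"
  show "y : W d" unfolding W_def
   using P.coord_homog[OF x y] P.coord_props(2)[OF x(1) P.MG.C_closed[OF y]]
   by (intro CollectI exI[of _ "coord R P d x y"]) auto
 qed
 ultimately show ?thesis by (metis le_refl)
qed

lemma fspan_kernel:
 assumes P: "grmod R P" and N: "grmod R N" and f: "f : graded_hom R P N"
  and fin: "fspan k (scal \<kappa> P) (deg P n)"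
 shows "fspan k (scal \<kappa> (kernel_module P N f)) (deg (kernel_module P N f) n)"
proof -
 interpret P: graded_left_module R P by fact
 interpret N: graded_left_module R N by fact
 interpret v: vspace k "scal \<kappa> P" by (rule scal_vspace) (rule P.left_module_axioms)
 let ?K = "kernel_module P N f"
 interpret K: graded_left_module R ?K by (rule kernel_graded[OF P N f])
 interpret vK: vspace k "scal \<kappa> ?K" by (rule scal_vspace) (rule K.left_module_axioms)
 let ?W = "deg ?K n"
 have ks: "submodule (a_kernel P N f) R P"
  by (rule kernel_submodule[OF P.left_module_axioms N.left_module_axioms graded_hom_linear[OF f]])
 have W: "submodule ?W k (scal \<kappa> P)"
  using scal_submodule[OF K.graded_left_module_axioms, of n] submoduleD[OF vK.M_group] P.MG.C_closed
   submoduleD(2,3,5)[OF vK.M_group scal_submodule[OF K.graded_left_module_axioms, of n]]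
  by (intro submoduleI'[OF v.left_module_axioms]) auto
 have fW: "fspan k (scal \<kappa> P) ?W"
  by (rule v.fspan_sub[OF W scal_submodule[OF P] _ fin]) auto
 have sub: "?W \<subseteq> a_kernel P N f" by (auto simp: a_kernel_iff)
 have "lc (scal \<kappa> P) d c w = lc (scal \<kappa> ?K) d c w" if "c : tup d (carrier k)" "w : tup d ?W" for d c w
  unfolding lc_scal kernel_module_def using that sub \<kappa>_closed
  by (intro restrict_lc[OF P.left_module_axioms ks, symmetric]) (auto simp: Pi_iff)
 then show ?thesis using fW unfolding fspan_def by (metis (no_types, lifting))
qed

end

section \<open>The trivial module\<close>

context graded_ring
begin

lemma aug_iff: "a : augmentation_ideal R \<longleftrightarrow> a : carrier R & rcomp R a 0 = \<zero>"
proof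
 assume "a : augmentation_ideal R"
 then obtain N c where N: "a = (\<Oplus>n\<in>N. c n)" "finite N" "0 \<notin> N" "c : (\<Pi> n\<in>N. component R n)"
  unfolding augmentation_ideal_def by blast
 have cc: "c n : carrier R" "c n : component R n" if "n : N" for n using N(4) that RG.C_closed by blast+
 have "rcomp R a 0 = (\<Oplus>n\<in>N. rcomp R (c n) 0)" unfolding N(1) using cc by (intro RG.hcomp_finsum) auto
 also have "... = \<zero>" using RG.hcomp_homog[OF cc(2)] N(3) by (intro add.finprod_one_eqI) auto
 finally show "a : carrier R & rcomp R a 0 = \<zero>" using N(1) cc by (auto intro!: finsum_closed)
next
 assume a: "a : carrier R & rcomp R a 0 = \<zero>"
 let ?N = "{n. rcomp R a n ~= \<zero>}"
 have "a = (\<Oplus>n\<in>?N. rcomp R a n)" using a RG.hcomp_props(3) by blast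
 moreover have "finite ?N" "0 \<notin> ?N" "rcomp R a : (\<Pi> n\<in>?N. component R n)"
  using a RG.hcomp_props(1,2) by auto
 ultimately show "a : augmentation_ideal R" unfolding augmentation_ideal_def by blast
qed

lemma rcomp_mult_low:
 assumes a: "a : component R m" and b: "b : carrier R" and n: "n < m"
 shows "rcomp R (a \<otimes> b) n = \<zero>"
proof -
 have ac: "a : carrier R" using RG.C_closed[OF a] .
 define T where "T = {j. rcomp R b j ~= \<zero>}"
 have fin: "finite T" using RG.hcomp_props(2)[OF b] by (simp add: T_def)
 have bj: "rcomp R b j : carrier R" "rcomp R b j : component R j" for j
  using RG.hcomp_carrier[OF b] RG.hcomp_props(1)[OF b] by auto
 have "a \<otimes> b = a \<otimes> (\<Oplus>j\<in>T. rcomp R b j)"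
  unfolding T_def using RG.hcomp_props(3)[OF b] by (rule arg_cong)
 also have "... = (\<Oplus>j\<in>T. a \<otimes> rcomp R b j)" using fin ac bj by (intro finsum_rdistr) auto
 finally have "rcomp R (a \<otimes> b) n = (\<Oplus>j\<in>T. rcomp R (a \<otimes> rcomp R b j) n)"
  using ac bj by (simp add: RG.hcomp_finsum)
 also have "... = \<zero>" using RG.hcomp_homog[OF component_mult[OF a bj(2)]] n
  by (intro add.finprod_one_eqI) auto
 finally show ?thesis .
qed

lemma rcomp_mult:
 assumes a: "a : carrier R" and b: "b : carrier R"
 shows "rcomp R (a \<otimes> b) n = (\<Oplus>i\<in>{..n}. rcomp R a i \<otimes> rcomp R b (n - i))"
proof -
 define S where "S = {i. rcomp R a i ~= \<zero>} \<union> {..n}"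
 have fin: "finite S" using RG.hcomp_props(2)[OF a] by (simp add: S_def)
 have ac: "rcomp R a i : carrier R" "rcomp R a i : component R i" for i
  using RG.hcomp_carrier[OF a] RG.hcomp_props(1)[OF a] by auto
 have bc: "rcomp R b i : carrier R" for i using RG.hcomp_carrier[OF b] .
 have z: "rcomp R (rcomp R a i \<otimes> b) n = (if i \<le> n then rcomp R a i \<otimes> rcomp R b (n - i) else \<zero>)" for i
  using rcomp_mult_l[OF ac(2)[of i] b, of "n - i"] rcomp_mult_low[OF ac(2)[of i] b, of n] by auto
 have "a = (\<Oplus>i\<in>S. rcomp R a i)" using fin by (intro RG.hcomp_sum[OF a]) (auto simp: S_def)
 then have "a \<otimes> b = (\<Oplus>i\<in>S. rcomp R a i) \<otimes> b" by (rule arg_cong)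
 also have "... = (\<Oplus>i\<in>S. rcomp R a i \<otimes> b)" using fin ac b by (intro finsum_ldistr) auto
 finally have "rcomp R (a \<otimes> b) n = (\<Oplus>i\<in>S. rcomp R (rcomp R a i \<otimes> b) n)"
  using ac b by (simp add: RG.hcomp_finsum)
 also have "... = (\<Oplus>i\<in>{..n}. rcomp R a i \<otimes> rcomp R b (n - i))"
  unfolding z using fin ac bc by (intro add.finprod_mono_neutral_cong_right) (auto simp: S_def)
 finally show ?thesis .
qed

lemma rcomp_mult_0:
 assumes "a : carrier R" "b : carrier R"
 shows "rcomp R (a \<otimes> b) 0 = rcomp R a 0 \<otimes> rcomp R b 0"
 using rcomp_mult[OF assms, of 0] assms by (simp add: RG.hcomp_carrier)

lemma aug_ideal: "ideal (augmentation_ideal R) R"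
proof (rule idealI[OF ring_axioms])
 show "subgroup (augmentation_ideal R) (add_monoid R)"
  by (rule subgroup_addI[OF abelian_group_axioms])
   (auto simp: aug_iff RG.hcomp_zero RG.hcomp_add RG.hcomp_neg)
qed (auto simp: aug_iff rcomp_mult_0 RG.hcomp_carrier)

abbreviation cls :: "'a => 'a set" where "cls a \<equiv> augmentation_ideal R +> a"

lemma cls_eq_iff:
 assumes "a : carrier R" "b : carrier R"
 shows "cls a = cls b \<longleftrightarrow> rcomp R a 0 = rcomp R b 0"
proof -
 interpret I: ideal "augmentation_ideal R" R by (rule aug_ideal)
 have "cls a = cls b \<longleftrightarrow> a \<ominus> b : augmentation_ideal R"
  using quotient_eq_iff_same_a_r_cos[OF aug_ideal assms] by simp
 also have "... \<longleftrightarrow> rcomp R a 0 \<ominus> rcomp R b 0 = \<zero>"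
  using assms by (simp add: aug_iff a_minus_def RG.hcomp_add RG.hcomp_neg)
 also have "... \<longleftrightarrow> rcomp R a 0 = rcomp R b 0"
  using diff_zero_imp_eq[of "rcomp R a 0" "rcomp R b 0"] assms by (auto simp: RG.hcomp_carrier a_minus_def r_neg)
 finally show ?thesis .
qed

lemma top_simps:
 "carrier (top_module R) = cls ` carrier R"
 "zero (top_module R) = cls \<zero>"
 "[|a : carrier R; b : carrier R|] ==> add (top_module R) (cls a) (cls b) = cls (a \<oplus> b)"
 "[|a : carrier R; b : carrier R|] ==> smult (top_module R) a (cls b) = cls (a \<otimes> b)"
 "deg (top_module R) n = (if n = 0 then cls ` carrier R else {cls \<zero>})"
proof -
 interpret I: ideal "augmentation_ideal R" R by (rule aug_ideal)
 have z: "augmentation_ideal R = cls \<zero>" using a_rcos_zero[OF aug_ideal, of \<zero>] RG.hcomp_zero by (simp add: aug_iff)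
 have c: "carrier (R Quot augmentation_ideal R) = cls ` carrier R"
  by (auto simp: FactRing_def A_RCOSETS_def RCOSETS_def a_r_coset_def)
 have z': "zero (R Quot augmentation_ideal R) = cls \<zero>" by (simp add: FactRing_def z[symmetric])
 show "carrier (top_module R) = cls ` carrier R" "zero (top_module R) = cls \<zero>"
  "deg (top_module R) n = (if n = 0 then cls ` carrier R else {cls \<zero>})"
  by (simp_all add: top_module_def Let_def c z')
 show "add (top_module R) (cls a) (cls b) = cls (a \<oplus> b)" "smult (top_module R) a (cls b) = cls (a \<otimes> b)"
  if "a : carrier R" "b : carrier R"
  using that by (simp_all add: top_module_def Let_def FactRing_def I.a_rcos_sum I.rcoset_mult_add)
qed

lemma top_graded: "grmod R (top_module R)"
proof -
 let ?T = "top_module R"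
 have g: "abelian_group ?T"
 proof (rule abelian_groupI)
  fix u assume "u : carrier ?T"
  then obtain a where "a : carrier R" "u = cls a" by (auto simp: top_simps)
  then show "EX y:carrier ?T. y \<oplus>\<^bsub>?T\<^esub> u = \<zero>\<^bsub>?T\<^esub>"
   by (intro bexI[of _ "cls (\<ominus> a)"]) (auto simp: top_simps l_neg)
 qed (auto simp: top_simps a_ac)
 interpret T: abelian_group ?T by (rule g)
 have lm: "left_module R ?T"
  by (intro left_module.intro left_module_axioms.intro ring_axioms g)
   (auto simp: top_simps l_distr r_distr m_assoc)
 have zc: "cls \<zero> : carrier ?T" by (auto simp: top_simps)
 have Tz: "\<zero>\<^bsub>?T\<^esub> = cls \<zero>" by (simp add: top_simps)
 have "internal_direct_sum ?T UNIV (deg ?T)"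
 proof (rule ids_intro[OF g, where p = "%n u. if n = 0 then u else \<zero>\<^bsub>?T\<^esub>"], goal_cases)
  case (1 n)
  have "subgroup {\<zero>\<^bsub>?T\<^esub>} (add_monoid ?T)" by (intro subgroup_addI[OF g]) auto
  then show ?case using carrier_subgroup_add[OF g] by (auto simp: top_simps)
 next
  case (3 x) show ?case by (rule finite_subset[of _ "{0}"]) auto
 next
  case (4 x)
  show ?case
  proof (cases "x = \<zero>\<^bsub>?T\<^esub>")
   case True
   then show ?thesis by (auto intro!: T.add.finprod_one_eqI[symmetric])
  next
   case False
   then have "{i. (if i = 0 then x else \<zero>\<^bsub>?T\<^esub>) ~= \<zero>\<^bsub>?T\<^esub>} = {0::int}" by auto
   then show ?thesis using 4 by (simp add: T.finsum_insert T.finsum_empty)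
  qed
 next
  case (6 i j x) then show ?case by (cases "i = 0") (auto simp: top_simps)
 qed (auto simp: top_simps)
 moreover have "a \<odot>\<^bsub>?T\<^esub> u : deg ?T (int m + n)" if a: "a : component R m" and u: "u : deg ?T n" for a u m n
 proof -
  have ac: "a : carrier R" using RG.C_closed[OF a] .
  obtain b where b: "b : carrier R" "u = cls b" "n ~= 0 ==> b = \<zero>" using u by (auto simp: top_simps split: if_splits)
  have "cls (a \<otimes> b) = cls \<zero>" if "m ~= 0"
   using rcomp_mult_0[OF ac b(1)] RG.hcomp_homog[OF a, of 0] that ac b(1)
   by (subst cls_eq_iff) (auto simp: RG.hcomp_zero RG.hcomp_carrier)
  then show ?thesis using b ac by (cases "m = 0"; cases "n = 0") (auto simp: top_simps)
 qed
 ultimately show ?thesis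
  by (intro graded_left_module.intro graded_left_module_axioms.intro lm graded_ring_axioms)
qed

lemma top_generated: "generated_in_degree R (top_module R) 0"
proof -
 interpret T: graded_left_module R "top_module R" by (rule top_graded)
 show ?thesis unfolding generated_in_degree_def
  using submoduleD(1)[OF T.M_group] by (auto simp: top_simps subset_iff)
qed

end

context connected
begin

lemma cls_scalar: "a : carrier R ==> EX c:carrier k. cls a = cls (\<kappa> c)"
proof -
 assume a: "a : carrier R"
 then obtain c where c: "c : carrier k" "rcomp R a 0 = \<kappa> c" using \<kappa>_surj RG.hcomp_props(1) by blast
 have "cls a = cls (\<kappa> c)"
  using RG.hcomp_homog[OF \<kappa>_in[OF c(1)], of 0] c a \<kappa>_closed by (subst cls_eq_iff) auto
 then show ?thesis using c by blast
qed

lemma cls_scalar_inj: "[|c : carrier k; cls (\<kappa> c) = cls \<zero>|] ==> c = \<zero>\<^bsub>k\<^esub>"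
 using cls_eq_iff[of "\<kappa> c" \<zero>] \<kappa>_closed RG.hcomp_homog[OF \<kappa>_in, of c 0] RG.hcomp_zero \<kappa>_eq_zero by simp

lemma top_basis: "basis_of k (scal \<kappa> (top_module R)) (deg (top_module R) 0) 1 (%_. cls \<one>)"
proof -
 interpret T: graded_left_module R "top_module R" by (rule top_graded)
 have lc1: "lc (top_module R) 1 (%i. \<kappa> (c i)) (%_. cls \<one>) = cls (\<kappa> (c 0))" if "c 0 : carrier k" for c
  using T.lc_Suc[of "%i. \<kappa> (c i)" 0 "%_. cls \<one>"] that \<kappa>_closed T.M.l_zero[of "cls (\<kappa> (c 0))"]
  by (auto simp: T.lc_0 top_simps)
 show ?thesis unfolding basis_of_def lc_scal
 proof (intro conjI ballI impI allI)
  fix y assume "y : deg (top_module R) 0"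
  then obtain c where "c : carrier k" "y = cls (\<kappa> c)" using cls_scalar by (auto simp: top_simps)
  then show "EX r:{..<1} \<rightarrow> carrier k. y = lc (top_module R) 1 (%i. \<kappa> (r i)) (%_. cls \<one>)"
   using lc1[of "%_. c"] by (intro bexI[of _ "%_. c"]) auto
 next
  fix c i assume c: "c : {..<1} \<rightarrow> carrier k" "lc (top_module R) 1 (%i. \<kappa> (c i)) (%_. cls \<one>) = \<zero>\<^bsub>scal \<kappa> (top_module R)\<^esub>" "i < (1::nat)"
  then have "cls (\<kappa> (c 0)) = cls \<zero>" using lc1[of c] by (auto simp: top_simps)
  then show "c i = \<zero>\<^bsub>k\<^esub>" using cls_scalar_inj c by auto
 qed (auto simp: top_simps)
qed

lemma one_not_zero: "\<one> ~= \<zero>"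
 using \<kappa>_one \<kappa>_eq_zero[of "\<one>\<^bsub>k\<^esub>"] K.one_not_zero by auto

section \<open>Finite generation\<close>

text \<open>The degree-one part of \<open>a b\<close> is \<open>a\<^sub>0 b\<^sub>1 + a\<^sub>1 b\<^sub>0\<close>, so the elements whose degree-one part lies in the span of
the degree-one parts of the generators form a subring.\<close>

lemma fspan_degree_one:
 assumes X: "finite X" "X \<subseteq> carrier R" "generate_ring R (\<kappa> ` carrier k \<union> X) = carrier R"
  and central: "!!c a. [|c : carrier k; a : carrier R|] ==> \<kappa> c \<otimes> a = a \<otimes> \<kappa> c"
 shows "fspan k (scal \<kappa> (reg R)) (component R 1)"
proof -
 interpret r: vspace k "scal \<kappa> (reg R)" by (rule scal_vspace) (rule reg_module[OF ring_axioms])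
 obtain h where h: "bij_betw h {..<card X} X" using ex_bij_betw_nat_finite[OF X(1)] by (auto simp: atLeast0LessThan)
 let ?d = "card X"
 define w where "w i = rcomp R (h i) 1" for i
 have hX: "h i : carrier R" if "i < ?d" for i using h X(2) that by (auto simp: bij_betw_def)
 have w: "w : {..<?d} \<rightarrow> component R 1" unfolding w_def using RG.hcomp_props(1)[OF hX] by auto
 have wc: "w : {..<?d} \<rightarrow> carrier (scal \<kappa> (reg R))" using w RG.C_closed by (auto simp: Pi_iff)
 define S where "S = r.span ?d w"
 have S: "submodule S k (scal \<kappa> (reg R))" unfolding S_def by (rule r.span_submodule[OF wc])
 note SD = submoduleD[OF r.M_group S]
 have neg: "\<ominus>\<^bsub>scal \<kappa> (reg R)\<^esub> x = \<ominus> x" for x by (rule a_inv_struct) simp_all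
 have sc: "a \<otimes> x : S" "x \<otimes> a : S" if a: "a : component R 0" and x: "x : S" for a x
 proof -
  obtain c where c: "c : carrier k" "a = \<kappa> c" using \<kappa>_surj[OF a] by blast
  show "a \<otimes> x : S" using SD(5)[OF c(1) x] c(2) by simp
  then show "x \<otimes> a : S" using central[OF c(1), of x] c(2) x SD(1) by auto
 qed
 have deg1: "rcomp R (a \<otimes> b) 1 = rcomp R a 0 \<otimes> rcomp R b 1 \<oplus> rcomp R a 1 \<otimes> rcomp R b 0"
  if ab: "a : carrier R" "b : carrier R" for a b
  using rcomp_mult[OF ab, of 1] ab finsum_Suc[of "%i. rcomp R a i \<otimes> rcomp R b (1 - i)" 0]
  by (simp add: RG.hcomp_carrier a_comm)
 have "rcomp R a 1 : S & a : carrier R" if "a : generate_ring R (\<kappa> ` carrier k \<union> X)" for a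
  using that
 proof (induction a rule: generate_ring.induct)
  case one
  then show ?case using RG.hcomp_homog[OF one_component, of 1] SD(2) by simp
 next
  case (incl a)
  then show ?case
  proof
   assume "a : \<kappa> ` carrier k"
   then show ?thesis using RG.hcomp_homog[OF \<kappa>_in, of _ 1] SD(2) \<kappa>_closed by auto
  next
   assume a: "a : X"
   then obtain i where i: "i < ?d" "a = h i" using h by (auto simp: bij_betw_def)
   then have "rcomp R a 1 = w i" by (simp add: w_def)
   then show ?thesis using r.span_gen[OF wc i(1)] a X(2) by (auto simp: S_def)
  qed
 next
  case (a_inv a)
  then show ?case using SD(4) neg by (auto simp: RG.hcomp_neg)
 next
  case (eng_add a b)
  then show ?case using SD(3) by (auto simp: RG.hcomp_add)
 next
  case (eng_mult a b)
  then have ab: "a : carrier R" "b : carrier R" "rcomp R a 1 : S" "rcomp R b 1 : S" by auto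
  show ?case unfolding deg1[OF ab(1,2)]
   using SD(3)[OF sc(1)[OF RG.hcomp_props(1)[OF ab(1)] ab(4)] sc(2)[OF RG.hcomp_props(1)[OF ab(2)] ab(3)]] ab
   by simp
 qed
 then have "rcomp R a 1 : S" if "a : carrier R" for a using X(3) that by auto
 then have sub: "component R 1 \<subseteq> S" using RG.hcomp_homog[of _ 1 1] RG.C_closed by (metis subsetI)
 show ?thesis unfolding fspan_def
 proof (intro exI conjI ballI)
  fix y assume "y : component R 1"
  then have "y : r.span ?d w" using sub unfolding S_def by blast
  then show "EX c:{..<?d} \<rightarrow> carrier k. y = lc (scal \<kappa> (reg R)) ?d c w" unfolding r.span_iff .
 qed (rule w)
qed

end

section \<open>The minimal resolution of the trivial module over a Koszul algebra\<close>

definition ker_seq ::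
 "('a, 'm) graded_module => (nat => ('a, 'p) graded_module) => ('p => 'm) => (nat => 'p => 'p) => nat => ('a, 'p) graded_module"
 where "ker_seq M P \<epsilon> d n =
  (case n of 0 => kernel_module (P 0) M \<epsilon> | Suc m => kernel_module (P (Suc m)) (P m) (d m))"

lemma kernel_module_cong: "zero N = zero N' ==> kernel_module M N f = kernel_module M N' f"
proof -
 assume "zero N = zero N'"
 then have "a_kernel M N f = a_kernel M N' f" by (auto simp: a_kernel_iff)
 then show ?thesis by (simp add: kernel_module_def)
qed

lemma resolution_covers:
 assumes "minimal_projective_resolution R M P \<epsilon> d"
 shows "projective_cover R (P 0) M \<epsilon>"
  "projective_cover R (P (Suc n)) (ker_seq M P \<epsilon> d n) (d n)"
  "ker_seq M P \<epsilon> d 0 = kernel_module (P 0) M \<epsilon>"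
  "ker_seq M P \<epsilon> d (Suc n) = kernel_module (P (Suc n)) (ker_seq M P \<epsilon> d n) (d n)"
proof -
 show "projective_cover R (P 0) M \<epsilon>" using assms by (simp add: minimal_projective_resolution_def)
 show "projective_cover R (P (Suc n)) (ker_seq M P \<epsilon> d n) (d n)"
  using assms by (cases n) (auto simp: minimal_projective_resolution_def ker_seq_def)
 show "ker_seq M P \<epsilon> d 0 = kernel_module (P 0) M \<epsilon>" by (simp add: ker_seq_def)
 have "zero (ker_seq M P \<epsilon> d n) = zero (P n)" by (cases n) (simp_all add: ker_seq_def)
 then show "ker_seq M P \<epsilon> d (Suc n) = kernel_module (P (Suc n)) (ker_seq M P \<epsilon> d n) (d n)"
  by (subst kernel_module_cong[of _ "P n"]) (simp_all add: ker_seq_def)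
qed

context connected
begin

lemma fspan_ker_seq:
 assumes res: "minimal_projective_resolution R M P \<epsilon> d"
  and fin: "fspan k (scal \<kappa> (P n)) (deg (P n) m)"
 shows "fspan k (scal \<kappa> (ker_seq M P \<epsilon> d n)) (deg (ker_seq M P \<epsilon> d n) m)"
proof (cases n)
 case 0
 note D = cover_D[OF resolution_covers(1)[OF res]]
 show ?thesis using fspan_kernel[OF D(1,2,3), of m] fin 0 by (simp only: resolution_covers(3)[OF res])
next
 case (Suc l)
 note D = cover_D[OF resolution_covers(2)[OF res, of l]]
 show ?thesis using fspan_kernel[OF D(1,2,3), of m] fin Suc by (simp only: resolution_covers(4)[OF res])
qed

text \<open>By induction along the resolution: its kernels are isomorphic to those of a linear resolution, hence
generated in degree \<open>n + 1\<close>, and their lowest components are finite-dimensional. The induction starts from the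
finite dimension of \<open>A\<^sub>1\<close>.\<close>

lemma koszul_resolution_bases:
 fixes P :: "nat => ('a, 'p) graded_module"
 assumes fin1: "fspan k (scal \<kappa> (reg R)) (component R 1)"
  and kos: "koszul_module R (top_module R)"
  and res: "minimal_projective_resolution R (top_module R) P \<epsilon> d"
 shows "EX x. x : {..<1} \<rightarrow> deg (P 0) 0 & \<epsilon> (x 0) = cls \<one> & basis_of R (P 0) (carrier (P 0)) 1 x"
  and "EX D x. x : {..<D} \<rightarrow> deg (P n) (int n) & basis_of R (P n) (carrier (P n)) D x"
proof -
 let ?T = "top_module R"
 let ?K = "ker_seq ?T P \<epsilon> d"
 note c0 = resolution_covers(1)[OF res] and c = resolution_covers(2)[OF res]
 obtain x0 where x0: "x0 : {..<1} \<rightarrow> deg (P 0) 0" "!!i. i < 1 ==> \<epsilon> (x0 i) = cls \<one>"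
  "basis_of R (P 0) (carrier (P 0)) 1 x0"
  using cover_basis[OF c0 top_basis top_generated] by blast
 then show "EX x. x : {..<1} \<rightarrow> deg (P 0) 0 & \<epsilon> (x 0) = cls \<one> & basis_of R (P 0) (carrier (P 0)) 1 x"
  by auto
 obtain P' :: "nat => ('a, 'a set) list_module" and \<epsilon>' d' where
  res': "minimal_projective_resolution R ?T P' \<epsilon>' d'" and gen': "!!i. generated_in_degree R (P' i) (int i)"
  using kos unfolding koszul_module_def by blast
 let ?K' = "ker_seq ?T P' \<epsilon>' d'"
 note c0' = resolution_covers(1)[OF res'] and c' = resolution_covers(2)[OF res']
 define Q where "Q n \<longleftrightarrow> (EX D x. x : {..<D} \<rightarrow> deg (P n) (int n) & basis_of R (P n) (carrier (P n)) D x) \<and>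
  (EX f:graded_hom R (?K n) (?K' n). bij_betw f (carrier (?K n)) (carrier (?K' n)))" for n
 have "Q n" for n
 proof (induction n)
  case 0
  have "(%x. x) : graded_hom R ?T ?T" by (auto simp: graded_hom_def linear_maps_iff linear_on_def)
  from cover_unique[OF c0 c0' this _ top_basis top_generated]
  have "EX f:graded_hom R (?K 0) (?K' 0). bij_betw f (carrier (?K 0)) (carrier (?K' 0))"
   unfolding resolution_covers(3)[OF res] resolution_covers(3)[OF res'] by (simp add: bij_betw_def)
  moreover have "EX D x. x : {..<D} \<rightarrow> deg (P 0) (int 0) & basis_of R (P 0) (carrier (P 0)) D x"
   using x0 by auto
  ultimately show ?case unfolding Q_def by blast
 next
  case (Suc n)
  then obtain D x f where x: "x : {..<D} \<rightarrow> deg (P n) (int n)" "basis_of R (P n) (carrier (P n)) D x"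
   and f: "f : graded_hom R (?K n) (?K' n)" "bij_betw f (carrier (?K n)) (carrier (?K' n))"
   unfolding Q_def by blast
  note DK = cover_D[OF c[of n]] and DK' = cover_D[OF c'[of n]]
  interpret K: graded_left_module R "?K n" by (rule DK)
  interpret v: vspace k "scal \<kappa> (?K n)" by (rule scal_vspace) (rule K.left_module_axioms)
  have gP: "grmod R (P n)"
   by (cases n) (use cover_D(1)[OF c0] cover_D(1)[OF c] in auto)
  have "generated_in_degree R (?K' n) (int (Suc n))"
   by (rule generated_image[OF DK'(1,2,3,4) gen'])
  then have gen: "generated_in_degree R (?K n) (int (Suc n))"
   using generated_image[OF DK'(2) DK(2) graded_iso_inv(1)[OF DK(2) DK'(2) f]]
    graded_iso_inv(2)[OF DK(2) DK'(2) f] by (simp add: bij_betw_def)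
  have "fspan k (scal \<kappa> (P n)) (deg (P n) (int (Suc n)))"
   using fin1 by (intro free_fspan[OF gP x(2,1)]) (simp add: zcomponent_def)
  then have "fspan k (scal \<kappa> (?K n)) (deg (?K n) (int (Suc n)))"
   by (rule fspan_ker_seq[OF res])
  then obtain e b where b: "basis_of k (scal \<kappa> (?K n)) (deg (?K n) (int (Suc n))) e b"
   using v.fspan_basis[OF scal_submodule[OF DK(2)]] by blast
  have "EX D x. x : {..<D} \<rightarrow> deg (P (Suc n)) (int (Suc n)) & basis_of R (P (Suc n)) (carrier (P (Suc n))) D x"
   using cover_basis[OF c b gen] by metis
  moreover have "EX f:graded_hom R (?K (Suc n)) (?K' (Suc n)). bij_betw f (carrier (?K (Suc n))) (carrier (?K' (Suc n)))"
   unfolding resolution_covers(4)[OF res] resolution_covers(4)[OF res']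
   by (rule cover_unique[OF c c' f b gen])
  ultimately show ?case unfolding Q_def by blast
 qed
 then show "EX D x. x : {..<D} \<rightarrow> deg (P n) (int n) & basis_of R (P n) (carrier (P n)) D x"
  unfolding Q_def by blast
qed

end

section \<open>Chain maps of a complex\<close>

lemma (in abelian_group) finsum_atMost_Suc:
 fixes n :: nat
 assumes "!!i. i \<le> Suc n ==> f i : carrier G"
 shows "finsum G f {..Suc n} = finsum G f {..n} \<oplus> f (Suc n)"
proof -
 have "finsum G f {..Suc n} = f (Suc n) \<oplus> finsum G f {..n}"
  using assms by (intro finsum_Suc) auto
 then show ?thesis using assms by (simp add: a_comm Pi_def)
qed

lemma (in abelian_group) finsum_triangle:
 fixes n :: nat
 assumes "!!j l. j + l \<le> n ==> f j l : carrier G"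
 shows "(\<Oplus>i\<in>{..n}. \<Oplus>j\<in>{..i}. f j (i - j)) = (\<Oplus>j\<in>{..n}. \<Oplus>l\<in>{..n - j}. f j l)"
 using assms
proof (induction n)
 case 0
 then show ?case by simp
next
 case (Suc n)
 have c: "f j l : carrier G" if "j + l \<le> Suc n" for j l using Suc.prems that by blast
 have inner: "(\<Oplus>l\<in>{..Suc n - j}. f j l) = (\<Oplus>l\<in>{..n - j}. f j l) \<oplus> f j (Suc n - j)" if "j \<le> n" for j
  using finsum_atMost_Suc[of "n - j" "f j"] c that by (simp add: Suc_diff_le)
 have "(\<Oplus>i\<in>{..Suc n}. \<Oplus>j\<in>{..i}. f j (i - j)) =
  (\<Oplus>i\<in>{..n}. \<Oplus>j\<in>{..i}. f j (i - j)) \<oplus> (\<Oplus>j\<in>{..Suc n}. f j (Suc n - j))"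
  using c by (intro finsum_atMost_Suc) (auto intro!: finsum_closed)
 also have "... = (\<Oplus>j\<in>{..n}. \<Oplus>l\<in>{..n - j}. f j l) \<oplus> ((\<Oplus>j\<in>{..n}. f j (Suc n - j)) \<oplus> f (Suc n) 0)"
  using c Suc.IH finsum_atMost_Suc[of n "%j. f j (Suc n - j)"] by simp
 also have "... = ((\<Oplus>j\<in>{..n}. \<Oplus>l\<in>{..n - j}. f j l) \<oplus> (\<Oplus>j\<in>{..n}. f j (Suc n - j))) \<oplus> f (Suc n) 0"
  using c by (intro a_assoc[symmetric]) (auto intro!: finsum_closed)
 also have "(\<Oplus>j\<in>{..n}. \<Oplus>l\<in>{..n - j}. f j l) \<oplus> (\<Oplus>j\<in>{..n}. f j (Suc n - j)) =
   (\<Oplus>j\<in>{..n}. (\<Oplus>l\<in>{..n - j}. f j l) \<oplus> f j (Suc n - j))"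
  using c by (intro finsum_addf[symmetric]) (auto intro!: finsum_closed)
 also have "... = (\<Oplus>j\<in>{..n}. \<Oplus>l\<in>{..Suc n - j}. f j l)"
  using c inner by (intro finsum_cong') (auto intro!: finsum_closed)
 also have "(\<Oplus>j\<in>{..n}. \<Oplus>l\<in>{..Suc n - j}. f j l) \<oplus> f (Suc n) 0 = (\<Oplus>j\<in>{..Suc n}. \<Oplus>l\<in>{..Suc n - j}. f j l)"
  using c finsum_atMost_Suc[of n "%j. \<Oplus>l\<in>{..Suc n - j}. f j l"] by (simp add: finsum_closed Pi_def)
 finally show ?case .
qed

lemma linear_on_finsum_maps:
 assumes "left_module R M" "left_module R N" "!!i. i : S ==> linear_on R M N (carrier M) (f i)"
 shows "linear_on R M N (carrier M) (%x. finsum N (%i. f i x) S)"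
proof -
 interpret M: left_module R M by fact
 interpret N: left_module R N by fact
 have c: "f i x : carrier N" if "i : S" "x : carrier M" for i x
  using assms(3)[OF that(1)] that(2) by (auto simp: linear_on_def)
 show ?thesis unfolding linear_on_def
 proof (intro conjI ballI)
  show "(%x. finsum N (%i. f i x) S) : carrier M \<rightarrow> carrier N" using c by (auto intro!: N.finsum_closed)
  fix x y assume xy: "x : carrier M" "y : carrier M"
  have "finsum N (%i. f i (x \<oplus>\<^bsub>M\<^esub> y)) S = finsum N (%i. f i x \<oplus>\<^bsub>N\<^esub> f i y) S"
   using assms(3) xy c by (intro N.finsum_cong') (auto simp: linear_on_def)
  also have "... = finsum N (%i. f i x) S \<oplus>\<^bsub>N\<^esub> finsum N (%i. f i y) S"
   using c xy by (intro N.finsum_addf) auto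
  finally show "finsum N (%i. f i (x \<oplus>\<^bsub>M\<^esub> y)) S = finsum N (%i. f i x) S \<oplus>\<^bsub>N\<^esub> finsum N (%i. f i y) S" .
 next
  fix a x assume ax: "a : carrier R" "x : carrier M"
  have "finsum N (%i. f i (a \<odot>\<^bsub>M\<^esub> x)) S = finsum N (%i. a \<odot>\<^bsub>N\<^esub> f i x) S"
   using assms(3) ax c by (intro N.finsum_cong') (auto simp: linear_on_def N.smult_closed)
  also have "... = a \<odot>\<^bsub>N\<^esub> finsum N (%i. f i x) S"
   using c ax by (intro N.finsum_smult_r[symmetric]) auto
  finally show "finsum N (%i. f i (a \<odot>\<^bsub>M\<^esub> x)) S = a \<odot>\<^bsub>N\<^esub> finsum N (%i. f i x) S" .
 qed
qed

lemma linear_on_add: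
 assumes "left_module R M" "left_module R N" "linear_on R M N (carrier M) f" "linear_on R M N (carrier M) g"
 shows "linear_on R M N (carrier M) (%x. f x \<oplus>\<^bsub>N\<^esub> g x)"
proof -
 interpret M: left_module R M by fact
 interpret N: left_module R N by fact
 show ?thesis using assms(3,4) unfolding linear_on_def
  by (auto simp: N.smult_r_distr N.M.a_ac Pi_iff)
qed

lemma linear_on_neg:
 assumes "left_module R M" "left_module R N" "linear_on R M N (carrier M) f"
 shows "linear_on R M N (carrier M) (%x. \<ominus>\<^bsub>N\<^esub> f x)"
proof -
 interpret M: left_module R M by fact
 interpret N: left_module R N by fact
 show ?thesis using assms(3) unfolding linear_on_def
  by (auto simp: N.smult_minus_r N.M.minus_add Pi_iff)
qed

lemma linear_on_const_zero:
 assumes "left_module R M" "left_module R N"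
 shows "linear_on R M N (carrier M) (%x. \<zero>\<^bsub>N\<^esub>)"
proof -
 interpret N: left_module R N by fact
 show ?thesis by (auto simp: linear_on_def N.smult_zero_r)
qed

locale chain_complex =
 fixes A :: "('a, 'z) ring_scheme" and P :: "nat => ('a, 'p, 'w) module_scheme" and d :: "nat => 'p => 'p"
 assumes P_module: "left_module A (P n)"
  and d_linear: "linear_on A (P (Suc n)) (P n) (carrier (P (Suc n))) (d n)"
begin

sublocale P: left_module A "P n" for n by (rule P_module)


abbreviation C where "C n \<equiv> carrier (P n)"
abbreviation CM where "CM \<equiv> chain_maps A P d"
abbreviation hom_P where "hom_P p q \<equiv> linear_on A (P p) (P q) (carrier (P p))"
abbreviation past where "past q m y \<equiv> (if q = 0 then \<zero>\<^bsub>P m\<^esub> else y)"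

abbreviation Z where "Z \<equiv> chain_map_ring A P d"
abbreviation B where "B \<equiv> null_homotopic A P d"

lemma Z_simps: "carrier Z = CM"
 "zero Z = (%n m. \<lambda>x\<in>C (m + n). \<zero>\<^bsub>P m\<^esub>)"
 "one Z = (%n m. \<lambda>x\<in>C (m + n). if n = 0 then x else \<zero>\<^bsub>P m\<^esub>)"
 by (simp_all add: chain_map_ring_def)

definition supp :: "(nat => nat => 'p => 'p) => nat set" where
 "supp F = {n. EX m. EX x:C (m + n). F n m x ~= \<zero>\<^bsub>P m\<^esub>}"

lemma cm_iff:
 "F : CM \<longleftrightarrow>
  (ALL n m. hom_P (m + n) m (F n m) & F n m : extensional (C (m + n))) \<and>
  (ALL n m. ALL x:C (Suc m + n). d m (F n (Suc m) x) = F n m (d (m + n) x)) & finite (supp F)"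
 unfolding chain_maps_def supp_def by (simp add: linear_maps_iff)

lemma supp_zero: "[|n \<notin> supp F; x : C (m + n)|] ==> F n m x = \<zero>\<^bsub>P m\<^esub>"
 unfolding supp_def by blast

lemma cm_lin: "[|F : CM; q = m + n|] ==> hom_P q m (F n m)"
 by (simp add: cm_iff)

lemma cm_closed: "[|F : CM; x : C q; q = m + n|] ==> F n m x : C m"
 using cm_lin[of F q m n] by (auto simp: linear_on_def)

lemma cm_comm: "[|F : CM; x : C (Suc q); q = m + n|] ==> d m (F n (Suc m) x) = F n m (d q x)"
 by (auto simp: cm_iff)

lemma cm_eqI:
 assumes "F : CM" "G : CM"
  "!!n m x. x : C (m + n) ==> F n m x = G n m x"
 shows "F = G"
proof (intro ext)
 fix n m x
 show "F n m x = G n m x"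
 proof (cases "x : C (m + n)")
  case False
  moreover have "F n m : extensional (C (m + n))" "G n m : extensional (C (m + n))"
   using assms(1,2) unfolding cm_iff by auto
  ultimately show ?thesis by (simp add: extensional_def)
 qed (rule assms(3))
qed

lemma d_closed: "x : C (Suc n) ==> d n x : C n"
 using d_linear[of n] by (auto simp: linear_on_def)

lemma d_add: "[|x : C (Suc n); y : C (Suc n)|] ==> d n (x \<oplus>\<^bsub>P (Suc n)\<^esub> y) = d n x \<oplus>\<^bsub>P n\<^esub> d n y"
 using d_linear[of n] by (auto simp: linear_on_def)

lemma d_zero: "d n \<zero>\<^bsub>P (Suc n)\<^esub> = \<zero>\<^bsub>P n\<^esub>"
 by (rule linear_on_zero[OF P_module P_module P.carrier_submodule d_linear])

lemma d_minus: "x : C (Suc n) ==> d n (\<ominus>\<^bsub>P (Suc n)\<^esub> x) = \<ominus>\<^bsub>P n\<^esub> d n x"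
 by (rule linear_on_minus[OF P_module P_module P.carrier_submodule d_linear])

lemma d_finsum: "g : S \<rightarrow> C (Suc n) ==> d n (finsum (P (Suc n)) g S) = finsum (P n) (%s. d n (g s)) S"
 by (rule linear_on_finsum[OF P_module P_module P.carrier_submodule d_linear])

lemma cm_zero: "[|F : CM; q = m + n|] ==> F n m \<zero>\<^bsub>P q\<^esub> = \<zero>\<^bsub>P m\<^esub>"
 by (rule linear_on_zero[OF P_module P_module P.carrier_submodule cm_lin])

lemma cm_add: "[|F : CM; x : C q; y : C q; q = m + n|] ==>
  F n m (x \<oplus>\<^bsub>P q\<^esub> y) = F n m x \<oplus>\<^bsub>P m\<^esub> F n m y"
 using cm_lin[of F q m n] by (auto simp: linear_on_def)

lemma cm_finsum: "[|F : CM; g : S \<rightarrow> C q; q = m + n|] ==>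
  F n m (finsum (P q) g S) = finsum (P m) (%s. F n m (g s)) S"
 by (rule linear_on_finsum[OF P_module P_module P.carrier_submodule cm_lin])

lemma cmI:
 assumes "!!n m. hom_P (m + n) m (f n m)"
  "!!n m x. x : C (Suc m + n) ==> d m (f n (Suc m) x) = f n m (d (m + n) x)"
  "finite {n. EX m. EX x:C (m + n). f n m x ~= \<zero>\<^bsub>P m\<^esub>}"
 shows "(%n m. \<lambda>x\<in>C (m + n). f n m x) : CM"
 unfolding cm_iff
proof (intro conjI allI ballI)
 fix n m
 show "hom_P (m + n) m (\<lambda>x\<in>C (m + n). f n m x)"
  by (rule linear_on_cong[OF assms(1) P.carrier_submodule P.M_group]) simp
 fix x assume x: "x : C (Suc m + n)"
 then show "d m ((\<lambda>x\<in>C (Suc m + n). f n (Suc m) x) x) = (\<lambda>x\<in>C (m + n). f n m x) (d (m + n) x)"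
  using assms(2)[OF x] d_closed[of x "m + n"] by simp
next
 have "supp (%n m. \<lambda>x\<in>C (m + n). f n m x) = {n. EX m. EX x:C (m + n). f n m x ~= \<zero>\<^bsub>P m\<^esub>}"
  unfolding supp_def by auto
 then show "finite (supp (%n m. \<lambda>x\<in>C (m + n). f n m x))" using assms(3) by simp
qed auto

lemma Z_add: "F \<oplus>\<^bsub>Z\<^esub> G = (%n m. \<lambda>x\<in>C (m + n). F n m x \<oplus>\<^bsub>P m\<^esub> G n m x)"
 by (simp add: chain_map_ring_def)

lemma Z_mult: "F \<otimes>\<^bsub>Z\<^esub> G = (%n m. \<lambda>x\<in>C (m + n). \<Oplus>\<^bsub>P m\<^esub>i\<in>{..n}. G (n - i) m (F i (m + (n - i)) x))"
 by (simp add: chain_map_ring_def)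

lemma Z_add_closed:
 assumes F: "F : CM" and G: "G : CM"
 shows "F \<oplus>\<^bsub>Z\<^esub> G : CM"
 unfolding Z_add
proof (rule cmI)
 fix n m
 show "hom_P (m + n) m (%x. F n m x \<oplus>\<^bsub>P m\<^esub> G n m x)"
  by (intro linear_on_add P_module cm_lin F G refl)
 fix x assume x: "x : C (Suc m + n)"
 then show "d m (F n (Suc m) x \<oplus>\<^bsub>P (Suc m)\<^esub> G n (Suc m) x) = F n m (d (m + n) x) \<oplus>\<^bsub>P m\<^esub> G n m (d (m + n) x)"
  using cm_closed[OF F x refl] cm_closed[OF G x refl] cm_comm[OF F, of x "m + n"] cm_comm[OF G, of x "m + n"]
  by (simp add: d_add)
next
 have "{n. EX m. EX x:C (m + n). F n m x \<oplus>\<^bsub>P m\<^esub> G n m x ~= \<zero>\<^bsub>P m\<^esub>} \<subseteq> supp F \<union> supp G"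
  using supp_zero[of _ F] supp_zero[of _ G] by fastforce
 then show "finite {n. EX m. EX x:C (m + n). F n m x \<oplus>\<^bsub>P m\<^esub> G n m x ~= \<zero>\<^bsub>P m\<^esub>}"
  using F G unfolding cm_iff by (meson finite_UnI finite_subset)
qed

lemma Z_zero_closed: "\<zero>\<^bsub>Z\<^esub> : CM"
 unfolding Z_simps by (rule cmI) (auto intro!: linear_on_const_zero P_module simp: d_zero)

lemma Z_neg_closed:
 assumes F: "F : CM"
 shows "(%n m. \<lambda>x\<in>C (m + n). \<ominus>\<^bsub>P m\<^esub> F n m x) : CM"
proof (rule cmI)
 fix n m
 show "hom_P (m + n) m (%x. \<ominus>\<^bsub>P m\<^esub> F n m x)"
  by (intro linear_on_neg P_module cm_lin F refl)
 fix x assume x: "x : C (Suc m + n)"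
 then show "d m (\<ominus>\<^bsub>P (Suc m)\<^esub> F n (Suc m) x) = \<ominus>\<^bsub>P m\<^esub> F n m (d (m + n) x)"
  using cm_closed[OF F x refl] cm_comm[OF F, of x "m + n"] by (simp add: d_minus)
next
 have "{n. EX m. EX x:C (m + n). \<ominus>\<^bsub>P m\<^esub> F n m x ~= \<zero>\<^bsub>P m\<^esub>} \<subseteq> supp F"
  using supp_zero[of _ F] by fastforce
 then show "finite {n. EX m. EX x:C (m + n). \<ominus>\<^bsub>P m\<^esub> F n m x ~= \<zero>\<^bsub>P m\<^esub>}"
  using F unfolding cm_iff by (meson finite_subset)
qed

lemma Z_group: "abelian_group Z"
proof (rule abelian_groupI, unfold Z_simps(1))
 fix F G assume F: "F : CM" and G: "G : CM"
 show "F \<oplus>\<^bsub>Z\<^esub> G : CM" by (rule Z_add_closed[OF F G])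
 show "F \<oplus>\<^bsub>Z\<^esub> G = G \<oplus>\<^bsub>Z\<^esub> F"
  by (intro cm_eqI Z_add_closed F G) (simp add: Z_add P.M.a_comm cm_closed[OF F] cm_closed[OF G])
 fix H assume H: "H : CM"
 show "F \<oplus>\<^bsub>Z\<^esub> G \<oplus>\<^bsub>Z\<^esub> H = F \<oplus>\<^bsub>Z\<^esub> (G \<oplus>\<^bsub>Z\<^esub> H)"
  by (intro cm_eqI Z_add_closed F G H) (simp add: Z_add P.M.a_assoc cm_closed[OF F] cm_closed[OF G] cm_closed[OF H])
next
 show "\<zero>\<^bsub>Z\<^esub> : CM" by (rule Z_zero_closed)
 fix F assume F: "F : CM"
 show "\<zero>\<^bsub>Z\<^esub> \<oplus>\<^bsub>Z\<^esub> F = F"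
  by (intro cm_eqI Z_add_closed Z_zero_closed F) (simp add: Z_add Z_simps cm_closed[OF F])
 show "EX G:CM. G \<oplus>\<^bsub>Z\<^esub> F = \<zero>\<^bsub>Z\<^esub>"
 proof (rule bexI[OF _ Z_neg_closed[OF F]])
  show "(%n m. \<lambda>x\<in>C (m + n). \<ominus>\<^bsub>P m\<^esub> F n m x) \<oplus>\<^bsub>Z\<^esub> F = \<zero>\<^bsub>Z\<^esub>"
   by (intro cm_eqI Z_add_closed Z_zero_closed Z_neg_closed F)
    (simp add: Z_add Z_simps cm_closed[OF F] P.M.l_neg)
 qed
qed

lemma term_lin:
 assumes F: "F : CM" and G: "G : CM" and i: "i \<le> n"
 shows "hom_P (m + n) m (%x. G (n - i) m (F i (m + (n - i)) x))"
proof -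
 have l: "hom_P (m + n) (m + (n - i)) (F i (m + (n - i)))"
  using i by (intro cm_lin[OF F]) simp
 show ?thesis
  by (rule linear_on_comp[OF l cm_lin[OF G refl]]) (use l in \<open>auto simp: linear_on_def\<close>)
qed

lemma term_closed:
 assumes F: "F : CM" and G: "G : CM" and i: "i \<le> n" and x: "x : C (m + n)"
 shows "F i (m + (n - i)) x : C (m + (n - i))" "G (n - i) m (F i (m + (n - i)) x) : C m"
 using cm_closed[OF F x, of "m + (n - i)" i] i cm_closed[OF G _ refl, of "F i (m + (n - i)) x" m "n - i"] by auto

lemma Z_mult_closed:
 assumes F: "F : CM" and G: "G : CM"
 shows "F \<otimes>\<^bsub>Z\<^esub> G : CM"
 unfolding Z_mult
proof (rule cmI)
 fix n m
 show "hom_P (m + n) m (%x. \<Oplus>\<^bsub>P m\<^esub>i\<in>{..n}. G (n - i) m (F i (m + (n - i)) x))"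
  by (intro linear_on_finsum_maps P_module term_lin F G) simp
 fix x assume x: "x : C (Suc m + n)"
 have "d m (\<Oplus>\<^bsub>P (Suc m)\<^esub>i\<in>{..n}. G (n - i) (Suc m) (F i (Suc m + (n - i)) x)) =
  (\<Oplus>\<^bsub>P m\<^esub>i\<in>{..n}. d m (G (n - i) (Suc m) (F i (Suc m + (n - i)) x)))"
  using term_closed[OF F G _ x] by (intro d_finsum) auto
 also have "... = (\<Oplus>\<^bsub>P m\<^esub>i\<in>{..n}. G (n - i) m (F i (m + (n - i)) (d (m + n) x)))"
 proof (intro P.M.finsum_cong' refl)
  have dx: "d (m + n) x : C (m + n)" using x d_closed by simp
  show "(%i. G (n - i) m (F i (m + (n - i)) (d (m + n) x))) : {..n} \<rightarrow> C m"
   using term_closed[OF F G _ dx] by auto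
  fix i assume "i : {..n}"
  then have i: "i \<le> n" by simp
  have "d m (G (n - i) (Suc m) (F i (Suc m + (n - i)) x)) = G (n - i) m (d (m + (n - i)) (F i (Suc (m + (n - i))) x))"
   using term_closed(1)[OF F G i x] by (subst cm_comm[OF G]) auto
  also have "d (m + (n - i)) (F i (Suc (m + (n - i))) x) = F i (m + (n - i)) (d (m + n) x)"
   using x i by (subst cm_comm[OF F, of _ "m + n"]) auto
  finally show "d m (G (n - i) (Suc m) (F i (Suc m + (n - i)) x)) = G (n - i) m (F i (m + (n - i)) (d (m + n) x))" .
 qed
 finally show "d m (\<Oplus>\<^bsub>P (Suc m)\<^esub>i\<in>{..n}. G (n - i) (Suc m) (F i (Suc m + (n - i)) x)) =
  (\<Oplus>\<^bsub>P m\<^esub>i\<in>{..n}. G (n - i) m (F i (m + (n - i)) (d (m + n) x)))" .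
next
 let ?S = "(\<lambda>(i, j). i + j) ` (supp F \<times> supp G)"
 have fin: "finite ?S" using F G unfolding cm_iff by blast
 have "(\<Oplus>\<^bsub>P m\<^esub>i\<in>{..n}. G (n - i) m (F i (m + (n - i)) x)) = \<zero>\<^bsub>P m\<^esub>" if n: "n \<notin> ?S" and x: "x : C (m + n)" for n m x
 proof (rule P.M.add.finprod_one_eqI)
  fix i assume "i : {..n}"
  then have i: "i \<le> n" by simp
  then have "i \<notin> supp F \<or> n - i \<notin> supp G" using n by force
  then show "G (n - i) m (F i (m + (n - i)) x) = \<zero>\<^bsub>P m\<^esub>"
  proof
   assume "i \<notin> supp F"
   moreover have "x : C (m + (n - i) + i)" using x i by simp
   ultimately have "F i (m + (n - i)) x = \<zero>\<^bsub>P (m + (n - i))\<^esub>" unfolding supp_def by blast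
   then show ?thesis using cm_zero[OF G refl] by simp
  next
   assume "n - i \<notin> supp G"
   then show ?thesis using term_closed(1)[OF F G i x] unfolding supp_def by blast
  qed
 qed
 then have "{n. EX m. EX x:C (m + n). (\<Oplus>\<^bsub>P m\<^esub>i\<in>{..n}. G (n - i) m (F i (m + (n - i)) x)) ~= \<zero>\<^bsub>P m\<^esub>} \<subseteq> ?S" by blast
 then show "finite {n. EX m. EX x:C (m + n). (\<Oplus>\<^bsub>P m\<^esub>i\<in>{..n}. G (n - i) m (F i (m + (n - i)) x)) ~= \<zero>\<^bsub>P m\<^esub>}"
  using fin by (rule finite_subset)
qed

lemma Z_one_closed: "\<one>\<^bsub>Z\<^esub> : CM"
 unfolding Z_simps
proof (rule cmI)
 fix n m
 show "hom_P (m + n) m (%x. if n = 0 then x else \<zero>\<^bsub>P m\<^esub>)"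
  using linear_on_const_zero[OF P_module P_module] by (cases "n = 0") (auto simp: linear_on_def)
 fix x assume "x : C (Suc m + n)"
 then show "d m (if n = 0 then x else \<zero>\<^bsub>P (Suc m)\<^esub>) = (if n = 0 then d (m + n) x else \<zero>\<^bsub>P m\<^esub>)"
  by (auto simp: d_zero)
next
 show "finite {n. EX m. EX x:C (m + n). (if n = 0 then x else \<zero>\<^bsub>P m\<^esub>) ~= \<zero>\<^bsub>P m\<^esub>}"
  by (rule finite_subset[of _ "{0}"]) auto
qed

lemma Z_ring: "ring Z"
proof (rule ringI)
 show "abelian_group Z" by (rule Z_group)
 show "Group.monoid Z"
 proof (rule Group.monoidI, unfold Z_simps(1))
  fix F G assume F: "F : CM" and G: "G : CM"
  show "F \<otimes>\<^bsub>Z\<^esub> G : CM" by (rule Z_mult_closed[OF F G])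
  fix H assume H: "H : CM"
  show "F \<otimes>\<^bsub>Z\<^esub> G \<otimes>\<^bsub>Z\<^esub> H = F \<otimes>\<^bsub>Z\<^esub> (G \<otimes>\<^bsub>Z\<^esub> H)"
  proof (intro cm_eqI Z_mult_closed F G H)
   fix n m x assume x: "x : C (m + n)"
   let ?f = "%j l. H (n - j - l) m (G l (m + (n - j - l)) (F j (m + (n - j)) x))"
   have Fx: "F j (m + (n - j)) x : C (m + (n - j))" if "j \<le> n" for j
    using term_closed(1)[OF F G that x] .
   have fc: "?f j l : C m" if "j + l \<le> n" for j l
    using term_closed(2)[OF G H _ Fx, of l j] that by auto
   have fc': "?f j (i - j) : C m" if "j \<le> i" "i \<le> n" for i j
    by (rule fc) (use that in simp)
   have "(F \<otimes>\<^bsub>Z\<^esub> G \<otimes>\<^bsub>Z\<^esub> H) n m x = (\<Oplus>\<^bsub>P m\<^esub>i\<in>{..n}. H (n - i) m ((F \<otimes>\<^bsub>Z\<^esub> G) i (m + (n - i)) x))"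
    using x by (simp add: Z_mult[of "F \<otimes>\<^bsub>Z\<^esub> G"])
   also have "... = (\<Oplus>\<^bsub>P m\<^esub>i\<in>{..n}. \<Oplus>\<^bsub>P m\<^esub>j\<in>{..i}. ?f j (i - j))"
   proof (intro P.M.finsum_cong' refl)
    show "(%i. \<Oplus>\<^bsub>P m\<^esub>j\<in>{..i}. ?f j (i - j)) : {..n} \<rightarrow> C m"
     by (intro Pi_I P.M.finsum_closed, rule fc') auto
    fix i assume "i : {..n}"
    then have i: "i \<le> n" by simp
    have xi: "x : C (m + (n - i) + i)" using x i by simp
    have "(F \<otimes>\<^bsub>Z\<^esub> G) i (m + (n - i)) x = (\<Oplus>\<^bsub>P (m + (n - i))\<^esub>j\<in>{..i}. G (i - j) (m + (n - i)) (F j (m + (n - i) + (i - j)) x))"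
     using xi by (simp add: Z_mult)
    then have "H (n - i) m ((F \<otimes>\<^bsub>Z\<^esub> G) i (m + (n - i)) x) =
     (\<Oplus>\<^bsub>P m\<^esub>j\<in>{..i}. H (n - i) m (G (i - j) (m + (n - i)) (F j (m + (n - i) + (i - j)) x)))"
     using term_closed(2)[OF F G _ xi] by (simp add: cm_finsum[OF H _ refl])
    also have "... = (\<Oplus>\<^bsub>P m\<^esub>j\<in>{..i}. ?f j (i - j))"
    proof (intro P.M.finsum_cong' refl)
     show "(%j. ?f j (i - j)) : {..i} \<rightarrow> C m" by (intro Pi_I, rule fc') (use i in auto)
     fix j assume "j : {..i}"
     then have e: "m + (n - i) + (i - j) = m + (n - j)" "n - j - (i - j) = n - i" using i by auto
     show "H (n - i) m (G (i - j) (m + (n - i)) (F j (m + (n - i) + (i - j)) x)) = ?f j (i - j)"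
      by (simp only: e)
    qed
    finally show "H (n - i) m ((F \<otimes>\<^bsub>Z\<^esub> G) i (m + (n - i)) x) = (\<Oplus>\<^bsub>P m\<^esub>j\<in>{..i}. ?f j (i - j))" .
   qed
   also have "... = (\<Oplus>\<^bsub>P m\<^esub>j\<in>{..n}. \<Oplus>\<^bsub>P m\<^esub>l\<in>{..n - j}. ?f j l)"
    using fc by (rule P.M.finsum_triangle)
   also have "... = (\<Oplus>\<^bsub>P m\<^esub>j\<in>{..n}. (G \<otimes>\<^bsub>Z\<^esub> H) (n - j) m (F j (m + (n - j)) x))"
    using Fx cm_closed[OF Z_mult_closed[OF G H] Fx refl] by (intro P.M.finsum_cong' refl) (auto simp: Z_mult)
   also have "... = (F \<otimes>\<^bsub>Z\<^esub> (G \<otimes>\<^bsub>Z\<^esub> H)) n m x"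
    using x by (simp add: Z_mult[of F])
   finally show "(F \<otimes>\<^bsub>Z\<^esub> G \<otimes>\<^bsub>Z\<^esub> H) n m x = (F \<otimes>\<^bsub>Z\<^esub> (G \<otimes>\<^bsub>Z\<^esub> H)) n m x" .
  qed
 next
  show "\<one>\<^bsub>Z\<^esub> : CM" by (rule Z_one_closed)
  fix F assume F: "F : CM"
  show "\<one>\<^bsub>Z\<^esub> \<otimes>\<^bsub>Z\<^esub> F = F"
  proof (intro cm_eqI Z_mult_closed Z_one_closed F)
   fix n m x assume x: "x : C (m + n)"
   have xi: "x : C (m + (n - i) + i)" if "i \<le> n" for i using x that by simp
   have "(\<one>\<^bsub>Z\<^esub> \<otimes>\<^bsub>Z\<^esub> F) n m x = (\<Oplus>\<^bsub>P m\<^esub>i\<in>{..n}. F (n - i) m (\<one>\<^bsub>Z\<^esub> i (m + (n - i)) x))"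
    using x by (simp add: Z_mult)
   also have "... = F n m x"
    using x xi cm_closed[OF F x refl]
    by (subst P.M.finsum_single[of _ 0]) (auto simp: Z_simps cm_zero[OF F])
   finally show "(\<one>\<^bsub>Z\<^esub> \<otimes>\<^bsub>Z\<^esub> F) n m x = F n m x" .
  qed
  show "F \<otimes>\<^bsub>Z\<^esub> \<one>\<^bsub>Z\<^esub> = F"
  proof (intro cm_eqI Z_mult_closed Z_one_closed F)
   fix n m x assume x: "x : C (m + n)"
   have "(F \<otimes>\<^bsub>Z\<^esub> \<one>\<^bsub>Z\<^esub>) n m x = (\<Oplus>\<^bsub>P m\<^esub>i\<in>{..n}. \<one>\<^bsub>Z\<^esub> (n - i) m (F i (m + (n - i)) x))"
    using x by (simp add: Z_mult)
   also have "... = F n m x"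
    using cm_closed[OF F x refl] term_closed(1)[OF F F _ x]
    by (subst P.M.finsum_single[of _ n]) (auto simp: Z_simps)
   finally show "(F \<otimes>\<^bsub>Z\<^esub> \<one>\<^bsub>Z\<^esub>) n m x = F n m x" .
  qed
 qed
next
 fix F G H assume "F : carrier Z" "G : carrier Z" "H : carrier Z"
 then have F: "F : CM" and G: "G : CM" and H: "H : CM" by (simp_all add: Z_simps)
 show "(F \<oplus>\<^bsub>Z\<^esub> G) \<otimes>\<^bsub>Z\<^esub> H = F \<otimes>\<^bsub>Z\<^esub> H \<oplus>\<^bsub>Z\<^esub> G \<otimes>\<^bsub>Z\<^esub> H"
 proof (intro cm_eqI Z_mult_closed Z_add_closed F G H)
  fix n m x assume x: "x : C (m + n)"
  have xi: "x : C (m + (n - i) + i)" if "i \<le> n" for i using x that by simp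
  have "((F \<oplus>\<^bsub>Z\<^esub> G) \<otimes>\<^bsub>Z\<^esub> H) n m x = (\<Oplus>\<^bsub>P m\<^esub>i\<in>{..n}. H (n - i) m ((F \<oplus>\<^bsub>Z\<^esub> G) i (m + (n - i)) x))"
   using x by (simp add: Z_mult)
  also have "... = (\<Oplus>\<^bsub>P m\<^esub>i\<in>{..n}. H (n - i) m (F i (m + (n - i)) x) \<oplus>\<^bsub>P m\<^esub> H (n - i) m (G i (m + (n - i)) x))"
   using xi term_closed[OF F H _ x] term_closed[OF G H _ x]
   by (intro P.M.finsum_cong' refl) (auto simp: Z_add cm_add[OF H])
  also have "... = (\<Oplus>\<^bsub>P m\<^esub>i\<in>{..n}. H (n - i) m (F i (m + (n - i)) x)) \<oplus>\<^bsub>P m\<^esub> (\<Oplus>\<^bsub>P m\<^esub>i\<in>{..n}. H (n - i) m (G i (m + (n - i)) x))"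
   using term_closed[OF F H _ x] term_closed[OF G H _ x] by (intro P.M.finsum_addf) auto
  also have "... = (F \<otimes>\<^bsub>Z\<^esub> H \<oplus>\<^bsub>Z\<^esub> G \<otimes>\<^bsub>Z\<^esub> H) n m x" using x by (simp add: Z_mult Z_add)
  finally show "((F \<oplus>\<^bsub>Z\<^esub> G) \<otimes>\<^bsub>Z\<^esub> H) n m x = (F \<otimes>\<^bsub>Z\<^esub> H \<oplus>\<^bsub>Z\<^esub> G \<otimes>\<^bsub>Z\<^esub> H) n m x" .
 qed
 show "H \<otimes>\<^bsub>Z\<^esub> (F \<oplus>\<^bsub>Z\<^esub> G) = H \<otimes>\<^bsub>Z\<^esub> F \<oplus>\<^bsub>Z\<^esub> H \<otimes>\<^bsub>Z\<^esub> G"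
 proof (intro cm_eqI Z_mult_closed Z_add_closed F G H)
  fix n m x assume x: "x : C (m + n)"
  have "(H \<otimes>\<^bsub>Z\<^esub> (F \<oplus>\<^bsub>Z\<^esub> G)) n m x = (\<Oplus>\<^bsub>P m\<^esub>i\<in>{..n}. (F \<oplus>\<^bsub>Z\<^esub> G) (n - i) m (H i (m + (n - i)) x))"
   using x by (simp add: Z_mult)
  also have "... = (\<Oplus>\<^bsub>P m\<^esub>i\<in>{..n}. F (n - i) m (H i (m + (n - i)) x) \<oplus>\<^bsub>P m\<^esub> G (n - i) m (H i (m + (n - i)) x))"
   using term_closed[OF H F _ x] term_closed[OF H G _ x]
   by (intro P.M.finsum_cong' refl) (auto simp: Z_add)
  also have "... = (\<Oplus>\<^bsub>P m\<^esub>i\<in>{..n}. F (n - i) m (H i (m + (n - i)) x)) \<oplus>\<^bsub>P m\<^esub> (\<Oplus>\<^bsub>P m\<^esub>i\<in>{..n}. G (n - i) m (H i (m + (n - i)) x))"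
   using term_closed[OF H F _ x] term_closed[OF H G _ x] by (intro P.M.finsum_addf) auto
  also have "... = (H \<otimes>\<^bsub>Z\<^esub> F \<oplus>\<^bsub>Z\<^esub> H \<otimes>\<^bsub>Z\<^esub> G) n m x" using x by (simp add: Z_mult Z_add)
  finally show "(H \<otimes>\<^bsub>Z\<^esub> (F \<oplus>\<^bsub>Z\<^esub> G)) n m x = (H \<otimes>\<^bsub>Z\<^esub> F \<oplus>\<^bsub>Z\<^esub> H \<otimes>\<^bsub>Z\<^esub> G) n m x" .
 qed
qed

end

section \<open>The ideal of null-homotopic chain maps\<close>

context chain_complex
begin

definition homotopy :: "(nat => nat => 'p => 'p) => (nat => nat => 'p => 'p) => bool" where
 "homotopy F h \<equiv> (ALL n p. n \<le> p + 1 --> hom_P p (p + 1 - n) (h n p)) \<and>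
  (ALL n m. ALL x:C (m + n). F n m x =
      d m (h n (m + n) x) \<oplus>\<^bsub>P m\<^esub>
      (if m + n = 0 then \<zero>\<^bsub>P m\<^esub> else h n (m + n - 1) (d (m + n - 1) x)))"

lemma B_iff: "F : B \<longleftrightarrow> F : CM & (EX h. homotopy F h)"
 unfolding null_homotopic_def homotopy_def linear_maps_iff by simp

lemma homotopy_lin: "[|homotopy F h; p + 1 = q + n|] ==> hom_P p q (h n p)"
proof -
 assume h: "homotopy F h" and e: "p + 1 = q + n"
 have "p + 1 - n = q" "n \<le> p + 1" using e by auto
 then show ?thesis using h unfolding homotopy_def by metis
qed

lemma homotopy_eq:
 assumes "homotopy F h" "x : C q" "q = m + n"
 shows "F n m x = d m (h n q x) \<oplus>\<^bsub>P m\<^esub> (past q m (h n (q - 1) (d (q - 1) x)))"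
 using assms unfolding homotopy_def by simp

lemma homotopy_closed: "[|homotopy F h; x : C p; p + 1 = q + n|] ==> h n p x : C q"
 using homotopy_lin[of F h p q n] by (auto simp: linear_on_def)

lemma homotopyI:
 assumes "!!n p q. p + 1 = q + n ==> hom_P p q (h n p)"
  "!!n m q x. [|x : C q; q = m + n|] ==>
   F n m x = d m (h n q x) \<oplus>\<^bsub>P m\<^esub> (past q m (h n (q - 1) (d (q - 1) x)))"
 shows "homotopy F h"
 using assms unfolding homotopy_def by simp

lemma d_pred: "[|x : C q; q ~= 0|] ==> d (q - 1) x : C (q - 1)"
 using d_closed[of x "q - 1"] by simp

lemma homotopy_snd_closed:
 assumes "homotopy F h" "x : C q" "q = m + n"
 shows "(past q m (h n (q - 1) (d (q - 1) x))) : C m"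
 using homotopy_closed[OF assms(1) d_pred[OF assms(2)], of m n] assms(3) by auto

lemma B_add:
 assumes "F : B" "G : B" shows "F \<oplus>\<^bsub>Z\<^esub> G : B"
proof -
 obtain h k where F: "F : CM" "homotopy F h" and G: "G : CM" "homotopy G k"
  using assms unfolding B_iff by blast
 have "homotopy (F \<oplus>\<^bsub>Z\<^esub> G) (%n p x. h n p x \<oplus>\<^bsub>P (p + 1 - n)\<^esub> k n p x)"
 proof (rule homotopyI)
  fix n p q :: nat assume e: "p + 1 = q + n"
  then have "p + 1 - n = q" by simp
  then show "hom_P p q (%x. h n p x \<oplus>\<^bsub>P (p + 1 - n)\<^esub> k n p x)"
   using linear_on_add[OF P_module P_module homotopy_lin[OF F(2) e] homotopy_lin[OF G(2) e]] by simp
 next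
  fix n m q x assume x: "x : C q" "q = m + n"
  have e: "q + 1 - n = Suc m" "q ~= 0 ==> q - 1 + 1 - n = m" using x(2) by auto
  have c: "h n q x : C (Suc m)" "k n q x : C (Suc m)"
   using homotopy_closed[OF F(2) x(1), of "Suc m" n] homotopy_closed[OF G(2) x(1), of "Suc m" n] x(2) by auto
  note s = homotopy_snd_closed[OF F(2) x] homotopy_snd_closed[OF G(2) x]
  have "(F \<oplus>\<^bsub>Z\<^esub> G) n m x = F n m x \<oplus>\<^bsub>P m\<^esub> G n m x" using x by (simp add: Z_add)
  also have "... = d m (h n q x \<oplus>\<^bsub>P (q + 1 - n)\<^esub> k n q x) \<oplus>\<^bsub>P m\<^esub>
    (past q m (h n (q - 1) (d (q - 1) x) \<oplus>\<^bsub>P (q - 1 + 1 - n)\<^esub> k n (q - 1) (d (q - 1) x)))"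
   unfolding homotopy_eq[OF F(2) x] homotopy_eq[OF G(2) x]
   using c s e d_closed[OF c(1)] d_closed[OF c(2)] by (auto simp: d_add P.M.a_ac)
  finally show "(F \<oplus>\<^bsub>Z\<^esub> G) n m x = d m (h n q x \<oplus>\<^bsub>P (q + 1 - n)\<^esub> k n q x) \<oplus>\<^bsub>P m\<^esub>
    (past q m (h n (q - 1) (d (q - 1) x) \<oplus>\<^bsub>P (q - 1 + 1 - n)\<^esub> k n (q - 1) (d (q - 1) x)))" .
 qed
 then show ?thesis using Z_add_closed[OF F(1) G(1)] unfolding B_iff by blast
qed

lemma B_zero: "\<zero>\<^bsub>Z\<^esub> : B"
proof -
 have "homotopy \<zero>\<^bsub>Z\<^esub> (%n p x. \<zero>\<^bsub>P (p + 1 - n)\<^esub>)"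
 proof (rule homotopyI)
  fix n p q :: nat assume "p + 1 = q + n"
  then have "p + 1 - n = q" by simp
  then show "hom_P p q (%x. \<zero>\<^bsub>P (p + 1 - n)\<^esub>)"
   using linear_on_const_zero[OF P_module P_module] by simp
 qed (auto simp: Z_simps d_zero)
 then show ?thesis using Z_zero_closed unfolding B_iff by blast
qed

text \<open>If \<open>h\<close> is a homotopy for \<open>F\<close>, then composing \<open>h\<close> with the chain map \<open>G\<close> gives one for the product; likewise
on the other side, where \<open>G\<close> comes first.\<close>

lemma B_mult_r:
 assumes "F : B" and G: "G : CM" shows "F \<otimes>\<^bsub>Z\<^esub> G : B"
proof -
 obtain h where F: "F : CM" and h: "homotopy F h" using assms unfolding B_iff by blast
 define h' where "h' n p x = (\<Oplus>\<^bsub>P (p + 1 - n)\<^esub>i\<in>{..n}. G (n - i) (p + 1 - n) (h i p x))" for n p x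
 have tl: "hom_P p q (%x. G (n - i) q (h i p x))" if "p + 1 = q + n" "i \<le> n" for n p q i
 proof -
  have l: "hom_P p (q + (n - i)) (h i p)"
   using that by (intro homotopy_lin[OF h]) simp
  show ?thesis by (rule linear_on_comp[OF l cm_lin[OF G refl]]) (use l in \<open>auto simp: linear_on_def\<close>)
 qed
 have tc: "G (n - i) q (h i p x) : C q" if "p + 1 = q + n" "i \<le> n" "x : C p" for n p q i x
  using tl[OF that(1,2)] that(3) by (auto simp: linear_on_def)
 have "homotopy (F \<otimes>\<^bsub>Z\<^esub> G) h'"
 proof (rule homotopyI)
  fix n p q :: nat assume e: "p + 1 = q + n"
  then have q: "p + 1 - n = q" by simp
  show "hom_P p q (h' n p)"
   unfolding h'_def q using tl[OF e] by (intro linear_on_finsum_maps P_module) simp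
 next
  fix n m q x assume x: "x : C q" "q = m + n"
  have "(F \<otimes>\<^bsub>Z\<^esub> G) n m x = (\<Oplus>\<^bsub>P m\<^esub>i\<in>{..n}. G (n - i) m (F i (m + (n - i)) x))" using x by (simp add: Z_mult)
  also have "... = (\<Oplus>\<^bsub>P m\<^esub>i\<in>{..n}. d m (G (n - i) (Suc m) (h i q x)) \<oplus>\<^bsub>P m\<^esub>
    (past q m (G (n - i) m (h i (q - 1) (d (q - 1) x)))))"
  proof (intro P.M.finsum_cong' refl)
   show "(%i. d m (G (n - i) (Suc m) (h i q x)) \<oplus>\<^bsub>P m\<^esub>
    (past q m (G (n - i) m (h i (q - 1) (d (q - 1) x))))) : {..n} \<rightarrow> C m"
    using tc[of q "Suc m" n _ x] tc[of "q - 1" m n _ "d (q - 1) x"] x d_pred[OF x(1)] d_closed by auto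
   fix i assume "i : {..n}"
   then have i: "i \<le> n" by simp
   have hc: "h i q x : carrier (P (Suc (m + (n - i))))" using homotopy_closed[OF h x(1)] x(2) i by auto
   have "F i (m + (n - i)) x = d (m + (n - i)) (h i q x) \<oplus>\<^bsub>P (m + (n - i))\<^esub>
    (past q (m + (n - i)) (h i (q - 1) (d (q - 1) x)))"
    using x i by (intro homotopy_eq[OF h]) auto
   moreover have "(past q (m + (n - i)) (h i (q - 1) (d (q - 1) x))) : C (m + (n - i))"
    using x i by (intro homotopy_snd_closed[OF h]) auto
   ultimately have "G (n - i) m (F i (m + (n - i)) x) = G (n - i) m (d (m + (n - i)) (h i q x)) \<oplus>\<^bsub>P m\<^esub>
    G (n - i) m (past q (m + (n - i)) (h i (q - 1) (d (q - 1) x)))"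
    using d_closed[OF hc] by (simp add: cm_add[OF G _ _ refl])
   also have "G (n - i) m (d (m + (n - i)) (h i q x)) = d m (G (n - i) (Suc m) (h i q x))"
    using hc by (intro cm_comm[OF G, symmetric]) auto
   also have "G (n - i) m (past q (m + (n - i)) (h i (q - 1) (d (q - 1) x))) =
    (past q m (G (n - i) m (h i (q - 1) (d (q - 1) x))))"
    by (simp add: cm_zero[OF G refl])
   finally show "G (n - i) m (F i (m + (n - i)) x) = d m (G (n - i) (Suc m) (h i q x)) \<oplus>\<^bsub>P m\<^esub>
    (past q m (G (n - i) m (h i (q - 1) (d (q - 1) x))))" .
  qed
  also have "... = (\<Oplus>\<^bsub>P m\<^esub>i\<in>{..n}. d m (G (n - i) (Suc m) (h i q x))) \<oplus>\<^bsub>P m\<^esub>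
    (\<Oplus>\<^bsub>P m\<^esub>i\<in>{..n}. if q = 0 then \<zero>\<^bsub>P m\<^esub> else G (n - i) m (h i (q - 1) (d (q - 1) x)))"
   using tc[of q "Suc m" n _ x] tc[of "q - 1" m n _ "d (q - 1) x"] x d_pred[OF x(1)] d_closed
   by (intro P.M.finsum_addf) auto
  also have "(\<Oplus>\<^bsub>P m\<^esub>i\<in>{..n}. d m (G (n - i) (Suc m) (h i q x))) = d m (h' n q x)"
  proof -
   have "q + 1 - n = Suc m" using x(2) by simp
   then show ?thesis unfolding h'_def using tc[of q "Suc m" n _ x] x by (subst d_finsum[symmetric]) auto
  qed
  also have "(\<Oplus>\<^bsub>P m\<^esub>i\<in>{..n}. if q = 0 then \<zero>\<^bsub>P m\<^esub> else G (n - i) m (h i (q - 1) (d (q - 1) x))) =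
   (past q m (h' n (q - 1) (d (q - 1) x)))"
  proof (cases "q = 0")
   case False
   then have "q - 1 + 1 - n = m" using x(2) by simp
   then show ?thesis using False by (simp add: h'_def)
  qed (simp add: P.M.finsum_zero)
  finally show "(F \<otimes>\<^bsub>Z\<^esub> G) n m x = d m (h' n q x) \<oplus>\<^bsub>P m\<^esub> (past q m (h' n (q - 1) (d (q - 1) x)))" .
 qed
 then show ?thesis using Z_mult_closed[OF F G] unfolding B_iff by blast
qed

lemma B_mult_l:
 assumes "F : B" and G: "G : CM" shows "G \<otimes>\<^bsub>Z\<^esub> F : B"
proof -
 obtain h where F: "F : CM" and h: "homotopy F h" using assms unfolding B_iff by blast
 define t where "t n p q i x = (if i \<le> p then h (n - i) (p - i) (G i (p - i) x) else \<zero>\<^bsub>P q\<^esub>)" for n p q i x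
 define h' where "h' n p x = (\<Oplus>\<^bsub>P (p + 1 - n)\<^esub>i\<in>{..n}. t n p (p + 1 - n) i x)" for n p x
 have tl: "hom_P p q (t n p q i)" if "p + 1 = q + n" "i \<le> n" for n p q i
 proof (cases "i \<le> p")
  case True
  have l: "hom_P p (p - i) (G i (p - i))" using True by (intro cm_lin[OF G]) simp
  have l': "hom_P (p - i) q (h (n - i) (p - i))"
   using that True by (intro homotopy_lin[OF h]) simp
  show ?thesis unfolding t_def using True linear_on_comp[OF l l'] l by (auto simp: linear_on_def[of _ _ _ _ "G i (p - i)"])
 next
  case False
  then show ?thesis unfolding t_def using linear_on_const_zero[OF P_module P_module] by simp
 qed
 have tc: "t n p q i x : C q" if "p + 1 = q + n" "i \<le> n" "x : C p" for n p q i x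
  using tl[OF that(1,2)] that(3) by (auto simp: linear_on_def)
 have "homotopy (G \<otimes>\<^bsub>Z\<^esub> F) h'"
 proof (rule homotopyI)
  fix n p q :: nat assume e: "p + 1 = q + n"
  then have q: "p + 1 - n = q" by simp
  show "hom_P p q (h' n p)"
   unfolding h'_def q using tl[OF e] by (intro linear_on_finsum_maps P_module) simp
 next
  fix n m q x assume x: "x : C q" "q = m + n"
  have "(G \<otimes>\<^bsub>Z\<^esub> F) n m x = (\<Oplus>\<^bsub>P m\<^esub>i\<in>{..n}. F (n - i) m (G i (m + (n - i)) x))" using x by (simp add: Z_mult)
  also have "... = (\<Oplus>\<^bsub>P m\<^esub>i\<in>{..n}. d m (t n q (Suc m) i x) \<oplus>\<^bsub>P m\<^esub>
    (past q m (t n (q - 1) m i (d (q - 1) x))))"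
  proof (intro P.M.finsum_cong' refl)
   show "(%i. d m (t n q (Suc m) i x) \<oplus>\<^bsub>P m\<^esub>
    (past q m (t n (q - 1) m i (d (q - 1) x)))) : {..n} \<rightarrow> C m"
    using tc[of q "Suc m" n _ x] tc[of "q - 1" m n _ "d (q - 1) x"] x d_pred[OF x(1)] d_closed by auto
   fix i assume "i : {..n}"
   then have i: "i \<le> n" by simp
   define y where "y = G i (q - i) x"
   have q: "q - i = m + (n - i)" "i \<le> q" using x(2) i by auto
   have y: "y : C (q - i)" using cm_closed[OF G x(1)] q unfolding y_def by auto
   have "F (n - i) m (G i (m + (n - i)) x) = d m (h (n - i) (q - i) y) \<oplus>\<^bsub>P m\<^esub>
    (past (q - i) m (h (n - i) (q - i - 1) (d (q - i - 1) y)))"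
    using homotopy_eq[OF h y q(1)] by (simp only: y_def q(1))
   also have "d m (h (n - i) (q - i) y) = d m (t n q (Suc m) i x)" using q(2) by (simp add: t_def y_def)
   also have "(past (q - i) m (h (n - i) (q - i - 1) (d (q - i - 1) y))) =
    (past q m (t n (q - 1) m i (d (q - 1) x)))"
   proof (cases "q - i = 0")
    case True
    then show ?thesis using q by (auto simp: t_def)
   next
    case False
    then have xs: "x : C (Suc (q - 1))" using x(1) by simp
    have e: "Suc (q - i - 1) = q - i" "q - 1 = q - i - 1 + i" using False by auto
    have "d (q - i - 1) y = G i (q - i - 1) (d (q - 1) x)"
     using cm_comm[OF G xs e(2)] unfolding y_def e(1) .
    then show ?thesis using False by (auto simp: t_def)
   qed
   finally show "F (n - i) m (G i (m + (n - i)) x) = d m (t n q (Suc m) i x) \<oplus>\<^bsub>P m\<^esub>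
    (past q m (t n (q - 1) m i (d (q - 1) x)))" .
  qed
  also have "... = (\<Oplus>\<^bsub>P m\<^esub>i\<in>{..n}. d m (t n q (Suc m) i x)) \<oplus>\<^bsub>P m\<^esub>
    (\<Oplus>\<^bsub>P m\<^esub>i\<in>{..n}. if q = 0 then \<zero>\<^bsub>P m\<^esub> else t n (q - 1) m i (d (q - 1) x))"
   using tc[of q "Suc m" n _ x] tc[of "q - 1" m n _ "d (q - 1) x"] x d_pred[OF x(1)] d_closed
   by (intro P.M.finsum_addf) auto
  also have "(\<Oplus>\<^bsub>P m\<^esub>i\<in>{..n}. d m (t n q (Suc m) i x)) = d m (h' n q x)"
  proof -
   have "q + 1 - n = Suc m" using x(2) by simp
   then show ?thesis unfolding h'_def using tc[of q "Suc m" n _ x] x by (subst d_finsum[symmetric]) auto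
  qed
  also have "(\<Oplus>\<^bsub>P m\<^esub>i\<in>{..n}. if q = 0 then \<zero>\<^bsub>P m\<^esub> else t n (q - 1) m i (d (q - 1) x)) =
   (past q m (h' n (q - 1) (d (q - 1) x)))"
  proof (cases "q = 0")
   case False
   then have "q - 1 + 1 - n = m" using x(2) by simp
   then show ?thesis using False by (simp add: h'_def)
  qed (simp add: P.M.finsum_zero)
  finally show "(G \<otimes>\<^bsub>Z\<^esub> F) n m x = d m (h' n q x) \<oplus>\<^bsub>P m\<^esub> (past q m (h' n (q - 1) (d (q - 1) x)))" .
 qed
 then show ?thesis using Z_mult_closed[OF G F] unfolding B_iff by blast
qed

lemma B_ideal: "ideal B Z"
proof (rule idealI[OF Z_ring])
 interpret Z: ring Z by (rule Z_ring)
 show "subgroup B (add_monoid Z)"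
 proof (rule subgroup_addI[OF Z_group])
  show "B \<subseteq> carrier Z" unfolding Z_simps by (auto simp: B_iff)
  fix F assume F: "F : B"
  then have "F : carrier Z" unfolding Z_simps by (simp add: B_iff)
  then have "\<ominus>\<^bsub>Z\<^esub> F = F \<otimes>\<^bsub>Z\<^esub> (\<ominus>\<^bsub>Z\<^esub> \<one>\<^bsub>Z\<^esub>)" using Z.r_minus[of F "\<one>\<^bsub>Z\<^esub>"] by simp
  moreover have "\<ominus>\<^bsub>Z\<^esub> \<one>\<^bsub>Z\<^esub> : CM" using Z.a_inv_closed[OF Z.one_closed] unfolding Z_simps(1) .
  ultimately show "\<ominus>\<^bsub>Z\<^esub> F : B" using B_mult_r[OF F] by simp
 qed (auto intro: B_add B_zero)
qed (auto simp: Z_simps intro: B_mult_l B_mult_r)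

abbreviation ecls where "ecls F \<equiv> B +>\<^bsub>Z\<^esub> F"
abbreviation E where "E \<equiv> ext_algebra A P d"

lemma E_simps:
 "carrier E = ecls ` CM" "zero E = ecls \<zero>\<^bsub>Z\<^esub>" "one E = ecls \<one>\<^bsub>Z\<^esub>"
 "[|F : CM; G : CM|] ==> ecls F \<oplus>\<^bsub>E\<^esub> ecls G = ecls (F \<oplus>\<^bsub>Z\<^esub> G)"
 "[|F : CM; G : CM|] ==> ecls F \<otimes>\<^bsub>E\<^esub> ecls G = ecls (F \<otimes>\<^bsub>Z\<^esub> G)"
 "component E n = {ecls F | F. F : CM & (ALL n'. n' ~= n --> F n' = \<zero>\<^bsub>Z\<^esub> n')}"
proof -
 interpret I: ideal B Z by (rule B_ideal)
 show "carrier E = ecls ` CM"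
  unfolding Z_simps(1)[symmetric]
  by (auto simp: ext_algebra_def Let_def FactRing_def A_RCOSETS_def RCOSETS_def a_r_coset_def)
 show "zero E = ecls \<zero>\<^bsub>Z\<^esub>" using I.a_rcos_zero[OF B_ideal B_zero] by (simp add: ext_algebra_def Let_def FactRing_def)
 show "one E = ecls \<one>\<^bsub>Z\<^esub>" by (simp add: ext_algebra_def Let_def FactRing_def)
 show "component E n = {ecls F | F. F : CM & (ALL n'. n' ~= n --> F n' = \<zero>\<^bsub>Z\<^esub> n')}"
  by (simp add: ext_algebra_def Let_def Z_simps(1))
 assume "F : CM" "G : CM"
 then have "F : carrier Z" "G : carrier Z" by (simp_all add: Z_simps)
 then show "ecls F \<oplus>\<^bsub>E\<^esub> ecls G = ecls (F \<oplus>\<^bsub>Z\<^esub> G)" "ecls F \<otimes>\<^bsub>E\<^esub> ecls G = ecls (F \<otimes>\<^bsub>Z\<^esub> G)"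
  by (simp_all add: ext_algebra_def Let_def FactRing_def I.a_rcos_sum I.rcoset_mult_add)
qed

lemma E_ring: "ring E"
proof -
 interpret I: ideal B Z by (rule B_ideal)
 interpret Q: ring "Z Quot B" by (rule I.quotient_is_ring)
 have s: "carrier E = carrier (Z Quot B)" "add E = add (Z Quot B)" "zero E = zero (Z Quot B)"
  "mult E = mult (Z Quot B)" "one E = one (Z Quot B)"
  by (simp_all add: ext_algebra_def Let_def)
 have "abelian_group E" by (rule abelian_group_struct[OF Q.abelian_group_axioms]) (simp_all add: s)
 then show ?thesis
  by (rule ringI) (auto intro!: Group.monoidI simp: s Q.m_assoc Q.l_distr Q.r_distr)
qed

lemma ecls_eq_iff:
 assumes "F : CM" "G : CM"
 shows "ecls F = ecls G \<longleftrightarrow> F \<ominus>\<^bsub>Z\<^esub> G : B"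
proof -
 interpret Z: ring Z by (rule Z_ring)
 show ?thesis using Z.quotient_eq_iff_same_a_r_cos[OF B_ideal] assms by (simp add: Z_simps)
qed

end

section \<open>Lifting along a linear minimal resolution\<close>

lemma linear_eq_on_basis:
 assumes M: "left_module R M" and N: "left_module R N" and f: "linear_on R M N (carrier M) f" and g: "linear_on R M N (carrier M) g"
  and b: "basis_of R M (carrier M) d x" and eq: "!!i. i < d ==> f (x i) = g (x i)" and z: "z : carrier M"
 shows "f z = g z"
proof -
 interpret M: left_module R M by fact
 interpret N: left_module R N by fact
 note c = M.coord_props[OF b z]
 have x: "x : tup d (carrier M)" using b by (simp add: basis_of_def)
 have "f z = lc N d (coord R M d x z) (%i. f (x i))"
  using linear_on_lc[OF M N M.carrier_submodule f c(1) x] c(2) by simp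
 also have "... = lc N d (coord R M d x z) (%i. g (x i))"
  using x f g eq c(1) by (intro N.lc_cong) (auto simp: linear_on_def Pi_iff)
 also have "... = g z" using linear_on_lc[OF M N M.carrier_submodule g c(1) x] c(2) by simp
 finally show ?thesis .
qed

text \<open>The minimal resolution of the trivial module over a Koszul algebra, in coordinates: the \<open>n\<close>-th term is free on
\<open>D n\<close> elements of degree \<open>n\<close>. Exactness at the zeroth term is expressed by the constant coefficient, since the
augmentation sends \<open>x 0 0\<close> to the class of \<open>1\<close>.\<close>

locale koszul_resolution = connected k \<iota> A
 for k :: "('k, 'y) ring_scheme" and \<iota> :: "'k => 'a" and A :: "'a graded_ring" (structure) +
 fixes P :: "nat => ('a, 'p) graded_module" and d :: "nat => 'p => 'p"
  and D :: "nat => nat" and x :: "nat => nat => 'p"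
 assumes central: "[|c : carrier k; a : carrier A|] ==> \<iota> c \<otimes> a = a \<otimes> \<iota> c"
  and P_graded: "grmod A (P n)"
  and d_hom: "d n : graded_hom A (P (Suc n)) (P n)"
  and basis: "basis_of A (P n) (carrier (P n)) (D n) (x n)"
  and x_deg: "x n : {..<D n} \<rightarrow> deg (P n) (int n)"
  and D0: "D 0 = 1"
  and exact_0: "z : carrier (P 0) ==>
   (EX y:carrier (P (Suc 0)). d 0 y = z) \<longleftrightarrow> rcomp A (coord A (P 0) (D 0) (x 0) z 0) 0 = \<zero>"
  and exact_Suc: "z : carrier (P (Suc n)) ==>
   (EX y:carrier (P (Suc (Suc n))). d (Suc n) y = z) \<longleftrightarrow> d n z = \<zero>\<^bsub>P n\<^esub>"
begin

sublocale chain_complex A P d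
proof (rule chain_complex.intro)
 fix n
 show "left_module A (P n)" by (rule graded_left_module.axioms(2)[OF P_graded])
 show "linear_on A (P (Suc n)) (P n) (carrier (P (Suc n))) (d n)" by (rule graded_hom_linear[OF d_hom])
qed

sublocale PG: graded_left_module A "P n" for n by (rule P_graded)

lemma x_closed: "i < D n ==> x n i : C n"
 using x_deg PG.MG.C_closed by blast

lemma x_Pi: "x n : {..<D n} \<rightarrow> C n"
 using x_closed by blast

abbreviation co :: "nat => 'p => nat => 'a" where "co n \<equiv> coord A (P n) (D n) (x n)"

lemma co_props: "z : C n ==> co n z : tup (D n) (carrier A)" "z : C n ==> lc (P n) (D n) (co n z) (x n) = z"
 using P.coord_props[OF basis] by auto

lemma co_closed: "[|z : C n; i < D n|] ==> co n z i : carrier A"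
 using co_props(1) by blast

lemma co_linear: "i < D n ==> linear_on A (P n) (reg A) (C n) (%z. co n z i)"
 unfolding linear_on_def using co_closed P.coord_add[OF basis P.carrier_submodule] P.coord_smult[OF basis P.carrier_submodule]
 by auto

lemma co_homog: "[|z : deg (P n) m; i < D n|] ==> co n z i : zcomponent A (m - int n)"
 by (rule PG.coord_homog[OF basis x_deg])

lemma co_x: "[|i < D n; j < D n|] ==> co n (x n j) i = (if i = j then \<one> else \<zero>)"
 by (rule P.coord_basis[OF basis P.carrier_submodule])

text \<open>The augmentation of the resolution, read as an element of \<open>A\<^sub>0\<close>.\<close>

definition au :: "'p => 'a" where "au z = rcomp A (co 0 z 0) 0"

lemma au_in: "z : C 0 ==> au z : component A 0"
 unfolding au_def using co_closed[of z 0 0] D0 RG.hcomp_props(1) by auto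

lemma au_closed: "z : C 0 ==> au z : carrier A"
 using au_in RG.C_closed by blast

lemma au_add: "[|y : C 0; z : C 0|] ==> au (y \<oplus>\<^bsub>P 0\<^esub> z) = au y \<oplus> au z"
 unfolding au_def using co_linear[of 0 0] co_closed[of _ 0 0] D0 by (simp add: linear_on_def RG.hcomp_add)

lemma au_smult: "[|a : carrier A; z : C 0|] ==> au (a \<odot>\<^bsub>P 0\<^esub> z) = rcomp A a 0 \<otimes> au z"
 unfolding au_def using co_linear[of 0 0] co_closed[of _ 0 0] D0 by (simp add: linear_on_def rcomp_mult_0)

lemma au_finsum: "g : S \<rightarrow> C 0 ==> au (finsum (P 0) g S) = finsum A (%s. au (g s)) S"
 using au_closed au_add
 by (intro additive_finsum[OF P.M_group abelian_group_axioms carrier_subgroup_add[OF P.M_group]]) auto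

lemma au_zero: "au \<zero>\<^bsub>P 0\<^esub> = \<zero>"
 using additive_zero[OF P.M_group abelian_group_axioms carrier_subgroup_add[OF P.M_group], where f = au] au_closed au_add by auto

lemma au_minus: "z : C 0 ==> au (\<ominus>\<^bsub>P 0\<^esub> z) = \<ominus> au z"
 using additive_minus[OF P.M_group abelian_group_axioms carrier_subgroup_add[OF P.M_group], where f = au] au_closed au_add by auto

lemma au_d: "y : C (Suc 0) ==> au (d 0 y) = \<zero>"
 using exact_0[of "d 0 y"] d_closed unfolding au_def by blast

lemma dd: "y : C (Suc (Suc n)) ==> d n (d (Suc n) y) = \<zero>\<^bsub>P n\<^esub>"
 using exact_Suc[of "d (Suc n) y" n] d_closed by blast

text \<open>The differential maps \<open>x (n + 1) j\<close>, of degree \<open>n + 1\<close>, to a combination of elements of degree \<open>n\<close>, so all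
coefficients have degree one. Linearity of the resolution thus makes the differentials vanish modulo \<open>A\<^bsub>\<ge>1\<^esub>\<close>.\<close>

lemma minimal:
 assumes y: "y : C (Suc n)" and i: "i < D n"
 shows "rcomp A (co n (d n y) i) 0 = \<zero>"
proof -
 have l: "linear_on A (P (Suc n)) (reg A) (C (Suc n)) (%y. co n (d n y) i)"
  by (rule linear_on_comp[OF d_linear co_linear[OF i]]) (auto simp: d_closed)
 interpret r: left_module A "reg A" by (rule reg_module[OF ring_axioms])
 note c = co_props[OF y]
 have z: "rcomp A (co n (d n (x (Suc n) j)) i) 0 = \<zero>" "co n (d n (x (Suc n) j)) i : carrier A" if "j < D (Suc n)" for j
 proof -
  have "x (Suc n) j : deg (P (Suc n)) (int (Suc n))" using x_deg[of "Suc n"] that by blast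
  then have "d n (x (Suc n) j) : deg (P n) (int (Suc n))" using d_hom[of n] by (auto simp: graded_hom_def)
  from co_homog[OF this i] have *: "co n (d n (x (Suc n) j)) i : component A 1" by (simp add: zcomponent_def)
  show "rcomp A (co n (d n (x (Suc n) j)) i) 0 = \<zero>" using RG.hcomp_homog[OF *, of 0] by simp
  show "co n (d n (x (Suc n) j)) i : carrier A" by (rule RG.C_closed[OF *])
 qed
 have "co n (d n y) i = lc (reg A) (D (Suc n)) (co (Suc n) y) (%j. co n (d n (x (Suc n) j)) i)"
  using linear_on_lc[OF P_module r.left_module_axioms P.carrier_submodule l c(1) x_Pi] c(2) by simp
 also have "... = (\<Oplus>j\<in>{..<D (Suc n)}. co (Suc n) y j \<otimes> co n (d n (x (Suc n) j)) i)"
  unfolding lc_def by (simp add: finsum_struct[of "reg A" A])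
 finally have "rcomp A (co n (d n y) i) 0 = (\<Oplus>j\<in>{..<D (Suc n)}. rcomp A (co (Suc n) y j \<otimes> co n (d n (x (Suc n) j)) i) 0)"
  using c(1) z(2) by (simp add: RG.hcomp_finsum Pi_iff)
 also have "... = \<zero>" using z c(1) by (intro add.finprod_one_eqI) (auto simp: rcomp_mult_0 RG.hcomp_carrier Pi_iff)
 finally show ?thesis .
qed

lemma au_linear_d:
 assumes f: "hom_P n 0 f" and y: "y : C (Suc n)"
 shows "au (f (d n y)) = \<zero>"
proof -
 have z: "d n y : C n" by (rule d_closed[OF y])
 note c = co_props[OF z]
 have fx: "f (x n i) : C 0" if "i < D n" for i using f x_closed[OF that] by (auto simp: linear_on_def)
 have "f (d n y) = (\<Oplus>\<^bsub>P 0\<^esub>i\<in>{..<D n}. co n (d n y) i \<odot>\<^bsub>P 0\<^esub> f (x n i))"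
  using linear_on_lc[OF P_module P_module P.carrier_submodule f c(1) x_Pi] c(2) by (simp add: lc_def)
 then have "au (f (d n y)) = (\<Oplus>i\<in>{..<D n}. au (co n (d n y) i \<odot>\<^bsub>P 0\<^esub> f (x n i)))"
  using fx c(1) by (simp add: au_finsum Pi_iff P.smult_closed)
 also have "... = \<zero>" using fx c(1) minimal[OF y] 
  by (intro add.finprod_one_eqI) (auto simp: au_smult au_closed Pi_iff)
 finally show ?thesis .
qed

text \<open>Cycles, with the augmentation in place of the missing differential of the zeroth term; by exactness these are
the images of the next differential.\<close>

definition cyc :: "nat => 'p => bool" where
 "cyc m z \<equiv> (case m of 0 => au z = \<zero> | Suc n => d n z = \<zero>\<^bsub>P n\<^esub>)"

lemma cyc_boundary: "[|z : C m; cyc m z|] ==> EX y:C (Suc m). d m y = z"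
 using exact_0[of z] exact_Suc[of z] by (cases m) (auto simp: cyc_def au_def)

lemma lift:
 assumes u: "hom_P q m u" and c: "!!i. i < D q ==> cyc m (u (x q i))"
 obtains v where "hom_P q (Suc m) v" "!!z. z : C q ==> d m (v z) = u z"
proof -
 have "EX y. y : C (Suc m) & d m y = u (x q i)" if "i < D q" for i
  using cyc_boundary[OF _ c[OF that]] u x_closed[OF that] by (auto simp: linear_on_def)
 then obtain y where y: "!!i. i < D q ==> y i : C (Suc m) & d m (y i) = u (x q i)" by metis
 then have yP: "y : {..<D q} \<rightarrow> C (Suc m)" by auto
 let ?v = "%z. lc (P (Suc m)) (D q) (co q z) y"
 note v = basis_extend_linear[OF P_module P_module basis P.carrier_submodule yP]
 have dv: "hom_P q m (%z. d m (?v z))"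
  by (rule linear_on_comp[OF v(1) d_linear]) (use v(1) in \<open>auto simp: linear_on_def\<close>)
 have "d m (?v z) = u z" if z: "z : C q" for z
  by (rule linear_eq_on_basis[OF P_module P_module dv u basis _ z]) (use v(2) y in auto)
 then show ?thesis using that[of ?v] v(1) by blast
qed

text \<open>The comparison theorem: the terms of the resolution are free, so that the components are obtained one after the
other by lifting along the differential.\<close>

lemma chain_map_exists:
 assumes f: "hom_P n 0 f"
 obtains F where "F : CM" "!!n'. n' ~= n ==> F n' = \<zero>\<^bsub>Z\<^esub> n'" "!!z. z : C n ==> F n 0 z = f z"
proof -
 define I where "I m g \<longleftrightarrow> hom_P (m + n) m g \<and>
   (ALL z:C (Suc (m + n)). cyc m (g (d (m + n) z))) & (m = 0 --> g = f)" for m g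
 have "EX G. ALL m. I m (G m) & (ALL z:C (Suc (m + n)). d m (G (Suc m) z) = G m (d (m + n) z))"
 proof (rule dependent_nat_choice)
  show "EX g. I 0 g" unfolding I_def cyc_def using f au_linear_d[OF f] by auto
 next
  fix g m assume g: "I m g"
  have l: "linear_on A (P (Suc (m + n))) (P m) (C (Suc (m + n))) (%z. g (d (m + n) z))"
   by (rule linear_on_comp[OF d_linear, where W = "C (m + n)"]) (use g in \<open>auto simp: I_def d_closed\<close>)
  have "cyc m (g (d (m + n) (x (Suc (m + n)) i)))" if "i < D (Suc (m + n))" for i
   using g x_closed[OF that] unfolding I_def by blast
  from lift[OF l this] obtain v where v: "linear_on A (P (Suc (m + n))) (P (Suc m)) (C (Suc (m + n))) v"
   "!!z. z : C (Suc (m + n)) ==> d m (v z) = g (d (m + n) z)" by blast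
  have "cyc (Suc m) (v (d (Suc m + n) z))" if z: "z : C (Suc (Suc m + n))" for z
  proof -
   have "d m (v (d (Suc (m + n)) z)) = g (d (m + n) (d (Suc (m + n)) z))" using z d_closed v(2) by simp
   also have "... = \<zero>\<^bsub>P m\<^esub>" using z dd g linear_on_zero[OF P_module P_module P.carrier_submodule]
    by (auto simp: I_def)
   finally show ?thesis by (simp add: cyc_def)
  qed
  then show "EX g'. I (Suc m) g' & (ALL z:C (Suc (m + n)). d m (g' z) = g (d (m + n) z))"
   using v by (intro exI[of _ v]) (auto simp: I_def)
 qed
 then obtain G where G: "!!m. I m (G m)" "!!m z. z : C (Suc (m + n)) ==> d m (G (Suc m) z) = G m (d (m + n) z)" by blast
 define F where "F = (%n' m. \<lambda>z\<in>C (m + n'). if n' = n then G m z else \<zero>\<^bsub>P m\<^esub>)"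
 have "F : CM" unfolding F_def
 proof (rule cmI)
  fix n' m
  show "hom_P (m + n') m (%z. if n' = n then G m z else \<zero>\<^bsub>P m\<^esub>)"
   using G(1)[of m] linear_on_const_zero[OF P_module P_module] by (cases "n' = n") (auto simp: I_def)
  fix z assume "z : C (Suc m + n')"
  then show "d m (if n' = n then G (Suc m) z else \<zero>\<^bsub>P (Suc m)\<^esub>) = (if n' = n then G m (d (m + n') z) else \<zero>\<^bsub>P m\<^esub>)"
   using G(2)[of z m] by (auto simp: d_zero)
 next
  show "finite {n'. EX m. EX z:C (m + n'). (if n' = n then G m z else \<zero>\<^bsub>P m\<^esub>) ~= \<zero>\<^bsub>P m\<^esub>}"
   by (rule finite_subset[of _ "{n}"]) auto
 qed
 moreover have "F n' = \<zero>\<^bsub>Z\<^esub> n'" if "n' ~= n" for n' using that by (simp add: F_def Z_simps)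
 moreover have "F n 0 z = f z" if "z : C n" for z using that G(1)[of 0] by (simp add: F_def I_def)
 ultimately show ?thesis using that by blast
qed

text \<open>A chain map whose lowest component vanishes after augmentation lifts the zero map, so the homotopy is constructed
degree by degree, starting from a lift of that component.\<close>

lemma null_homotopicI:
 assumes F: "F : CM" and conc: "!!n'. n' ~= n ==> F n' = \<zero>\<^bsub>Z\<^esub> n'"
  and au0: "!!i. i < D n ==> au (F n 0 (x n i)) = \<zero>"
 shows "F : B"
proof -
 define I where "I m g \<longleftrightarrow> hom_P (m + n) (Suc m) g \<and>
   (ALL w:C (Suc (m + n)). d m (g (d (m + n) w)) = F n m (d (m + n) w)) \<and>
   (m = 0 --> (ALL z:C n. d 0 (g z) = F n 0 z))" for m g
 have "EX G. ALL m. I m (G m) & (ALL z:C (Suc (m + n)).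
   d (Suc m) (G (Suc m) z) = F n (Suc m) z \<ominus>\<^bsub>P (Suc m)\<^esub> G m (d (m + n) z))"
 proof (rule dependent_nat_choice)
  have "hom_P n 0 (F n 0)" by (rule cm_lin[OF F]) simp
  moreover have "cyc 0 (F n 0 (x n i))" if "i < D n" for i using au0[OF that] by (simp add: cyc_def)
  ultimately obtain v where "hom_P n (Suc 0) v" "!!z. z : C n ==> d 0 (v z) = F n 0 z"
   using lift by blast
  then show "EX g. I 0 g" using d_closed by (auto simp: I_def)
 next
  fix g m assume g: "I m g"
  have gl: "hom_P (m + n) (Suc m) g" using g by (simp add: I_def)
  have l1: "linear_on A (P (Suc (m + n))) (P (Suc m)) (C (Suc (m + n))) (%z. g (d (m + n) z))"
   by (rule linear_on_comp[OF d_linear gl]) (auto simp: d_closed)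
  have l2: "linear_on A (P (Suc (m + n))) (P (Suc m)) (C (Suc (m + n))) (F n (Suc m))"
   by (rule cm_lin[OF F]) simp
  have l: "linear_on A (P (Suc (m + n))) (P (Suc m)) (C (Suc (m + n))) (%z. F n (Suc m) z \<ominus>\<^bsub>P (Suc m)\<^esub> g (d (m + n) z))"
   by (rule linear_on_sub[OF P_module P_module P.carrier_submodule l2 l1])
  have cl: "F n (Suc m) z : C (Suc m)" "g (d (m + n) z) : C (Suc m)" if "z : C (Suc (m + n))" for z
   using l1 l2 that by (auto simp: linear_on_def)
  have "cyc (Suc m) (F n (Suc m) (x (Suc (m + n)) i) \<ominus>\<^bsub>P (Suc m)\<^esub> g (d (m + n) (x (Suc (m + n)) i)))" if "i < D (Suc (m + n))" for i
  proof -
   let ?z = "x (Suc (m + n)) i"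
   have z: "?z : C (Suc (m + n))" by (rule x_closed[OF that])
   have "d m (F n (Suc m) ?z \<ominus>\<^bsub>P (Suc m)\<^esub> g (d (m + n) ?z)) = F n m (d (m + n) ?z) \<oplus>\<^bsub>P m\<^esub> \<ominus>\<^bsub>P m\<^esub> F n m (d (m + n) ?z)"
    using cl[OF z] g z cm_comm[OF F z refl] by (simp add: a_minus_def d_add d_minus I_def)
   also have "... = \<zero>\<^bsub>P m\<^esub>" using cm_closed[OF F d_closed[OF z] refl] by (simp add: P.M.r_neg)
   finally show ?thesis by (simp add: cyc_def)
  qed
  from lift[OF l this] obtain v where v: "linear_on A (P (Suc (m + n))) (P (Suc (Suc m))) (C (Suc (m + n))) v"
   "!!z. z : C (Suc (m + n)) ==> d (Suc m) (v z) = F n (Suc m) z \<ominus>\<^bsub>P (Suc m)\<^esub> g (d (m + n) z)" by blast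
  have "d (Suc m) (v (d (Suc m + n) w)) = F n (Suc m) (d (Suc m + n) w)" if w: "w : C (Suc (Suc m + n))" for w
  proof -
   have dw: "d (Suc (m + n)) w : C (Suc (m + n))" using w d_closed by simp
   have "g (d (m + n) (d (Suc (m + n)) w)) = \<zero>\<^bsub>P (Suc m)\<^esub>"
    using w dd linear_on_zero[OF P_module P_module P.carrier_submodule gl] by simp
   then show ?thesis using v(2)[OF dw] cl(1)[OF dw] by (simp add: a_minus_def)
  qed
  then show "EX g'. I (Suc m) g' & (ALL z:C (Suc (m + n)).
   d (Suc m) (g' z) = F n (Suc m) z \<ominus>\<^bsub>P (Suc m)\<^esub> g (d (m + n) z))"
   using v by (intro exI[of _ v]) (auto simp: I_def)
 qed
 then obtain G where G: "!!m. I m (G m)" "!!m z. z : C (Suc (m + n)) ==>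
   d (Suc m) (G (Suc m) z) = F n (Suc m) z \<ominus>\<^bsub>P (Suc m)\<^esub> G m (d (m + n) z)" by blast
 have Gl: "hom_P (m + n) (Suc m) (G m)" for m using G(1) by (simp add: I_def)
 define h where "h n' p = (if n' = n & n \<le> p then G (p - n) else (%z. \<zero>\<^bsub>P (p + 1 - n')\<^esub>))" for n' p
 have "homotopy F h"
 proof (rule homotopyI)
  fix n' p q :: nat assume e: "p + 1 = q + n'"
  then have q: "p + 1 - n' = q" by simp
  show "hom_P p q (h n' p)"
  proof (cases "n' = n & n \<le> p")
   case True
   then have "p - n + n = p" "Suc (p - n) = q" using e by auto
   then show ?thesis using Gl[of "p - n"] True by (simp add: h_def)
  next
   case False
   then have "h n' p = (%z. \<zero>\<^bsub>P q\<^esub>)" using q by (auto simp: h_def)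
   then show ?thesis using linear_on_const_zero[OF P_module P_module] by simp
  qed
 next
  fix n' m q z assume z: "z : C q" "q = m + n'"
  show "F n' m z = d m (h n' q z) \<oplus>\<^bsub>P m\<^esub> (past q m (h n' (q - 1) (d (q - 1) z)))"
  proof (cases "n' = n")
   case False
   have e: "q + 1 - n' = Suc m" "q ~= 0 ==> q - 1 + 1 - n' = m" using z(2) by auto
   have "F n' m z = \<zero>\<^bsub>P m\<^esub>" using conc[OF False] z by (simp add: Z_simps)
   moreover have "d m (h n' q z) = \<zero>\<^bsub>P m\<^esub>" using False e(1) by (simp add: h_def d_zero)
   moreover have "h n' (q - 1) (d (q - 1) z) = \<zero>\<^bsub>P m\<^esub>" if "q ~= 0" using False e(2)[OF that] by (simp add: h_def)
   ultimately show ?thesis by simp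
  next
   case True
   show ?thesis
   proof (cases m)
    case 0
    have qn: "q = n" using z(2) True 0 by simp
    have h1: "h n q z = G 0 z" by (simp add: h_def qn)
    have h2: "(past q m (h n (q - 1) (d (q - 1) z))) = \<zero>\<^bsub>P m\<^esub>"
     using qn 0 by (auto simp: h_def)
    have "d 0 (G 0 z) = F n 0 z" using G(1)[of 0] z qn by (simp add: I_def)
    moreover have "F n 0 z : C 0" using cm_closed[OF F z(1), of 0 n] qn by simp
    ultimately show ?thesis unfolding True h1 h2 using 0 by simp
   next
    case (Suc l)
    have ql: "q = Suc (l + n)" using z(2) True Suc by simp
    then have zl: "z : C (Suc (l + n))" using z(1) by simp
    have h1: "h n q z = G (Suc l) z" by (simp add: h_def ql Suc_diff_le)
    have h2: "(past q m (h n (q - 1) (d (q - 1) z))) = G l (d (l + n) z)"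
     by (simp add: h_def ql)
    have c: "F n (Suc l) z : C (Suc l)" "G l (d (l + n) z) : C (Suc l)"
     using cm_closed[OF F zl, of "Suc l" n] Gl[of l] d_closed[OF zl] by (auto simp: linear_on_def)
    have "d (Suc l) (G (Suc l) z) \<oplus>\<^bsub>P (Suc l)\<^esub> G l (d (l + n) z) = F n (Suc l) z"
     unfolding G(2)[OF zl] using c by (simp add: a_minus_def P.M.a_assoc P.M.l_neg)
    then show ?thesis unfolding True h1 h2 using Suc by simp
   qed
  qed
 qed
 then show ?thesis using F unfolding B_iff by blast
qed

end

section \<open>Ext classes as linear functionals\<close>

lemma opposite_simps [simp]:
 "carrier (opposite R) = carrier R" "zero (opposite R) = zero R" "one (opposite R) = one R"
 "add (opposite R) = add R" "mult (opposite R) = (%x y. y \<otimes>\<^bsub>R\<^esub> x)" 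
 by (simp_all add: opposite_def)

lemma opposite_component [simp]: "component (opposite R) = component R"
 by (simp add: opposite_def)

lemma internal_direct_sum_ex:
 assumes "internal_direct_sum G I C" "x : carrier G"
 shows "EX c. x = (\<Oplus>\<^bsub>G\<^esub>i\<in>{i : I. c i ~= \<zero>\<^bsub>G\<^esub>}. c i)"
proof -
 have "\<exists>!c. c : (\<Pi>\<^sub>E i\<in>I. C i) & finite {i : I. c i ~= \<zero>\<^bsub>G\<^esub>} & x = (\<Oplus>\<^bsub>G\<^esub>i\<in>{i : I. c i ~= \<zero>\<^bsub>G\<^esub>}. c i)"
  using assms unfolding internal_direct_sum_def by simp
 then show ?thesis by (elim ex1E conjE exI)
qed

context koszul_resolution
begin

sublocale Z: ring Z by (rule Z_ring)
sublocale E: ring E by (rule E_ring)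

lemma Z_minus: "F : CM ==> \<ominus>\<^bsub>Z\<^esub> F = (%n m. \<lambda>z\<in>C (m + n). \<ominus>\<^bsub>P m\<^esub> F n m z)"
proof (rule Z.minus_equality, unfold Z_simps(1))
 assume F: "F : CM"
 show "(%n m. \<lambda>z\<in>C (m + n). \<ominus>\<^bsub>P m\<^esub> F n m z) \<oplus>\<^bsub>Z\<^esub> F = \<zero>\<^bsub>Z\<^esub>"
  by (intro cm_eqI Z_add_closed Z_zero_closed Z_neg_closed F)
   (simp add: Z_add Z_simps cm_closed[OF F] P.M.l_neg)
qed (auto intro: Z_neg_closed)

lemma B_au:
 assumes F: "F : B" and z: "z : C n"
 shows "au (F n 0 z) = \<zero>"
proof -
 obtain h where h: "homotopy F h" using F unfolding B_iff by blast
 have e: "F n 0 z = d 0 (h n n z) \<oplus>\<^bsub>P 0\<^esub> (if n = 0 then \<zero>\<^bsub>P 0\<^esub> else h n (n - 1) (d (n - 1) z))"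
  by (rule homotopy_eq[OF h z]) simp
 have c1: "h n n z : C (Suc 0)" by (rule homotopy_closed[OF h z]) simp
 have c2: "(if n = 0 then \<zero>\<^bsub>P 0\<^esub> else h n (n - 1) (d (n - 1) z)) : C 0"
  by (rule homotopy_snd_closed[OF h z]) simp
 have "au (if n = 0 then \<zero>\<^bsub>P 0\<^esub> else h n (n - 1) (d (n - 1) z)) = \<zero>"
 proof (cases n)
  case (Suc l)
  have "hom_P l 0 (h n l)" by (rule homotopy_lin[OF h]) (simp add: Suc)
  from au_linear_d[OF this] z show ?thesis by (simp add: Suc)
 qed (simp add: au_zero)
 then show ?thesis unfolding e using c1 c2 d_closed[OF c1] by (simp add: au_add au_d)
qed

text \<open>The coordinates of an Ext class with respect to the basis of the \<open>n\<close>-th term. By minimality they do not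
depend on the representative, and by the comparison theorem they determine the class.\<close>

definition lam :: "nat => (nat => nat => 'p => 'p) set => nat => 'a" where
 "lam n r i = au ((SOME F. F : CM & r = ecls F) n 0 (x n i))"

lemma x_closed0: "i < D n ==> x n i : C (0 + n)"
 using x_closed by simp

lemma lam_ecls:
 assumes F: "F : CM" and i: "i < D n"
 shows "lam n (ecls F) i = au (F n 0 (x n i))"
proof -
 define G where "G = (SOME G. G : CM & ecls F = ecls G)"
 have "EX G. G : CM & ecls F = ecls G" using F by blast
 from someI_ex[OF this] have G: "G : CM" "ecls F = ecls G" unfolding G_def by blast+
 note xi = x_closed[OF i]
 have c: "F n 0 (x n i) : C 0" "G n 0 (x n i) : C 0"
  using cm_closed[OF F xi, of 0 n] cm_closed[OF G(1) xi, of 0 n] by auto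
 have "F \<ominus>\<^bsub>Z\<^esub> G : B" using ecls_eq_iff[OF F G(1)] G(2) by simp
 from B_au[OF this xi] have "au ((F \<ominus>\<^bsub>Z\<^esub> G) n 0 (x n i)) = \<zero>" .
 moreover have "(F \<ominus>\<^bsub>Z\<^esub> G) n 0 (x n i) = F n 0 (x n i) \<oplus>\<^bsub>P 0\<^esub> \<ominus>\<^bsub>P 0\<^esub> G n 0 (x n i)"
  unfolding a_minus_def Z_minus[OF G(1)] Z_add using xi by simp
 ultimately have "au (F n 0 (x n i)) \<ominus> au (G n 0 (x n i)) = \<zero>" using c by (simp add: au_add au_minus a_minus_def)
 then have "au (F n 0 (x n i)) = au (G n 0 (x n i))" using diff_zero_imp_eq au_closed c by blast
 then show ?thesis by (simp add: lam_def G_def)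
qed

lemma E_cases: "r : carrier E ==> (!!F. [|F : CM; r = ecls F|] ==> Q) ==> Q"
 unfolding E_simps(1) by blast

lemma comp_cases:
 assumes "r : component E n"
 obtains F where "F : CM" "r = ecls F" "!!n'. n' ~= n ==> F n' = \<zero>\<^bsub>Z\<^esub> n'"
 using assms unfolding E_simps(6) by blast

lemma comp_closed: "r : component E n ==> r : carrier E"
 unfolding E_simps by blast

lemma lam_in: "[|r : carrier E; i < D n|] ==> lam n r i : component A 0"
 using au_in cm_closed[OF _ x_closed0, of _ i n 0 n] by (elim E_cases) (simp add: lam_ecls)

lemma lam_closed: "[|r : carrier E; i < D n|] ==> lam n r i : carrier A"
 using lam_in RG.C_closed by blast

lemma lam_add:
 assumes "r : carrier E" "s : carrier E" "i < D n"
 shows "lam n (r \<oplus>\<^bsub>E\<^esub> s) i = lam n r i \<oplus> lam n s i"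
proof -
 obtain F G where F: "F : CM" "r = ecls F" and G: "G : CM" "s = ecls G"
  using assms(1,2) by (meson E_cases)
 have c: "F n 0 (x n i) : C 0" "G n 0 (x n i) : C 0"
  using cm_closed[OF F(1) x_closed[OF assms(3)], of 0 n] cm_closed[OF G(1) x_closed[OF assms(3)], of 0 n] by auto
 have "(F \<oplus>\<^bsub>Z\<^esub> G) n 0 (x n i) = F n 0 (x n i) \<oplus>\<^bsub>P 0\<^esub> G n 0 (x n i)"
  unfolding Z_add using x_closed[OF assms(3)] by simp
 then show ?thesis unfolding F(2) G(2) E_simps(4)[OF F(1) G(1)]
  using c by (simp add: lam_ecls F G Z_add_closed assms(3) au_add)
qed

lemma lam_minus: "[|r : carrier E; i < D n|] ==> lam n (\<ominus>\<^bsub>E\<^esub> r) i = \<ominus> lam n r i"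
 using additive_minus[OF E.abelian_group_axioms abelian_group_axioms carrier_subgroup_add[OF E.abelian_group_axioms],
   of "%r. lam n r i"] lam_closed lam_add by auto

lemma lam_finsum: "[|g : S \<rightarrow> carrier E; i < D n|] ==> lam n (finsum E g S) i = finsum A (%s. lam n (g s) i) S"
 using additive_finsum[OF E.abelian_group_axioms abelian_group_axioms carrier_subgroup_add[OF E.abelian_group_axioms],
   of "%r. lam n r i"] lam_closed lam_add by auto

lemma lam_other:
 assumes "r : component E m" "m ~= n" "i < D n"
 shows "lam n r i = \<zero>"
proof -
 obtain F where F: "F : CM" "r = ecls F" "!!n'. n' ~= m ==> F n' = \<zero>\<^bsub>Z\<^esub> n'"
  using comp_cases[OF assms(1)] by metis
 have "F n 0 (x n i) = \<zero>\<^bsub>P 0\<^esub>" using F(3)[of n] assms x_closed by (simp add: Z_simps)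
 then show ?thesis unfolding F(2) using F(1) assms(3) by (simp add: lam_ecls au_zero)
qed

lemma lam_inj:
 assumes "r : component E n" "!!i. i < D n ==> lam n r i = \<zero>"
 shows "r = \<zero>\<^bsub>E\<^esub>"
proof -
 obtain F where F: "F : CM" "r = ecls F" "!!n'. n' ~= n ==> F n' = \<zero>\<^bsub>Z\<^esub> n'"
  using comp_cases[OF assms(1)] by metis
 have "F : B" using F assms(2) by (intro null_homotopicI[OF F(1,3)]) (auto simp: lam_ecls)
 moreover have "F \<ominus>\<^bsub>Z\<^esub> \<zero>\<^bsub>Z\<^esub> = F" using F(1) by (simp add: a_minus_def Z_simps(1))
 ultimately show ?thesis unfolding F(2) E_simps(2) using ecls_eq_iff[OF F(1) Z_zero_closed] by simp
qed

lemma lam_surj: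
 assumes c: "c : {..<D n} \<rightarrow> component A 0"
 obtains r where "r : component E n" "!!i. i < D n ==> lam n r i = c i"
proof -
 have cc: "c i : carrier A" if "i < D n" for i using c that RG.C_closed by blast
 have x0: "x 0 0 : C 0" using x_closed[of 0 0] D0 by simp
 have y: "(%i. c i \<odot>\<^bsub>P 0\<^esub> x 0 0) : {..<D n} \<rightarrow> C 0" using cc x0 P.smult_closed by auto
 note l = basis_extend_linear[OF P_module P_module basis P.carrier_submodule y]
 obtain F where F: "F : CM" "!!n'. n' ~= n ==> F n' = \<zero>\<^bsub>Z\<^esub> n'"
  "!!z. z : C n ==> F n 0 z = lc (P 0) (D n) (co n z) (%i. c i \<odot>\<^bsub>P 0\<^esub> x 0 0)"
  using chain_map_exists[OF l(1)] by blast
 have au1: "au (x 0 0) = \<one>" unfolding au_def using co_x[of 0 0 0] D0 RG.hcomp_homog[OF one_component, of 0] by simp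
 have "lam n (ecls F) i = c i" if i: "i < D n" for i
 proof -
  have "lam n (ecls F) i = au (c i \<odot>\<^bsub>P 0\<^esub> x 0 0)"
   unfolding lam_ecls[OF F(1) i] F(3)[OF x_closed[OF i]] l(2)[OF i] ..
  also have "... = rcomp A (c i) 0" using cc[OF i] x0 au1 by (simp add: au_smult RG.hcomp_carrier)
  also have "... = c i" using RG.hcomp_homog[of "c i" 0 0] c i by auto
  finally show ?thesis .
 qed
 moreover have "ecls F : component E n" unfolding E_simps using F(1,2) by blast
 ultimately show ?thesis using that by blast
qed

section \<open>Scalars in the Ext algebra\<close>

definition scal_map :: "'k => nat => nat => 'p => 'p" where
 "scal_map c = (%n m. \<lambda>z\<in>C (m + n). if n = 0 then \<iota> c \<odot>\<^bsub>P m\<^esub> z else \<zero>\<^bsub>P m\<^esub>)"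

text \<open>The structure map of the Ext algebra: a scalar acts by multiplication, which is a chain map because \<open>k\<close> is
central in \<open>A\<close>.\<close>

definition kap :: "'k => (nat => nat => 'p => 'p) set" where "kap c = ecls (scal_map c)"

lemma smult_central: "[|c : carrier k; a : carrier A; z : C n|] ==>
 \<iota> c \<odot>\<^bsub>P n\<^esub> (a \<odot>\<^bsub>P n\<^esub> z) = a \<odot>\<^bsub>P n\<^esub> (\<iota> c \<odot>\<^bsub>P n\<^esub> z)"
 using \<kappa>_closed by (simp add: P.smult_assoc[symmetric] central)

lemma scal_linear: "c : carrier k ==> hom_P n n (%z. \<iota> c \<odot>\<^bsub>P n\<^esub> z)"
 using \<kappa>_closed by (auto simp: linear_on_def P.smult_closed P.smult_r_distr smult_central)

lemma scal_map_closed: "c : carrier k ==> scal_map c : CM"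
 unfolding scal_map_def
proof (rule cmI)
 assume c: "c : carrier k"
 fix n m
 show "hom_P (m + n) m (%z. if n = 0 then \<iota> c \<odot>\<^bsub>P m\<^esub> z else \<zero>\<^bsub>P m\<^esub>)"
  using scal_linear[OF c] linear_on_const_zero[OF P_module P_module] by (cases "n = 0") auto
 fix z assume "z : C (Suc m + n)"
 then show "d m (if n = 0 then \<iota> c \<odot>\<^bsub>P (Suc m)\<^esub> z else \<zero>\<^bsub>P (Suc m)\<^esub>) = (if n = 0 then \<iota> c \<odot>\<^bsub>P m\<^esub> d (m + n) z else \<zero>\<^bsub>P m\<^esub>)"
  using d_linear[of m] \<kappa>_closed[OF c] by (auto simp: d_zero linear_on_def)
next
 show "finite {n. EX m. EX z:C (m + n). (if n = 0 then \<iota> c \<odot>\<^bsub>P m\<^esub> z else \<zero>\<^bsub>P m\<^esub>) ~= \<zero>\<^bsub>P m\<^esub>}"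
  by (rule finite_subset[of _ "{0}"]) auto
qed

lemma kap_in: "c : carrier k ==> kap c : component E 0"
 unfolding E_simps kap_def using scal_map_closed by (fastforce simp: scal_map_def Z_simps)

lemma mult_scal:
 assumes c: "c : carrier k" and F: "F : CM" and z: "z : C (m + n)"
 shows "(F \<otimes>\<^bsub>Z\<^esub> scal_map c) n m z = \<iota> c \<odot>\<^bsub>P m\<^esub> F n m z" "(scal_map c \<otimes>\<^bsub>Z\<^esub> F) n m z = \<iota> c \<odot>\<^bsub>P m\<^esub> F n m z"
proof -
 have f: "F n m z : C m" by (rule cm_closed[OF F z refl])
 have "(F \<otimes>\<^bsub>Z\<^esub> scal_map c) n m z = (\<Oplus>\<^bsub>P m\<^esub>i\<in>{..n}. scal_map c (n - i) m (F i (m + (n - i)) z))"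
  using z by (simp add: Z_mult)
 also have "... = \<iota> c \<odot>\<^bsub>P m\<^esub> F n m z"
  using f term_closed(1)[OF F F _ z] \<kappa>_closed[OF c]
  by (subst P.M.finsum_single[of _ n]) (auto simp: scal_map_def P.smult_closed)
 finally show "(F \<otimes>\<^bsub>Z\<^esub> scal_map c) n m z = \<iota> c \<odot>\<^bsub>P m\<^esub> F n m z" .
 have zi: "z : C (m + (n - i) + i)" if "i \<le> n" for i using z that by simp
 have l: "F n m (\<iota> c \<odot>\<^bsub>P (m + n)\<^esub> z) = \<iota> c \<odot>\<^bsub>P m\<^esub> F n m z"
  using cm_lin[OF F, of "m + n" m n] z \<kappa>_closed[OF c] by (auto simp: linear_on_def)
 have "(scal_map c \<otimes>\<^bsub>Z\<^esub> F) n m z = (\<Oplus>\<^bsub>P m\<^esub>i\<in>{..n}. F (n - i) m (scal_map c i (m + (n - i)) z))"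
  using z by (simp add: Z_mult)
 also have "... = \<iota> c \<odot>\<^bsub>P m\<^esub> F n m z"
  using z zi f l \<kappa>_closed[OF c]
  by (subst P.M.finsum_single[of _ 0]) (auto simp: scal_map_def cm_zero[OF F] P.smult_closed)
 finally show "(scal_map c \<otimes>\<^bsub>Z\<^esub> F) n m z = \<iota> c \<odot>\<^bsub>P m\<^esub> F n m z" .
qed

lemma kap_central: "[|c : carrier k; r : carrier E|] ==> kap c \<otimes>\<^bsub>E\<^esub> r = r \<otimes>\<^bsub>E\<^esub> kap c"
proof (elim E_cases)
 fix F assume c: "c : carrier k" and F: "F : CM" "r = ecls F"
 have "scal_map c \<otimes>\<^bsub>Z\<^esub> F = F \<otimes>\<^bsub>Z\<^esub> scal_map c"
  by (intro cm_eqI Z_mult_closed scal_map_closed c F(1)) (simp only: mult_scal[OF c F(1)])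
 then show ?thesis unfolding F(2) kap_def using c F(1) by (simp add: E_simps scal_map_closed)
qed

lemma lam_kap_mult:
 assumes c: "c : carrier k" and r: "r : carrier E" and i: "i < D n"
 shows "lam n (kap c \<otimes>\<^bsub>E\<^esub> r) i = \<iota> c \<otimes> lam n r i"
proof -
 obtain F where F: "F : CM" "r = ecls F" using r by (elim E_cases)
 note xi = x_closed0[OF i]
 have c': "F n 0 (x n i) : C 0" by (rule cm_closed[OF F(1) xi refl])
 have "lam n (kap c \<otimes>\<^bsub>E\<^esub> r) i = au ((scal_map c \<otimes>\<^bsub>Z\<^esub> F) n 0 (x n i))"
  unfolding F(2) kap_def E_simps(5)[OF scal_map_closed[OF c] F(1)]
  by (rule lam_ecls[OF Z_mult_closed[OF scal_map_closed[OF c] F(1)] i])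
 also have "... = rcomp A (\<iota> c) 0 \<otimes> au (F n 0 (x n i))"
  unfolding mult_scal(2)[OF c F(1) xi] using c' \<kappa>_closed[OF c] by (simp add: au_smult)
 finally show ?thesis using RG.hcomp_homog[OF \<kappa>_in[OF c], of 0] F i by (simp add: lam_ecls)
qed

lemma au_x0: "au (x 0 0) = \<one>"
 unfolding au_def using co_x[of 0 0 0] D0 RG.hcomp_homog[OF one_component, of 0] by simp

lemma lam_one: "lam 0 \<one>\<^bsub>E\<^esub> 0 = \<one>"
 unfolding E_simps(3) using D0 x_closed[of 0 0] au_x0
 by (simp add: lam_ecls[OF Z_one_closed]) (simp add: Z_simps)

lemma kap_one: "kap \<one>\<^bsub>k\<^esub> = \<one>\<^bsub>E\<^esub>"
proof -
 have "scal_map \<one>\<^bsub>k\<^esub> = \<one>\<^bsub>Z\<^esub>"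
  by (intro cm_eqI scal_map_closed Z_one_closed) (auto simp: scal_map_def Z_simps \<kappa>_one P.smult_one)
 then show ?thesis by (simp add: kap_def E_simps)
qed

lemma kap_hom: "kap : ring_hom k E"
proof (rule ring_hom_memI)
 fix c assume c: "c : carrier k"
 show "kap c : carrier E" using kap_in[OF c] comp_closed by blast
 fix c' assume c': "c' : carrier k"
 have "scal_map (c \<otimes>\<^bsub>k\<^esub> c') = scal_map c \<otimes>\<^bsub>Z\<^esub> scal_map c'"
 proof (intro cm_eqI Z_mult_closed scal_map_closed c c' K.m_closed)
  fix n m z assume z: "z : C (m + n)"
  show "scal_map (c \<otimes>\<^bsub>k\<^esub> c') n m z = (scal_map c \<otimes>\<^bsub>Z\<^esub> scal_map c') n m z"
   unfolding mult_scal(2)[OF c scal_map_closed[OF c'] z] using z c c' ring_hom_mult[OF \<kappa>_hom c c'] \<kappa>_closed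
   by (auto simp: scal_map_def P.smult_assoc P.smult_zero_r)
 qed
 then show "kap (c \<otimes>\<^bsub>k\<^esub> c') = kap c \<otimes>\<^bsub>E\<^esub> kap c'"
  using c c' by (simp add: kap_def E_simps scal_map_closed)
 have "scal_map (c \<oplus>\<^bsub>k\<^esub> c') = scal_map c \<oplus>\<^bsub>Z\<^esub> scal_map c'"
 proof (intro cm_eqI Z_add_closed scal_map_closed c c' K.a_closed)
  fix n m z assume z: "z : C (m + n)"
  show "scal_map (c \<oplus>\<^bsub>k\<^esub> c') n m z = (scal_map c \<oplus>\<^bsub>Z\<^esub> scal_map c') n m z"
   using z c c' ring_hom_add[OF \<kappa>_hom c c'] \<kappa>_closed
   by (auto simp: scal_map_def Z_add P.smult_l_distr)
 qed
 then show "kap (c \<oplus>\<^bsub>k\<^esub> c') = kap c \<oplus>\<^bsub>E\<^esub> kap c'"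
  using c c' by (simp add: kap_def E_simps scal_map_closed)
qed (rule kap_one)

lemma kap_bij:
 assumes G: "graded_ring (opposite E)"
 shows "bij_betw kap (carrier k) (component E 0)"
proof -
 interpret G: graded_ring "opposite E" by (rule G)
 have D: "0 < D 0" using D0 by simp
 have l: "lam 0 (kap c) 0 = \<iota> c" if c: "c : carrier k" for c
  using lam_kap_mult[OF c E.one_closed D] lam_one kap_in[OF c] comp_closed \<kappa>_closed[OF c] by simp
 show ?thesis unfolding bij_betw_def
 proof
  show "inj_on kap (carrier k)"
  proof (rule inj_onI)
   fix a b assume ab: "a : carrier k" "b : carrier k" "kap a = kap b"
   then have "\<iota> a = \<iota> b" using l[of a] l[of b] by simp
   then show "a = b" using ab \<kappa>_bij by (auto simp: bij_betw_def inj_on_def)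
  qed
  show "kap ` carrier k = component E 0"
  proof
   show "kap ` carrier k \<subseteq> component E 0" using kap_in by blast
   show "component E 0 \<subseteq> kap ` carrier k"
   proof
    fix r assume r: "r : component E 0"
    have rc: "r : carrier E" by (rule comp_closed[OF r])
    obtain c where c: "c : carrier k" "lam 0 r 0 = \<iota> c" using \<kappa>_surj[OF lam_in[OF rc D]] by blast
    have kc: "kap c : carrier E" using kap_in[OF c(1)] comp_closed by blast
    have m: "\<ominus>\<^bsub>opposite E\<^esub> y = \<ominus>\<^bsub>E\<^esub> y" for y by (rule a_inv_struct) simp_all
    have "r \<oplus>\<^bsub>E\<^esub> \<ominus>\<^bsub>E\<^esub> kap c : component E 0"
     using G.RG.C_subD(3,4)[of _ 0] r kap_in[OF c(1)] m by simp
    moreover have "lam 0 (r \<oplus>\<^bsub>E\<^esub> \<ominus>\<^bsub>E\<^esub> kap c) i = \<zero>" if "i < D 0" for i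
     using that rc kc c l[OF c(1)] \<kappa>_closed[OF c(1)] D0 by (simp add: lam_add lam_minus r_neg)
    ultimately have "r \<oplus>\<^bsub>E\<^esub> \<ominus>\<^bsub>E\<^esub> kap c = \<zero>\<^bsub>E\<^esub>" by (rule lam_inj)
    then have "r = kap c" using rc kc E.diff_zero_imp_eq by (simp add: a_minus_def)
    then show "r : kap ` carrier k" using c(1) by blast
   qed
  qed
 qed
qed

text \<open>An empty decomposition would force \<open>1\<close> into the augmentation ideal, although the coordinate of \<open>1\<close> in degree \<open>0\<close> is
nonzero. Consequently a simple summand exists, and with it the graded ring structure of the opposite Ext
algebra.\<close>

lemma decomposition_nonempty:
 assumes "simple_decomposition (opposite E) Ss" shows "Ss ~= []"
proof
 assume Ss: "Ss = []"
 let ?R = "opposite E"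
 have g: "abelian_group ?R" by (rule abelian_group_struct[OF E.abelian_group_axioms]) simp_all
 have fs: "finsum ?R f S = finsum E f S" for f :: "nat => _" and S by (rule finsum_struct) simp_all
 let ?I = "augmentation_ideal ?R"
 have I: "EX N c. a = finsum E c N & finite N & 0 \<notin> N & (ALL n:N. c n : component E n)" if "a : ?I" for a
  using that unfolding augmentation_ideal_def fs by auto
 have Ic: "?I \<subseteq> carrier E" using I comp_closed by (fastforce intro!: E.finsum_closed)
 have zI: "\<zero>\<^bsub>E\<^esub> : ?I" unfolding augmentation_ideal_def fs
  by (intro CollectI exI[of _ "{}"]) auto
 let ?T = "top_module ?R"
 have cosI: "?I +>\<^bsub>?R\<^esub> a = {i \<oplus>\<^bsub>E\<^esub> a | i. i : ?I}" for a by (auto simp: a_r_coset_def r_coset_def)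
 have z: "\<zero>\<^bsub>?T\<^esub> = ?I" by (simp add: top_module_def Let_def FactRing_def)
 have c: "carrier ?T = {?I +>\<^bsub>?R\<^esub> a | a. a : carrier E}"
  by (auto simp: top_module_def Let_def FactRing_def A_RCOSETS_def RCOSETS_def a_r_coset_def)
 have "?I +>\<^bsub>?R\<^esub> \<zero>\<^bsub>E\<^esub> = ?I" unfolding cosI using Ic by force
 then have zc: "?I : carrier ?T" unfolding c by force
 have "x = ?I" if x: "x : carrier ?T" for x
 proof -
  have "EX c. x = (\<Oplus>\<^bsub>?T\<^esub>i\<in>{i : {..<length Ss}. c i ~= \<zero>\<^bsub>?T\<^esub>}. c i)"
   by (rule internal_direct_sum_ex[of _ _ "(!) Ss", OF _ x]) (use assms in \<open>simp add: simple_decomposition_def\<close>)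
  then obtain c :: "nat => (nat => nat => 'p => 'p) set set" where "x = finsum ?T c {}" using Ss by auto
  also have "... = \<zero>\<^bsub>?T\<^esub>" using zc unfolding z[symmetric] by (simp add: finsum_def finprod_def)
  finally show ?thesis using z by simp
 qed
 then have "?I +>\<^bsub>?R\<^esub> \<one>\<^bsub>E\<^esub> = ?I" unfolding c using E.one_closed by blast
 then have "\<zero>\<^bsub>E\<^esub> \<oplus>\<^bsub>E\<^esub> \<one>\<^bsub>E\<^esub> : ?I" unfolding cosI using zI by blast
 then obtain N c where N: "\<one>\<^bsub>E\<^esub> = finsum E c N" "finite N" "0 \<notin> N" "ALL n:N. c n : component E n"
  using I[of "\<one>\<^bsub>E\<^esub>"] by auto
 have D: "0 < D 0" using D0 by simp
 have "lam 0 \<one>\<^bsub>E\<^esub> 0 = (\<Oplus>n\<in>N. lam 0 (c n) 0)" unfolding N(1) using N(4) comp_closed by (intro lam_finsum D) auto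
 also have "... = \<zero>"
 proof (rule add.finprod_one_eqI)
  fix n assume "n : N"
  then have "c n : component E n" "n ~= 0" using N(3,4) by metis+
  then show "lam 0 (c n) 0 = \<zero>" using lam_other D by blast
 qed
 finally show False using lam_one one_not_zero by simp
qed

end

section \<open>The Koszul dual pair\<close>

locale koszul_dual = A: connected k \<iota> A + R: connected k \<kappa> R
 for k :: "('k, 'y) ring_scheme" and \<iota> :: "'k => 'a" and A :: "('a, 'z) graded_ring_scheme" (structure)
  and \<kappa> :: "'k => 'r" and R :: "('r, 'w) graded_ring_scheme" +
 fixes g :: nat and e :: "nat => 'a" and \<epsilon> :: "nat => 'r"
 assumes A_central: "[|c : carrier k; a : carrier A|] ==> \<iota> c \<otimes>\<^bsub>A\<^esub> a = a \<otimes>\<^bsub>A\<^esub> \<iota> c"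
  and R_central: "[|c : carrier k; r : carrier R|] ==> \<kappa> c \<otimes>\<^bsub>R\<^esub> r = r \<otimes>\<^bsub>R\<^esub> \<kappa> c"
  and e_in: "t < g ==> e t : component A 1"
  and \<epsilon>_in: "t < g ==> \<epsilon> t : component R 1"
  and R_fin: "fspan k (scal \<kappa> (reg R)) (component R n)"
begin

definition rcoch :: "nat => nat => ('r => 'a) => bool" where
 "rcoch n m f \<equiv> linear_on k (scal \<kappa> (reg R)) (scal \<iota> (reg A)) (component R n) f & f : component R n \<rightarrow> component A m"

definition rdelta :: "('r => 'a) => 'r => 'a" where
 "rdelta f r = (\<Oplus>\<^bsub>A\<^esub>t\<in>{..<g}. f (\<epsilon> t \<otimes>\<^bsub>R\<^esub> r) \<otimes>\<^bsub>A\<^esub> e t)"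

end

lemma (in koszul_dual) R_zfin: "fspan k (scal \<kappa> (reg R)) (zcomponent R z)"
proof (cases "z \<ge> 0")
 case False
 interpret r: vspace k "scal \<kappa> (reg R)" by (rule R.scal_vspace) (rule reg_module[OF R.ring_axioms])
 show ?thesis using False unfolding zcomponent_def fspan_def
  by (auto intro!: exI[of _ 0] simp: r.lc_0)
qed (simp add: zcomponent_def R_fin)

text \<open>The only properties of the Ext algebra that are used for modules over it: the complex of cochains on \<open>R\<close>
itself is exact in all degrees but the one belonging to the trivial module.\<close>

locale exact_koszul_dual = koszul_dual k \<iota> A \<kappa> R g e \<epsilon>
 for k :: "('k, 'y) ring_scheme" and \<iota> :: "'k => 'a" and A :: "('a, 'z) graded_ring_scheme" (structure)
  and \<kappa> :: "'k => 'r" and R :: "('r, 'w) graded_ring_scheme" and g and e and \<epsilon> +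
 assumes rdelta_rdelta: "[|rcoch (Suc (Suc n)) m f; r : component R n|] ==> rdelta (rdelta f) r = \<zero>\<^bsub>A\<^esub>"
  and rexact_low: "[|rcoch (Suc n) 0 f; !!r. r : component R n ==> rdelta f r = \<zero>\<^bsub>A\<^esub>; r : component R (Suc n)|] ==> f r = \<zero>\<^bsub>A\<^esub>"
  and rexact: "[|rcoch (Suc n) (Suc m) f; !!r. r : component R n ==> rdelta f r = \<zero>\<^bsub>A\<^esub>|] ==>
   EX h. rcoch (Suc (Suc n)) m h & (ALL r:component R (Suc n). f r = rdelta h r)"
  and rexact_0: "rcoch 0 (Suc m) f ==> EX h. rcoch 1 m h & (ALL r:component R 0. f r = rdelta h r)"

context koszul_resolution
begin

text \<open>The pairing of Ext classes with the \<open>n\<close>-th term. It identifies elements of degree \<open>m + n\<close> in the \<open>n\<close>-th term with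
linear maps from the \<open>n\<close>-th Ext group to \<open>A\<^sub>m\<close>.\<close>

definition pr :: "nat => (nat => nat => 'p => 'p) set => 'p => 'a" where
 "pr n r y = (\<Oplus>i\<in>{..<D n}. co n y i \<otimes> lam n r i)"

abbreviation ee :: "nat => 'a" where "ee t \<equiv> co 0 (d 0 (x 1 t)) 0"

lemma ee_in: "t < D 1 ==> ee t : component A 1"
proof -
 assume "t < D 1"
 then have "x 1 t : deg (P 1) (int 1)" using x_deg[of 1] by blast
 then have "d 0 (x 1 t) : deg (P 0) 1" using d_hom[of 0] by (auto simp: graded_hom_def)
 from co_homog[OF this, of 0] D0 show ?thesis by (simp add: zcomponent_def)
qed

definition eps :: "nat => (nat => nat => 'p => 'p) set" where
 "eps t = (SOME r. r : component E 1 & (ALL i<D 1. lam 1 r i = (if i = t then \<one> else \<zero>)))"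

lemma dual_exists: "EX r. r : component E n & (ALL i<D n. lam n r i = (if i = t then \<one> else \<zero>))"
proof -
 have c: "(%i. if i = t then \<one> else \<zero>) : {..<D n} \<rightarrow> component A 0"
  using one_component RG.C_subD(2)[of 0] by auto
 obtain r where "r : component E n" "!!i. i < D n ==> lam n r i = (if i = t then \<one> else \<zero>)"
  using lam_surj[OF c] by blast
 then show ?thesis by blast
qed

lemma eps_props: "eps t : component E 1" "i < D 1 ==> lam 1 (eps t) i = (if i = t then \<one> else \<zero>)"
 using someI_ex[OF dual_exists[of 1 t]] unfolding eps_def by auto

lemma pr_closed: "[|r : carrier E; y : C n|] ==> pr n r y : carrier A"
 unfolding pr_def using co_closed lam_closed by (intro finsum_closed) auto

lemma pr_linear:
 assumes r: "r : carrier E" shows "linear_on A (P n) (reg A) (C n) (pr n r)"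
proof -
 have c: "co n y i \<otimes> lam n r i : carrier A" if "y : C n" "i < D n" for y i
  using co_closed[OF that] lam_closed[OF r that(2)] by simp
 show ?thesis unfolding linear_on_def
 proof (intro conjI ballI)
  show "pr n r : C n \<rightarrow> carrier (reg A)" using pr_closed[OF r] by auto
  fix y z assume yz: "y : C n" "z : C n"
  have "pr n r (y \<oplus>\<^bsub>P n\<^esub> z) = (\<Oplus>i\<in>{..<D n}. co n y i \<otimes> lam n r i \<oplus> co n z i \<otimes> lam n r i)"
   unfolding pr_def using yz co_closed lam_closed[OF r] c co_linear[of _ n]
   by (intro finsum_cong') (auto simp: linear_on_def l_distr)
  also have "... = pr n r y \<oplus> pr n r z" unfolding pr_def using c yz by (intro finsum_addf) auto
  finally show "pr n r (y \<oplus>\<^bsub>P n\<^esub> z) = pr n r y \<oplus>\<^bsub>reg A\<^esub> pr n r z" by simp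
 next
  fix a y assume ay: "a : carrier A" "y : C n"
  have "pr n r (a \<odot>\<^bsub>P n\<^esub> y) = (\<Oplus>i\<in>{..<D n}. a \<otimes> (co n y i \<otimes> lam n r i))"
   unfolding pr_def using ay co_closed lam_closed[OF r] c co_linear[of _ n]
   by (intro finsum_cong') (auto simp: linear_on_def m_assoc)
  also have "... = a \<otimes> pr n r y" unfolding pr_def using c ay by (intro finsum_rdistr[symmetric]) auto
  finally show "pr n r (a \<odot>\<^bsub>P n\<^esub> y) = a \<odot>\<^bsub>reg A\<^esub> pr n r y" by simp
 qed
qed

lemma pr_x: "[|r : carrier E; j < D n|] ==> pr n r (x n j) = lam n r j"
 unfolding pr_def using lam_closed[of r _ n]
 by (subst finsum_single[of _ j]) (auto simp: co_x)

lemma pr_add: "[|r : carrier E; s : carrier E; y : C n|] ==> pr n (r \<oplus>\<^bsub>E\<^esub> s) y = pr n r y \<oplus> pr n s y"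
proof -
 assume a: "r : carrier E" "s : carrier E" "y : C n"
 have "pr n (r \<oplus>\<^bsub>E\<^esub> s) y = (\<Oplus>i\<in>{..<D n}. co n y i \<otimes> lam n r i \<oplus> co n y i \<otimes> lam n s i)"
  unfolding pr_def using a co_closed lam_closed by (intro finsum_cong') (auto simp: lam_add r_distr)
 also have "... = pr n r y \<oplus> pr n s y" unfolding pr_def using a co_closed lam_closed by (intro finsum_addf) auto
 finally show ?thesis .
qed

lemma pr_kap: "[|c : carrier k; r : carrier E; y : C n|] ==> pr n (kap c \<otimes>\<^bsub>E\<^esub> r) y = \<iota> c \<otimes> pr n r y"
proof -
 assume a: "c : carrier k" "r : carrier E" "y : C n"
 have "pr n (kap c \<otimes>\<^bsub>E\<^esub> r) y = (\<Oplus>i\<in>{..<D n}. \<iota> c \<otimes> (co n y i \<otimes> lam n r i))"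
  unfolding pr_def
 proof (intro finsum_cong' refl)
  show "(%i. \<iota> c \<otimes> (co n y i \<otimes> lam n r i)) : tup (D n) (carrier A)"
   using a co_closed lam_closed \<kappa>_closed by auto
  fix i assume "i : {..<D n}"
  then have i: "i < D n" by simp
  have "co n y i \<otimes> (\<iota> c \<otimes> lam n r i) = (co n y i \<otimes> \<iota> c) \<otimes> lam n r i"
   using a i co_closed lam_closed \<kappa>_closed by (simp add: m_assoc)
  also have "... = \<iota> c \<otimes> (co n y i \<otimes> lam n r i)"
   using a i co_closed lam_closed \<kappa>_closed by (simp add: central[symmetric] m_assoc)
  finally show "co n y i \<otimes> lam n (kap c \<otimes>\<^bsub>E\<^esub> r) i = \<iota> c \<otimes> (co n y i \<otimes> lam n r i)"
   using a i by (simp add: lam_kap_mult)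
 qed
 also have "... = \<iota> c \<otimes> pr n r y" unfolding pr_def using a co_closed lam_closed \<kappa>_closed
  by (intro finsum_rdistr[symmetric]) auto
 finally show ?thesis .
qed

lemma pr_homog:
 assumes "r : carrier E" "y : deg (P n) (int (m + n))"
 shows "pr n r y : component A m"
 unfolding pr_def
proof (rule subgroup_finsum[OF abelian_group_axioms RG.C_sub], rule Pi_I)
 fix i assume "i : {..<D n}"
 then have "co n y i : component A m" "lam n r i : component A 0"
  using co_homog[OF assms(2), of i] lam_in[OF assms(1)] by (auto simp: zcomponent_def)
 then show "co n y i \<otimes> lam n r i : component A m" using component_mult[of _ m _ 0] by simp
qed

lemma pr_inj:
 assumes y: "y : C n" and z: "!!r. r : component E n ==> pr n r y = \<zero>"
 shows "y = \<zero>\<^bsub>P n\<^esub>"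
proof -
 have "co n y j = \<zero>" if j: "j < D n" for j
 proof -
  obtain r where r: "r : component E n" "ALL i<D n. lam n r i = (if i = j then \<one> else \<zero>)"
   using dual_exists by blast
  have "pr n r y = co n y j" unfolding pr_def using j r(2) co_closed[OF y]
   by (subst finsum_single[of _ j]) auto
  then show ?thesis using z[OF r(1)] by simp
 qed
 then have "lc (P n) (D n) (co n y) (x n) = lc (P n) (D n) (%_. \<zero>) (x n)"
  using co_props(1)[OF y] x_Pi by (intro P.lc_cong) auto
 then show ?thesis using co_props(2)[OF y] P.lc_zero[OF x_Pi] by simp
qed

text \<open>Under the pairing, the differential of the resolution is adjoint to multiplication by the degree-one classes:
a representative of \<open>r\<close> commutes with the differentials, and on the first term the differential is given by the
elements \<open>ee t\<close>.\<close>

lemma comp_mult_eq: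
 assumes r: "r : component E n" and z: "z : C (Suc n)"
 shows "(\<Oplus>t\<in>{..<D 1}. pr (Suc n) (r \<otimes>\<^bsub>E\<^esub> eps t) z \<otimes> ee t) = pr n r (d n z)"
proof -
 obtain F where F: "F : CM" "r = ecls F" "!!n'. n' ~= n ==> F n' = \<zero>\<^bsub>Z\<^esub> n'"
  using comp_cases[OF r] by metis
 have "EX G. G : CM & eps t = ecls G" for t using comp_closed[OF eps_props(1)] by (meson E_cases)
 then obtain G where G: "!!t. G t : CM" "!!t. eps t = ecls (G t)" by metis
 have rc: "r : carrier E" by (rule comp_closed[OF r])
 have ec: "eps t : carrier E" for t by (rule comp_closed[OF eps_props(1)])
 have eec: "ee t : carrier A" if "t < D 1" for t using ee_in[OF that] RG.C_closed by blast
 interpret ra: left_module A "reg A" by (rule reg_module[OF ring_axioms])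
 let ?L = "%z. \<Oplus>t\<in>{..<D 1}. pr (Suc n) (r \<otimes>\<^bsub>E\<^esub> eps t) z \<otimes> ee t"
 have L: "linear_on A (P (Suc n)) (reg A) (C (Suc n)) ?L"
 proof -
  have "linear_on A (P (Suc n)) (reg A) (C (Suc n)) (%z. finsum (reg A) (%t. pr (Suc n) (r \<otimes>\<^bsub>E\<^esub> eps t) z \<otimes> ee t) {..<D 1})"
  proof (rule linear_on_finsum_maps[OF P_module ra.left_module_axioms])
   fix t assume "t : {..<D 1}"
   then have t: "ee t : carrier A" using eec by simp
   show "linear_on A (P (Suc n)) (reg A) (C (Suc n)) (%z. pr (Suc n) (r \<otimes>\<^bsub>E\<^esub> eps t) z \<otimes> ee t)"
    using pr_linear[of "r \<otimes>\<^bsub>E\<^esub> eps t" "Suc n"] rc ec t unfolding linear_on_def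
    by (auto simp: l_distr m_assoc Pi_iff)
  qed
  then show ?thesis by (simp add: finsum_struct[of "reg A" A])
 qed
 have R: "linear_on A (P (Suc n)) (reg A) (C (Suc n)) (%z. pr n r (d n z))"
  by (rule linear_on_comp[OF d_linear pr_linear[OF rc]]) (auto simp: d_closed)
 show ?thesis
 proof (rule linear_eq_on_basis[OF P_module ra.left_module_axioms L R basis _ z])
  fix j assume j: "j < D (Suc n)"
  let ?z = "x (Suc n) j"
  have zc: "?z : C (Suc n)" by (rule x_closed[OF j])
  define w where "w = F n (Suc 0) ?z"
  have w: "w : C (Suc 0)" unfolding w_def by (rule cm_closed[OF F(1) zc]) simp
  have wa: "co 1 w s : carrier A" if "s < D 1" for s using co_closed[of w 1 s] w that by simp
  have 1: "pr (Suc n) (r \<otimes>\<^bsub>E\<^esub> eps t) ?z = rcomp A (co 1 w t) 0" if t: "t < D 1" for t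
  proof -
   have "pr (Suc n) (r \<otimes>\<^bsub>E\<^esub> eps t) ?z = au ((F \<otimes>\<^bsub>Z\<^esub> G t) (Suc n) 0 ?z)"
   proof -
    have re: "r \<otimes>\<^bsub>E\<^esub> eps t : carrier E" using rc ec by simp
    have "r \<otimes>\<^bsub>E\<^esub> eps t = ecls (F \<otimes>\<^bsub>Z\<^esub> G t)" unfolding F(2) G(2) by (rule E_simps(5)[OF F(1) G(1)])
    then show ?thesis using pr_x[OF re j] lam_ecls[OF Z_mult_closed[OF F(1) G(1)] j, of t] by simp
   qed
   also have "(F \<otimes>\<^bsub>Z\<^esub> G t) (Suc n) 0 ?z = (\<Oplus>\<^bsub>P 0\<^esub>i\<in>{..Suc n}. G t (Suc n - i) 0 (F i (Suc n - i) ?z))"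
    using zc by (simp add: Z_mult)
   also have "... = G t 1 0 w"
   proof (subst P.M.finsum_single[of _ n])
    fix i assume i: "i : {..Suc n}" "i ~= n"
    have "F i (Suc n - i) ?z = \<zero>\<^bsub>P (Suc n - i)\<^esub>" using F(3)[OF i(2)] zc i(1) by (simp add: Z_simps)
    then show "G t (Suc n - i) 0 (F i (Suc n - i) ?z) = \<zero>\<^bsub>P 0\<^esub>" by (simp add: cm_zero[OF G(1)])
   next
    show "G t (Suc n - n) 0 (F n (Suc n - n) ?z) : C 0"
     using cm_closed[OF G(1), of w 1 0 1 t] w by (simp add: w_def)
   qed (auto simp: w_def)
   also have "G t 1 0 w = (\<Oplus>\<^bsub>P 0\<^esub>s\<in>{..<D 1}. co 1 w s \<odot>\<^bsub>P 0\<^esub> G t 1 0 (x 1 s))"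
    using linear_on_lc[OF P_module P_module P.carrier_submodule cm_lin[OF G(1), of 1 0 1 t] co_props(1)[of w 1] x_Pi]
     co_props(2)[of w 1] w by (simp add: lc_def)
   finally have "pr (Suc n) (r \<otimes>\<^bsub>E\<^esub> eps t) ?z = au (\<Oplus>\<^bsub>P 0\<^esub>s\<in>{..<D 1}. co 1 w s \<odot>\<^bsub>P 0\<^esub> G t 1 0 (x 1 s))" .
   also have "... = (\<Oplus>s\<in>{..<D 1}. rcomp A (co 1 w s) 0 \<otimes> lam 1 (eps t) s)"
   proof -
    have Gx: "G t 1 0 (x 1 s) : C 0" if "s < D 1" for s
     using cm_closed[OF G(1) x_closed[OF that], of 0 1] by simp
    have "au (\<Oplus>\<^bsub>P 0\<^esub>s\<in>{..<D 1}. co 1 w s \<odot>\<^bsub>P 0\<^esub> G t 1 0 (x 1 s)) = (\<Oplus>s\<in>{..<D 1}. au (co 1 w s \<odot>\<^bsub>P 0\<^esub> G t 1 0 (x 1 s)))"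
     using Gx wa by (intro au_finsum) (auto simp: P.smult_closed)
    also have "... = (\<Oplus>s\<in>{..<D 1}. rcomp A (co 1 w s) 0 \<otimes> lam 1 (eps t) s)"
     using Gx wa lam_closed[OF ec] by (intro finsum_cong') (auto simp: au_smult G(2)[of t] lam_ecls[OF G(1)] RG.hcomp_carrier au_closed)
    finally show ?thesis .
   qed
   also have "... = rcomp A (co 1 w t) 0"
    using t wa by (subst finsum_single[of _ t]) (auto simp: eps_props(2)[unfolded One_nat_def] RG.hcomp_carrier)
   finally show ?thesis .
  qed
  have 2: "rcomp A (co 0 (d 0 w) 0) 1 = (\<Oplus>t\<in>{..<D 1}. rcomp A (co 1 w t) 0 \<otimes> ee t)"
  proof -
   have l: "linear_on A (P 1) (reg A) (C 1) (%w. co 0 (d 0 w) 0)"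
    using linear_on_comp[OF d_linear[of 0] co_linear[of 0 0]] D0 by (simp add: d_closed)
   have "co 0 (d 0 w) 0 = (\<Oplus>t\<in>{..<D 1}. co 1 w t \<otimes> ee t)"
    using linear_on_lc[OF P_module ra.left_module_axioms P.carrier_submodule l co_props(1)[of w 1] x_Pi]
     co_props(2)[of w 1] w by (simp add: lc_def finsum_struct[of "reg A" A])
   then have "rcomp A (co 0 (d 0 w) 0) 1 = (\<Oplus>t\<in>{..<D 1}. rcomp A (co 1 w t \<otimes> ee t) 1)"
    using wa eec by (simp add: RG.hcomp_finsum Pi_iff)
   also have "... = (\<Oplus>t\<in>{..<D 1}. rcomp A (co 1 w t) 0 \<otimes> ee t)"
   proof (intro finsum_cong' refl)
    show "(%t. rcomp A (co 1 w t) 0 \<otimes> ee t) : {..<D 1} \<rightarrow> carrier A"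
     using wa eec RG.hcomp_carrier by auto
    fix t assume "t : {..<D 1}"
    then have t: "t < D 1" by simp
    show "rcomp A (co 1 w t \<otimes> ee t) 1 = rcomp A (co 1 w t) 0 \<otimes> ee t"
     using rcomp_mult_r[OF ee_in[OF t] wa[OF t], of 0] by simp
   qed
   finally show ?thesis .
  qed
  have 3: "d 0 w = F n 0 (d n ?z)" unfolding w_def by (rule cm_comm[OF F(1) zc]) simp
  have dz: "d n ?z : C n" by (rule d_closed[OF zc])
  have Fx: "F n 0 (x n i) : C 0" if "i < D n" for i using cm_closed[OF F(1) x_closed[OF that], of 0 n] by simp
  have D00: "0 < D 0" using D0 by simp
  have 4: "rcomp A (co 0 (F n 0 (d n ?z)) 0) 1 = pr n r (d n ?z)"
  proof -
   have l: "linear_on A (P n) (reg A) (C n) (%w. co 0 (F n 0 w) 0)"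
    using linear_on_comp[OF cm_lin[OF F(1), of n 0 n] co_linear[OF D00]] cm_closed[OF F(1), of _ n 0 n] by simp
   have c1: "co n (d n ?z) i : component A 1" if "i < D n" for i
   proof -
    have "?z : deg (P (Suc n)) (int (Suc n))" using x_deg[of "Suc n"] j by blast
    then have "d n ?z : deg (P n) (int (Suc n))" using d_hom[of n] by (auto simp: graded_hom_def)
    from co_homog[OF this that] show ?thesis by (simp add: zcomponent_def)
   qed
   have c1c: "co n (d n ?z) i : carrier A" if "i < D n" for i using c1[OF that] RG.C_closed by blast
   have "co 0 (F n 0 (d n ?z)) 0 = (\<Oplus>i\<in>{..<D n}. co n (d n ?z) i \<otimes> co 0 (F n 0 (x n i)) 0)"
    using linear_on_lc[OF P_module ra.left_module_axioms P.carrier_submodule l co_props(1)[OF dz] x_Pi]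
     co_props(2)[OF dz] by (simp add: lc_def finsum_struct[of "reg A" A])
   then have "rcomp A (co 0 (F n 0 (d n ?z)) 0) 1 = (\<Oplus>i\<in>{..<D n}. rcomp A (co n (d n ?z) i \<otimes> co 0 (F n 0 (x n i)) 0) 1)"
    using c1c co_closed[OF Fx D00] by (simp add: RG.hcomp_finsum Pi_iff)
   also have "... = pr n r (d n ?z)" unfolding pr_def
   proof (intro finsum_cong' refl)
    show "(%i. co n (d n ?z) i \<otimes> lam n r i) : tup (D n) (carrier A)" using c1c lam_closed[OF rc] by auto
    fix i assume "i : {..<D n}"
    then have i: "i < D n" by simp
    have "lam n r i = rcomp A (co 0 (F n 0 (x n i)) 0) 0"
     unfolding F(2) lam_ecls[OF F(1) i] au_def ..
    then show "rcomp A (co n (d n ?z) i \<otimes> co 0 (F n 0 (x n i)) 0) 1 = co n (d n ?z) i \<otimes> lam n r i"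
     using rcomp_mult_l[OF c1[OF i] co_closed[OF Fx[OF i] D00], of 0] by simp
   qed
   finally show ?thesis .
  qed
  have "?L ?z = (\<Oplus>t\<in>{..<D 1}. rcomp A (co 1 w t) 0 \<otimes> ee t)"
   using 1 wa eec by (intro finsum_cong') (auto simp: RG.hcomp_carrier)
  also have "... = pr n r (d n ?z)" using 2 3 4 by simp
  finally show "?L ?z = pr n r (d n ?z)" .
 qed
qed

lemma comp_decomp:
 assumes G: "graded_ring (opposite E)" and r: "r : component E n"
  and s: "!!i. i < D n ==> s i : component E n & (ALL j<D n. lam n (s i) j = (if j = i then \<one> else \<zero>))"
  and c: "!!i. i < D n ==> c i : carrier k & lam n r i = \<iota> (c i)"
 shows "r = (\<Oplus>\<^bsub>E\<^esub>i\<in>{..<D n}. kap (c i) \<otimes>\<^bsub>E\<^esub> s i)"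
proof -
 interpret G: graded_ring "opposite E" by (rule G)
 have rc: "r : carrier E" by (rule comp_closed[OF r])
 have sc: "s i : carrier E" if "i < D n" for i using s[OF that] comp_closed by blast
 have kc: "kap (c i) : carrier E" if "i < D n" for i using c[OF that] kap_in comp_closed by blast
 let ?t = "\<Oplus>\<^bsub>E\<^esub>i\<in>{..<D n}. kap (c i) \<otimes>\<^bsub>E\<^esub> s i"
 have tc: "?t : carrier E" using sc kc by (intro E.finsum_closed) auto
 have sub: "subgroup (component E n) (add_monoid E)"
  using G.RG.C_sub[of n] subgroup_struct[of "opposite E" E] by simp
 have "kap (c i) \<otimes>\<^bsub>E\<^esub> s i : component E n" if "i < D n" for i
  using G.component_mult[of "s i" n "kap (c i)" 0] s[OF that] kap_in c[OF that] by simp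
 then have tE: "?t : component E n" by (intro subgroup_finsum[OF E.abelian_group_axioms sub]) auto
 note subD = subgroup_addD[OF E.abelian_group_axioms sub]
 have "lam n ?t j = lam n r j" if j: "j < D n" for j
 proof -
  have "lam n ?t j = (\<Oplus>i\<in>{..<D n}. lam n (kap (c i) \<otimes>\<^bsub>E\<^esub> s i) j)"
   using sc kc j by (intro lam_finsum) auto
  also have "... = (\<Oplus>i\<in>{..<D n}. if i = j then \<iota> (c i) else \<zero>)"
   using c s sc j \<kappa>_closed by (intro finsum_cong') (auto simp: lam_kap_mult)
  also have "... = \<iota> (c j)" using j c \<kappa>_closed by (subst finsum_single[of _ j]) auto
  finally show ?thesis using c[OF j] by simp
 qed
 then have "lam n (r \<oplus>\<^bsub>E\<^esub> \<ominus>\<^bsub>E\<^esub> ?t) j = \<zero>" if "j < D n" for j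
  using that rc tc lam_closed[OF rc that] by (simp add: lam_add lam_minus r_neg)
 moreover have "r \<oplus>\<^bsub>E\<^esub> \<ominus>\<^bsub>E\<^esub> ?t : component E n" using r tE subD(3,4) by blast
 ultimately have "r \<oplus>\<^bsub>E\<^esub> \<ominus>\<^bsub>E\<^esub> ?t = \<zero>\<^bsub>E\<^esub>" by (intro lam_inj) auto
 then show ?thesis using E.diff_zero_imp_eq[OF rc tc] by (simp add: a_minus_def)
qed

end

lemma (in connected) component_submodule: "submodule (component R n) k (scal \<kappa> (reg R))"
proof -
 interpret r: vspace k "scal \<kappa> (reg R)" by (rule scal_vspace) (rule reg_module[OF ring_axioms])
 show ?thesis
  using RG.C_subD component_mult[OF \<kappa>_in] by (intro submoduleI'[OF r.left_module_axioms]) auto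
qed

lemma (in koszul_dual) rdelta_cong:
 assumes "!!s. s : component R (Suc n) ==> f s = h s" "r : component R n" "f : component R (Suc n) \<rightarrow> carrier A"
 shows "rdelta f r = rdelta h r"
proof -
 have *: "\<epsilon> t \<otimes>\<^bsub>R\<^esub> r : component R (Suc n)" if "t < g" for t
  using R.component_mult[OF \<epsilon>_in[OF that] assms(2)] by simp
 have "h s : carrier A" if "s : component R (Suc n)" for s using assms(1,3) that by (metis PiE)
 then show ?thesis unfolding rdelta_def using * assms(1) A.RG.C_closed[OF e_in]
  by (intro A.finsum_cong') auto
qed

context koszul_resolution
begin

lemma connected_opposite:
 assumes G: "graded_ring (opposite E)"
 shows "connected k kap (opposite E)"
proof -
 have "kap : ring_hom k (opposite E)"
 proof (rule ring_hom_memI)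
  fix a b assume ab: "a : carrier k" "b : carrier k"
  show "kap a : carrier (opposite E)" using ring_hom_closed[OF kap_hom ab(1)] by simp
  show "kap (a \<oplus>\<^bsub>k\<^esub> b) = kap a \<oplus>\<^bsub>opposite E\<^esub> kap b" using ring_hom_add[OF kap_hom ab] by simp
  show "kap (a \<otimes>\<^bsub>k\<^esub> b) = kap a \<otimes>\<^bsub>opposite E\<^esub> kap b"
   using ring_hom_mult[OF kap_hom ab] kap_central[OF ab(1) ring_hom_closed[OF kap_hom ab(2)]] by simp
 qed (simp add: kap_one)
 then show ?thesis using G kap_bij[OF G] K.field_axioms
  by (simp add: connected_def connected_axioms_def)
qed

text \<open>Cochains on the Ext algebra are elements of the resolution by the pairing, and the coboundary becomes its
differential. The exactness statements are therefore those of the resolution, split into internal degrees.\<close>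

lemma koszul_dual_opposite:
 assumes G: "graded_ring (opposite E)"
 shows "exact_koszul_dual k \<iota> A kap (opposite E) (D 1) ee eps"
proof -
 let ?R = "opposite E"
 let ?V = "scal kap (reg ?R)" and ?W = "scal \<iota> (reg A)"
 interpret R: connected k kap ?R by (rule connected_opposite[OF G])
 interpret V: vspace k ?V by (rule R.scal_vspace) (rule reg_module[OF R.ring_axioms])
 interpret W: vspace k ?W by (rule scal_vspace) (rule reg_module[OF ring_axioms])
 define s where "s n t = (SOME r. r : component E n & (ALL i<D n. lam n r i = (if i = t then \<one> else \<zero>)))" for n t
 have s: "s n t : component E n" "i < D n ==> lam n (s n t) i = (if i = t then \<one> else \<zero>)" for n t i
  using someI_ex[OF dual_exists[of n t]] unfolding s_def by auto
 have decomp: "EX c:{..<D n} \<rightarrow> carrier k. r = lc ?V (D n) c (s n) & (ALL i<D n. lam n r i = \<iota> (c i))" if r: "r : component E n" for n r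
 proof -
  have "EX c. i < D n --> c : carrier k & lam n r i = \<iota> c" for i
   using \<kappa>_surj[OF lam_in[OF comp_closed[OF r]]] by blast
  then obtain c where c: "!!i. i < D n ==> c i : carrier k & lam n r i = \<iota> (c i)" by metis
  have "lc ?V (D n) c (s n) = (\<Oplus>\<^bsub>E\<^esub>i\<in>{..<D n}. s n i \<otimes>\<^bsub>E\<^esub> kap (c i))"
   unfolding lc_def by (simp add: finsum_struct[of ?V E])
  also have "... = (\<Oplus>\<^bsub>E\<^esub>i\<in>{..<D n}. kap (c i) \<otimes>\<^bsub>E\<^esub> s n i)"
  proof (intro E.finsum_cong' refl)
   have "kap (c i) : carrier E" if "i < D n" for i using kap_in c[OF that] comp_closed by blast
   then show "(%i. kap (c i) \<otimes>\<^bsub>E\<^esub> s n i) : tup (D n) (carrier E)" using comp_closed[OF s(1)] by auto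
   fix i assume "i : {..<D n}"
   then show "s n i \<otimes>\<^bsub>E\<^esub> kap (c i) = kap (c i) \<otimes>\<^bsub>E\<^esub> s n i"
    using kap_central[of "c i" "s n i"] c comp_closed[OF s(1)] by auto
  qed
  also have "... = r" by (rule comp_decomp[OF G r, symmetric]) (use s c in auto)
  finally show ?thesis using c by (intro bexI[of _ c]) auto
 qed
 interpret KD: koszul_dual k \<iota> A kap ?R "D 1" ee eps
 proof (intro koszul_dual.intro koszul_dual_axioms.intro)
  fix n
  show "fspan k ?V (component ?R n)" unfolding fspan_def using s(1) decomp
   by (intro exI[of _ "D n"] exI[of _ "s n"]) fastforce
 qed (use connected_axioms R.connected_axioms central kap_central ee_in eps_props(1) in auto)
 have rep: "EX y:deg (P n) (int (m + n)). ALL r:component E n. f r = pr n r y" if f: "KD.rcoch n m f" for n m f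
 proof -
  have fl: "linear_on k ?V ?W (component E n) f" and fc: "f : component E n \<rightarrow> component A m"
   using f by (auto simp: KD.rcoch_def)
  have fs: "f (s n i) : component A m" "f (s n i) : carrier A" for i using fc s(1) RG.C_closed by blast+
  define y where "y = lc (P n) (D n) (%i. f (s n i)) (x n)"
  have y: "y : deg (P n) (int (m + n))"
   using PG.lc_homog[of "%i. f (s n i)" "D n" "int m" "x n" n "int n"] fs x_deg[of n] by (simp add: y_def zcomponent_def)
  have cy: "co n y i = f (s n i)" if "i < D n" for i
   unfolding y_def by (rule P.coord_unique[OF basis P.carrier_submodule _ refl that]) (use fs in auto)
  have "f r = pr n r y" if r: "r : component E n" for r
  proof -
   obtain c where c: "c : tup (D n) (carrier k)" "r = lc ?V (D n) c (s n)" "ALL i<D n. lam n r i = \<iota> (c i)"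
    using decomp[OF r] by blast
   have sm: "submodule (component E n) k ?V" using R.component_submodule[of n] by simp
   have "f r = lc ?W (D n) c (%i. f (s n i))"
    unfolding c(2) by (rule linear_on_lc[OF V.left_module_axioms W.left_module_axioms sm fl c(1)]) (use s in auto)
   also have "... = (\<Oplus>i\<in>{..<D n}. \<iota> (c i) \<otimes> f (s n i))" unfolding lc_def by (simp add: finsum_struct[of ?W A])
   also have "... = pr n r y" unfolding pr_def using c cy fs \<kappa>_closed
    by (intro finsum_cong') (auto simp: central Pi_iff)
   finally show ?thesis .
  qed
  then show ?thesis using y by blast
 qed
 have rcoch_pr: "KD.rcoch n m (%r. pr n r y)" if y: "y : deg (P n) (int (m + n))" for n m y
 proof -
  have yc: "y : C n" using PG.MG.C_closed[OF y] .
  show ?thesis unfolding KD.rcoch_def linear_on_def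
  proof (intro conjI ballI)
   fix c r assume c: "c : carrier k" "r : component ?R n"
   show "pr n (c \<odot>\<^bsub>?V\<^esub> r) y = c \<odot>\<^bsub>?W\<^esub> pr n r y"
    using pr_kap[OF c(1) _ yc, of r] kap_central[OF c(1), of r] comp_closed[of r n] c(2) by simp
  qed (use comp_closed pr_add[OF _ _ yc] pr_homog[OF _ y] pr_closed[OF _ yc] in auto)
 qed
 have rd: "KD.rdelta (%r. pr (Suc n) r y) r = pr n r (d n y)" if "r : component E n" "y : C (Suc n)" for n r y
  unfolding KD.rdelta_def using comp_mult_eq[OF that] by simp
 have rdf: "KD.rdelta f r = pr n r (d n y)"
  if f: "KD.rcoch (Suc n) m f" and y: "y : deg (P (Suc n)) (int (m + Suc n))" "ALL r:component E (Suc n). f r = pr (Suc n) r y"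
   and r: "r : component E n" for n m f y r
 proof -
  have "KD.rdelta f r = KD.rdelta (%r. pr (Suc n) r y) r"
  proof (rule KD.rdelta_cong[of n])
   show "f : component ?R (Suc n) \<rightarrow> carrier A" using f RG.C_closed unfolding KD.rcoch_def by blast
  qed (use y(2) r in auto)
  then show ?thesis using rd[OF r PG.MG.C_closed[OF y(1)]] by simp
 qed
 have homog: "EX z:deg (P (Suc n)) q. d n z = y" if z: "z : C (Suc n)" "d n z = y" and y: "y : deg (P n) q" for n z y q
 proof -
  have "d n (mcomp (P (Suc n)) z q) = mcomp (P n) (d n z) q" by (rule graded_hom_mcomp[OF P_graded P_graded d_hom z(1)])
  also have "... = y" using PG.MG.hcomp_homog[OF y, of q] z(2) by simp
  finally show ?thesis using PG.MG.hcomp_props(1)[OF z(1)] by blast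
 qed
 show ?thesis
 proof (intro exact_koszul_dual.intro exact_koszul_dual_axioms.intro)
  show "koszul_dual k \<iota> A kap ?R (D 1) ee eps" by (rule KD.koszul_dual_axioms)
 next
  fix n m f r assume f: "KD.rcoch (Suc (Suc n)) m f" and r: "r : component ?R n"
  obtain y where y: "y : deg (P (Suc (Suc n))) (int (m + Suc (Suc n)))" "ALL r:component E (Suc (Suc n)). f r = pr (Suc (Suc n)) r y"
   using rep[OF f] by blast
  note yc = PG.MG.C_closed[OF y(1)]
  have d1: "KD.rdelta f s = pr (Suc n) s (d (Suc n) y)" if "s : component E (Suc n)" for s by (rule rdf[OF f y that])
  have "KD.rdelta (KD.rdelta f) r = KD.rdelta (%s. pr (Suc n) s (d (Suc n) y)) r"
  proof (rule KD.rdelta_cong[of n])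
   show "KD.rdelta f : component ?R (Suc n) \<rightarrow> carrier A" using d1 pr_closed comp_closed d_closed[OF yc] by auto
  qed (use d1 r in auto)
  also have "... = pr n r (d n (d (Suc n) y))" using rd[of r n] r d_closed[OF yc] by simp
  also have "... = \<zero>" unfolding dd[OF yc]
   using linear_on_zero[OF P_module reg_module[OF ring_axioms] P.carrier_submodule pr_linear[OF comp_closed]] r by simp
  finally show "KD.rdelta (KD.rdelta f) r = \<zero>" .
 next
  fix n f r assume f: "KD.rcoch (Suc n) 0 f" and z: "!!r. r : component ?R n ==> KD.rdelta f r = \<zero>" and r: "r : component ?R (Suc n)"
  obtain y where y: "y : deg (P (Suc n)) (int (0 + Suc n))" "ALL r:component E (Suc n). f r = pr (Suc n) r y"
   using rep[OF f] by blast
  note yc = PG.MG.C_closed[OF y(1)]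
  have "d n y = \<zero>\<^bsub>P n\<^esub>" by (rule pr_inj[OF d_closed[OF yc]]) (use rdf[OF f y] z in simp)
  then obtain w where "w : C (Suc (Suc n))" "d (Suc n) w = y" using exact_Suc[OF yc] by blast
  then obtain w where w: "w : deg (P (Suc (Suc n))) (int (Suc n))" "d (Suc n) w = y" using homog y(1) by (metis add_0)
  have "w = \<zero>\<^bsub>P (Suc (Suc n))\<^esub>" using w(1) basis_bounded[OF P_graded basis x_deg, of "int (Suc n)" "Suc (Suc n)"] by auto
  then have "y = \<zero>\<^bsub>P (Suc n)\<^esub>" using w(2) d_zero by simp
  then show "f r = \<zero>" using y(2) r linear_on_zero[OF P_module reg_module[OF ring_axioms] P.carrier_submodule pr_linear[OF comp_closed]] by simp
 next
  fix n m f assume f: "KD.rcoch (Suc n) (Suc m) f" and z: "!!r. r : component ?R n ==> KD.rdelta f r = \<zero>"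
  obtain y where y: "y : deg (P (Suc n)) (int (Suc m + Suc n))" "ALL r:component E (Suc n). f r = pr (Suc n) r y"
   using rep[OF f] by blast
  note yc = PG.MG.C_closed[OF y(1)]
  have "d n y = \<zero>\<^bsub>P n\<^esub>" by (rule pr_inj[OF d_closed[OF yc]]) (use rdf[OF f y] z in simp)
  then obtain w where "w : C (Suc (Suc n))" "d (Suc n) w = y" using exact_Suc[OF yc] by blast
  then obtain w where w: "w : deg (P (Suc (Suc n))) (int (Suc m + Suc n))" "d (Suc n) w = y" using homog y(1) by metis
  have "w : deg (P (Suc (Suc n))) (int (m + Suc (Suc n)))" using w(1) by simp
  from rcoch_pr[OF this] show "EX h. KD.rcoch (Suc (Suc n)) m h & (ALL r:component ?R (Suc n). f r = KD.rdelta h r)"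
   using y(2) rd[of _ "Suc n" w] w(2) PG.MG.C_closed[OF w(1)] by (intro exI[of _ "%r. pr (Suc (Suc n)) r w"]) auto
 next
  fix m f assume f: "KD.rcoch 0 (Suc m) f"
  obtain y where y: "y : deg (P 0) (int (Suc m + 0))" "ALL r:component E 0. f r = pr 0 r y"
   using rep[OF f] by blast
  note yc = PG.MG.C_closed[OF y(1)]
  have c: "co 0 y 0 : component A (Suc m)" using co_homog[OF y(1), of 0] D0 by (simp add: zcomponent_def nat_add_distrib)
  have "rcomp A (co 0 y 0) 0 = \<zero>" using RG.hcomp_homog[OF c, of 0] by simp
  then obtain w where "w : C (Suc 0)" "d 0 w = y" using exact_0[OF yc] by blast
  then obtain w where w: "w : deg (P (Suc 0)) (int (Suc m + 0))" "d 0 w = y" using homog y(1) by metis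
  have "w : deg (P 1) (int (m + 1))" using w(1) by simp
  from rcoch_pr[OF this] show "EX h. KD.rcoch 1 m h & (ALL r:component ?R 0. f r = KD.rdelta h r)"
   using y(2) rd[of _ 0 w] w(2) PG.MG.C_closed[OF w(1)] by (intro exI[of _ "%r. pr 1 r w"]) auto
 qed
qed

end

section \<open>Cochains on graded modules over the dual ring\<close>

context exact_koszul_dual
begin

abbreviation Aw where "Aw \<equiv> scal \<iota> (reg A)"

lemma Aw_module: "left_module k Aw"
 using A.scal_vspace[OF reg_module[OF A.ring_axioms]] by (simp add: vspace_def)

definition coch :: "('r, 'm) graded_module => int => nat => ('m => 'a) => bool" where
 "coch M j m f \<equiv> linear_on k (scal \<kappa> M) Aw (deg M j) f & f : deg M j \<rightarrow> component A m"

definition delta :: "('r, 'm) graded_module => ('m => 'a) => 'm => 'a" where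
 "delta M f x = (\<Oplus>t\<in>{..<g}. f (\<epsilon> t \<odot>\<^bsub>M\<^esub> x) \<otimes> e t)"

definition cob :: "('r, 'm) graded_module => int => nat => ('m => 'a) => bool" where
 "cob M j m f \<equiv> (case m of 0 => ALL x:deg M j. f x = \<zero>
   | Suc n => EX h. coch M (j + 1) n h & (ALL x:deg M j. f x = delta M h x))"

text \<open>Exactness at \<open>Hom(M\<^sub>j, A\<^sub>m)\<close>. For \<open>m = 0\<close> there is nothing to the left, so coboundaries are zero there.\<close>

definition exact_at :: "('r, 'm) graded_module => int => nat => bool" where
 "exact_at M j m \<equiv> (ALL f. coch M j m f --> (ALL x:deg M (j - 1). delta M f x = \<zero>) --> cob M j m f)"

lemma cochD:
 assumes "coch M j m f"
 shows "x : deg M j ==> f x : component A m" "x : deg M j ==> f x : carrier A"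
  "[|x : deg M j; y : deg M j|] ==> f (x \<oplus>\<^bsub>M\<^esub> y) = f x \<oplus> f y"
  "[|c : carrier k; x : deg M j|] ==> f (\<kappa> c \<odot>\<^bsub>M\<^esub> x) = \<iota> c \<otimes> f x"
 using assms A.RG.C_closed unfolding coch_def linear_on_def by auto

lemma cochI:
 assumes "!!x. x : deg M j ==> f x : component A m"
  "!!x y. [|x : deg M j; y : deg M j|] ==> f (x \<oplus>\<^bsub>M\<^esub> y) = f x \<oplus> f y"
  "!!c x. [|c : carrier k; x : deg M j|] ==> f (\<kappa> c \<odot>\<^bsub>M\<^esub> x) = \<iota> c \<otimes> f x"
 shows "coch M j m f"
 unfolding coch_def linear_on_def
proof (intro conjI ballI Pi_I)
 show "f x : carrier Aw" if "x : deg M j" for x using A.RG.C_closed[OF assms(1)[OF that]] by simp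
qed (use assms in simp_all)

lemma e_closed: "t < g ==> e t : carrier A"
 using e_in A.RG.C_closed by blast

lemma eps_closed: "t < g ==> \<epsilon> t : carrier R"
 using \<epsilon>_in R.RG.C_closed by blast

lemma eps_smult: "[|grmod R M; t < g; x : deg M (j - 1)|] ==> \<epsilon> t \<odot>\<^bsub>M\<^esub> x : deg M j"
 using graded_left_module.component_smult[of R M "\<epsilon> t" 1 x "j - 1"] \<epsilon>_in by simp

lemma delta_term:
 assumes "grmod R M" "coch M j m f" "t < g" "x : deg M (j - 1)"
 shows "f (\<epsilon> t \<odot>\<^bsub>M\<^esub> x) \<otimes> e t : component A (Suc m)" "f (\<epsilon> t \<odot>\<^bsub>M\<^esub> x) \<otimes> e t : carrier A"
 using A.component_mult[OF cochD(1)[OF assms(2) eps_smult[OF assms(1,3,4)]] e_in[OF assms(3)]] A.RG.C_closed by auto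

lemma delta_coch:
 assumes M: "grmod R M" and f: "coch M j m f"
 shows "coch M (j - 1) (Suc m) (delta M f)"
proof -
 interpret M: graded_left_module R M by fact
 note t = delta_term[OF M f]
 note es = eps_smult[OF M]
 show ?thesis
 proof (rule cochI)
  fix x assume x: "x : deg M (j - 1)"
  show "delta M f x : component A (Suc m)" unfolding delta_def
   using t(1)[OF _ x] by (intro subgroup_finsum[OF A.abelian_group_axioms A.RG.C_sub]) auto
  fix y assume y: "y : deg M (j - 1)"
  have "delta M f (x \<oplus>\<^bsub>M\<^esub> y) = (\<Oplus>s\<in>{..<g}. f (\<epsilon> s \<odot>\<^bsub>M\<^esub> x) \<otimes> e s \<oplus> f (\<epsilon> s \<odot>\<^bsub>M\<^esub> y) \<otimes> e s)"
   unfolding delta_def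
  proof (intro A.finsum_cong' refl)
   fix s assume "s : {..<g}"
   then have s: "s < g" by simp
   show "f (\<epsilon> s \<odot>\<^bsub>M\<^esub> (x \<oplus>\<^bsub>M\<^esub> y)) \<otimes> e s = f (\<epsilon> s \<odot>\<^bsub>M\<^esub> x) \<otimes> e s \<oplus> f (\<epsilon> s \<odot>\<^bsub>M\<^esub> y) \<otimes> e s"
    using M.smult_r_distr[OF eps_closed[OF s] M.MG.C_closed[OF x] M.MG.C_closed[OF y]]
     cochD(3)[OF f es[OF s x] es[OF s y]] cochD(2)[OF f es[OF s x]] cochD(2)[OF f es[OF s y]] e_closed[OF s]
    by (simp add: A.l_distr)
  qed (use t(2)[OF _ x] t(2)[OF _ y] in auto)
  also have "... = delta M f x \<oplus> delta M f y" unfolding delta_def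
   using t(2)[OF _ x] t(2)[OF _ y] by (intro A.finsum_addf) auto
  finally show "delta M f (x \<oplus>\<^bsub>M\<^esub> y) = delta M f x \<oplus> delta M f y" .
 next
  fix c x assume c: "c : carrier k" and x: "x : deg M (j - 1)"
  have "delta M f (\<kappa> c \<odot>\<^bsub>M\<^esub> x) = (\<Oplus>s\<in>{..<g}. \<iota> c \<otimes> (f (\<epsilon> s \<odot>\<^bsub>M\<^esub> x) \<otimes> e s))"
   unfolding delta_def
  proof (intro A.finsum_cong' refl)
   fix s assume "s : {..<g}"
   then have s: "s < g" by simp
   have "\<epsilon> s \<odot>\<^bsub>M\<^esub> (\<kappa> c \<odot>\<^bsub>M\<^esub> x) = \<kappa> c \<odot>\<^bsub>M\<^esub> (\<epsilon> s \<odot>\<^bsub>M\<^esub> x)"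
    using M.smult_assoc[OF eps_closed[OF s] R.\<kappa>_closed[OF c] M.MG.C_closed[OF x]]
     M.smult_assoc[OF R.\<kappa>_closed[OF c] eps_closed[OF s] M.MG.C_closed[OF x]] R_central[OF c eps_closed[OF s]] by simp
   then show "f (\<epsilon> s \<odot>\<^bsub>M\<^esub> (\<kappa> c \<odot>\<^bsub>M\<^esub> x)) \<otimes> e s = \<iota> c \<otimes> (f (\<epsilon> s \<odot>\<^bsub>M\<^esub> x) \<otimes> e s)"
    using cochD(4)[OF f c es[OF s x]] cochD(2)[OF f es[OF s x]] e_closed[OF s] A.\<kappa>_closed[OF c] by (simp add: A.m_assoc)
  qed (use t(2)[OF _ x] A.\<kappa>_closed[OF c] in auto)
  also have "... = \<iota> c \<otimes> delta M f x" unfolding delta_def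
   using t(2)[OF _ x] A.\<kappa>_closed[OF c] by (intro A.finsum_rdistr[symmetric]) auto
  finally show "delta M f (\<kappa> c \<odot>\<^bsub>M\<^esub> x) = \<iota> c \<otimes> delta M f x" .
 qed
qed

lemma delta_cong:
 assumes M: "grmod R M" and f: "coch M j m f" and eq: "!!y. y : deg M j ==> f y = h y"
  and x: "x : deg M (j - 1)"
 shows "delta M f x = delta M h x"
 unfolding delta_def using delta_term(2)[OF M f _ x] eq[OF eps_smult[OF M _ x]] by (intro A.finsum_cong') auto

lemma coch_sub:
 assumes M: "grmod R M" and f: "coch M j m f" and h: "coch M j m h"
 shows "coch M j m (%x. f x \<ominus> h x)"
proof (rule cochI)
 fix x assume x: "x : deg M j"
 note fx = cochD(1,2)[OF f x] and hx = cochD(1,2)[OF h x]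
 show "f x \<ominus> h x : component A m" using fx hx A.RG.C_subD(3,4) by (simp add: a_minus_def)
 fix y assume y: "y : deg M j"
 show "f (x \<oplus>\<^bsub>M\<^esub> y) \<ominus> h (x \<oplus>\<^bsub>M\<^esub> y) = f x \<ominus> h x \<oplus> (f y \<ominus> h y)"
  using cochD(3)[OF f x y] cochD(3)[OF h x y] fx hx cochD(2)[OF f y] cochD(2)[OF h y]
  by (simp add: a_minus_def A.minus_add A.a_ac)
next
 fix c x assume c: "c : carrier k" and x: "x : deg M j"
 show "f (\<kappa> c \<odot>\<^bsub>M\<^esub> x) \<ominus> h (\<kappa> c \<odot>\<^bsub>M\<^esub> x) = \<iota> c \<otimes> (f x \<ominus> h x)"
  using cochD(4)[OF f c x] cochD(4)[OF h c x] cochD(2)[OF f x] cochD(2)[OF h x] A.\<kappa>_closed[OF c]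
  by (simp add: a_minus_def A.r_distr A.r_minus)
qed

lemma delta_sub:
 assumes M: "grmod R M" and f: "coch M j m f" and h: "coch M j m h" and x: "x : deg M (j - 1)"
 shows "delta M (%x. f x \<ominus> h x) x = delta M f x \<ominus> delta M h x"
proof -
 note t = delta_term(2)[OF M f _ x] and t' = delta_term(2)[OF M h _ x]
 have "delta M (%x. f x \<ominus> h x) x \<oplus> delta M h x = delta M f x"
 proof -
  have "delta M (%x. f x \<ominus> h x) x = (\<Oplus>s\<in>{..<g}. f (\<epsilon> s \<odot>\<^bsub>M\<^esub> x) \<otimes> e s \<ominus> h (\<epsilon> s \<odot>\<^bsub>M\<^esub> x) \<otimes> e s)"
   unfolding delta_def using t t' cochD(2)[OF f eps_smult[OF M _ x]] cochD(2)[OF h eps_smult[OF M _ x]] e_closed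
   by (intro A.finsum_cong') (auto simp: a_minus_def A.l_distr A.l_minus)
  then have "delta M (%x. f x \<ominus> h x) x \<oplus> delta M h x =
    (\<Oplus>s\<in>{..<g}. (f (\<epsilon> s \<odot>\<^bsub>M\<^esub> x) \<otimes> e s \<ominus> h (\<epsilon> s \<odot>\<^bsub>M\<^esub> x) \<otimes> e s) \<oplus> h (\<epsilon> s \<odot>\<^bsub>M\<^esub> x) \<otimes> e s)"
   unfolding delta_def using t t' by (simp add: A.finsum_addf Pi_iff)
  also have "... = delta M f x" unfolding delta_def using t t'
   by (intro A.finsum_cong') (auto simp: a_minus_def A.a_assoc A.l_neg)
  finally show ?thesis .
 qed
 moreover have "delta M f x : carrier A" "delta M h x : carrier A" "delta M (%x. f x \<ominus> h x) x : carrier A"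
  using cochD(2)[OF delta_coch[OF M] x] f h coch_sub[OF M f h] by blast+
 ultimately show ?thesis by (metis A.add.inv_solve_right' A.minus_eq)
qed

lemma coch_orbit:
 assumes M: "grmod R M" and f: "coch M (int q + t) m f" and x: "x : deg M t"
 shows "rcoch q m (%r. f (r \<odot>\<^bsub>M\<^esub> x))"
proof -
 interpret M: graded_left_module R M by fact
 note xc = M.MG.C_closed[OF x]
 have rx: "r \<odot>\<^bsub>M\<^esub> x : deg M (int q + t)" if "r : component R q" for r using M.component_smult[OF that x] .
 show ?thesis unfolding rcoch_def linear_on_def
 proof (intro conjI ballI)
  fix r s assume r: "r : component R q" "s : component R q"
  show "f ((r \<oplus>\<^bsub>scal \<kappa> (reg R)\<^esub> s) \<odot>\<^bsub>M\<^esub> x) = f (r \<odot>\<^bsub>M\<^esub> x) \<oplus>\<^bsub>Aw\<^esub> f (s \<odot>\<^bsub>M\<^esub> x)"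
   using cochD(3)[OF f rx[OF r(1)] rx[OF r(2)]] M.smult_l_distr[OF R.RG.C_closed[OF r(1)] R.RG.C_closed[OF r(2)] xc] by simp
 next
  fix c r assume c: "c : carrier k" and r: "r : component R q"
  show "f ((c \<odot>\<^bsub>scal \<kappa> (reg R)\<^esub> r) \<odot>\<^bsub>M\<^esub> x) = c \<odot>\<^bsub>Aw\<^esub> f (r \<odot>\<^bsub>M\<^esub> x)"
   using cochD(4)[OF f c rx[OF r]] M.smult_assoc[OF R.\<kappa>_closed[OF c] R.RG.C_closed[OF r] xc] by simp
 qed (use cochD(1,2)[OF f rx] in auto)
qed

lemma rdelta_orbit:
 assumes M: "grmod R M" and f: "coch M (int (Suc q) + t) m f"
  and x: "x : deg M t" and r: "r : component R q"
 shows "rdelta (%r. f (r \<odot>\<^bsub>M\<^esub> x)) r = delta M f (r \<odot>\<^bsub>M\<^esub> x)"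
proof -
 interpret M: graded_left_module R M by fact
 have "f ((\<epsilon> s \<otimes>\<^bsub>R\<^esub> r) \<odot>\<^bsub>M\<^esub> x) = f (\<epsilon> s \<odot>\<^bsub>M\<^esub> (r \<odot>\<^bsub>M\<^esub> x))" if "s < g" for s
  using M.smult_assoc[OF eps_closed[OF that] R.RG.C_closed[OF r] M.MG.C_closed[OF x]] by simp
 moreover have "r \<odot>\<^bsub>M\<^esub> x : deg M ((int (Suc q) + t) - 1)" using M.component_smult[OF r x] by simp
 ultimately show ?thesis unfolding rdelta_def delta_def using delta_term(2)[OF M f]
  by (intro A.finsum_cong') auto
qed

lemma delta_delta:
 assumes M: "grmod R M" and f: "coch M j m f" and x: "x : deg M (j - 2)"
 shows "delta M (delta M f) x = \<zero>"
proof -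
 interpret M: graded_left_module R M by fact
 note xc = M.MG.C_closed[OF x]
 have f2: "coch M (int (Suc (Suc 0)) + (j - 2)) m f" using f by simp
 have f1: "coch M (j - 1) (Suc m) (delta M f)" by (rule delta_coch[OF M f])
 have f1': "coch M (int (Suc 0) + (j - 2)) (Suc m) (delta M f)" using f1 by simp
 note rc = coch_orbit[OF M f2 x] and rc1 = coch_orbit[OF M f1' x]
 have "delta M (delta M f) x = delta M (delta M f) (\<one>\<^bsub>R\<^esub> \<odot>\<^bsub>M\<^esub> x)" using M.smult_one[OF xc] by simp
 also have "... = rdelta (%r. delta M f (r \<odot>\<^bsub>M\<^esub> x)) \<one>\<^bsub>R\<^esub>"
  by (rule rdelta_orbit[OF M f1' x R.one_component, symmetric])
 also have "... = rdelta (rdelta (%r. f (r \<odot>\<^bsub>M\<^esub> x))) \<one>\<^bsub>R\<^esub>"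
  by (rule rdelta_cong[OF _ R.one_component])
   (use rdelta_orbit[OF M f2 x] rc1 A.RG.C_closed in \<open>auto simp: rcoch_def\<close>)
 also have "... = \<zero>" by (rule rdelta_rdelta[OF rc R.one_component])
 finally show ?thesis .
qed

text \<open>Cochains on a free module are families of cochains on \<open>R\<close>, one for each basis element, so a solution of the
equation for each of them can be assembled.\<close>

lemma coch_free:
 assumes P: "grmod R P" and b: "basis_of R P (carrier P) d x" "x : {..<d} \<rightarrow> deg P t"
  and f: "coch P (int q + t) (Suc m) f"
  and h: "!!i. i < d ==> rcoch (Suc q) m (h i) & (ALL r:component R q. f (r \<odot>\<^bsub>P\<^esub> x i) = rdelta (h i) r)"
 shows "EX h. coch P (int q + t + 1) m h & (ALL y:deg P (int q + t). f y = delta P h y)"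
proof -
 interpret P: graded_left_module R P by fact
 have cd: "coord R P d x y i : component R p" if "y : deg P (int p + t)" "i < d" for y i p
  using P.coord_homog[OF b that] by (simp add: zcomponent_def)
 define H where "H y = (\<Oplus>i\<in>{..<d}. h i (coord R P d x y i))" for y
 have hc: "h i r : component A m" "h i r : carrier A" if "i < d" "r : component R (Suc q)" for i r
  using h[OF that(1)] that(2) A.RG.C_closed unfolding rcoch_def by blast+
 have hl: "linear_on k (scal \<kappa> (reg R)) Aw (component R (Suc q)) (h i)" if "i < d" for i
  using h[OF that] unfolding rcoch_def by blast
 have cd': "coord R P d x y i : component R (Suc q)" if "y : deg P (int q + t + 1)" "i < d" for y i
  using cd[of y "Suc q" i] that by (simp add: ac_simps)
 have H: "coch P (int q + t + 1) m H"
 proof (rule cochI)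
  fix y assume y: "y : deg P (int q + t + 1)"
  show "H y : component A m" unfolding H_def using hc(1) cd'[OF y]
   by (intro subgroup_finsum[OF A.abelian_group_axioms A.RG.C_sub]) auto
  fix z assume z: "z : deg P (int q + t + 1)"
  have "H (y \<oplus>\<^bsub>P\<^esub> z) = (\<Oplus>i\<in>{..<d}. h i (coord R P d x y i) \<oplus> h i (coord R P d x z i))"
   unfolding H_def using hc(2) cd'[OF y] cd'[OF z] hl P.coord_add[OF b(1) P.carrier_submodule P.MG.C_closed[OF y] P.MG.C_closed[OF z]]
   by (intro A.finsum_cong') (auto simp: linear_on_def)
  also have "... = H y \<oplus> H z" unfolding H_def using hc(2) cd'[OF y] cd'[OF z] by (intro A.finsum_addf) auto
  finally show "H (y \<oplus>\<^bsub>P\<^esub> z) = H y \<oplus> H z" .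
 next
  fix c y assume c: "c : carrier k" and y: "y : deg P (int q + t + 1)"
  have "H (\<kappa> c \<odot>\<^bsub>P\<^esub> y) = (\<Oplus>i\<in>{..<d}. \<iota> c \<otimes> h i (coord R P d x y i))"
   unfolding H_def using hc(2) cd'[OF y] hl c A.\<kappa>_closed[OF c]
    P.coord_smult[OF b(1) P.carrier_submodule P.MG.C_closed[OF y] R.\<kappa>_closed[OF c]]
   by (intro A.finsum_cong') (auto simp: linear_on_def)
  also have "... = \<iota> c \<otimes> H y" unfolding H_def using hc(2) cd'[OF y] A.\<kappa>_closed[OF c]
   by (intro A.finsum_rdistr[symmetric]) auto
  finally show "H (\<kappa> c \<odot>\<^bsub>P\<^esub> y) = \<iota> c \<otimes> H y" .
 qed
 have "f y = delta P H y" if y: "y : deg P (int q + t)" for y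
 proof -
  note yc = P.MG.C_closed[OF y]
  note c = P.coord_props[OF b(1) yc]
  let ?c = "coord R P d x y"
  have cq: "?c i : component R q" if "i < d" for i using cd[OF y that] .
  have xi: "x i : deg P t" if "i < d" for i using b(2) that by auto
  have cx: "?c i \<odot>\<^bsub>P\<^esub> x i : deg P (int q + t)" if "i < d" for i using P.component_smult[OF cq[OF that] xi[OF that]] .
  have fl: "linear_on k (scal \<kappa> P) Aw (deg P (int q + t)) f" using f by (simp add: coch_def)
  interpret v: vspace k "scal \<kappa> P" by (rule R.scal_vspace) (rule P.left_module_axioms)
  have "f y = f (finsum (scal \<kappa> P) (%i. ?c i \<odot>\<^bsub>P\<^esub> x i) {..<d})"
   using c(2) by (simp add: lc_def finsum_struct[of "scal \<kappa> P" P])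
  also have "... = finsum Aw (%i. f (?c i \<odot>\<^bsub>P\<^esub> x i)) {..<d}"
   using cx by (intro linear_on_finsum[OF v.left_module_axioms Aw_module R.scal_submodule[OF P] fl]) auto
  also have "... = (\<Oplus>i\<in>{..<d}. f (?c i \<odot>\<^bsub>P\<^esub> x i))" by (rule finsum_struct) simp_all
  also have "... = (\<Oplus>i\<in>{..<d}. \<Oplus>s\<in>{..<g}. h i (\<epsilon> s \<otimes>\<^bsub>R\<^esub> ?c i) \<otimes> e s)"
   using h cq cochD(2)[OF f cx] by (intro A.finsum_cong') (auto simp: rdelta_def)
  also have "... = (\<Oplus>s\<in>{..<g}. \<Oplus>i\<in>{..<d}. h i (\<epsilon> s \<otimes>\<^bsub>R\<^esub> ?c i) \<otimes> e s)"
  proof (rule A.finsum_swap)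
   fix i s assume "i : {..<d}" "s : {..<g}"
   then have is': "i < d" "s < g" by auto
   have "\<epsilon> s \<otimes>\<^bsub>R\<^esub> ?c i : component R (Suc q)" using R.component_mult[OF \<epsilon>_in[OF is'(2)] cq[OF is'(1)]] by simp
   then show "h i (\<epsilon> s \<otimes>\<^bsub>R\<^esub> ?c i) \<otimes> e s : carrier A" using hc(2)[OF is'(1)] e_closed[OF is'(2)] by simp
  qed auto
  also have "... = delta P H y" unfolding delta_def
  proof (intro A.finsum_cong' refl)
   fix s assume "s : {..<g}"
   then have s: "s < g" by simp
   have es: "\<epsilon> s \<otimes>\<^bsub>R\<^esub> ?c i : component R (Suc q)" if "i < d" for i
    using R.component_mult[OF \<epsilon>_in[OF s] cq[OF that]] by simp
   have "H (\<epsilon> s \<odot>\<^bsub>P\<^esub> y) = (\<Oplus>i\<in>{..<d}. h i (\<epsilon> s \<otimes>\<^bsub>R\<^esub> ?c i))"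
    unfolding H_def using P.coord_smult[OF b(1) P.carrier_submodule yc eps_closed[OF s]] hc(2)[OF _ es]
    by (intro A.finsum_cong') auto
   then show "(\<Oplus>i\<in>{..<d}. h i (\<epsilon> s \<otimes>\<^bsub>R\<^esub> ?c i) \<otimes> e s) = H (\<epsilon> s \<odot>\<^bsub>P\<^esub> y) \<otimes> e s"
    using hc(2)[OF _ es] e_closed[OF s] by (simp add: A.finsum_ldistr Pi_iff)
  next
   have "\<epsilon> s \<odot>\<^bsub>P\<^esub> y : deg P (int q + t + 1)" if "s < g" for s
    using P.component_smult[OF \<epsilon>_in[OF that] y] by (simp add: ac_simps)
   then show "(%s. H (\<epsilon> s \<odot>\<^bsub>P\<^esub> y) \<otimes> e s) : {..<g} \<rightarrow> carrier A"
    using cochD(2)[OF H] e_closed by auto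
  qed
  finally show ?thesis .
 qed
 then show ?thesis using H by blast
qed

lemma free_exact:
 assumes P: "grmod R P" and b: "basis_of R P (carrier P) d x" "x : {..<d} \<rightarrow> deg P t" and j: "t < j"
 shows "exact_at P j m"
 unfolding exact_at_def
proof (intro allI impI)
 interpret P: graded_left_module R P by fact
 define q where "q = nat (j - t - 1)"
 have jq: "j = int (Suc q) + t" "j - 1 = int q + t" using j by (auto simp: q_def)
 fix f assume f: "coch P j m f" and z: "ALL y:deg P (j - 1). delta P f y = \<zero>"
 have xi: "x i : deg P t" if "i < d" for i using b(2) that by auto
 have rc: "rcoch (Suc q) m (%r. f (r \<odot>\<^bsub>P\<^esub> x i))" if "i < d" for i
  using coch_orbit[OF P _ xi[OF that], of "Suc q" m f] f jq by simp
 have rz: "rdelta (%r. f (r \<odot>\<^bsub>P\<^esub> x i)) r = \<zero>" if "i < d" "r : component R q" for i r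
  using rdelta_orbit[OF P f[unfolded jq(1)] xi[OF that(1)] that(2)] z P.component_smult[OF that(2) xi[OF that(1)]] jq by simp
 show "cob P j m f"
 proof (cases m)
  case 0
  have "f y = \<zero>" if y: "y : deg P j" for y
  proof -
   note c = P.coord_props[OF b(1) P.MG.C_closed[OF y]]
   let ?c = "coord R P d x y"
   have cq: "?c i : component R (Suc q)" if "i < d" for i
    using P.coord_homog[OF b y that] jq(1) by (simp add: zcomponent_def nat_add_distrib)
   have cx: "?c i \<odot>\<^bsub>P\<^esub> x i : deg P j" if "i < d" for i
    unfolding jq(1) using P.component_smult[OF cq[OF that] xi[OF that]] .
   have fl: "linear_on k (scal \<kappa> P) Aw (deg P j) f" using f by (simp add: coch_def)
   interpret v: vspace k "scal \<kappa> P" by (rule R.scal_vspace) (rule P.left_module_axioms)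
   have "f y = f (finsum (scal \<kappa> P) (%i. ?c i \<odot>\<^bsub>P\<^esub> x i) {..<d})"
    using c(2) by (simp add: lc_def finsum_struct[of "scal \<kappa> P" P])
   also have "... = finsum Aw (%i. f (?c i \<odot>\<^bsub>P\<^esub> x i)) {..<d}"
    using cx by (intro linear_on_finsum[OF v.left_module_axioms Aw_module R.scal_submodule[OF P] fl]) auto
   also have "... = (\<Oplus>i\<in>{..<d}. f (?c i \<odot>\<^bsub>P\<^esub> x i))" by (rule finsum_struct) simp_all
   also have "... = \<zero>" using rexact_low[OF rc[unfolded 0] rz cq] by (intro A.add.finprod_one_eqI) auto
   finally show ?thesis .
  qed
  then show ?thesis by (simp add: cob_def 0)
 next
  case (Suc l)
  have "EX h. rcoch (Suc (Suc q)) l h & (ALL r:component R (Suc q). f (r \<odot>\<^bsub>P\<^esub> x i) = rdelta h r)" if "i < d" for i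
   using rexact[OF rc[OF that, unfolded Suc] rz[OF that]] by simp
  then obtain h where h: "!!i. i < d ==> rcoch (Suc (Suc q)) l (h i) & (ALL r:component R (Suc q). f (r \<odot>\<^bsub>P\<^esub> x i) = rdelta (h i) r)" by metis
  from coch_free[OF P b f[unfolded jq(1) Suc] h]
  show ?thesis unfolding cob_def Suc jq(1) by simp
 qed
qed

lemma free_bottom:
 assumes P: "grmod R P" and b: "basis_of R P (carrier P) d x" "x : {..<d} \<rightarrow> deg P t"
  and f: "coch P t (Suc m) f"
 shows "EX h. coch P (t + 1) m h & (ALL y:deg P t. f y = delta P h y)"
proof -
 have f': "coch P (int 0 + t) (Suc m) f" using f by simp
 define Q where "Q i h \<longleftrightarrow> rcoch (Suc 0) m h & (ALL r:component R 0. f (r \<odot>\<^bsub>P\<^esub> x i) = rdelta h r)" for i h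
 have "EX h. Q i h" if i: "i < d" for i
 proof -
  have "x i : deg P t" using b(2) i by blast
  then have "rcoch 0 (Suc m) (%r. f (r \<odot>\<^bsub>P\<^esub> x i))" by (rule coch_orbit[OF P f'])
  from rexact_0[OF this] show ?thesis unfolding Q_def One_nat_def .
 qed
 then obtain h where h: "!!i. i < d ==> Q i (h i)" by metis
 have "EX h. coch P (int 0 + t + 1) m h & (ALL y:deg P (int 0 + t). f y = delta P h y)"
  by (rule coch_free[OF P b f']) (rule h[unfolded Q_def])
 then show ?thesis unfolding of_nat_0 add_0_left .
qed

end

section \<open>Dimension shifting along a free presentation\<close>

context exact_koszul_dual
begin

lemma cob_0: "cob M j 0 f \<longleftrightarrow> (ALL x:deg M j. f x = \<zero>)" and
 cob_Suc: "cob M j (Suc n) f \<longleftrightarrow> (EX h. coch M (j + 1) n h & (ALL x:deg M j. f x = delta M h x))"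
 by (simp_all add: cob_def)

lemma coch_at_zero: "coch N j m f ==> grmod R N ==> f \<zero>\<^bsub>N\<^esub> = \<zero>"
 using linear_on_zero[OF _ Aw_module R.scal_submodule, of N j f] R.scal_vspace[of N]
 by (simp add: coch_def vspace_def graded_left_module_def)

lemma coch_pull:
 assumes "grmod R N" "grmod R M" "h : graded_hom R N M" "coch M j m f"
 shows "coch N j m (%x. f (h x))"
proof -
 interpret N: graded_left_module R N by fact
 have hl: "linear_on R N M (carrier N) h" and hc: "!!x. x : deg N j ==> h x : deg M j"
  using assms(3) by (auto simp: graded_hom_def linear_maps_iff)
 have add: "h (x \<oplus>\<^bsub>N\<^esub> y) = h x \<oplus>\<^bsub>M\<^esub> h y" if "x : deg N j" "y : deg N j" for x y
  using hl N.MG.C_closed that unfolding linear_on_def by blast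
 have sm: "h (r \<odot>\<^bsub>N\<^esub> x) = r \<odot>\<^bsub>M\<^esub> h x" if "r : carrier R" "x : deg N j" for r x
  using hl N.MG.C_closed that unfolding linear_on_def by blast
 show ?thesis
  by (rule cochI) (simp_all add: cochD[OF assms(4)] hc add sm R.\<kappa>_closed)
qed

lemma delta_pull:
 assumes "grmod R N" "grmod R M" "h : graded_hom R N M" "coch M j m f" "x : deg N (j - 1)"
 shows "delta N (%x. f (h x)) x = delta M f (h x)"
proof -
 interpret N: graded_left_module R N by fact
 have hx: "h x : deg M (j - 1)" and sm: "!!r. r : carrier R ==> h (r \<odot>\<^bsub>N\<^esub> x) = r \<odot>\<^bsub>M\<^esub> h x"
  using assms(3) N.MG.C_closed[OF assms(5)] assms(5) by (auto simp: graded_hom_def linear_maps_iff linear_on_def image_subset_iff)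
 show ?thesis unfolding delta_def
  using delta_term(2)[OF assms(2,4) _ hx] sm[OF eps_closed] by (intro A.finsum_cong') auto
qed

lemma cob_pull:
 assumes "grmod R N" "grmod R M" "h : graded_hom R N M" "cob M j m f"
 shows "cob N j m (%x. f (h x))"
proof -
 have hc: "!!x. x : deg N j ==> h x : deg M j"
  using assms(3) by (auto simp: graded_hom_def)
 show ?thesis
 proof (cases m)
  case 0
  then show ?thesis using assms(4) hc by (simp add: cob_0)
 next
  case (Suc n)
  then obtain w where w: "coch M (j + 1) n w" "!!x. x : deg M j ==> f x = delta M w x"
   using assms(4) by (auto simp: cob_Suc)
  have "f (h x) = delta N (%x. w (h x)) x" if x: "x : deg N j" for x
   using delta_pull[OF assms(1-3) w(1), of x] w(2)[OF hc[OF x]] x by simp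
  then show ?thesis using coch_pull[OF assms(1-3) w(1)] unfolding Suc cob_Suc by blast
 qed
qed

lemma cob_cong: "[|cob M j m f; !!x. x : deg M j ==> f x = h x|] ==> cob M j m h"
 unfolding cob_def by (cases m) auto

lemma exact_atD: "[|exact_at M j m; coch M j m f; !!x. x : deg M (j - 1) ==> delta M f x = \<zero>|] ==> cob M j m f"
 unfolding exact_at_def by blast

lemma delta_cob:
 assumes M: "grmod R M" and c: "cob M j m f" and f: "coch M j m f" and x: "x : deg M (j - 1)"
 shows "delta M f x = \<zero>"
proof (cases m)
 case 0
 then show ?thesis using c eps_smult[OF M _ x] e_closed unfolding delta_def
  by (intro A.add.finprod_one_eqI) (auto simp: cob_0)
next
 case (Suc n)
 then obtain w where w: "coch M (j + 1) n w" "!!x. x : deg M j ==> f x = delta M w x"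
  using c by (auto simp: cob_Suc)
 have "delta M f x = delta M (delta M w) x" by (rule delta_cong[OF M f w(2) x])
 also have "... = \<zero>" using delta_delta[OF M w(1), of x] x by simp
 finally show ?thesis .
qed

end

text \<open>An exact sequence \<open>0 \<rightarrow> L \<rightarrow> P \<rightarrow> M \<rightarrow> 0\<close> with \<open>P\<close> free on finitely many generators of degree \<open>t\<close>.\<close>

locale presentation = exact_koszul_dual k \<iota> A \<kappa> R g e \<epsilon>
 for k :: "('k, 'y) ring_scheme" and \<iota> :: "'k => 'a" and A :: "('a, 'z) graded_ring_scheme" (structure)
  and \<kappa> :: "'k => 'r" and R :: "('r, 'w) graded_ring_scheme" and g and e and \<epsilon> +
 fixes L :: "('r, 'l) graded_module" and P :: "('r, 'p) graded_module" and M :: "('r, 'm) graded_module"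
  and u :: "'l => 'p" and \<pi> :: "'p => 'm" and t :: int and d :: nat and x :: "nat => 'p"
 assumes L: "grmod R L" and P: "grmod R P" and M: "grmod R M"
  and u: "u : graded_hom R L P" and \<pi>: "\<pi> : graded_hom R P M"
  and basis: "basis_of R P (carrier P) d x" and degree: "x : {..<d} \<rightarrow> deg P t"
  and surj: "\<pi> ` carrier P = carrier M" and inj: "inj_on u (carrier L)"
  and exact: "!!j. u ` deg L j = {y : deg P j. \<pi> y = \<zero>\<^bsub>M\<^esub>}"
  and low: "deg L t = {\<zero>\<^bsub>L\<^esub>}"
begin

sublocale Lm: graded_left_module R L by (rule L)
sublocale Pm: graded_left_module R P by (rule P)
sublocale Mm: graded_left_module R M by (rule M)

lemma u_in: "l : deg L j ==> u l : deg P j"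
 and pi_u: "l : deg L j ==> \<pi> (u l) = \<zero>\<^bsub>M\<^esub>"
 and pi_in: "y : deg P j ==> \<pi> y : deg M j"
 using exact[of j] \<pi> by (auto simp: graded_hom_def image_subset_iff)

text \<open>The components of \<open>P\<close> are finite-dimensional, so linear maps extend from the image of \<open>L\<close>.\<close>

lemma lift_cochain:
 assumes f: "coch L j m f"
 obtains h where "coch P j m h" "!!l. l : deg L j ==> h (u l) = f l"
proof -
 interpret v: vspace k "scal \<kappa> P" by (rule R.scal_vspace) (rule Pm.left_module_axioms)
 let ?U = "u ` deg L j" and ?g = "%y. f (inv_into (carrier L) u y)"
 have g: "?g (u l) = f l" if "l : deg L j" for l
  using inv_into_f_f[OF inj Lm.MG.C_closed[OF that]] by simp
 have lu: "linear_on R L P (carrier L) u" using graded_hom_linear[OF u] .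
 have sm: "\<kappa> c \<odot>\<^bsub>P\<^esub> u l = u (\<kappa> c \<odot>\<^bsub>L\<^esub> l)" "\<kappa> c \<odot>\<^bsub>L\<^esub> l : deg L j" if "c : carrier k" "l : deg L j" for c l
  using lu R.\<kappa>_closed[OF that(1)] Lm.MG.C_closed[OF that(2)] Lm.component_smult[OF R.\<kappa>_in[OF that(1)] that(2)]
  by (auto simp: linear_on_def)
 have ad: "u l \<oplus>\<^bsub>P\<^esub> u l' = u (l \<oplus>\<^bsub>L\<^esub> l')" "l \<oplus>\<^bsub>L\<^esub> l' : deg L j" if "l : deg L j" "l' : deg L j" for l l'
  using lu Lm.MG.C_closed[OF that(1)] Lm.MG.C_closed[OF that(2)] Lm.MG.C_subD(3)[OF that] by (auto simp: linear_on_def)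
 have z: "\<zero>\<^bsub>P\<^esub> : ?U" unfolding exact
  using Pm.MG.C_subD(2) linear_on_zero[OF Pm.left_module_axioms Mm.left_module_axioms Pm.carrier_submodule graded_hom_linear[OF \<pi>]] by simp
 have U: "submodule ?U k (scal \<kappa> P)"
 proof (rule submoduleI'[OF v.left_module_axioms])
  show "?U \<subseteq> carrier (scal \<kappa> P)" using u_in Pm.MG.C_closed by auto
 qed (use z ad sm in auto)
 have gl: "linear_on k (scal \<kappa> P) Aw ?U ?g" unfolding linear_on_def
 proof (intro conjI ballI)
  show "?g : ?U \<rightarrow> carrier Aw" using g cochD(2)[OF f] by auto
  fix y z assume "y : ?U" "z : ?U"
  then obtain l l' where l: "l : deg L j" "l' : deg L j" and yz: "y = u l" "z = u l'" by blast
  show "?g (y \<oplus>\<^bsub>scal \<kappa> P\<^esub> z) = ?g y \<oplus>\<^bsub>Aw\<^esub> ?g z"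
   unfolding yz scal_simps ad(1)[OF l] g[OF l(1)] g[OF l(2)] g[OF ad(2)[OF l]] using cochD(3)[OF f l] by simp
 next
  fix c y assume c: "c : carrier k" and "y : ?U"
  then obtain l where l: "l : deg L j" and y: "y = u l" by blast
  show "?g (c \<odot>\<^bsub>scal \<kappa> P\<^esub> y) = c \<odot>\<^bsub>Aw\<^esub> ?g y"
   using cochD(4)[OF f c l] g[OF l] g[OF sm(2)[OF c l]] sm(1)[OF c l] unfolding y by simp
 qed
 have gT: "?g : ?U \<rightarrow> component A m" using g cochD(1)[OF f] by auto
 have UP: "?U \<subseteq> deg P j" using u_in by blast
 from R.free_fspan[OF P basis degree R_zfin] have "fspan k (scal \<kappa> P) (deg P j)" .
 from v.extend_linear[OF U R.scal_submodule[OF P] UP this gl gT]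
 obtain h where h: "linear_on k (scal \<kappa> P) Aw (deg P j) h" "h : deg P j \<rightarrow> component A m"
  "!!y. y : ?U ==> h y = ?g y" by blast
 show ?thesis
 proof (rule that)
  show "coch P j m h" using h by (simp add: coch_def)
  show "h (u l) = f l" if l: "l : deg L j" for l
   using h(3)[of "u l"] l g[OF l] by simp
 qed
qed

lemma descend_cochain:
 assumes f: "coch P j m f" and z: "!!l. l : deg L j ==> f (u l) = \<zero>"
 obtains h where "coch M j m h" "!!y. y : deg P j ==> h (\<pi> y) = f y"
proof -
 have lp: "linear_on R P M (carrier P) \<pi>" using graded_hom_linear[OF \<pi>] .
 let ?h = "%v. f (SOME y. y : deg P j & \<pi> y = v)"
 have wd: "f y = f y'" if y: "y : deg P j" "y' : deg P j" "\<pi> y = \<pi> y'" for y y'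
 proof -
  have n: "\<ominus>\<^bsub>P\<^esub> y' : deg P j" using Pm.MG.C_subD(4) y(2) .
  then have d: "y \<ominus>\<^bsub>P\<^esub> y' : deg P j" using y(1) Pm.MG.C_subD(3) by (simp add: a_minus_def)
  have "\<pi> (y \<ominus>\<^bsub>P\<^esub> y') = \<zero>\<^bsub>M\<^esub>"
   using linear_on_diff[OF Pm.left_module_axioms Mm.left_module_axioms Pm.carrier_submodule lp Pm.MG.C_closed[OF y(1)] Pm.MG.C_closed[OF y(2)]]
    y(3) Mm.MG.C_closed[OF pi_in[OF y(2)]] by (simp add: a_minus_def Mm.r_neg)
  then have "y \<ominus>\<^bsub>P\<^esub> y' : u ` deg L j" using d exact by simp
  then have "f (y \<ominus>\<^bsub>P\<^esub> y') = \<zero>" using z by auto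
  moreover have "y = (y \<ominus>\<^bsub>P\<^esub> y') \<oplus>\<^bsub>P\<^esub> y'"
   using Pm.MG.C_closed[OF y(1)] Pm.MG.C_closed[OF y(2)] by (simp add: a_minus_def Pm.a_assoc Pm.l_neg)
  ultimately have "f y = \<zero> \<oplus> f y'" using cochD(3)[OF f d y(2)] by metis
  then show ?thesis using cochD(2)[OF f y(2)] by simp
 qed
 have h: "?h (\<pi> y) = f y" if y: "y : deg P j" for y
 proof (rule someI2[of _ y])
  fix z assume "z : deg P j & \<pi> z = \<pi> y"
  then show "f z = f y" using wd[of z y] y by simp
 qed (simp add: y)
 have ex: "EX y. y : deg P j & v = \<pi> y" if "v : deg M j" for v
  by (rule graded_surj_comp[OF P M \<pi> surj that]) blast
 have "coch M j m ?h"
 proof (rule cochI)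
  fix v assume "v : deg M j"
  then obtain y where y: "y : deg P j" "v = \<pi> y" using ex by blast
  show "?h v : component A m" unfolding y(2) h[OF y(1)] by (rule cochD(1)[OF f y(1)])
  fix w assume "w : deg M j"
  then obtain z where z: "z : deg P j" "w = \<pi> z" using ex by blast
  have e: "\<pi> y \<oplus>\<^bsub>M\<^esub> \<pi> z = \<pi> (y \<oplus>\<^bsub>P\<^esub> z)"
   using lp Pm.MG.C_closed y(1) z(1) by (simp add: linear_on_def)
  show "?h (v \<oplus>\<^bsub>M\<^esub> w) = ?h v \<oplus> ?h w"
   unfolding y(2) z(2) e h[OF y(1)] h[OF z(1)] h[OF Pm.MG.C_subD(3)[OF y(1) z(1)]] by (rule cochD(3)[OF f y(1) z(1)])
 next
  fix c v assume c: "c : carrier k" and "v : deg M j"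
  then obtain y where y: "y : deg P j" "v = \<pi> y" using ex by blast
  have e: "\<kappa> c \<odot>\<^bsub>M\<^esub> \<pi> y = \<pi> (\<kappa> c \<odot>\<^bsub>P\<^esub> y)"
   using lp Pm.MG.C_closed y(1) R.\<kappa>_closed[OF c] by (simp add: linear_on_def)
  have "\<kappa> c \<odot>\<^bsub>P\<^esub> y : deg P j" using Pm.component_smult[OF R.\<kappa>_in[OF c] y(1)] by simp
  note hc = h[OF this]
  show "?h (\<kappa> c \<odot>\<^bsub>M\<^esub> v) = \<iota> c \<otimes> ?h v" unfolding y(2) e hc h[OF y(1)] by (rule cochD(4)[OF f c y(1)])
 qed
 then show ?thesis by (rule that) (rule h)
qed

lemma delta_pi: "[|coch M (j + 1) m f; y : deg P j|] ==> delta P (%y. f (\<pi> y)) y = delta M f (\<pi> y)"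
 using delta_pull[OF P M \<pi>, of "j + 1" m f y] by simp

lemma delta_u: "[|coch P (j + 1) m h; l : deg L j|] ==> delta L (%l. h (u l)) l = delta P h (u l)"
 using delta_pull[OF L P u, of "j + 1" m h l] by simp

text \<open>The connecting homomorphism in terms of cochains: \<open>h\<close> restricts to a cochain on \<open>L\<close>, and its coboundary descends
to \<open>f\<close> on \<open>M\<close>. One direction corrects \<open>h\<close> by a coboundary until it vanishes on \<open>L\<close> and hence descends; the other
uses that \<open>h\<close> minus a pulled back cochain is a cocycle on the free module \<open>P\<close>.\<close>

lemma coboundary_transfer:
 assumes j: "t \<le> j" and f: "coch M j (Suc m) f" and h: "coch P (j + 1) m h"
  and eq: "!!y. y : deg P j ==> delta P h y = f (\<pi> y)"
 shows "cob L (j + 1) m (%l. h (u l)) \<longleftrightarrow> cob M j (Suc m) f"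
proof
 assume c: "cob L (j + 1) m (%l. h (u l))"
 obtain h' where h': "coch P (j + 1) m h'" "!!l. l : deg L (j + 1) ==> h' (u l) = \<zero>"
  "!!y. y : deg P j ==> delta P h' y = delta P h y"
 proof (cases m)
  case 0
  then show ?thesis using c h that[of h] by (simp add: cob_0)
 next
  case (Suc n)
  with c obtain w where w: "coch L (j + 1 + 1) n w" "!!l. l : deg L (j + 1) ==> h (u l) = delta L w l"
   by (auto simp: cob_Suc)
  obtain w' where w': "coch P (j + 1 + 1) n w'" "!!l. l : deg L (j + 1 + 1) ==> w' (u l) = w l"
   by (rule lift_cochain[OF w(1)]) blast
  have dw: "coch P (j + 1) (Suc n) (delta P w')" using delta_coch[OF P w'(1)] by (simp add: ac_simps)
  have ww: "coch L (j + 1 + 1) n (%l. w' (u l))" by (rule coch_pull[OF L P u w'(1)])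
  show ?thesis
  proof (rule that)
   show "coch P (j + 1) m (%y. h y \<ominus> delta P w' y)" using coch_sub[OF P h[unfolded Suc] dw] Suc by simp
   show "h (u l) \<ominus> delta P w' (u l) = \<zero>" if l: "l : deg L (j + 1)" for l
   proof -
    have "delta P w' (u l) = delta L (%l. w' (u l)) l" using delta_u[OF w'(1) l] by simp
    also have "... = delta L w l" using delta_cong[OF L ww w'(2), of l] l by (simp add: ac_simps)
    finally have "delta P w' (u l) = h (u l)" using w(2)[OF l] by simp
    then show ?thesis using cochD(2)[OF h u_in[OF l]] by (simp add: a_minus_def A.r_neg)
   qed
   show "delta P (%y. h y \<ominus> delta P w' y) y = delta P h y" if y: "y : deg P j" for y
   proof -
    have "delta P (delta P w') y = \<zero>" using delta_delta[OF P w'(1), of y] y by simp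
    moreover have "delta P h y : carrier A" using cochD(2)[OF delta_coch[OF P h], of y] y by simp
    ultimately show ?thesis using delta_sub[OF P h[unfolded Suc] dw, of y] y by (simp add: a_minus_def)
   qed
  qed
 qed
 obtain h'' where h'': "coch M (j + 1) m h''" "!!y. y : deg P (j + 1) ==> h'' (\<pi> y) = h' y"
  by (rule descend_cochain[OF h'(1,2)], assumption, blast)
 have "f v = delta M h'' v" if v: "v : deg M j" for v
 proof -
  obtain y where y: "y : deg P j" "\<pi> y = v" using graded_surj_comp[OF P M \<pi> surj v] .
  have "delta M h'' (\<pi> y) = delta P (%y. h'' (\<pi> y)) y" using delta_pi[OF h''(1) y(1)] by simp
  also have "... = delta P h' y"
   by (rule delta_cong[OF P coch_pull[OF P M \<pi> h''(1)] h''(2)]) (use y(1) in simp_all)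
  finally show ?thesis using h'(3)[OF y(1)] eq[OF y(1)] y(2) by simp
 qed
 then show "cob M j (Suc m) f" using h''(1) unfolding cob_Suc by blast
next
 assume "cob M j (Suc m) f"
 then obtain w where w: "coch M (j + 1) m w" "!!v. v : deg M j ==> f v = delta M w v"
  by (auto simp: cob_Suc)
 have wp: "coch P (j + 1) m (%y. w (\<pi> y))" by (rule coch_pull[OF P M \<pi> w(1)])
 let ?h = "%y. h y \<ominus> w (\<pi> y)"
 have dz: "delta P ?h y = \<zero>" if y: "y : deg P (j + 1 - 1)" for y
 proof -
  have y': "y : deg P j" using y by simp
  have "delta P (%y. w (\<pi> y)) y = delta P h y" using delta_pi[OF w(1) y'] w(2)[OF pi_in[OF y']] eq[OF y'] by simp
  then show ?thesis using delta_sub[OF P h wp y] cochD(2)[OF delta_coch[OF P h] y] by (simp add: a_minus_def A.r_neg)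
 qed
 have "exact_at P (j + 1) m" by (rule free_exact[OF P basis degree]) (use j in simp)
 then have "cob P (j + 1) m ?h" using coch_sub[OF P h wp] dz by (rule exact_atD)
 then have "cob L (j + 1) m (%l. h (u l) \<ominus> w (\<pi> (u l)))" by (rule cob_pull[OF L P u])
 then show "cob L (j + 1) m (%l. h (u l))"
  by (rule cob_cong) (simp add: pi_u coch_at_zero[OF w(1) M] cochD(2)[OF h u_in] a_minus_def)
qed

lemma exact_quotient:
 assumes j: "t < j" and ex: "!!m'. m = Suc m' ==> exact_at L (j + 1) m'"
 shows "exact_at M j m"
 unfolding exact_at_def
proof (intro allI impI)
 fix f assume f: "coch M j m f" and z: "ALL v:deg M (j - 1). delta M f v = \<zero>"
 have fp: "coch P j m (%y. f (\<pi> y))" by (rule coch_pull[OF P M \<pi> f])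
 have dz: "delta P (%y. f (\<pi> y)) y = \<zero>" if "y : deg P (j - 1)" for y
  using delta_pull[OF P M \<pi> f that] z pi_in[OF that] by simp
 have c: "cob P j m (%y. f (\<pi> y))" by (rule exact_atD[OF free_exact[OF P basis degree j] fp dz])
 show "cob M j m f"
 proof (cases m)
  case 0
  have "f v = \<zero>" if "v : deg M j" for v
   by (rule graded_surj_comp[OF P M \<pi> surj that]) (use c in \<open>auto simp: 0 cob_0\<close>)
  then show ?thesis by (simp add: 0 cob_0)
 next
  case (Suc n)
  then obtain h where h: "coch P (j + 1) n h" "!!y. y : deg P j ==> f (\<pi> y) = delta P h y"
   using c by (auto simp: cob_Suc)
  have "cob L (j + 1) n (%l. h (u l))"
  proof (rule exact_atD[OF ex[OF Suc] coch_pull[OF L P u h(1)]])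
   fix l assume "l : deg L (j + 1 - 1)"
   then have l: "l : deg L j" by simp
   show "delta L (%l. h (u l)) l = \<zero>"
    unfolding delta_u[OF h(1) l] h(2)[OF u_in[OF l], symmetric] pi_u[OF l] by (rule coch_at_zero[OF f M])
  qed
  then show ?thesis using coboundary_transfer[OF _ f[unfolded Suc] h(1)] h(2) j Suc by simp
 qed
qed

lemma exact_kernel:
 assumes j: "t < j" and ex: "exact_at M j (Suc m)"
 shows "exact_at L (j + 1) m"
 unfolding exact_at_def
proof (intro allI impI)
 fix q assume q: "coch L (j + 1) m q" and z: "ALL l:deg L (j + 1 - 1). delta L q l = \<zero>"
 obtain h f where hf: "coch P (j + 1) m h" "!!l. l : deg L (j + 1) ==> h (u l) = q l"
  "coch M j (Suc m) f" "!!y. y : deg P j ==> delta P h y = f (\<pi> y)"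
 proof -
  obtain h where h: "coch P (j + 1) m h" "!!l. l : deg L (j + 1) ==> h (u l) = q l"
   by (rule lift_cochain[OF q]) blast
  have dh: "coch P j (Suc m) (delta P h)" using delta_coch[OF P h(1)] by simp
  have du: "delta P h (u l) = \<zero>" if l: "l : deg L j" for l
  proof -
   have "delta P h (u l) = delta L (%l. h (u l)) l" using delta_u[OF h(1) l] by simp
   also have "... = delta L q l" using delta_cong[OF L coch_pull[OF L P u h(1)] h(2), of l] l by simp
   finally show ?thesis using z l by simp
  qed
  show ?thesis
  proof (rule descend_cochain[OF dh du])
   fix f assume f: "coch M j (Suc m) f" "!!y. y : deg P j ==> f (\<pi> y) = delta P h y"
   show ?thesis by (rule that[OF h f(1)], assumption, rule f(2)[symmetric])
  qed
 qed
 have "delta M f v = \<zero>" if v: "v : deg M (j - 1)" for v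
 proof -
  obtain y where y: "y : deg P (j - 1)" "\<pi> y = v" using graded_surj_comp[OF P M \<pi> surj v] .
  have "delta M f (\<pi> y) = delta P (%y. f (\<pi> y)) y" using delta_pull[OF P M \<pi> hf(3) y(1)] by simp
  also have "... = delta P (delta P h) y"
   by (rule delta_cong[OF P coch_pull[OF P M \<pi> hf(3)] hf(4)[symmetric] y(1)])
  also have "... = \<zero>" using delta_delta[OF P hf(1), of y] y(1) by simp
  finally show ?thesis using y(2) by simp
 qed
 then have "cob M j (Suc m) f" by (rule exact_atD[OF ex hf(3)])
 then have "cob L (j + 1) m (%l. h (u l))" using coboundary_transfer[OF _ hf(3,1,4)] j by simp
 then show "cob L (j + 1) m q" by (rule cob_cong) (rule hf(2))
qed

end

section \<open>Koszul modules and cochains\<close>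

lemma basis_generated:
 assumes P: "grmod R P" and b: "basis_of R P (carrier P) d x" "x : {..<d} \<rightarrow> deg P t"
 shows "generated_in_degree R P t"
 unfolding generated_in_degree_def
proof (intro allI impI)
 interpret P: graded_left_module R P by fact
 fix U assume U: "submodule U R P & deg P t \<subseteq> U"
 then have "x : tup d U" using b(2) by blast
 then have "y : U" if "y : carrier P" for y
  using P.lc_in[of U "coord R P d x y" d x] P.coord_props[OF b(1) that] U by simp
 moreover have "U \<subseteq> carrier P" using submoduleD(1)[OF P.M_group] U by blast
 ultimately show "U = carrier P" by blast
qed

context exact_koszul_dual
begin

text \<open>The cohomological form of being Koszul up to a shift by \<open>t\<close>.\<close>

definition lin :: "('r, 'm) graded_module => int => bool" where
 "lin M t \<equiv> grmod R M & (ALL n<t. deg M n = {\<zero>\<^bsub>M\<^esub>}) \<and>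
   (ALL n. fspan k (scal \<kappa> M) (deg M n)) & (ALL j>t. ALL m. exact_at M j m)"

text \<open>Otherwise some \<open>M\<^sub>j\<close> with \<open>j > t\<close> is not contained in a submodule \<open>U\<close> that contains \<open>M\<^bsub>j-1\<^esub>\<close>. A functional on \<open>M\<^sub>j\<close>
that vanishes on \<open>U\<close> is then a nonzero cocycle with values in \<open>A\<^sub>0\<close>, against exactness.\<close>

lemma lin_generated:
 assumes l: "lin M t"
 shows "generated_in_degree R M t"
 unfolding generated_in_degree_def
proof (intro allI impI)
 have M: "grmod R M" and low: "!!n. n < t ==> deg M n = {\<zero>\<^bsub>M\<^esub>}"
  and fin: "!!n. fspan k (scal \<kappa> M) (deg M n)" and ex: "!!j. j > t ==> exact_at M j 0"
  using l by (auto simp: lin_def)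
 interpret M: graded_left_module R M by (rule M)
 interpret v: vspace k "scal \<kappa> M" by (rule R.scal_vspace) (rule M.left_module_axioms)
 fix U assume "submodule U R M & deg M t \<subseteq> U"
 then have U: "submodule U R M" and Ut: "deg M t \<subseteq> U" by auto
 note UD = submoduleD[OF M.M_group U]
 have step: "deg M j \<subseteq> U" if j: "j > t" and IH: "deg M (j - 1) \<subseteq> U" for j
 proof (rule ccontr)
  assume "\<not> deg M j \<subseteq> U"
  then obtain y where y: "y : deg M j" "y \<notin> U \<inter> deg M j" by blast
  have W: "submodule (deg M j) k (scal \<kappa> M)" by (rule R.scal_submodule[OF M])
  have L: "submodule (U \<inter> deg M j) k (scal \<kappa> M)"
   using UD M.MG.C_subD submoduleD[OF v.M_group W] submoduleD[OF v.M_group R.scal_submodule_of[OF M.left_module_axioms U]]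
   by (intro submoduleI'[OF v.left_module_axioms]) auto
  obtain f where f: "linear_on k (scal \<kappa> M) (reg k) (deg M j) f" "!!x. x : U \<inter> deg M j ==> f x = \<zero>\<^bsub>k\<^esub>" "f y ~= \<zero>\<^bsub>k\<^esub>"
   by (rule v.separate[OF L W Int_lower2 fin y]) blast
  have fc: "f x : carrier k" if "x : deg M j" for x using f(1) that by (auto simp: linear_on_def)
  have "coch M j 0 (%x. \<iota> (f x))"
   using f(1) A.\<kappa>_in[OF fc] ring_hom_add[OF A.\<kappa>_hom] ring_hom_mult[OF A.\<kappa>_hom] fc
   by (intro cochI) (auto simp: linear_on_def)
  moreover have "delta M (%x. \<iota> (f x)) x = \<zero>" if x: "x : deg M (j - 1)" for x
   unfolding delta_def
  proof (rule A.add.finprod_one_eqI)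
   fix s assume "s : {..<g}"
   then have s: "s < g" by simp
   have "\<epsilon> s \<odot>\<^bsub>M\<^esub> x : U \<inter> deg M j" using UD(5)[OF eps_closed[OF s]] IH x eps_smult[OF M s x] by blast
   then show "\<iota> (f (\<epsilon> s \<odot>\<^bsub>M\<^esub> x)) \<otimes> e s = \<zero>" using f(2) A.\<kappa>_zero e_closed[OF s] by simp
  qed
  ultimately have "cob M j 0 (%x. \<iota> (f x))" by (rule exact_atD[OF ex[OF j]])
  then have "\<iota> (f y) = \<zero>" using y(1) by (simp add: cob_0)
  then show False using A.\<kappa>_eq_zero[OF fc[OF y(1)]] f(3) by simp
 qed
 have up: "deg M (t + int n) \<subseteq> U" for n
 proof (induction n)
  case (Suc n)
  then show ?case using step[of "t + int (Suc n)"] by simp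
 qed (use Ut in simp)
 have all: "deg M n \<subseteq> U" for n
 proof (cases "n < t")
  case True
  then show ?thesis using low UD(2) by simp
 next
  case False
  then show ?thesis using up[of "nat (n - t)"] by simp
 qed
 have "x : U" if x: "x : carrier M" for x
  by (subst M.MG.hcomp_props(3)[OF x])
   (use all M.MG.hcomp_props(1)[OF x] in \<open>blast intro: subgroup_finsum[OF M.M_group UD(6)]\<close>)
 then show "U = carrier M" using UD(1) by blast
qed

lemma cover_presentation:
 assumes c: "projective_cover R Q M \<pi>" and gen: "generated_in_degree R M t" and fin: "fspan k (scal \<kappa> M) (deg M t)"
 obtains d x where "presentation k \<iota> A \<kappa> R g e \<epsilon> (kernel_module Q M \<pi>) Q M (%y. y) \<pi> t d x"
  "!!n. fspan k (scal \<kappa> (kernel_module Q M \<pi>)) (deg (kernel_module Q M \<pi>) n)"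
  "!!n. n \<le> t ==> deg (kernel_module Q M \<pi>) n = {\<zero>\<^bsub>kernel_module Q M \<pi>\<^esub>}"
proof -
 note cD = cover_D[OF c]
 interpret Q: graded_left_module R Q by (rule cD)
 interpret M: graded_left_module R M by (rule cD)
 interpret v: vspace k "scal \<kappa> M" by (rule R.scal_vspace) (rule M.left_module_axioms)
 let ?K = "kernel_module Q M \<pi>"
 note K = kernel_graded(1)[OF cD(1-3)]
 obtain d b where b: "basis_of k (scal \<kappa> M) (deg M t) d b"
  using v.fspan_basis[OF R.scal_submodule[OF cD(2)] fin] by blast
 obtain x where x: "x : {..<d} \<rightarrow> deg Q t" "basis_of R Q (carrier Q) d x"
  using R.cover_basis[OF c b gen] by blast
 have low: "deg ?K n = {\<zero>\<^bsub>?K\<^esub>}" if "n \<le> t" for n using R.cover_kernel_low[OF c b gen that] by simp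
 have fK: "fspan k (scal \<kappa> ?K) (deg ?K n)" for n
  using R.fspan_kernel[OF cD(1-3) R.free_fspan[OF cD(1) x(2,1) R_zfin]] by blast
 have u: "(%y. y) : graded_hom R ?K Q" by (auto simp: graded_hom_def linear_maps_iff linear_on_def)
 have "presentation k \<iota> A \<kappa> R g e \<epsilon> ?K Q M (%y. y) \<pi> t d x"
  by (intro presentation.intro exact_koszul_dual_axioms presentation_axioms.intro K cD u x low)
   (auto intro: Q.MG.C_closed)
 then show ?thesis using that fK low by blast
qed

lemma lin_kernel:
 assumes l: "lin M t" and c: "projective_cover R Q M \<pi>"
 shows "lin (kernel_module Q M \<pi>) (t + 1)"
proof -
 have fin: "fspan k (scal \<kappa> M) (deg M t)" and ex: "!!j m. j > t ==> exact_at M j m" using l by (auto simp: lin_def)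
 obtain d x where p: "presentation k \<iota> A \<kappa> R g e \<epsilon> (kernel_module Q M \<pi>) Q M (%y. y) \<pi> t d x"
  and K: "!!n. fspan k (scal \<kappa> (kernel_module Q M \<pi>)) (deg (kernel_module Q M \<pi>) n)"
  "!!n. n \<le> t ==> deg (kernel_module Q M \<pi>) n = {\<zero>\<^bsub>kernel_module Q M \<pi>\<^esub>}"
  by (rule cover_presentation[OF c lin_generated[OF l] fin]) blast
 interpret p: presentation k \<iota> A \<kappa> R g e \<epsilon> "kernel_module Q M \<pi>" Q M "%y. y" \<pi> t d x by (rule p)
 have ex': "exact_at (kernel_module Q M \<pi>) j m" if "j > t + 1" for j m
  using p.exact_kernel[of "j - 1" m] ex[of "j - 1"] that by simp
 show ?thesis unfolding lin_def
  by (intro conjI allI impI p.L K(1) ex') (use K(2) in simp_all)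
qed

lemma lin_cover:
 assumes l: "lin M t"
 obtains d f where "projective_cover R (free_module R d t :: ('r, 'x) list_module) M f"
  "generated_in_degree R (free_module R d t :: ('r, 'x) list_module) t"
proof -
 have M: "grmod R M" and fin: "fspan k (scal \<kappa> M) (deg M t)" using l by (auto simp: lin_def)
 interpret v: vspace k "scal \<kappa> M" by (rule R.scal_vspace) (rule graded_left_module.axioms(2)[OF M])
 obtain d b where b: "basis_of k (scal \<kappa> M) (deg M t) d b"
  using v.fspan_basis[OF R.scal_submodule[OF M] fin] by blast
 obtain f where "projective_cover R (free_module R d t :: ('r, 'x) list_module) M f"
  by (rule R.cover_exists[OF M b lin_generated[OF l]])
 moreover have "generated_in_degree R (free_module R d t :: ('r, 'x) list_module) t"
  by (rule basis_generated[OF R.free_graded R.free_basis]) (use R.unit_vec_in in blast)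
 ultimately show ?thesis by (rule that)
qed

text \<open>The property passes to the kernel of a free cover, with \<open>t\<close> raised by one; iterating this gives the linear
resolution.\<close>

lemma lin_koszul:
 fixes M :: "('r, 'm) graded_module"
 assumes l: "lin M 0"
 shows "koszul_module R M"
proof -
 have M: "grmod R M" "left_bounded M" using l unfolding lin_def left_bounded_def by blast+
 obtain d0 \<epsilon>0 where c0: "projective_cover R (free_module R d0 0 :: ('r, 'm) list_module) M \<epsilon>0"
  and g0: "generated_in_degree R (free_module R d0 0 :: ('r, 'm) list_module) 0"
  by (rule lin_cover[OF l])
 let ?P0 = "free_module R d0 0 :: ('r, 'm) list_module"
 define good where "good K t p \<longleftrightarrow> projective_cover R (fst p) K (snd p) & generated_in_degree R (fst p) t"
  for K :: "('r, 'm) list_module" and t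
   and p :: "('r, 'm) list_module \<times> (('r + 'm) list => ('r + 'm) list)"
 define cov where "cov K t = (SOME p. good K t p)" for K t
 have cov: "good K t (cov K t)" if K: "lin K t" for K t
 proof -
  obtain d f where "projective_cover R (free_module R d t :: ('r, 'm) list_module) K f"
   "generated_in_degree R (free_module R d t :: ('r, 'm) list_module) t"
   by (rule lin_cover[OF K])
  then have "good K t (free_module R d t, f)" by (simp add: good_def)
  then show ?thesis unfolding cov_def by (rule someI)
 qed
 define K where "K = rec_nat (kernel_module ?P0 M \<epsilon>0)
  (%n N. kernel_module (fst (cov N (int n + 1))) N (snd (cov N (int n + 1))))"
 have K0: "K 0 = kernel_module ?P0 M \<epsilon>0"
  and KS: "K (Suc n) = kernel_module (fst (cov (K n) (int n + 1))) (K n) (snd (cov (K n) (int n + 1)))" for n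
  by (simp_all add: K_def)
 have lK: "lin (K n) (int n + 1)" for n
 proof (induction n)
  case 0
  then show ?case using lin_kernel[OF l c0] by (simp add: K0)
 next
  case (Suc n)
  from lin_kernel[OF Suc] cov[OF Suc]
  have "lin (K (Suc n)) (int n + 1 + 1)" unfolding KS good_def by blast
  then show ?case by (simp add: ac_simps)
 qed
 note cK = cov[OF lK, unfolded good_def]
 define P where "P n = (case n of 0 => ?P0 | Suc n => fst (cov (K n) (int n + 1)))" for n
 define d where "d n = snd (cov (K n) (int n + 1))" for n
 have zK: "zero (K n) = zero (P n)" for n by (cases n) (simp_all add: K0 KS P_def)
 have KP: "K (Suc n) = kernel_module (P (Suc n)) (P n) (d n)" for n
  unfolding KS d_def P_def nat.case by (rule kernel_module_cong) (simp add: zK P_def split: nat.split)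
 have cP: "projective_cover R (P (Suc n)) (K n) (d n)" for n using cK by (simp add: P_def d_def)
 have "minimal_projective_resolution R M P \<epsilon>0 d"
  unfolding minimal_projective_resolution_def
 proof (intro conjI allI)
  show "projective_cover R (P 0) M \<epsilon>0" using c0 by (simp add: P_def)
  show "projective_cover R (P 1) (kernel_module (P 0) M \<epsilon>0) (d 0)" using cP[of 0] by (simp add: K0 P_def)
  show "projective_cover R (P (n + 2)) (kernel_module (P (n + 1)) (P n) (d n)) (d (n + 1))" for n
   using cP[of "Suc n"] unfolding KP by simp
 qed
 moreover have "generated_in_degree R (P n) (int n)" for n
  by (cases n) (use g0 cK in \<open>simp_all add: P_def ac_simps\<close>)
 ultimately show ?thesis unfolding koszul_module_def using M lin_generated[OF l] by blast
qed

text \<open>Going down the resolution lowers \<open>m\<close>, and for \<open>m = 0\<close> exactness on \<open>M\<close> follows from exactness on a free module.\<close>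

lemma koszul_exact:
 fixes M :: "('r, 'm) graded_module"
 assumes kos: "koszul_module R M" and fin: "fspan k (scal \<kappa> M) (deg M 0)" and j: "j > 0"
 shows "exact_at M j m"
proof -
 have gM: "generated_in_degree R M 0" using kos by (simp add: koszul_module_def)
 obtain P :: "nat => ('r, 'm) list_module" and \<epsilon>0 d where
  res: "minimal_projective_resolution R M P \<epsilon>0 d" and gen: "!!i. generated_in_degree R (P i) (int i)"
  using kos unfolding koszul_module_def by blast
 let ?K = "ker_seq M P \<epsilon>0 d"
 note c0 = resolution_covers(1)[OF res] and c = resolution_covers(2)[OF res]
 obtain d0 x0 where p0: "presentation k \<iota> A \<kappa> R g e \<epsilon> (?K 0) (P 0) M (%y. y) \<epsilon>0 0 d0 x0"
  and f0: "!!n. fspan k (scal \<kappa> (?K 0)) (deg (?K 0) n)"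
  unfolding resolution_covers(3)[OF res] by (rule cover_presentation[OF c0 gM fin]) blast
 have gK: "generated_in_degree R (?K n) (int n + 1)" for n
  using generated_image[OF cover_D(1-4)[OF c[of n]] gen[of "Suc n"]] by (simp add: ac_simps)
 have fK: "fspan k (scal \<kappa> (?K n)) (deg (?K n) z)" for n z
 proof (induction n arbitrary: z)
  case (Suc n)
  show ?case unfolding resolution_covers(4)[OF res] by (rule cover_presentation[OF c gK Suc]) blast
 qed (rule f0)
 have "exact_at (?K n) i m" if "i > int n + 1" for n i m using that
 proof (induction m arbitrary: n i rule: less_induct)
  case (less m)
  obtain d' x where p: "presentation k \<iota> A \<kappa> R g e \<epsilon> (?K (Suc n)) (P (Suc n)) (?K n) (%y. y) (d n) (int n + 1) d' x"
   unfolding resolution_covers(4)[OF res] by (rule cover_presentation[OF c gK fK]) blast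
  show ?case by (rule presentation.exact_quotient[OF p]) (use less in auto)
 qed
 note K = this
 show ?thesis by (rule presentation.exact_quotient[OF p0 j]) (use K[of 0] j in simp)
qed

end

section \<open>The lowest cohomology of a syzygy\<close>

context exact_koszul_dual
begin

lemma coch_scale:
 assumes f: "coch M j m f" and c: "c : component A l"
 shows "coch M j (l + m) (%x. c \<otimes> f x)"
proof (rule cochI)
 have cc: "c : carrier A" using A.RG.C_closed[OF c] .
 fix x assume x: "x : deg M j"
 show "c \<otimes> f x : component A (l + m)" by (rule A.component_mult[OF c cochD(1)[OF f x]])
 show "c \<otimes> f (x \<oplus>\<^bsub>M\<^esub> y) = c \<otimes> f x \<oplus> c \<otimes> f y" if y: "y : deg M j" for y
  using cochD(3)[OF f x y] cochD(2)[OF f x] cochD(2)[OF f y] cc by (simp add: A.r_distr)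
 show "c \<otimes> f (\<kappa> b \<odot>\<^bsub>M\<^esub> x) = \<iota> b \<otimes> (c \<otimes> f x)" if b: "b : carrier k" for b
  using cochD(4)[OF f b x] cochD(2)[OF f x] cc A.\<kappa>_closed[OF b] A_central[OF b cc]
  by (simp add: A.m_assoc[symmetric])
qed

lemma delta_scale:
 assumes M: "grmod R M" and f: "coch M j m f" and c: "c : carrier A" and x: "x : deg M (j - 1)"
 shows "delta M (%x. c \<otimes> f x) x = c \<otimes> delta M f x"
proof -
 have "delta M (%x. c \<otimes> f x) x = (\<Oplus>s\<in>{..<g}. c \<otimes> (f (\<epsilon> s \<odot>\<^bsub>M\<^esub> x) \<otimes> e s))"
  unfolding delta_def using delta_term(2)[OF M f _ x] c cochD(2)[OF f eps_smult[OF M _ x]] e_closed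
  by (intro A.finsum_cong') (auto simp: A.m_assoc)
 also have "... = c \<otimes> delta M f x" unfolding delta_def
  using delta_term(2)[OF M f _ x] c by (intro A.finsum_rdistr[symmetric]) auto
 finally show ?thesis .
qed

text \<open>\<open>\<Phi> m f a\<close> relates a cochain on the lowest component \<open>M\<^sub>t\<close> to an element of \<open>A\<^bsub>m+i\<^esub>\<close>. Such a relation is a
left-linear identification of the cohomology there with \<open>A\<close> shifted by \<open>i\<close>. A relation is easier to carry along the
syzygies than a map, since each step involves choices of liftings.\<close>

definition bottom :: "('r, 'm) graded_module => int => nat => (nat => ('m => 'a) => 'a => bool) => bool" where
 "bottom M t i \<Phi> \<equiv>
  (ALL m f a. \<Phi> m f a --> coch M t m f & a : component A (m + i) & (cob M t m f \<longleftrightarrow> a = \<zero>)) \<and>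
  (ALL m f. coch M t m f --> (EX a. \<Phi> m f a)) \<and>
  (ALL m. ALL a:component A (m + i). EX f. \<Phi> m f a) \<and>
  (ALL m f a l. ALL c:component A l. \<Phi> m f a --> \<Phi> (l + m) (%x. c \<otimes> f x) (c \<otimes> a))"

lemma bottomD:
 assumes "bottom M t i \<Phi>"
 shows "\<Phi> m f a ==> coch M t m f" "\<Phi> m f a ==> a : component A (m + i)" "\<Phi> m f a ==> cob M t m f \<longleftrightarrow> a = \<zero>"
  "coch M t m f ==> EX a. \<Phi> m f a" "a : component A (m + i) ==> EX f. \<Phi> m f a"
  "[|c : component A l; \<Phi> m f a|] ==> \<Phi> (l + m) (%x. c \<otimes> f x) (c \<otimes> a)"
 using assms unfolding bottom_def by blast+

lemma bottomI:
 assumes "!!m f a. \<Phi> m f a ==> coch M t m f" "!!m f a. \<Phi> m f a ==> a : component A (m + i)"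
  "!!m f a. \<Phi> m f a ==> cob M t m f \<longleftrightarrow> a = \<zero>"
  "!!m f. coch M t m f ==> EX a. \<Phi> m f a" "!!m a. a : component A (m + i) ==> EX f. \<Phi> m f a"
  "!!m f a c l. [|c : component A l; \<Phi> m f a|] ==> \<Phi> (l + m) (%x. c \<otimes> f x) (c \<otimes> a)"
 shows "bottom M t i \<Phi>"
 using assms unfolding bottom_def by blast

lemma iso_cob:
 assumes N: "grmod R N" and M: "grmod R M"
  and h: "h : graded_hom R N M" "bij_betw h (carrier N) (carrier M)"
  and eq: "!!x. x : deg N j ==> f x = f' (h x)"
 shows "cob N j m f \<longleftrightarrow> cob M j m f'"
proof
 interpret N: graded_left_module R N by (rule N)
 interpret M: graded_left_module R M by (rule M)
 let ?v = "inv_into (carrier N) h"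
 note v = graded_iso_inv[OF N M h]
 assume "cob N j m f"
 then have "cob M j m (%x. f (?v x))" by (rule cob_pull[OF M N v(1)])
 then show "cob M j m f'"
 proof (rule cob_cong)
  fix x assume x: "x : deg M j"
  have "?v x : deg N j" using v(1) x by (auto simp: graded_hom_def)
  from eq[OF this] show "f (?v x) = f' x"
   using bij_betw_inv_into_right[OF h(2) M.MG.C_closed[OF x]] by simp
 qed
next
 assume "cob M j m f'"
 from cob_pull[OF N M h(1) this] show "cob N j m f" by (rule cob_cong) (simp add: eq)
qed

lemma bottom_iso:
 assumes N: "grmod R N" and M: "grmod R M"
  and h: "h : graded_hom R N M" "bij_betw h (carrier N) (carrier M)" and \<Phi>: "bottom M t i \<Phi>"
 shows "bottom N t i (%m f a. coch N t m f & (EX f'. \<Phi> m f' a & (ALL x:deg N t. f x = f' (h x))))"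
proof -
 interpret N: graded_left_module R N by (rule N)
 note v = graded_iso_inv[OF N M h] and B = bottomD[OF \<Phi>]
 show ?thesis
 proof (rule bottomI)
  fix m f assume f: "coch N t m f"
  obtain a where "\<Phi> m (%x. f (inv_into (carrier N) h x)) a" using B(4)[OF coch_pull[OF M N v(1) f]] by blast
  moreover have "f x = f (inv_into (carrier N) h (h x))" if "x : deg N t" for x
   using bij_betw_inv_into_left[OF h(2) N.MG.C_closed[OF that]] by simp
  ultimately show "EX a. coch N t m f & (EX f'. \<Phi> m f' a & (ALL x:deg N t. f x = f' (h x)))"
   using f by blast
 next
  fix m a assume "a : component A (m + i)"
  then obtain f where f: "\<Phi> m f a" using B(5) by blast
  then show "EX f. coch N t m f & (EX f'. \<Phi> m f' a & (ALL x:deg N t. f x = f' (h x)))"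
   using coch_pull[OF N M h(1) B(1)[OF f]] by blast
 next
  fix m f a assume a: "coch N t m f & (EX f'. \<Phi> m f' a & (ALL x:deg N t. f x = f' (h x)))"
  then obtain f' where f': "\<Phi> m f' a" "!!x. x : deg N t ==> f x = f' (h x)" by blast
  show "coch N t m f" "a : component A (m + i)" using a B(2)[OF f'(1)] by auto
  show "cob N t m f \<longleftrightarrow> a = \<zero>" using iso_cob[OF N M h, of t f f' m] f'(2) B(3)[OF f'(1)] by simp
  fix c l assume c: "c : component A l"
  show "coch N t (l + m) (%x. c \<otimes> f x) \<and>
   (EX f'. \<Phi> (l + m) f' (c \<otimes> a) & (ALL x:deg N t. c \<otimes> f x = f' (h x)))"
   using coch_scale[OF conjunct1[OF a] c] B(6)[OF c f'(1)] f'(2)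
   by (intro conjI exI[of _ "%x. c \<otimes> f' x"]) simp_all
 qed
qed

lemma lin_iso:
 assumes N: "grmod R N" and M: "grmod R M"
  and h: "h : graded_hom R N M" "bij_betw h (carrier N) (carrier M)" and l: "lin M t"
 shows "lin N t"
proof -
 interpret N: graded_left_module R N by (rule N)
 interpret M: graded_left_module R M by (rule M)
 let ?v = "inv_into (carrier N) h"
 note v = graded_iso_inv[OF N M h]
 have vM: "vspace k (scal \<kappa> M)" by (rule R.scal_vspace) (rule M.left_module_axioms)
 interpret vM: vspace k "scal \<kappa> M" by (rule vM)
 interpret vN: vspace k "scal \<kappa> N" by (rule R.scal_vspace) (rule N.left_module_axioms)
 have im: "deg N n = ?v ` deg M n" for n
 proof
  show "?v ` deg M n \<subseteq> deg N n" using v(1) by (auto simp: graded_hom_def)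
  show "deg N n \<subseteq> ?v ` deg M n"
  proof
   fix x assume x: "x : deg N n"
   have "h x : deg M n" using h(1) x by (auto simp: graded_hom_def)
   moreover have "x = ?v (h x)" using bij_betw_inv_into_left[OF h(2) N.MG.C_closed[OF x]] by simp
   ultimately show "x : ?v ` deg M n" by blast
  qed
 qed
 have vl: "linear_on R M N (carrier M) ?v" by (rule graded_hom_linear[OF v(1)])
 have vz: "?v \<zero>\<^bsub>M\<^esub> = \<zero>\<^bsub>N\<^esub>" by (rule linear_on_zero[OF M.left_module_axioms N.left_module_axioms M.carrier_submodule vl])
 have "linear_on k (scal \<kappa> M) (scal \<kappa> N) (deg M n) ?v" for n
  using vl R.\<kappa>_closed M.MG.C_closed[of _ n] unfolding linear_on_def by (auto simp: Pi_iff)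
 then have fs: "fspan k (scal \<kappa> N) (deg N n)" for n
  unfolding im using l
  by (intro fspan_image[OF vM.left_module_axioms vN.left_module_axioms R.scal_submodule[OF M]]) (auto simp: lin_def)
 have ex: "exact_at N j m" if j: "t < j" for j m
  unfolding exact_at_def
 proof (intro allI impI)
  fix f assume f: "coch N j m f" and z: "ALL x:deg N (j - 1). delta N f x = \<zero>"
  have "cob M j m (%x. f (?v x))"
  proof (rule exact_atD[OF _ coch_pull[OF M N v(1) f]])
   show "exact_at M j m" using l j by (simp add: lin_def)
   fix x assume x: "x : deg M (j - 1)"
   then have "?v x : deg N (j - 1)" using im by blast
   then show "delta M (%x. f (?v x)) x = \<zero>" using delta_pull[OF M N v(1) f x] z by simp
  qed
  moreover have "f x = f (?v (h x))" if "x : deg N j" for x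
   using bij_betw_inv_into_left[OF h(2) N.MG.C_closed[OF that]] by simp
  ultimately show "cob N j m f" using iso_cob[OF N M h, of j f "%x. f (?v x)" m] by simp
 qed
 have low: "deg N n = {\<zero>\<^bsub>N\<^esub>}" if "n < t" for n
  using l that vz by (simp add: im lin_def)
 show ?thesis unfolding lin_def by (intro conjI allI impI N fs ex low)
qed

end

context presentation
begin

text \<open>Extend a cochain on \<open>L\<close> to \<open>P\<close>; its coboundary descends to the lowest component of \<open>M\<close>, where it has a value \<open>a\<close>.
All of \<open>A\<^bsub>m+i+1\<^esub>\<close> is reached because every cochain of positive internal degree on the generators of \<open>P\<close> is a
coboundary.\<close>

lemma bottom_kernel:
 assumes \<Phi>: "bottom M t i \<Phi>"
 shows "bottom L (t + 1) (Suc i) (%m q a. coch L (t + 1) m q & (EX h f. coch P (t + 1) m h \<and>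
  (ALL l:deg L (t + 1). h (u l) = q l) & \<Phi> (Suc m) f a & (ALL y:deg P t. delta P h y = f (\<pi> y))))"
proof (rule bottomI)
 note B = bottomD[OF \<Phi>]
 {
  fix m q assume q: "coch L (t + 1) m q"
  obtain h where h: "coch P (t + 1) m h" "!!l. l : deg L (t + 1) ==> h (u l) = q l"
   by (rule lift_cochain[OF q]) blast
  have dh: "coch P t (Suc m) (delta P h)" using delta_coch[OF P h(1)] by simp
  have lz: "u \<zero>\<^bsub>L\<^esub> = \<zero>\<^bsub>P\<^esub>"
   by (rule linear_on_zero[OF Lm.left_module_axioms Pm.left_module_axioms Lm.carrier_submodule graded_hom_linear[OF u]])
  have dz: "delta P h (u l) = \<zero>" if "l : deg L t" for l
   using coch_at_zero[OF dh P] that low lz by simp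
  obtain f where f: "coch M t (Suc m) f" "!!y. y : deg P t ==> f (\<pi> y) = delta P h y"
   by (rule descend_cochain[OF dh dz], assumption, blast)
  obtain a where "\<Phi> (Suc m) f a" using B(4)[OF f(1)] by blast
  then show "EX a. coch L (t + 1) m q & (EX h f. coch P (t + 1) m h \<and>
   (ALL l:deg L (t + 1). h (u l) = q l) & \<Phi> (Suc m) f a & (ALL y:deg P t. delta P h y = f (\<pi> y)))"
   using q h f(2)[symmetric] by blast
 }
 {
  fix m a assume "a : component A (m + Suc i)"
  then obtain f where f: "\<Phi> (Suc m) f a" using B(5)[of a "Suc m"] by auto
  obtain h where h: "coch P (t + 1) m h" "ALL y:deg P t. f (\<pi> y) = delta P h y"
   using free_bottom[OF P basis degree coch_pull[OF P M \<pi> B(1)[OF f]]] by blast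
  then show "EX q. coch L (t + 1) m q & (EX h f. coch P (t + 1) m h \<and>
   (ALL l:deg L (t + 1). h (u l) = q l) & \<Phi> (Suc m) f a & (ALL y:deg P t. delta P h y = f (\<pi> y)))"
   using coch_pull[OF L P u h(1)] f by force
 }
 fix m q a
 assume "coch L (t + 1) m q & (EX h f. coch P (t + 1) m h \<and>
  (ALL l:deg L (t + 1). h (u l) = q l) & \<Phi> (Suc m) f a & (ALL y:deg P t. delta P h y = f (\<pi> y)))"
 then obtain h f where q: "coch L (t + 1) m q" and h: "coch P (t + 1) m h"
  "!!l. l : deg L (t + 1) ==> h (u l) = q l" and f: "\<Phi> (Suc m) f a"
  "!!y. y : deg P t ==> delta P h y = f (\<pi> y)" by blast
 show "coch L (t + 1) m q" by (rule q)
 show "a : component A (m + Suc i)" using B(2)[OF f(1)] by simp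
 have "cob L (t + 1) m q \<longleftrightarrow> cob L (t + 1) m (%l. h (u l))"
  using cob_cong[of L "t + 1" m q "%l. h (u l)"] cob_cong[of L "t + 1" m "%l. h (u l)" q] h(2) by auto
 also have "... \<longleftrightarrow> cob M t (Suc m) f" by (rule coboundary_transfer[OF order_refl B(1)[OF f(1)] h(1) f(2)])
 finally show "cob L (t + 1) m q \<longleftrightarrow> a = \<zero>" using B(3)[OF f(1)] by simp
 fix c l assume c: "c : component A l"
 have "delta P (%y. c \<otimes> h y) y = c \<otimes> f (\<pi> y)" if "y : deg P t" for y
  using delta_scale[OF P h(1) A.RG.C_closed[OF c], of y] f(2)[OF that] that by simp
 then show "coch L (t + 1) (l + m) (%x. c \<otimes> q x) & (EX h f. coch P (t + 1) (l + m) h \<and>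
  (ALL x:deg L (t + 1). h (u x) = c \<otimes> q x) & \<Phi> (Suc (l + m)) f (c \<otimes> a) \<and>
  (ALL y:deg P t. delta P h y = f (\<pi> y)))"
  using coch_scale[OF q c] coch_scale[OF h(1) c] h(2) B(6)[OF c f(1)]
  by (intro conjI exI[of _ "%y. c \<otimes> h y"] exI[of _ "%x. c \<otimes> f x"]) auto
qed

end

context exact_koszul_dual
begin

lemma coch_zero: "grmod R M ==> coch M j m (%_. \<zero>)"
 using A.RG.C_subD(2) A.\<kappa>_closed by (intro cochI) auto

lemma delta_zero: "grmod R M ==> delta M (%_. \<zero>) x = \<zero>"
 unfolding delta_def using e_closed by (intro A.add.finprod_one_eqI) auto

lemma cob_zero: "grmod R M ==> (!!x. x : deg M j ==> f x = \<zero>) ==> cob M j m f"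
 by (cases m) (auto simp: cob_0 cob_Suc delta_zero intro!: exI[of _ "%_. \<zero>"] coch_zero)

abbreviation triv :: "('r, 'r set) graded_module" where "triv \<equiv> top_module R"

lemma triv_component: "n ~= 0 ==> deg triv n = {\<zero>\<^bsub>triv\<^esub>}"
 by (simp add: R.top_simps)

lemma triv_lin: "lin triv 0"
proof -
 interpret T: graded_left_module R triv by (rule R.top_graded)
 interpret v: vspace k "scal \<kappa> triv" by (rule R.scal_vspace) (rule T.left_module_axioms)
 have fs: "fspan k (scal \<kappa> triv) (deg triv n)" for n
 proof (cases "n = 0")
  case True
  then show ?thesis using basis_fspan[OF R.top_basis] by simp
 next
  case False
  show ?thesis unfolding fspan_def triv_component[OF False] by (auto intro!: exI[of _ 0] simp: v.lc_0)
 qed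
 have ex: "exact_at triv j m" if "j > 0" for j m
  unfolding exact_at_def
 proof (intro allI impI cob_zero R.top_graded)
  fix f x assume "coch triv j m f" "x : deg triv j"
  then show "f x = \<zero>" using coch_at_zero[OF _ R.top_graded, of j m f] triv_component[of j] that by simp
 qed
 show ?thesis unfolding lin_def by (intro conjI allI impI R.top_graded fs ex triv_component) simp
qed

lemma triv_bottom: "bottom triv 0 0 (%m f a. coch triv 0 m f & f (R.cls \<one>\<^bsub>R\<^esub>) = a)"
proof -
 interpret T: graded_left_module R triv by (rule R.top_graded)
 interpret v: vspace k "scal \<kappa> triv" by (rule R.scal_vspace) (rule T.left_module_axioms)
 let ?o = "R.cls \<one>\<^bsub>R\<^esub>"
 define c where "c X = coord k (scal \<kappa> triv) 1 (%_. ?o) X 0" for X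
 have W: "submodule (deg triv 0) k (scal \<kappa> triv)" by (rule R.scal_submodule[OF R.top_graded])
 have o: "?o : deg triv 0" by (simp add: R.top_simps)
 have cc: "c X : carrier k" if "X : deg triv 0" for X
  unfolding c_def using v.coord_closed[OF R.top_basis that] by simp
 have X: "X = \<kappa> (c X) \<odot>\<^bsub>triv\<^esub> ?o" if "X : deg triv 0" for X
  using v.coord_props(2)[OF R.top_basis that] v.lc_Suc[of "coord k (scal \<kappa> triv) 1 (%_. ?o) X" 0 "%_. ?o"]
   v.coord_props(1)[OF R.top_basis that] T.MG.C_closed[OF o] T.smult_closed[OF R.\<kappa>_closed[OF cc[OF that]]]
  by (simp add: c_def v.lc_0)
 have fX: "f X = \<iota> (c X) \<otimes> f ?o" if "coch triv 0 m f" "X : deg triv 0" for m f X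
  using cochD(4)[OF that(1) cc[OF that(2)] o] X[OF that(2)] by simp
 have z: "cob triv 0 m f \<longleftrightarrow> f ?o = \<zero>" if f: "coch triv 0 m f" for m f
 proof
  assume cb: "cob triv 0 m f"
  show "f ?o = \<zero>"
  proof (cases m)
   case 0
   then show ?thesis using cb o by (simp add: cob_0)
  next
   case (Suc n)
   then have "cob triv 0 (Suc n) f" using cb by simp
   then obtain w where w: "coch triv (0 + 1) n w" "!!x. x : deg triv 0 ==> f x = delta triv w x"
    unfolding cob_Suc by blast
   have "\<epsilon> s \<odot>\<^bsub>triv\<^esub> ?o = \<zero>\<^bsub>triv\<^esub>" if "s < g" for s
    using eps_smult[OF R.top_graded that, of ?o 1] o triv_component[of 1] by simp
   then have "delta triv w ?o = \<zero>" unfolding delta_def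
    using coch_at_zero[OF w(1) R.top_graded] e_closed by (intro A.add.finprod_one_eqI) auto
   then show ?thesis using w(2)[OF o] by simp
  qed
 next
  assume "f ?o = \<zero>"
  then show "cob triv 0 m f" using fX[OF f] A.\<kappa>_closed[OF cc] by (intro cob_zero R.top_graded) auto
 qed
 have ex: "EX f. coch triv 0 m f & f ?o = a" if a: "a : component A m" for m a
 proof (intro exI conjI)
  have ac: "a : carrier A" using A.RG.C_closed[OF a] .
  show "coch triv 0 m (%X. \<iota> (c X) \<otimes> a)"
  proof (rule cochI)
   fix X assume X: "X : deg triv 0"
   show "\<iota> (c X) \<otimes> a : component A m" using A.component_mult[OF A.\<kappa>_in[OF cc[OF X]] a] by simp
   show "\<iota> (c (X \<oplus>\<^bsub>triv\<^esub> Y)) \<otimes> a = \<iota> (c X) \<otimes> a \<oplus> \<iota> (c Y) \<otimes> a" if Y: "Y : deg triv 0" for Y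
    using v.coord_add[OF R.top_basis W X Y] ring_hom_add[OF A.\<kappa>_hom cc[OF X] cc[OF Y]]
     A.l_distr[OF A.\<kappa>_closed[OF cc[OF X]] A.\<kappa>_closed[OF cc[OF Y]] ac] by (simp add: c_def)
   show "\<iota> (c (\<kappa> b \<odot>\<^bsub>triv\<^esub> X)) \<otimes> a = \<iota> b \<otimes> (\<iota> (c X) \<otimes> a)" if b: "b : carrier k" for b
    using v.coord_smult[OF R.top_basis W X b] ring_hom_mult[OF A.\<kappa>_hom b cc[OF X]]
     A.m_assoc[OF A.\<kappa>_closed[OF b] A.\<kappa>_closed[OF cc[OF X]] ac] by (simp add: c_def)
  qed
  show "\<iota> (c ?o) \<otimes> a = a"
   using v.coord_basis[OF R.top_basis W, of 0 0] ac A.\<kappa>_one by (simp add: c_def)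
 qed
 show ?thesis
 proof (rule bottomI)
  fix m a assume "a : component A (m + 0)"
  then show "EX f. coch triv 0 m f & f ?o = a" using ex by simp
 qed (use z cochD(1)[OF _ o] coch_scale in auto)
qed

lemma syzygy_lin_bottom:
 assumes "is_syzygy R triv i N"
 shows "lin N (int i) & (\<exists>\<Phi>. bottom N (int i) i \<Phi>)"
 using assms
proof (induction rule: is_syzygy.induct)
 case (zero N)
 then obtain h where N: "grmod R N" and h: "h : graded_hom R triv N" "bij_betw h (carrier triv) (carrier N)"
  unfolding graded_isomorphic_def by blast
 note v = graded_iso_inv[OF R.top_graded N h]
 show ?case using lin_iso[OF N R.top_graded v triv_lin] bottom_iso[OF N R.top_graded v triv_bottom] by auto
next
 case (Suc n N P \<pi> N')
 then obtain h where K: "grmod R (kernel_module P N \<pi>)" and N: "grmod R N'"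
  and h: "h : graded_hom R (kernel_module P N \<pi>) N'" "bij_betw h (carrier (kernel_module P N \<pi>)) (carrier N')"
  unfolding graded_isomorphic_def by blast
 note v = graded_iso_inv[OF K N h]
 from Suc obtain \<Phi> where l: "lin N (int n)" and \<Phi>: "bottom N (int n) n \<Phi>" by blast
 have fin: "fspan k (scal \<kappa> N) (deg N (int n))" using l by (simp add: lin_def)
 obtain d x where p: "presentation k \<iota> A \<kappa> R g e \<epsilon> (kernel_module P N \<pi>) P N (%y. y) \<pi> (int n) d x"
  by (rule cover_presentation[OF Suc(2) lin_generated[OF l] fin]) blast
 have "\<exists>\<Phi>. bottom N' (int n + 1) (Suc n) \<Phi>"
  by (rule exI) (rule bottom_iso[OF N K v presentation.bottom_kernel[OF p \<Phi>]])
 moreover have e: "int (Suc n) = int n + 1" by simp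
 ultimately show ?case unfolding e using lin_iso[OF N K v lin_kernel[OF l Suc(2)]] by blast
qed

text \<open>Needed for the converse implication, where every \<open>b \<in> A\<^sub>i\<close> has to be realised by a syzygy.\<close>

lemma syzygy_exists: "EX N. is_syzygy R triv i N"
proof (induction i)
 case 0
 have "graded_isomorphic R triv (copy_module triv)"
  unfolding graded_isomorphic_def using R.top_graded copy_graded[OF R.top_graded]
  by (auto intro!: bexI[of _ "%x. [Inr x]"] simp: bij_betw_def inj_on_def)
 then show ?case by (blast intro: is_syzygy.zero)
next
 case (Suc i)
 then obtain N where N: "is_syzygy R triv i N" by blast
 then have l: "lin N (int i)" using syzygy_lin_bottom by blast
 obtain d f where c: "projective_cover R (free_module R d (int i) :: ('r, 'r set) list_module) N f"
  by (rule lin_cover[OF l])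
 let ?K = "kernel_module (free_module R d (int i) :: ('r, 'r set) list_module) N f"
 have "grmod R ?K" by (rule kernel_graded(1)[OF cover_D(1-3)[OF c]])
 then have "graded_isomorphic R ?K ?K"
  unfolding graded_isomorphic_def
  by (auto intro!: bexI[of _ "%x. x"] simp: bij_betw_def graded_hom_def linear_maps_iff linear_on_def)
 then show ?case using is_syzygy.Suc[OF N c] by blast
qed

end

section \<open>Shifts\<close>

lemma shift_simps [simp]:
 "carrier (shift M i) = carrier M" "zero (shift M i) = zero M" "add (shift M i) = add M" "smult (shift M i) = smult M"
 "deg (shift M i) n = deg M (i + n)"
 by (simp_all add: shift_def)

lemma shift_graded:
 assumes "grmod R M"
 shows "grmod R (shift M i)"
proof -
 interpret M: graded_left_module R M by fact
 let ?S = "shift M i"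
 have g: "abelian_group ?S" by (rule abelian_group_struct[OF M.M_group]) simp_all
 have m: "left_module R ?S"
  using M.smult_closed M.smult_l_distr M.smult_r_distr M.smult_assoc M.smult_one
  by (intro left_module.intro M.R_ring g left_module_axioms.intro) simp_all
 have "internal_direct_sum ?S UNIV (deg ?S)"
 proof (rule ids_intro[OF g, where p = "%n x. mcomp M x (i + n)"])
  have inj: "inj_on ((+) i) X" for X by (simp add: inj_on_def)
  have im: "(+) i ` {n. mcomp M x (i + n) ~= \<zero>\<^bsub>M\<^esub>} = {n. mcomp M x n ~= \<zero>\<^bsub>M\<^esub>}" for x
  proof
   show "{n. mcomp M x n ~= \<zero>\<^bsub>M\<^esub>} \<subseteq> (+) i ` {n. mcomp M x (i + n) ~= \<zero>\<^bsub>M\<^esub>}"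
    by (rule subsetI, rule_tac x = "xa - i" in image_eqI) auto
  qed auto
  fix x assume "x : carrier ?S"
  then have x: "x : carrier M" by simp
  show "finite {n. mcomp M x (i + n) ~= \<zero>\<^bsub>?S\<^esub>}"
   using M.MG.hcomp_props(2)[OF x] finite_image_iff[OF inj] im[of x] by (metis shift_simps(2))
  have "x = (\<Oplus>\<^bsub>M\<^esub>n\<in>(+) i ` {n. mcomp M x (i + n) ~= \<zero>\<^bsub>M\<^esub>}. mcomp M x n)"
   unfolding im by (rule M.MG.hcomp_props(3)[OF x])
  also have "... = (\<Oplus>\<^bsub>M\<^esub>n\<in>{n. mcomp M x (i + n) ~= \<zero>\<^bsub>M\<^esub>}. mcomp M x (i + n))"
   using M.MG.hcomp_carrier[OF x] by (intro M.add.finprod_reindex inj) auto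
  also have "... = (\<Oplus>\<^bsub>?S\<^esub>n\<in>{n. mcomp M x (i + n) ~= \<zero>\<^bsub>?S\<^esub>}. mcomp M x (i + n))"
   unfolding shift_simps by (rule finsum_struct) simp_all
  finally show "x = (\<Oplus>\<^bsub>?S\<^esub>n\<in>{n. mcomp M x (i + n) ~= \<zero>\<^bsub>?S\<^esub>}. mcomp M x (i + n))" .
 qed (use M.MG.C_sub M.MG.hcomp_props(1) M.MG.hcomp_add M.MG.hcomp_homog in \<open>simp_all add: shift_def\<close>)
 moreover have "a \<odot>\<^bsub>?S\<^esub> x : deg ?S (int p + n)" if "a : component R p" "x : deg ?S n" for a p x n
  using M.component_smult[OF that(1), of x "i + n"] that(2) by (simp add: ac_simps)
 ultimately show ?thesis
  by (intro graded_left_module.intro m graded_left_module_axioms.intro M.graded_ring_axioms)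
qed

context graded_left_module
begin

lemma mcomp_smult_bottom:
 assumes low: "!!n. n < t ==> deg M n = {\<zero>\<^bsub>M\<^esub>}" and r: "r : carrier R" and x: "x : carrier M"
 shows "mcomp M (r \<odot>\<^bsub>M\<^esub> x) t = rcomp R r 0 \<odot>\<^bsub>M\<^esub> mcomp M x t"
proof -
 let ?S = "insert 0 {n. rcomp R r n ~= \<zero>}"
 have fin: "finite ?S" using RG.hcomp_props(2)[OF r] by simp
 have h: "rcomp R r n : component R n" "rcomp R r n : carrier R" for n
  using RG.hcomp_props(1)[OF r] RG.hcomp_carrier[OF r] by auto
 have xt: "mcomp M x n : carrier M" for n using MG.hcomp_carrier[OF x] .
 have "r = (\<Oplus>n\<in>?S. rcomp R r n)" by (rule RG.hcomp_sum[OF r fin]) simp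
 then have "r \<odot>\<^bsub>M\<^esub> x = (\<Oplus>n\<in>?S. rcomp R r n) \<odot>\<^bsub>M\<^esub> x" by (rule arg_cong)
 also have "... = (\<Oplus>\<^bsub>M\<^esub>n\<in>?S. rcomp R r n \<odot>\<^bsub>M\<^esub> x)" using h x by (intro finsum_smult_l) auto
 finally have "mcomp M (r \<odot>\<^bsub>M\<^esub> x) t = mcomp M (\<Oplus>\<^bsub>M\<^esub>n\<in>?S. rcomp R r n \<odot>\<^bsub>M\<^esub> x) t" by (rule arg_cong)
 also have "... = (\<Oplus>\<^bsub>M\<^esub>n\<in>?S. mcomp M (rcomp R r n \<odot>\<^bsub>M\<^esub> x) t)"
  using h x smult_closed by (intro MG.hcomp_finsum) auto
 also have "... = mcomp M (rcomp R r 0 \<odot>\<^bsub>M\<^esub> x) t"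
 proof (rule finsum_single[OF fin])
  fix n assume n: "n : ?S" "n ~= 0"
  have "mcomp M x (t - int n) : deg M (t - int n)" by (rule MG.hcomp_props(1)[OF x])
  then have "mcomp M x (t - int n) = \<zero>\<^bsub>M\<^esub>" using low[of "t - int n"] n by simp
  then show "mcomp M (rcomp R r n \<odot>\<^bsub>M\<^esub> x) t = \<zero>\<^bsub>M\<^esub>"
   using mcomp_smult[OF h(1) x, of n t] smult_zero_r[OF h(2)] by simp
 qed (use MG.hcomp_carrier[OF smult_closed[OF h(2) x]] in simp_all)
 also have "... = rcomp R r 0 \<odot>\<^bsub>M\<^esub> mcomp M x t" using mcomp_smult[OF h(1) x, of 0 t] by simp
 finally show ?thesis .
qed

end

section \<open>Zero divisors and homogeneous elements\<close>

text \<open>The product of the top-degree components of \<open>x\<close> and \<open>y\<close> is the component of \<open>x y\<close> in the highest possible degree.\<close>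

lemma (in graded_ring) domain_homogeneous:
 assumes z: "!!m n a b. [|a : component R m; b : component R n; a \<otimes> b = \<zero>|] ==> a = \<zero> \<or> b = \<zero>"
  and x: "x : carrier R" and y: "y : carrier R" and xy: "x \<otimes> y = \<zero>"
 shows "x = \<zero> \<or> y = \<zero>"
proof (rule ccontr)
 assume "\<not> ?thesis"
 then have nz: "x ~= \<zero>" "y ~= \<zero>" by auto
 have top: "EX m. rcomp R v m ~= \<zero> & (ALL i>m. rcomp R v i = \<zero>)" if v: "v : carrier R" "v ~= \<zero>" for v
 proof -
  let ?S = "{i. rcomp R v i ~= \<zero>}"
  have fin: "finite ?S" by (rule RG.hcomp_props(2)[OF v(1)])
  have "?S ~= {}" using RG.hcomp_eqI[OF v(1) zero_closed] RG.hcomp_zero v(2) by auto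
  then have "Max ?S : ?S" using fin by (rule Max_in[rotated])
  moreover have "rcomp R v i = \<zero>" if "i > Max ?S" for i
   using Max_ge[OF fin, of i] that by auto
  ultimately show ?thesis by blast
 qed
 obtain m where m: "rcomp R x m ~= \<zero>" "!!i. i > m ==> rcomp R x i = \<zero>" using top[OF x nz(1)] by blast
 obtain n where n: "rcomp R y n ~= \<zero>" "!!i. i > n ==> rcomp R y i = \<zero>" using top[OF y nz(2)] by blast
 note c = RG.hcomp_carrier[OF x] RG.hcomp_carrier[OF y]
 have "\<zero> = rcomp R (x \<otimes> y) (m + n)" unfolding xy by (rule RG.hcomp_zero[symmetric])
 also have "... = (\<Oplus>i\<in>{..m + n}. rcomp R x i \<otimes> rcomp R y (m + n - i))" by (rule rcomp_mult[OF x y])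
 also have "... = rcomp R x m \<otimes> rcomp R y (m + n - m)"
 proof (rule finsum_single)
  fix i assume "i : {..m + n}" "i ~= m"
  then consider "i > m" | "m + n - i > n" by fastforce
  then show "rcomp R x i \<otimes> rcomp R y (m + n - i) = \<zero>" by cases (use m n c in simp_all)
 qed (use c in auto)
 finally have "rcomp R x m \<otimes> rcomp R y n = \<zero>" by simp
 from z[OF RG.hcomp_props(1)[OF x] RG.hcomp_props(1)[OF y] this] show False using m n by blast
qed

section \<open>Kernels of maps from a syzygy to the trivial module\<close>

context exact_koszul_dual
begin

lemma coch_struct:
 assumes "add M = add N" "smult M = smult N" "deg M j = deg N j'"
 shows "coch M j m f \<longleftrightarrow> coch N j' m f"
 using assms by (auto simp: coch_def linear_on_def scal_def)

lemma cob_struct: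
 assumes "add M = add N" "smult M = smult N" "deg M j = deg N j'" "deg M (j + 1) = deg N (j' + 1)"
 shows "cob M j m f \<longleftrightarrow> cob N j' m f"
 using assms coch_struct[OF assms(1,2,4)] by (auto simp: cob_def delta_def split: nat.split)

lemma exact_at_struct:
 assumes "add M = add N" "smult M = smult N" "!!l. l \<ge> j - 1 ==> deg M l = deg N (j' - j + l)"
 shows "exact_at M j m \<longleftrightarrow> exact_at N j' m"
 using coch_struct[OF assms(1,2), of j j'] cob_struct[OF assms(1,2), of j j'] assms(3)[of "j - 1"] assms(3)[of j]
  assms(3)[of "j + 1"] assms(2) by (simp add: exact_at_def delta_def)

lemma triv_functional:
 obtains T where "coch triv 0 0 T" "!!X. [|X : deg triv 0; T X = \<zero>|] ==> X = \<zero>\<^bsub>triv\<^esub>"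
proof -
 interpret T: graded_left_module R triv by (rule R.top_graded)
 let ?o = "R.cls \<one>\<^bsub>R\<^esub>"
 have "\<one> : component A (0 + 0)" using A.one_component by simp
 from bottomD(5)[OF triv_bottom this] obtain T where T: "coch triv 0 0 T" "T ?o = \<one>" by blast
 have o: "?o : deg triv 0" by (simp add: R.top_simps)
 have "X = \<zero>\<^bsub>triv\<^esub>" if X: "X : deg triv 0" "T X = \<zero>" for X
 proof -
  obtain a where a: "a : carrier R" "X = R.cls a" using X(1) by (auto simp: R.top_simps)
  obtain c where c: "c : carrier k" "X = R.cls (\<kappa> c)" using R.cls_scalar[OF a(1)] a(2) by auto
  have Xc: "X = \<kappa> c \<odot>\<^bsub>triv\<^esub> ?o" using R.top_simps(4)[OF R.\<kappa>_closed[OF c(1)] R.one_closed] c R.\<kappa>_closed[OF c(1)] by simp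
  have "\<iota> c = \<zero>" using cochD(4)[OF T(1) c(1) o] X(2) T(2) A.\<kappa>_closed[OF c(1)] unfolding Xc by simp
  then have "c = \<zero>\<^bsub>k\<^esub>" by (rule A.\<kappa>_eq_zero[OF c(1)])
  then show ?thesis using Xc R.\<kappa>_zero T.smult_zero_l[OF T.MG.C_closed[OF o]] by simp
 qed
 then show ?thesis using that T(1) by blast
qed

lemma coch_factor:
 assumes N: "grmod R N" and p: "coch N t 0 p" and w: "coch N t m w"
  and ker: "!!x. [|x : deg N t; p x = \<zero>|] ==> w x = \<zero>"
 shows "EX a:component A m. ALL x:deg N t. w x = a \<otimes> p x"
proof (cases "ALL x:deg N t. p x = \<zero>")
 case True
 then show ?thesis using ker A.RG.C_subD(2) by (intro bexI[of _ \<zero>]) auto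
next
 case False
 interpret N: graded_left_module R N by (rule N)
 obtain y where y: "y : deg N t" "p y ~= \<zero>" using False by blast
 obtain c where c: "c : carrier k" "p y = \<iota> c" using A.\<kappa>_surj[OF cochD(1)[OF p y(1)]] by blast
 then have "c : Units k" using y(2) A.\<kappa>_zero by (auto simp: A.K.field_Units)
 then have ic: "inv\<^bsub>k\<^esub> c : carrier k" "inv\<^bsub>k\<^esub> c \<otimes>\<^bsub>k\<^esub> c = \<one>\<^bsub>k\<^esub>" by (auto simp: A.K.Units_l_inv)
 define z where "z = \<kappa> (inv\<^bsub>k\<^esub> c) \<odot>\<^bsub>N\<^esub> y"
 have z: "z : deg N t" unfolding z_def using N.component_smult[OF R.\<kappa>_in[OF ic(1)] y(1)] by simp
 have pz: "p z = \<one>" unfolding z_def cochD(4)[OF p ic(1) y(1)] c(2)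
  using ring_hom_mult[OF A.\<kappa>_hom ic(1) c(1)] ic(2) A.\<kappa>_one by simp
 note wz = cochD(2)[OF w z]
 have gk: "abelian_group k" by (rule A.K.abelian_group_axioms)
 have neg: "\<iota> (\<ominus>\<^bsub>k\<^esub> b) = \<ominus> \<iota> b" if "b : carrier k" for b
  using that A.\<kappa>_closed ring_hom_add[OF A.\<kappa>_hom]
  by (intro additive_minus[OF gk A.abelian_group_axioms carrier_subgroup_add[OF gk]]) auto
 have "w x = w z \<otimes> p x" if x: "x : deg N t" for x
 proof -
  obtain b where b: "b : carrier k" "p x = \<iota> b" using A.\<kappa>_surj[OF cochD(1)[OF p x]] by blast
  have nb: "\<ominus>\<^bsub>k\<^esub> b : carrier k" "\<iota> (\<ominus>\<^bsub>k\<^esub> b) = \<ominus> \<iota> b"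
   using b(1) neg by auto
  note bc = A.\<kappa>_closed[OF b(1)]
  have v: "\<kappa> (\<ominus>\<^bsub>k\<^esub> b) \<odot>\<^bsub>N\<^esub> z : deg N t" using N.component_smult[OF R.\<kappa>_in[OF nb(1)] z] by simp
  have "p (x \<oplus>\<^bsub>N\<^esub> \<kappa> (\<ominus>\<^bsub>k\<^esub> b) \<odot>\<^bsub>N\<^esub> z) = \<zero>"
   using cochD(3)[OF p x v] cochD(4)[OF p nb(1) z] pz b(2) bc nb(2) by (simp add: A.r_neg)
  then have "w (x \<oplus>\<^bsub>N\<^esub> \<kappa> (\<ominus>\<^bsub>k\<^esub> b) \<odot>\<^bsub>N\<^esub> z) = \<zero>" by (rule ker[OF N.MG.C_subD(3)[OF x v]])
  then have "w x \<ominus> \<iota> b \<otimes> w z = \<zero>"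
   using cochD(3)[OF w x v] cochD(4)[OF w nb(1) z] nb(2) wz bc by (simp add: a_minus_def A.l_minus)
  then have "w x = \<iota> b \<otimes> w z" by (rule A.diff_zero_imp_eq[OF cochD(2)[OF w x] A.m_closed[OF bc wz]])
  then show ?thesis using A_central[OF b(1) wz] b(2) by simp
 qed
 then show ?thesis using cochD(1)[OF w z] by blast
qed

text \<open>\<open>K\<close> agrees with \<open>N\<close> shifted by \<open>t\<close> except in degree \<open>0\<close>.\<close>

text \<open>The cocycle condition for \<open>h\<close> on \<open>K\<close> only concerns the hyperplane \<open>p = 0\<close> of \<open>N\<^sub>t\<close>, so it says that the coboundary of
\<open>h\<close> on all of \<open>N\<^sub>t\<close> is some multiple \<open>a p\<close>.\<close>

lemma hyperplane_exact:
 assumes N: "grmod R N" and l: "!!m. exact_at N (t + 1) m"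
  and s: "add K = add N" "smult K = smult N" and K: "!!j. j \<ge> 1 ==> deg K j = deg N (t + j)"
  and K0: "deg K 0 = {x : deg N t. p x = \<zero>}"
  and p: "coch N t 0 p" "y : deg N t" "p y ~= \<zero>"
 shows "exact_at K 1 m \<longleftrightarrow> (ALL a:component A (Suc m). cob N t (Suc m) (%x. a \<otimes> p x) --> a = \<zero>)"
proof -
 have c: "coch K 1 m h \<longleftrightarrow> coch N (t + 1) m h" for h by (rule coch_struct[OF s]) (simp add: K)
 have cb: "cob K 1 m h \<longleftrightarrow> cob N (t + 1) m h" for h by (rule cob_struct[OF s]) (simp_all add: K ac_simps)
 have d: "delta K = delta N" by (intro ext) (simp add: delta_def s)
 show ?thesis
 proof
  assume ex: "exact_at K 1 m"
  show "ALL a:component A (Suc m). cob N t (Suc m) (%x. a \<otimes> p x) --> a = \<zero>"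
  proof (intro ballI impI)
   fix a assume a: "a : component A (Suc m)" and "cob N t (Suc m) (%x. a \<otimes> p x)"
   then obtain h where h: "coch N (t + 1) m h" "!!x. x : deg N t ==> a \<otimes> p x = delta N h x"
    unfolding cob_Suc by blast
   have ac: "a : carrier A" using A.RG.C_closed[OF a] .
   have "delta K h x = \<zero>" if x: "x : deg K (1 - 1)" for x
   proof -
    have "x : deg N t" "p x = \<zero>" using x K0 by auto
    then show ?thesis using h(2)[of x] ac by (simp add: d)
   qed
   then have "cob N (t + 1) m h" using exact_atD[OF ex c[THEN iffD2, OF h(1)]] cb by blast
   then have "delta N h y = \<zero>" by (rule delta_cob[OF N _ h(1)]) (simp add: p)
   then have ay: "a \<otimes> p y = \<zero>" using h(2)[OF p(2)] by simp
   obtain b where b: "b : carrier k" "p y = \<iota> b" using A.\<kappa>_surj[OF cochD(1)[OF p(1,2)]] by blast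
   then have "b : Units k" using p(3) A.\<kappa>_zero by (auto simp: A.K.field_Units)
   then have ib: "inv\<^bsub>k\<^esub> b : carrier k" "b \<otimes>\<^bsub>k\<^esub> inv\<^bsub>k\<^esub> b = \<one>\<^bsub>k\<^esub>" by (auto simp: A.K.Units_r_inv)
   have "\<iota> b \<otimes> \<iota> (inv\<^bsub>k\<^esub> b) = \<one>"
    using ring_hom_mult[OF A.\<kappa>_hom b(1) ib(1), symmetric] ib(2) A.\<kappa>_one by simp
   then have "a = a \<otimes> (\<iota> b \<otimes> \<iota> (inv\<^bsub>k\<^esub> b))" using ac by simp
   also have "... = \<zero>" using ay ac A.\<kappa>_closed b ib(1) by (simp add: A.m_assoc[symmetric])
   finally show "a = \<zero>" .
  qed
 next
  assume a0: "ALL a:component A (Suc m). cob N t (Suc m) (%x. a \<otimes> p x) --> a = \<zero>"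
  show "exact_at K 1 m" unfolding exact_at_def
  proof (intro allI impI)
   fix h assume "coch K 1 m h" and z: "ALL x:deg K (1 - 1). delta K h x = \<zero>"
   then have h: "coch N (t + 1) m h" using c by simp
   have dh: "coch N t (Suc m) (delta N h)" using delta_coch[OF N h] by simp
   have "delta N h x = \<zero>" if "x : deg N t" "p x = \<zero>" for x
    using z K0 that by (simp add: d)
   from coch_factor[OF N p(1) dh this] obtain a where a: "a : component A (Suc m)"
    "!!x. x : deg N t ==> delta N h x = a \<otimes> p x" by blast
   have "cob N t (Suc m) (%x. a \<otimes> p x)" unfolding cob_Suc using h a(2)[symmetric] by blast
   then have "a = \<zero>" using a0 a(1) by blast
   then have "delta N h x = \<zero>" if "x : deg N (t + 1 - 1)" for x
    using a(2)[of x] cochD(2)[OF p(1), of x] that by simp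
   then show "cob K 1 m h" using exact_atD[OF l h] cb by blast
  qed
 qed
qed

text \<open>Every functional on the lowest component of \<open>N\<close> is induced by a homomorphism to the trivial module: compose it with
the projection to that component, which is linear over \<open>R \<rightarrow> R\<^sub>0\<close>.\<close>

lemma functional_hom:
 assumes l: "lin N (int i)" and p: "coch N (int i) 0 p"
 obtains f where "f : graded_hom R (shift N (int i)) triv"
  "!!x. x : deg N (int i) ==> f x = \<zero>\<^bsub>triv\<^esub> \<longleftrightarrow> p x = \<zero>"
proof -
 have N: "grmod R N" and low: "!!n. n < int i ==> deg N n = {\<zero>\<^bsub>N\<^esub>}" using l by (auto simp: lin_def)
 interpret N: graded_left_module R N by (rule N)
 interpret T: graded_left_module R triv by (rule R.top_graded)
 let ?q = "%x. mcomp N x (int i)"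
 define c where "c x = inv_into (carrier k) \<iota> (p x)" for x
 have bij: "bij_betw \<iota> (carrier k) (component A 0)" by (rule A.\<kappa>_bij)
 have c: "c x : carrier k" "\<iota> (c x) = p x" if "x : deg N (int i)" for x
  using bij_betw_inv_into_right[OF bij cochD(1)[OF p that]] cochD(1)[OF p that] bij
  unfolding c_def by (auto simp: bij_betw_def intro: inv_into_into)
 have ceq: "b = b'" if "b : carrier k" "b' : carrier k" "\<iota> b = \<iota> b'" for b b'
  using bij that by (auto simp: bij_betw_def inj_on_def)
 have q: "?q x : deg N (int i)" if "x : carrier N" for x using N.MG.hcomp_props(1)[OF that] .
 have cadd: "c (x \<oplus>\<^bsub>N\<^esub> y) = c x \<oplus>\<^bsub>k\<^esub> c y" if xy: "x : deg N (int i)" "y : deg N (int i)" for x y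
  using c[OF xy(1)] c[OF xy(2)] c[OF N.MG.C_subD(3)[OF xy]] cochD(3)[OF p xy] ring_hom_add[OF A.\<kappa>_hom]
  by (intro ceq) auto
 have csm: "c (\<kappa> b \<odot>\<^bsub>N\<^esub> x) = b \<otimes>\<^bsub>k\<^esub> c x" if b: "b : carrier k" and x: "x : deg N (int i)" for b x
  using c[OF x] c[of "\<kappa> b \<odot>\<^bsub>N\<^esub> x"] N.component_smult[OF R.\<kappa>_in[OF b] x] cochD(4)[OF p b x] ring_hom_mult[OF A.\<kappa>_hom b] b
  by (intro ceq) auto
 define f where "f x = R.cls (\<kappa> (c (?q x)))" for x
 have kc: "\<kappa> (c (?q x)) : carrier R" if "x : carrier N" for x using R.\<kappa>_closed[OF c(1)[OF q[OF that]]] .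
 have "f : graded_hom R (shift N (int i)) triv"
  unfolding graded_hom_def linear_maps_iff linear_on_def
 proof (intro CollectI conjI allI ballI)
  show "f : carrier (shift N (int i)) \<rightarrow> carrier triv" using kc by (auto simp: f_def R.top_simps)
  fix x assume "x : carrier (shift N (int i))"
  then have x: "x : carrier N" by simp
  show "f (x \<oplus>\<^bsub>shift N (int i)\<^esub> y) = f x \<oplus>\<^bsub>triv\<^esub> f y" if "y : carrier (shift N (int i))" for y
  proof -
   have y: "y : carrier N" using that by simp
   have "\<kappa> (c (?q (x \<oplus>\<^bsub>N\<^esub> y))) = \<kappa> (c (?q x)) \<oplus>\<^bsub>R\<^esub> \<kappa> (c (?q y))"
    unfolding N.MG.hcomp_add[OF x y] cadd[OF q[OF x] q[OF y]]
    by (rule ring_hom_add[OF R.\<kappa>_hom c(1)[OF q[OF x]] c(1)[OF q[OF y]]])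
   then show ?thesis using R.top_simps(3)[OF kc[OF x] kc[OF y]] by (simp add: f_def)
  qed
  fix r assume r: "r : carrier R"
  obtain b where b: "b : carrier k" "rcomp R r 0 = \<kappa> b" using R.\<kappa>_surj[OF R.RG.hcomp_props(1)[OF r]] by blast
  have "?q (r \<odot>\<^bsub>N\<^esub> x) = \<kappa> b \<odot>\<^bsub>N\<^esub> ?q x"
   unfolding b(2)[symmetric] by (rule N.mcomp_smult_bottom[OF _ r x]) (rule low)
  then have "\<kappa> (c (?q (r \<odot>\<^bsub>N\<^esub> x))) = \<kappa> (c (\<kappa> b \<odot>\<^bsub>N\<^esub> ?q x))" by (rule arg_cong)
  also have "... = \<kappa> b \<otimes>\<^bsub>R\<^esub> \<kappa> (c (?q x))"
   unfolding csm[OF b(1) q[OF x]]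
   by (rule ring_hom_mult[OF R.\<kappa>_hom b(1) c(1)[OF q[OF x]]])
  finally have "R.cls (\<kappa> (c (?q (r \<odot>\<^bsub>N\<^esub> x)))) = R.cls (\<kappa> b \<otimes>\<^bsub>R\<^esub> \<kappa> (c (?q x)))" by (rule arg_cong)
  also have "... = R.cls (r \<otimes>\<^bsub>R\<^esub> \<kappa> (c (?q x)))"
   using R.cls_eq_iff R.rcomp_mult_0[OF r kc[OF x]] R.rcomp_mult_0[OF R.\<kappa>_closed[OF b(1)] kc[OF x]]
    R.RG.hcomp_homog[OF R.\<kappa>_in[OF b(1)], of 0] b(2) R.\<kappa>_closed[OF b(1)] r kc[OF x] by simp
  finally show "f (r \<odot>\<^bsub>shift N (int i)\<^esub> x) = r \<odot>\<^bsub>triv\<^esub> f x"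
   using R.top_simps(4)[OF r kc[OF x]] by (simp add: f_def)
 next
  fix n
  show "f ` deg (shift N (int i)) n \<subseteq> deg triv n"
  proof (rule image_subsetI)
   fix x assume "x : deg (shift N (int i)) n"
   then have x: "x : deg N (int i + n)" by simp
   show "f x : deg triv n"
   proof (cases "n = 0")
    case True
    then show ?thesis using kc[OF N.MG.C_closed[OF x]] by (auto simp: f_def R.top_simps)
   next
    case False
    have z: "\<zero>\<^bsub>N\<^esub> : deg N (int i)" by (rule N.MG.C_subD(2))
    have "?q x = \<zero>\<^bsub>N\<^esub>" using N.MG.hcomp_homog[OF x, of "int i"] False by simp
    then have "\<iota> (c (?q x)) = \<iota> \<zero>\<^bsub>k\<^esub>" using c(2)[OF z] coch_at_zero[OF p N] A.\<kappa>_zero by simp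
    then have "c (?q x) = \<zero>\<^bsub>k\<^esub>" using ceq c(1)[OF q[OF N.MG.C_closed[OF x]]] A.K.zero_closed by blast
    then show ?thesis using False by (simp add: f_def R.top_simps R.\<kappa>_zero)
   qed
  qed
 qed
 moreover have "f x = \<zero>\<^bsub>triv\<^esub> \<longleftrightarrow> p x = \<zero>" if x: "x : deg N (int i)" for x
 proof -
  have qx: "?q x = x" using N.MG.hcomp_homog[OF x, of "int i"] by simp
  show ?thesis
  proof
   assume "f x = \<zero>\<^bsub>triv\<^esub>"
   then have "c x = \<zero>\<^bsub>k\<^esub>" using R.cls_scalar_inj[OF c(1)[OF x]] by (simp add: f_def qx R.top_simps)
   then show "p x = \<zero>" using c(2)[OF x] A.\<kappa>_zero by simp
  next
   assume "p x = \<zero>"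
   then have "c x = \<zero>\<^bsub>k\<^esub>" using A.\<kappa>_eq_zero[OF c(1)[OF x]] c(2)[OF x] by simp
   then show "f x = \<zero>\<^bsub>triv\<^esub>" by (simp add: f_def qx R.top_simps R.\<kappa>_zero)
  qed
 qed
 ultimately show ?thesis by (rule that)
qed

lemma kernel_koszul_iff_exact:
 assumes l: "lin N (int i)" and f: "f : graded_hom R (shift N (int i)) triv"
 shows "koszul_module R (kernel_module (shift N (int i)) triv f) \<longleftrightarrow> (ALL m. exact_at (kernel_module (shift N (int i)) triv f) 1 m)"
proof -
 let ?S = "shift N (int i)"
 let ?K = "kernel_module ?S triv f"
 have N: "grmod R N" and low: "!!n. n < int i ==> deg N n = {\<zero>\<^bsub>N\<^esub>}"
  and fin: "!!n. fspan k (scal \<kappa> N) (deg N n)" and ex: "!!j m. j > int i ==> exact_at N j m"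
  using l by (auto simp: lin_def)
 interpret N: graded_left_module R N by (rule N)
 have S: "grmod R ?S" by (rule shift_graded[OF N])
 interpret S: graded_left_module R ?S by (rule S)
 interpret T: graded_left_module R triv by (rule R.top_graded)
 have fz: "f \<zero>\<^bsub>N\<^esub> = \<zero>\<^bsub>triv\<^esub>"
  using linear_on_zero[OF S.left_module_axioms T.left_module_axioms S.carrier_submodule graded_hom_linear[OF f]] by simp
 have K: "deg ?K j = deg N (int i + j)" if j: "j \<ge> 1" for j
 proof -
  have "f x = \<zero>\<^bsub>triv\<^esub>" if x: "x : deg N (int i + j)" for x
  proof -
   have "f ` deg ?S j \<subseteq> deg triv j" using f unfolding graded_hom_def by blast
   then show ?thesis using triv_component[of j] j x by (auto simp only: shift_simps image_subset_iff)
  qed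
  then show ?thesis using N.MG.C_closed by auto
 qed
 have "scal \<kappa> ?S = scal \<kappa> N" by (simp add: scal_def shift_def)
 then have fS: "fspan k (scal \<kappa> ?S) (deg ?S n)" for n using fin by simp
 have fK: "fspan k (scal \<kappa> ?K) (deg ?K n)" for n by (rule R.fspan_kernel[OF S R.top_graded f fS])
 show ?thesis
 proof
  assume "koszul_module R ?K"
  then show "ALL m. exact_at ?K 1 m" by (intro allI koszul_exact fK) simp_all
 next
  assume ex1: "ALL m. exact_at ?K 1 m"
  have exK: "exact_at ?K j m" if j: "j > 0" for j m
  proof (cases "j = 1")
   case True
   then show ?thesis using ex1 by simp
  next
   case False
   have "exact_at ?K j m \<longleftrightarrow> exact_at N (int i + j) m"
   proof (rule exact_at_struct)
    show "deg ?K l = deg N (int i + j - j + l)" if "l \<ge> j - 1" for l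
     using K[of l] that False j by simp
   qed simp_all
   then show ?thesis using ex[of "int i + j"] j by simp
  qed
  have lowK: "deg ?K n = {\<zero>\<^bsub>?K\<^esub>}" if "n < 0" for n
  proof -
   have "deg N (int i + n) = {\<zero>\<^bsub>N\<^esub>}" using low that by simp
   then show ?thesis using fz by (auto simp only: kernel_simps shift_simps)
  qed
  have "lin ?K 0" unfolding lin_def
   by (intro conjI allI impI kernel_graded(1)[OF S R.top_graded f] lowK fK exK)
  then show "koszul_module R ?K" by (rule lin_koszul)
 qed
qed

lemma kernel_koszul_iff:
 assumes l: "lin N (int i)" and \<Phi>: "bottom N (int i) i \<Phi>"
  and f: "f : graded_hom R (shift N (int i)) triv"
  and p: "\<Phi> 0 p b" "!!x. x : deg N (int i) ==> f x = \<zero>\<^bsub>triv\<^esub> \<longleftrightarrow> p x = \<zero>" and b: "b ~= \<zero>"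
 shows "koszul_module R (kernel_module (shift N (int i)) triv f) \<longleftrightarrow>
  (ALL m. ALL a:component A (Suc m). a \<otimes> b = \<zero> --> a = \<zero>)"
proof -
 let ?S = "shift N (int i)"
 let ?K = "kernel_module ?S triv f"
 have N: "grmod R N" and fin: "!!n. fspan k (scal \<kappa> N) (deg N n)" and ex: "!!j m. j > int i ==> exact_at N j m"
  using l by (auto simp: lin_def)
 interpret N: graded_left_module R N by (rule N)
 note B = bottomD[OF \<Phi>]
 have pc: "coch N (int i) 0 p" by (rule B(1)[OF p(1)])
 obtain y where y: "y : deg N (int i)" "p y ~= \<zero>" using B(3)[OF p(1)] b by (auto simp: cob_0)
 have K: "deg ?K j = deg N (int i + j)" if j: "j \<ge> 1" for j
 proof -
  have "f x = \<zero>\<^bsub>triv\<^esub>" if x: "x : deg N (int i + j)" for x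
  proof -
   have "f ` deg ?S j \<subseteq> deg triv j" using f unfolding graded_hom_def by blast
   then show ?thesis using triv_component[of j] j x by (auto simp only: shift_simps image_subset_iff)
  qed
  then show ?thesis using N.MG.C_closed by auto
 qed
 have K0: "deg ?K 0 = {x : deg N (int i). p x = \<zero>}" using p(2) N.MG.C_closed by auto
 have lK: "koszul_module R ?K \<longleftrightarrow> (ALL m. exact_at ?K 1 m)"
  by (rule kernel_koszul_iff_exact[OF l f])
 also have "... \<longleftrightarrow> (ALL m. ALL a:component A (Suc m). cob N (int i) (Suc m) (%x. a \<otimes> p x) --> a = \<zero>)"
  using hyperplane_exact[OF N ex _ _ K K0 pc y] by simp
 also have "... \<longleftrightarrow> (ALL m. ALL a:component A (Suc m). a \<otimes> b = \<zero> --> a = \<zero>)"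
  using B(3)[OF B(6)[OF _ p(1)]] by simp
 finally show ?thesis .
qed

end

section \<open>Domains and the Koszul syzygy condition\<close>

context exact_koszul_dual
begin

lemma domain_iff_kernels_koszul:
 "noncommutative_domain A \<longleftrightarrow> (ALL i N f. is_syzygy R triv i N & f : graded_hom R (shift N (int i)) triv -->
   koszul_module R (kernel_module (shift N (int i)) triv f))"
proof
 assume dom: "noncommutative_domain A"
 show "ALL i N f. is_syzygy R triv i N & f : graded_hom R (shift N (int i)) triv -->
   koszul_module R (kernel_module (shift N (int i)) triv f)"
 proof (intro allI impI, elim conjE)
  fix i N f assume N: "is_syzygy R triv i N" and f: "f : graded_hom R (shift N (int i)) triv"
  obtain \<Phi> where l: "lin N (int i)" and \<Phi>: "bottom N (int i) i \<Phi>" using syzygy_lin_bottom[OF N] by blast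
  have gN: "grmod R N" and ex: "!!j m. j > int i ==> exact_at N j m" using l by (auto simp: lin_def)
  interpret N: graded_left_module R N by (rule gN)
  obtain T where T: "coch triv 0 0 T" "!!X. [|X : deg triv 0; T X = \<zero>|] ==> X = \<zero>\<^bsub>triv\<^esub>"
   by (rule triv_functional) blast
  have "coch (shift N (int i)) 0 0 (%x. T (f x))"
   by (rule coch_pull[OF shift_graded[OF gN] R.top_graded f T(1)])
  then have p: "coch N (int i) 0 (%x. T (f x))" using coch_struct[of "shift N (int i)" N 0 "int i"] by simp
  have fj: "f x : deg triv j" if "x : deg N (int i + j)" for x j
  proof -
   have "f ` deg (shift N (int i)) j \<subseteq> deg triv j" using f unfolding graded_hom_def by blast
   then show ?thesis using that by (auto simp only: shift_simps image_subset_iff)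
  qed
  have fp: "f x = \<zero>\<^bsub>triv\<^esub> \<longleftrightarrow> T (f x) = \<zero>" if x: "x : deg N (int i)" for x
   using T(2)[of "f x"] fj[of x 0] x coch_at_zero[OF T(1) R.top_graded] by auto
  obtain b where b: "\<Phi> 0 (%x. T (f x)) b" using bottomD(4)[OF \<Phi> p] by blast
  show "koszul_module R (kernel_module (shift N (int i)) triv f)"
  proof (cases "b = \<zero>")
   case True
   then have z: "f x = \<zero>\<^bsub>triv\<^esub>" if "x : deg N (int i)" for x
    using bottomD(3)[OF \<Phi> b] fp that by (simp add: cob_0)
   have "exact_at (kernel_module (shift N (int i)) triv f) 1 m" for m
   proof -
    have "f x = \<zero>\<^bsub>triv\<^esub>" if "x : deg N (int i + j)" "j \<ge> 0" for x j
     using fj[OF that(1)] triv_component[of j] z that by (cases "j = 0") simp_all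
    then have "exact_at (kernel_module (shift N (int i)) triv f) 1 m \<longleftrightarrow> exact_at N (int i + 1) m"
     using N.MG.C_closed by (intro exact_at_struct) auto
    then show ?thesis using ex by simp
   qed
   then show ?thesis using kernel_koszul_iff_exact[OF l f] by blast
  next
   case False
   have "b : carrier A" using bottomD(2)[OF \<Phi> b] A.RG.C_closed by blast
   then have "ALL m. ALL a:component A (Suc m). a \<otimes> b = \<zero> --> a = \<zero>"
    using dom False A.RG.C_closed unfolding noncommutative_domain_def by blast
   then show ?thesis using kernel_koszul_iff[OF l \<Phi> f b fp False] by blast
  qed
 qed
next
 assume kos: "ALL i N f. is_syzygy R triv i N & f : graded_hom R (shift N (int i)) triv -->
   koszul_module R (kernel_module (shift N (int i)) triv f)"
 have "a = \<zero> \<or> b = \<zero>" if a: "a : component A m" and b: "b : component A n" and ab: "a \<otimes> b = \<zero>" for m n a b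
 proof (rule ccontr)
  assume "\<not> (a = \<zero> \<or> b = \<zero>)"
  then have nz: "a ~= \<zero>" "b ~= \<zero>" by auto
  obtain N where N: "is_syzygy R triv n N" using syzygy_exists by blast
  obtain \<Phi> where l: "lin N (int n)" and \<Phi>: "bottom N (int n) n \<Phi>" using syzygy_lin_bottom[OF N] by blast
  have b': "b : component A (0 + n)" using b by simp
  obtain p where p: "\<Phi> 0 p b" using bottomD(5)[OF \<Phi> b'] by blast
  obtain f where f: "f : graded_hom R (shift N (int n)) triv"
   "!!x. x : deg N (int n) ==> f x = \<zero>\<^bsub>triv\<^esub> \<longleftrightarrow> p x = \<zero>"
   by (rule functional_hom[OF l bottomD(1)[OF \<Phi> p]]) blast
  have reg: "ALL m. ALL a:component A (Suc m). a \<otimes> b = \<zero> --> a = \<zero>"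
   using kernel_koszul_iff[OF l \<Phi> f(1) p f(2) nz(2)] kos N f(1) by blast
  show False
  proof (cases m)
   case 0
   then obtain c where c: "c : carrier k" "a = \<iota> c" using A.\<kappa>_surj[of a] a by blast
   then have "c : Units k" using nz(1) A.\<kappa>_zero by (auto simp: A.K.field_Units)
   then have ic: "inv\<^bsub>k\<^esub> c : carrier k" "inv\<^bsub>k\<^esub> c \<otimes>\<^bsub>k\<^esub> c = \<one>\<^bsub>k\<^esub>" by (auto simp: A.K.Units_l_inv)
   have bc: "b : carrier A" using A.RG.C_closed[OF b] .
   have "\<iota> (inv\<^bsub>k\<^esub> c) \<otimes> \<iota> c = \<one>"
    using ring_hom_mult[OF A.\<kappa>_hom ic(1) c(1), symmetric] ic(2) A.\<kappa>_one by simp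
   then have "b = \<iota> (inv\<^bsub>k\<^esub> c) \<otimes> (\<iota> c \<otimes> b)"
    using bc A.\<kappa>_closed[OF ic(1)] A.\<kappa>_closed[OF c(1)] by (simp add: A.m_assoc[symmetric])
   then show False using ab c(2) A.\<kappa>_closed[OF ic(1)] nz(2) by simp
  next
   case (Suc l)
   then show False using reg a ab nz(1) by blast
  qed
 qed
 then show "noncommutative_domain A"
  using A.domain_homogeneous A.one_not_zero unfolding noncommutative_domain_def by blast
qed

end

text \<open>The trivial module is one-dimensional, so every summand of a decomposition is all of it.\<close>

lemma (in connected) simple_summand_top:
 assumes S: "simple_decomposition R Ss" and U: "U : set Ss"
 shows "restrict_module (top_module R) U = top_module R"
proof -
 let ?T = "top_module R"
 interpret T: graded_left_module R ?T by (rule top_graded)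
 have gU: "graded_submodule R U ?T" and "carrier (restrict_module ?T U) ~= {zero (restrict_module ?T U)}"
  using S U unfolding simple_decomposition_def graded_simple_def by blast+
 then have sU: "submodule U R ?T" and nz: "U ~= {\<zero>\<^bsub>?T\<^esub>}" by (auto simp: graded_submodule_def)
 note UD = submoduleD[OF T.M_group sU]
 obtain X where X: "X : U" "X ~= \<zero>\<^bsub>?T\<^esub>" using nz UD(2) by blast
 obtain a where a: "a : carrier R" "X = cls a" using UD(1) X(1) by (auto simp: top_simps)
 obtain c where c: "c : carrier k" "X = cls (\<kappa> c)" using cls_scalar[OF a(1)] a(2) by auto
 have "c ~= \<zero>\<^bsub>k\<^esub>" using X(2) c(2) \<kappa>_zero by (auto simp: top_simps)
 then have "c : Units k" using c(1) by (auto simp: K.field_Units)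
 then have ic: "inv\<^bsub>k\<^esub> c : carrier k" "inv\<^bsub>k\<^esub> c \<otimes>\<^bsub>k\<^esub> c = \<one>\<^bsub>k\<^esub>" by (auto simp: K.Units_l_inv)
 have "\<kappa> (inv\<^bsub>k\<^esub> c) \<odot>\<^bsub>?T\<^esub> X = cls \<one>"
  using top_simps(4)[OF \<kappa>_closed[OF ic(1)] \<kappa>_closed[OF c(1)]] ring_hom_mult[OF \<kappa>_hom ic(1) c(1), symmetric] ic(2) \<kappa>_one c(2)
  by simp
 then have one: "cls \<one> : U" using UD(5)[OF \<kappa>_closed[OF ic(1)] X(1)] by simp
 have "cls r : U" if "r : carrier R" for r
  using UD(5)[OF that one] top_simps(4)[OF that one_closed] that by simp
 then have "U = carrier ?T" using UD(1) by (auto simp: top_simps)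
 then show ?thesis using T.MG.C_closed by (auto simp: restrict_module_def Int_absorb2 subset_iff)
qed

theorem theorem1p3:
  fixes k :: "'k ring" and \<iota> :: "'k \<Rightarrow> 'a" and A :: "'a graded_ring"
    and P :: "nat \<Rightarrow> ('a, 'p) graded_module" and \<epsilon> :: "'p \<Rightarrow> 'a set" and d :: "nat \<Rightarrow> 'p \<Rightarrow> 'p"
  assumes "field k"
    and "connected_graded_algebra k \<iota> A"
    and "finitely_generated_algebra k \<iota> A"
    and "koszul_ring A"
    and "minimal_projective_resolution A (top_module A) P \<epsilon> d"
    and "simple_decomposition (opposite (ext_algebra A P d)) Ss"
  shows "noncommutative_domain A \<longleftrightarrow> koszul_syzygy_condition (ext_algebra A P d) Ss"
proof -
 note res = assms(5)
 interpret A: connected k \<iota> A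
  using assms(1,2) by (simp add: connected_def connected_axioms_def connected_graded_algebra_def)
 have central: "\<iota> c \<otimes>\<^bsub>A\<^esub> a = a \<otimes>\<^bsub>A\<^esub> \<iota> c" if "c : carrier k" "a : carrier A" for c a
  using assms(2) that by (simp add: connected_graded_algebra_def)
 let ?T = "top_module A"
 interpret T: graded_left_module A ?T by (rule A.top_graded)
 obtain X where X: "finite X" "X \<subseteq> carrier A" "generate_ring A (\<iota> ` carrier k \<union> X) = carrier A"
  using assms(3) by (auto simp: finitely_generated_algebra_def)
 have fin1: "fspan k (scal \<iota> (reg A)) (component A 1)" by (rule A.fspan_degree_one[OF X central])
 have kos: "koszul_module A ?T" using assms(4) by (simp add: koszul_ring_def)
 obtain x0 where x0: "x0 : {..<1} \<rightarrow> deg (P 0) 0" "\<epsilon> (x0 0) = A.cls \<one>\<^bsub>A\<^esub>" "basis_of A (P 0) (carrier (P 0)) 1 x0"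
  using A.koszul_resolution_bases(1)[OF fin1 kos res] by blast
 have "EX D x. x : {..<D} \<rightarrow> deg (P n) (int n) & basis_of A (P n) (carrier (P n)) D x" for n
  by (rule A.koszul_resolution_bases(2)[OF fin1 kos res])
 then obtain D' x' where x': "!!n. x' n : {..<D' n} \<rightarrow> deg (P n) (int n)"
  "!!n. basis_of A (P n) (carrier (P n)) (D' n) (x' n)" by metis
 define D where "D n = (if n = 0 then 1 else D' n)" for n :: nat
 define x where "x n = (if n = 0 then x0 else x' n)" for n :: nat
 note c0 = cover_D[OF resolution_covers(1)[OF res]] and c = cover_D[OF resolution_covers(2)[OF res]]
 have gP: "grmod A (P n)" for n by (cases n) (use c0(1) c(1) in auto)
 interpret P0: graded_left_module A "P 0" by (rule gP)
 have im: "(EX y:carrier (P (Suc n)). d n y = z) \<longleftrightarrow> z : carrier (ker_seq ?T P \<epsilon> d n)" for n z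
  unfolding c(4)[symmetric] by blast
 interpret koszul_resolution k \<iota> A P d D x
 proof (intro koszul_resolution.intro A.connected_axioms koszul_resolution_axioms.intro)
  show "d n : graded_hom A (P (Suc n)) (P n)" for n
  proof -
   have "(%y. y) : graded_hom A (ker_seq ?T P \<epsilon> d n) (P n)"
    by (cases n) (auto simp: ker_seq_def graded_hom_def linear_maps_iff linear_on_def)
   from graded_hom_comp[OF c(3) this] show ?thesis by simp
  qed
  show "basis_of A (P n) (carrier (P n)) (D n) (x n)" for n using x0(3) x'(2) by (simp add: D_def x_def)
  show "x n : {..<D n} \<rightarrow> deg (P n) (int n)" for n
   using x0(1) x'(1)[of n] by (cases "n = 0") (simp_all add: D_def x_def)
  show "(EX y:carrier (P (Suc (Suc n))). d (Suc n) y = z) \<longleftrightarrow> d n z = \<zero>\<^bsub>P n\<^esub>" if "z : carrier (P (Suc n))" for n z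
   unfolding im using that by (simp add: ker_seq_def)
  fix z assume z: "z : carrier (P 0)"
  let ?c = "coord A (P 0) 1 x0 z 0"
  have cc: "?c : carrier A" by (rule P0.coord_closed[OF x0(3) z]) simp
  have x00: "x0 0 : carrier (P 0)" using x0(1) P0.MG.C_closed by auto
  have "lc (P 0) 1 (coord A (P 0) 1 x0 z) x0 = ?c \<odot>\<^bsub>P 0\<^esub> x0 0"
   using P0.lc_Suc[of "coord A (P 0) 1 x0 z" 0 x0] P0.coord_props(1)[OF x0(3) z] x00 cc P0.smult_closed[OF cc x00]
   by (simp add: P0.lc_0)
  then have "z = ?c \<odot>\<^bsub>P 0\<^esub> x0 0" using P0.coord_props(2)[OF x0(3) z] by simp
  then have "\<epsilon> z = \<epsilon> (?c \<odot>\<^bsub>P 0\<^esub> x0 0)" by (rule arg_cong)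
  also have "... = ?c \<odot>\<^bsub>?T\<^esub> A.cls \<one>\<^bsub>A\<^esub>"
   using graded_hom_linear[OF c0(3)] cc x00 x0(2) by (simp add: linear_on_def)
  also have "... = A.cls ?c" using A.top_simps(4)[OF cc A.one_closed] cc by simp
  finally have "\<epsilon> z = \<zero>\<^bsub>?T\<^esub> \<longleftrightarrow> rcomp A ?c 0 = \<zero>\<^bsub>A\<^esub>"
   using A.cls_eq_iff[OF cc A.zero_closed] A.RG.hcomp_zero by (simp add: A.top_simps)
  then show "(EX y:carrier (P (Suc 0)). d 0 y = z) \<longleftrightarrow> rcomp A (coord A (P 0) (D 0) (x 0) z 0) 0 = \<zero>\<^bsub>A\<^esub>"
   unfolding im using z by (simp add: ker_seq_def D_def x_def)
 qed (use central gP in \<open>simp_all add: D_def\<close>)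
 let ?R = "opposite E"
 have Ss: "simple_decomposition ?R Ss" using assms(6) .
 have "Ss ~= []" by (rule decomposition_nonempty[OF Ss])
 then have "hd Ss : set Ss" by simp
 then have "graded_simple ?R (restrict_module (top_module ?R) (hd Ss))"
  using Ss by (simp add: simple_decomposition_def)
 then have "graded_ring ?R" by (auto simp: graded_simple_def dest: graded_left_module.axioms(1))
 from koszul_dual_opposite[OF this]
 interpret dual: exact_koszul_dual k \<iota> A kap ?R "D 1" ee eps .
 have S: "restrict_module (top_module ?R) (Ss ! j) = top_module ?R" if "j < length Ss" for j
  using dual.R.simple_summand_top[OF Ss] that by simp
 have "koszul_syzygy_condition E Ss \<longleftrightarrow>
  (ALL i N f. is_syzygy ?R dual.triv i N & f : graded_hom ?R (shift N (int i)) dual.triv -->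
    koszul_module ?R (kernel_module (shift N (int i)) dual.triv f))"
  unfolding koszul_syzygy_condition_def Let_def
  using S \<open>Ss ~= []\<close> by (metis length_greater_0_conv)
 then show ?thesis unfolding dual.domain_iff_kernels_koszul by simp
qed

end
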